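(* Let $\theta>0$, let $a_n\ge b_n\ge-\tfrac12$ be such that $\bar a=\lim a_n/n$ and $\bar b=\lim b_n/n$ exist, and let $\{\lambda(n)\}$ be partitions with $\ell(\lambda(n))\le n$. Assume that either the functions $\Phi_{\lambda(n)}(z,1,\dots,1;\theta,a_n,b_n)$ ($n-1$ ones, $|z|=1$) converge pointwise on $\mathbb T^1$ to a continuous function, or these functions converge infinitesimally about $z=1$ (i.e. all their Taylor coefficients in a local coordinate about $z=1$ converge). Then $\{\lambda(n)\}$ is a Vershik–Kerov sequence.
   Context: $\Phi_\lambda(z;\theta,a,b)=\mathcal J_\lambda(z;\theta,a,b)/\mathcal J_\lambda(1,\dots,1;\theta,a,b)$, where for $\ell(\lambda)\le n$ the $BC_n$ Jacobi polynomial $\mathcal J_\lambda$ is the unique Laurent polynomial in $z_1,\dots,z_n$ invariant under permutations and each $z_i\mapsto z_i^{-1}$, equal to $z^\lambda+$(lexicographically lower monomials), with $\{\mathcal J_\lambda\}$ pairwise orthogonal on $\mathbb T^n$ w.r.t. Haar measure times $\prod_{i<j}|z_i-z_j|^{2\theta}|1-z_iz_j|^{2\theta}\prod_i|1-z_i|^{2a+1}|1+z_i|^{2b+1}$. A Vershik–Kerov sequence is a sequence of partitions $\lambda(n)$ with $\ell(\lambda(n))\le n$ for which the limits $\lim\lambda(n)_i/n$, $\lim\lambda(n)'_i/n$ ($i\ge1$, $\lambda'$ the conjugate partition) and $\lim|\lambda(n)|/n$ all exist and are finite. *)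

theory Defs
  imports "HOL-Analysis.Analysis"
begin

text \<open>Laurent polynomials in the variables z_0,...,z_(n-1), given by their coefficient
  function on exponent vectors (exponents beyond index n-1 are zero).\<close>

type_synonym lpoly = "(nat \<Rightarrow> int) \<Rightarrow> complex"

definition lp_ok :: "nat \<Rightarrow> lpoly \<Rightarrow> bool" where
  "lp_ok n c \<longleftrightarrow> finite {\<alpha>. c \<alpha> \<noteq> 0} \<and> (\<forall>\<alpha>. c \<alpha> \<noteq> 0 \<longrightarrow> (\<forall>i\<ge>n. \<alpha> i = 0))"

definition lp_eval :: "nat \<Rightarrow> lpoly \<Rightarrow> (nat \<Rightarrow> complex) \<Rightarrow> complex" where
  "lp_eval n c z = (\<Sum>\<alpha>\<in>{\<alpha>. c \<alpha> \<noteq> 0}. c \<alpha> * (\<Prod>i<n. z i powi \<alpha> i))"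

definition bc_invariant :: "nat \<Rightarrow> lpoly \<Rightarrow> bool" where
  "bc_invariant n c \<longleftrightarrow>
     (\<forall>z. (\<forall>i<n. z i \<noteq> 0) \<longrightarrow>
        (\<forall>\<sigma>. \<sigma> permutes {..<n} \<longrightarrow> lp_eval n c (z \<circ> \<sigma>) = lp_eval n c z) \<and>
        (\<forall>i<n. lp_eval n c (z(i := inverse (z i))) = lp_eval n c z))"

definition lex_less :: "nat \<Rightarrow> (nat \<Rightarrow> int) \<Rightarrow> (nat \<Rightarrow> int) \<Rightarrow> bool" where
  "lex_less n \<alpha> \<beta> \<longleftrightarrow> (\<exists>k<n. (\<forall>i<k. \<alpha> i = \<beta> i) \<and> \<alpha> k < \<beta> k)"

definition is_partition_len :: "nat \<Rightarrow> (nat \<Rightarrow> nat) \<Rightarrow> bool" where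
  "is_partition_len n lam \<longleftrightarrow> (\<forall>i j. i \<le> j \<longrightarrow> lam j \<le> lam i) \<and> (\<forall>i\<ge>n. lam i = 0)"

definition conj_part :: "(nat \<Rightarrow> nat) \<Rightarrow> nat \<Rightarrow> nat" where
  "conj_part lam i = card {j. i < lam j}"

definition part_size :: "nat \<Rightarrow> (nat \<Rightarrow> nat) \<Rightarrow> nat" where
  "part_size n lam = (\<Sum>i<n. lam i)"

definition bc_weight :: "nat \<Rightarrow> real \<Rightarrow> real \<Rightarrow> real \<Rightarrow> (nat \<Rightarrow> complex) \<Rightarrow> real" where
  "bc_weight n \<theta> a b z =
     (\<Prod>i<n. \<Prod>j\<in>{i<..<n}. cmod (z i - z j) powr (2*\<theta>) * cmod (1 - z i * z j) powr (2*\<theta>)) *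
     (\<Prod>i<n. cmod (1 - z i) powr (2*a+1) * cmod (1 + z i) powr (2*b+1))"

text \<open>Haar measure on T^n, parametrised by angles (up to a normalising constant,
  irrelevant for orthogonality).\<close>
definition torus_measure :: "nat \<Rightarrow> (nat \<Rightarrow> real) measure" where
  "torus_measure n = PiM {..<n} (\<lambda>_. restrict_space lborel {0..2*pi})"

definition lp_inner :: "nat \<Rightarrow> real \<Rightarrow> real \<Rightarrow> real \<Rightarrow> lpoly \<Rightarrow> lpoly \<Rightarrow> complex" where
  "lp_inner n \<theta> a b c d =
     (LINT t|torus_measure n.
        lp_eval n c (\<lambda>i. cis (t i)) * cnj (lp_eval n d (\<lambda>i. cis (t i)))
        * complex_of_real (bc_weight n \<theta> a b (\<lambda>i. cis (t i))))"

definition jacobi_family_spec ::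
    "nat \<Rightarrow> real \<Rightarrow> real \<Rightarrow> real \<Rightarrow> ((nat \<Rightarrow> nat) \<Rightarrow> lpoly) \<Rightarrow> bool" where
  "jacobi_family_spec n \<theta> a b J \<longleftrightarrow>
     (\<forall>lam. is_partition_len n lam \<longrightarrow>
        lp_ok n (J lam) \<and> bc_invariant n (J lam) \<and> J lam (int \<circ> lam) = 1 \<and>
        (\<forall>\<alpha>. J lam \<alpha> \<noteq> 0 \<longrightarrow> \<alpha> = int \<circ> lam \<or> lex_less n \<alpha> (int \<circ> lam))) \<and>
     (\<forall>lam mu. is_partition_len n lam \<and> is_partition_len n mu \<and> lam \<noteq> mu \<longrightarrow>
        lp_inner n \<theta> a b (J lam) (J mu) = 0) \<and>
     (\<forall>lam. \<not> is_partition_len n lam \<longrightarrow> J lam = (\<lambda>_. 0))"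

definition jacobi_poly :: "nat \<Rightarrow> real \<Rightarrow> real \<Rightarrow> real \<Rightarrow> (nat \<Rightarrow> nat) \<Rightarrow> lpoly" where
  "jacobi_poly n \<theta> a b lam = (THE J. jacobi_family_spec n \<theta> a b J) lam"

definition jacobi_Phi ::
    "nat \<Rightarrow> real \<Rightarrow> real \<Rightarrow> real \<Rightarrow> (nat \<Rightarrow> nat) \<Rightarrow> (nat \<Rightarrow> complex) \<Rightarrow> complex" where
  "jacobi_Phi n \<theta> a b lam z =
     lp_eval n (jacobi_poly n \<theta> a b lam) z / lp_eval n (jacobi_poly n \<theta> a b lam) (\<lambda>_. 1)"

definition Phi1 :: "nat \<Rightarrow> real \<Rightarrow> real \<Rightarrow> real \<Rightarrow> (nat \<Rightarrow> nat) \<Rightarrow> complex \<Rightarrow> complex" where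
  "Phi1 n \<theta> a b lam z = jacobi_Phi n \<theta> a b lam (\<lambda>i. if i = 0 then z else 1)"

definition taylor_coeff_at1 :: "(complex \<Rightarrow> complex) \<Rightarrow> nat \<Rightarrow> complex" where
  "taylor_coeff_at1 f k = (deriv ^^ k) f 1 / of_nat (fact k)"

definition vershik_kerov :: "(nat \<Rightarrow> nat \<Rightarrow> nat) \<Rightarrow> bool" where
  "vershik_kerov lam \<longleftrightarrow>
     (\<forall>i. convergent (\<lambda>n. real (lam n i) / real n)) \<and>
     (\<forall>i. convergent (\<lambda>n. real (conj_part (lam n) i) / real n)) \<and>
     convergent (\<lambda>n. real (part_size n (lam n)) / real n)"

end

theory Submission
 imports Defs "HOL-Real_Asymp.Real_Asymp"
begin

text \<open>
 The Dunkl operators \<open>Sop i\<close> of type BC act on Laurent polynomials. The raising operators for the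
 affine reflection \<open>s0\<close> and the transpositions produce eigenfunctions of the Cherednik operators \<open>Yop i\<close>
 with nonnegative coefficients; symmetrising gives eigenfunctions of the power sums
 \<open>Dop k\<close> of the squared Dunkl operators. These are self-adjoint for the torus weight and their eigenvalues
 \<open>EE lam k\<close> separate partitions, so the symmetrisations are the Jacobi polynomials, and the Laurent
 coefficients of \<open>Phi1\<close> are probability weights.

 Putting all variables but the first equal to 1, the eigenvalue equations become a recursion of power
 series at \<open>z = 1\<close>, which expresses \<open>EE lam k\<close> through the Taylor coefficients of \<open>Phi1\<close>. Hence
 infinitesimal convergence makes \<open>EE lam k / n^(2k)\<close> converge. Pointwise convergence to a continuous limit
 gives tightness of the weights; the recursion bounds the fourth moment by the square of the second one,
 so all moments are bounded and converge, and the first case applies.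

 The generating function of the \<open>EE lam k\<close> is a product over the shifted parts \<open>ll lam i\<close>. Its
 logarithm yields convergence of the sums of \<open>F (ll lam i / n) - F (ll 0 i / n)\<close> for even monomials and then,
 by the Weierstrass theorem, for smooth \<open>F\<close> vanishing near 0. Steps \<open>F\<close> to the right and to the left
 of \<open>lim ll 0 0 / n\<close> count long rows and long columns.
\<close>

section \<open>Divided differences on Laurent polynomials\<close>

text \<open>Two forms of the operators are kept side by side. \<open>Sop i\<close> is equivariant
  under the finite Weyl group, so it is compatible with symmetrisation, integration by parts and
  setting variables equal to 1. \<open>Yop i\<close> differs from it by reflections; its Hecke
  relations make every raising step a combination \<open>E \<circ> s + kappa * E\<close> with
  \<open>kappa >= 0\<close>. This positivity is what turns coefficients into probabilities. The
  support of the eigenfunctions is not followed through the construction. It is recovered afterwards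
  from the eigenvalues, because the vector \<open>bar eta\<close> determines \<open>eta\<close>. The
  numbers \<open>EE lam k\<close> are not power sums of the parameters \<open>ll lam i\<close>; they
  come from a triangular recursion whose generating function telescopes into products. Subtracting
  the logarithm of the product formula for the empty partition cancels the large common part, so
  that a finite limit remains after scaling. For small exponents the weight is too singular to
  differentiate. It is regularised, and the reflections antisymmetrise the integrand, which makes
  the singular factors bounded before the limit is taken.\<close>

definition along :: "(nat => int) => (nat => int) => int => nat => int" where
 "along nu alpha r = (%k. nu k + r * alpha k)"

text \<open>The identities below only use that \<open>s\<close> is an involution that maps the
  lattice line through a point in direction \<open>alpha\<close> to itself and reverses it. The same
  \<open>s\<close> may serve several directions, as \<open>fl i\<close> does for \<open>ee i\<close>
  and \<open>rl i\<close>.\<close>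

definition is_refl :: "(nat => int) => ((nat => int) => nat => int) => bool" where
 "is_refl alpha s \<longleftrightarrow> alpha ~= (%_. 0) \<and> (\<forall>nu. s (s nu) = nu) \<and>
   (\<forall>nu r. s (along nu alpha r) = along (s nu) alpha (- r)) \<and> (\<forall>nu. \<exists>m. s nu = along nu alpha m)"

definition fin_supp :: "lpoly => bool" where
 "fin_supp c \<longleftrightarrow> finite {mu. c mu ~= 0}"

text \<open>The coefficients of \<open>(1 + z^(-alpha)) / (1 - z^(-alpha)) * (f - s f)\<close>. Only finitely many terms of the
 series are nonzero.\<close>

definition Nop :: "(nat => int) => ((nat => int) => nat => int) => lpoly => lpoly" where
 "Nop alpha s c nu = (c nu - c (s nu)) +
   2*(\<Sum>r. c (along nu alpha (1 + int r)) - c (s (along nu alpha (1 + int r))))"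

lemma along_0 [simp]: "along nu alpha 0 = nu"
 by (simp add: along_def)

lemma along_along [simp]: "along (along nu alpha r) alpha q = along nu alpha (r + q)"
 by (auto simp: along_def algebra_simps)

lemma inj_along: "alpha ~= (%_. 0) ==> along nu alpha r = along nu alpha q \<longleftrightarrow> r = q"
 by (auto simp: along_def fun_eq_iff)

lemma fin_supp_comp_inj:
 assumes "fin_supp c" "inj s" shows "fin_supp (c \<circ> s)"
proof -
 have "{mu. (c \<circ> s) mu ~= 0} = s -` {mu. c mu ~= 0}" by auto
 then show ?thesis using finite_vimageI[of "{mu. c mu ~= 0}" s] assms by (simp add: fin_supp_def)
qed

lemma is_refl_inj: "is_refl alpha s ==> inj s"
 by (metis injI is_refl_def)

lemma fin_supp_add: "fin_supp c ==> fin_supp d ==> fin_supp (%nu. c nu + d nu)"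
 unfolding fin_supp_def by (rule finite_subset[of _ "{mu. c mu ~= 0} \<union> {mu. d mu ~= 0}"]) auto

lemma fin_supp_diff: "fin_supp c ==> fin_supp d ==> fin_supp (%nu. c nu - d nu)"
 unfolding fin_supp_def by (rule finite_subset[of _ "{mu. c mu ~= 0} \<union> {mu. d mu ~= 0}"]) auto

lemma fin_supp_scale: "fin_supp c ==> fin_supp (%nu. g nu * c nu)"
 unfolding fin_supp_def by (rule finite_subset[of _ "{mu. c mu ~= 0}"]) auto

lemma finite_line:
 assumes "fin_supp c" "alpha ~= (%_. 0)" shows "finite {r. c (along nu alpha r) ~= 0}"
proof -
 have "inj (along nu alpha)" by (rule injI) (simp add: inj_along assms)
 then have "finite (along nu alpha -` {mu. c mu ~= 0})"
  using assms(1) by (intro finite_vimageI) (auto simp: fin_supp_def)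
 then show ?thesis by (simp add: vimage_def)
qed

lemma finite_half_line:
 assumes "fin_supp c" "alpha ~= (%_. 0)" shows "finite {r::nat. c (along nu alpha (1 + int r)) ~= 0}"
proof -
 have "finite ((%r. 1 + int r) -` {r. c (along nu alpha r) ~= 0})"
  by (rule finite_vimageI[OF finite_line[OF assms]]) (auto intro: injI)
 then show ?thesis by (simp add: vimage_def)
qed

lemma summable_half_line:
 assumes "fin_supp c" "alpha ~= (%_. 0)" shows "summable (%r. c (along nu alpha (1 + int r)))"
 by (rule summable_finite[OF finite_half_line[OF assms]]) auto

lemma fin_supp_anti: "fin_supp c ==> is_refl alpha s ==> fin_supp (%nu. c nu - c (s nu))"
 using fin_supp_diff[of c "c \<circ> s"] fin_supp_comp_inj[of c s] is_refl_inj by (auto simp: o_def)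

lemma summable_Nop:
 assumes "fin_supp c" "is_refl alpha s"
 shows "summable (%r. c (along nu alpha (1 + int r)) - c (s (along nu alpha (1 + int r))))"
 using summable_half_line[OF fin_supp_anti[OF assms], of alpha nu] assms(2) by (simp add: is_refl_def)

lemma Nop_diff:
 assumes "fin_supp c" "is_refl alpha s"
 shows "Nop alpha s c nu - Nop alpha s c (along nu alpha 1) =
  (c nu - c (s nu)) + (c (along nu alpha 1) - c (s (along nu alpha 1)))"
proof -
 let ?f = "%r. c (along nu alpha (1 + int r)) - c (s (along nu alpha (1 + int r)))"
 have "suminf ?f = ?f 0 + (\<Sum>r. ?f (Suc r))"
  using suminf_split_head[OF summable_Nop[OF assms, of nu]] by simp
 moreover have "(%r. ?f (Suc r)) = (%r. c (along (along nu alpha 1) alpha (1 + int r)) - c (s (along (along nu alpha 1) alpha (1 + int r))))"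
  by (simp add: algebra_simps)
 ultimately have e: "suminf ?f = ?f 0 + (\<Sum>r. c (along (along nu alpha 1) alpha (1 + int r)) - c (s (along (along nu alpha 1) alpha (1 + int r))))"
  by metis
 show ?thesis unfolding Nop_def e by simp
qed

text \<open>\<open>s\<close> reverses the line while \<open>d\<close> changes sign, so the sum over
  the whole line is its own negative. A support confined to \<open>r >= 1\<close> makes the
  half-line sum the full one.\<close>

lemma line_sum_zero:
 assumes "fin_supp d" "is_refl alpha s" "\<And>nu. d (s nu) = - d nu" "\<And>r. r <= 0 ==> d (along nu alpha r) = 0"
 shows "(\<Sum>r. d (along nu alpha (1 + int r))) = 0"
proof -
 have alpha: "alpha ~= (%_. 0)" using assms(2) by (simp add: is_refl_def)
 define T where "T = {r. d (along nu alpha r) ~= 0}"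
 have finT: "finite T" unfolding T_def by (rule finite_line[OF assms(1) alpha])
 have pos: "r >= 1" if "r \<in> T" for r using assms(4)[of r] that by (force simp: T_def)
 obtain m where m: "s nu = along nu alpha m" using assms(2) unfolding is_refl_def by blast
 have anti: "d (along nu alpha (m - r)) = - d (along nu alpha r)" for r
 proof -
  have "s (along nu alpha r) = along nu alpha (m - r)" using assms(2) by (simp add: is_refl_def m)
  then show ?thesis using assms(3)[of "along nu alpha r"] by simp
 qed
 have "(\<Sum>r\<in>T. d (along nu alpha r)) = (\<Sum>r\<in>T. d (along nu alpha (m - r)))"
  by (rule sum.reindex_bij_witness[of _ "%r. m - r" "%r. m - r"]) (auto simp: T_def anti)
 then have z: "(\<Sum>r\<in>T. d (along nu alpha r)) = 0" by (simp add: anti sum_negf)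
 have "(\<Sum>r. d (along nu alpha (1 + int r))) = (\<Sum>r\<in>{r. d (along nu alpha (1 + int r)) ~= 0}. d (along nu alpha (1 + int r)))"
  by (rule suminf_finite[OF finite_half_line[OF assms(1) alpha]]) auto
 also have "... = (\<Sum>r\<in>T. d (along nu alpha r))"
 proof (rule sum.reindex_bij_witness[of _ "%r. nat (r - 1)" "%r. 1 + int r"])
  fix b assume b: "b \<in> T"
  show "1 + int (nat (b - 1)) = b" using pos[OF b] by simp
  then show "nat (b - 1) \<in> {r. d (along nu alpha (1 + int r)) ~= 0}" using b by (simp add: T_def)
 qed (auto simp: T_def)
 finally show ?thesis using z by simp
qed

text \<open>This is the divisibility of \<open>f - s f\<close> by \<open>1 - z^(-alpha)\<close> in
  coefficient form: past the last support point the tail is empty, and before the first one it is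
  the full antisymmetric sum, which vanishes.\<close>

lemma Nop_between:
 assumes "fin_supp c" "is_refl alpha s" "Nop alpha s c nu ~= 0"
 shows "\<exists>r\<ge>0. c (along nu alpha r) - c (s (along nu alpha r)) ~= 0"
  and "\<exists>r\<le>0. c (along nu alpha r) - c (s (along nu alpha r)) ~= 0"
proof -
 define d where "d = (%nu. c nu - c (s nu))"
 have N: "Nop alpha s c nu = d nu + 2*(\<Sum>r. d (along nu alpha (1 + int r)))" by (simp add: Nop_def d_def)
 have dd: "fin_supp d" unfolding d_def by (rule fin_supp_anti[OF assms(1,2)])
 have anti: "d (s nu) = - d nu" for nu using assms(2) by (simp add: d_def is_refl_def)
 show "\<exists>r\<ge>0. c (along nu alpha r) - c (s (along nu alpha r)) ~= 0"
 proof (rule ccontr)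
  assume "\<not> ?thesis"
  then have z: "d (along nu alpha r) = 0" if "r >= 0" for r using that by (auto simp: d_def)
  have "d nu = 0" using z[of 0] by simp
  moreover have "(%r. d (along nu alpha (1 + int r))) = (%r. 0)" using z by auto
  ultimately show False using N assms(3) by simp
 qed
 show "\<exists>r\<le>0. c (along nu alpha r) - c (s (along nu alpha r)) ~= 0"
 proof (rule ccontr)
  assume "\<not> ?thesis"
  then have z: "d (along nu alpha r) = 0" if "r <= 0" for r using that by (auto simp: d_def)
  have "d nu = 0" using z[of 0] by simp
  then show False using line_sum_zero[OF dd assms(2) anti z] N assms(3) by simp
 qed
qed

lemma fin_supp_Nop:
 assumes "fin_supp c" "is_refl alpha s" shows "fin_supp (Nop alpha s c)"
proof -
 define d where "d = (%nu. c nu - c (s nu))"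
 have D: "finite {mu. d mu ~= 0}" using fin_supp_anti[OF assms] by (simp add: fin_supp_def d_def)
 obtain k where k: "alpha k ~= 0" using assms(2) unfolding is_refl_def by blast
 \<comment> \<open>A coordinate with \<open>alpha k ~= 0\<close> bounds the number of steps between
   the two support points enclosing \<open>nu\<close>, so \<open>nu\<close> lies in a finite union
   of segments.\<close>
 have "{nu. Nop alpha s c nu ~= 0} \<subseteq>
  (\<Union>mu\<in>{mu. d mu ~= 0}. \<Union>mu'\<in>{mu. d mu ~= 0}. (%r. along mu alpha r) ` {- \<bar>mu k - mu' k\<bar>..0})"
 proof
  fix nu assume "nu \<in> {nu. Nop alpha s c nu ~= 0}"
  then have "Nop alpha s c nu ~= 0" by simp
  from Nop_between[OF assms this] obtain r q where
   r: "r >= 0" "d (along nu alpha r) ~= 0" and q: "q <= 0" "d (along nu alpha q) ~= 0"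
   by (auto simp: d_def)
  have e: "along nu alpha r k - along nu alpha q k = (r - q) * alpha k" by (simp add: along_def algebra_simps)
  have "1 <= \<bar>alpha k\<bar>" using k by linarith
  then have "(r - q)*1 <= (r - q)*\<bar>alpha k\<bar>" using r q by (intro mult_left_mono) auto
  then have "r <= \<bar>along nu alpha r k - along nu alpha q k\<bar>" using r q unfolding e by (simp add: abs_mult)
  moreover have "nu = along (along nu alpha r) alpha (- r)" by simp
  ultimately have "nu \<in> (%x. along (along nu alpha r) alpha x) ` {- \<bar>along nu alpha r k - along nu alpha q k\<bar>..0}"
   using r by (intro image_eqI[of _ _ "- r"]) auto
  then show "nu \<in> (\<Union>mu\<in>{mu. d mu ~= 0}. \<Union>mu'\<in>{mu. d mu ~= 0}. (%r. along mu alpha r) ` {- \<bar>mu k - mu' k\<bar>..0})"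
   using r q by blast
 qed
 then show ?thesis unfolding fin_supp_def by (rule finite_subset) (use D in auto)
qed

text \<open>The difference equation says
  \<open>(1 - z^(-alpha)) G = (1 + z^(-alpha)) (f - s f)\<close>. Two finitely supported solutions
  differ by a function that is periodic along \<open>alpha\<close>, hence by 0. Linearity, sign
  change and the multiplication rules for \<open>Nop\<close> are obtained by exhibiting a
  solution.\<close>

lemma Nop_unique:
 assumes "fin_supp G" "fin_supp c" "is_refl alpha s"
  "\<And>nu. G nu - G (along nu alpha 1) = (c nu - c (s nu)) + (c (along nu alpha 1) - c (s (along nu alpha 1)))"
 shows "Nop alpha s c = G"
proof -
 define h where "h = (%nu. Nop alpha s c nu - G nu)"
 have fh: "fin_supp h" unfolding h_def by (intro fin_supp_diff fin_supp_Nop assms)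
 have per: "h (along nu alpha 1) = h nu" for nu
  using Nop_diff[OF assms(2,3), of nu] assms(4)[of nu] unfolding h_def by algebra
 have per': "h (along nu alpha (int r)) = h nu" for nu r
 proof (induction r)
  case (Suc r)
  have "h (along nu alpha (int (Suc r))) = h (along (along nu alpha (int r)) alpha 1)" by (simp add: algebra_simps)
  then show ?case using per Suc by metis
 qed simp
 have "h nu = 0" for nu
 proof (rule ccontr)
  assume "h nu ~= 0"
  then have "range int \<subseteq> {r. h (along nu alpha r) ~= 0}" using per' by auto
  moreover have "finite {r. h (along nu alpha r) ~= 0}"
   using finite_line[OF fh] assms(3) by (simp add: is_refl_def)
  ultimately have "finite (range int)" by (rule finite_subset)
  then show False using finite_imageD[of int UNIV] by (simp add: inj_def)
 qed
 then show ?thesis by (auto simp: h_def)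
qed

lemma Nop_lincomb:
 assumes "fin_supp c" "fin_supp d" "is_refl alpha s"
 shows "Nop alpha s (%nu. x * c nu + y * d nu) = (%nu. x * Nop alpha s c nu + y * Nop alpha s d nu)"
proof (rule Nop_unique)
 show "fin_supp (%nu. x * Nop alpha s c nu + y * Nop alpha s d nu)" "fin_supp (%nu. x * c nu + y * d nu)"
  by (intro fin_supp_add fin_supp_scale fin_supp_Nop assms)+
 fix nu
 have "x*(Nop alpha s c nu - Nop alpha s c (along nu alpha 1)) + y*(Nop alpha s d nu - Nop alpha s d (along nu alpha 1)) =
  x*((c nu - c (s nu)) + (c (along nu alpha 1) - c (s (along nu alpha 1)))) +
  y*((d nu - d (s nu)) + (d (along nu alpha 1) - d (s (along nu alpha 1))))"
  by (simp only: Nop_diff[OF assms(1,3)] Nop_diff[OF assms(2,3)])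
 then show "x * Nop alpha s c nu + y * Nop alpha s d nu - (x * Nop alpha s c (along nu alpha 1) + y * Nop alpha s d (along nu alpha 1)) =
  x * c nu + y * d nu - (x * c (s nu) + y * d (s nu)) +
  (x * c (along nu alpha 1) + y * d (along nu alpha 1) - (x * c (s (along nu alpha 1)) + y * d (s (along nu alpha 1))))"
  by (simp add: algebra_simps)
qed (rule assms)

lemma is_refl_neg: "is_refl alpha s ==> is_refl (%k. - alpha k) s"
proof -
 assume a: "is_refl alpha s"
 have e: "along nu (%k. - alpha k) r = along nu alpha (- r)" for nu r by (simp add: along_def)
 have "\<exists>m. s nu = along nu alpha (- m)" for nu
 proof -
  obtain m where "s nu = along nu alpha m" using a unfolding is_refl_def by blast
  then show ?thesis by (intro exI[of _ "-m"]) simp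
 qed
 then show ?thesis using a unfolding is_refl_def e by (auto simp: fun_eq_iff)
qed

text \<open>The fraction \<open>(1 + x) / (1 - x)\<close> is odd under the exchange of
  \<open>x\<close> and \<open>1 / x\<close>.\<close>

lemma Nop_neg:
 assumes "fin_supp c" "is_refl alpha s"
 shows "Nop (%k. - alpha k) s c = (%nu. - Nop alpha s c nu)"
proof (rule Nop_unique)
 show "fin_supp (%nu. - Nop alpha s c nu)"
  using fin_supp_scale[OF fin_supp_Nop[OF assms], of "%_. -1"] by simp
 fix nu
 have e: "along nu (%k. - alpha k) 1 = along nu alpha (- 1)" by (simp add: along_def)
 show "- Nop alpha s c nu - - Nop alpha s c (along nu (%k. - alpha k) 1) = c nu - c (s nu) + (c (along nu (%k. - alpha k) 1) - c (s (along nu (%k. - alpha k) 1)))"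
  unfolding e using Nop_diff[OF assms, of "along nu alpha (-1)"] by (simp add: algebra_simps)
qed (use assms is_refl_neg in auto)

lemma Nop_equivariant:
 assumes "\<And>nu r. t (along nu alpha r) = along (t nu) beta r" "\<And>nu. t (s nu) = s' (t nu)"
 shows "Nop alpha s (c \<circ> t) = Nop beta s' c \<circ> t"
 by (rule ext) (simp add: Nop_def assms)

text \<open>Commutation with multiplication by \<open>z^beta\<close> when
  \<open>s beta = beta - alpha\<close>, that is, when the coroot of \<open>alpha\<close> takes the
  value 1 on \<open>beta\<close>. \<open>Nop_mult2\<close> is the case \<open>beta = alpha\<close>,
  where the value is 2 and an extra middle term appears.\<close>

lemma Nop_mult1:
 assumes "fin_supp c" "is_refl alpha s" "\<And>mu. s (along mu beta (-1)) = along (along (s mu) beta (-1)) alpha 1"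
  "inj (%mu. along mu beta (-1))"
 shows "Nop alpha s (%nu. c (along nu beta (-1))) =
  (%nu. Nop alpha s c (along nu beta (-1)) + c (s (along nu beta (-1))) + c (s (along (along nu beta (-1)) alpha 1)))"
  (is "Nop alpha s ?c = ?G")
proof (rule Nop_unique)
 have inj: "inj s" "inj (%mu. along mu alpha 1)"
  using is_refl_inj[OF assms(2)] by (auto simp: inj_def along_def fun_eq_iff)
 have fs: "fin_supp (%nu. d (along nu beta (-1)))" if "fin_supp d" for d
  using fin_supp_comp_inj[OF that assms(4)] by (simp add: o_def)
 show "fin_supp ?c" by (rule fs[OF assms(1)])
 have cs: "fin_supp (%nu. c (s nu))" using fin_supp_comp_inj[OF assms(1) inj(1)] by (simp add: o_def)
 have cs': "fin_supp (%nu. c (s (along nu alpha 1)))" using fin_supp_comp_inj[OF cs inj(2)] by (simp add: o_def)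
 show "fin_supp ?G"
  by (intro fin_supp_add fs[OF fin_supp_Nop[OF assms(1,2)]] fs[OF cs] fs[OF cs'])
 fix nu
 have comm: "along (along nu alpha 1) beta (-1) = along (along nu beta (-1)) alpha 1" by (auto simp: along_def)
 have s1: "along (s mu) beta (-1) = s (along (along mu beta (-1)) alpha 1)" for mu
  using assms(3)[of mu] assms(2) by (simp add: is_refl_def)
 have "Nop alpha s c (along nu beta (-1)) - Nop alpha s c (along (along nu beta (-1)) alpha 1) =
  c (along nu beta (-1)) - c (s (along nu beta (-1))) + (c (along (along nu beta (-1)) alpha 1) - c (s (along (along nu beta (-1)) alpha 1)))"
  by (rule Nop_diff[OF assms(1,2)])
 then show "?G nu - ?G (along nu alpha 1) = ?c nu - ?c (s nu) + (?c (along nu alpha 1) - ?c (s (along nu alpha 1)))"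
  unfolding s1 comm by (simp add: algebra_simps)
qed (rule assms)

lemma Nop_mult2:
 assumes "fin_supp c" "is_refl alpha s" "\<And>mu. s (along mu alpha (-1)) = along (s mu) alpha 1"
 shows "Nop alpha s (%nu. c (along nu alpha (-1))) =
  (%nu. Nop alpha s c (along nu alpha (-1)) + c (s (along nu alpha (-1))) + 2 * c (s nu) + c (s (along nu alpha 1)))"
  (is "Nop alpha s ?c = ?G")
proof (rule Nop_unique)
 have inj: "inj s" "inj (%mu. along mu alpha 1)" "inj (%mu. along mu alpha (-1))"
  using is_refl_inj[OF assms(2)] by (auto simp: inj_def along_def fun_eq_iff)
 have fs: "fin_supp (%nu. d (along nu alpha (-1)))" if "fin_supp d" for d
  using fin_supp_comp_inj[OF that inj(3)] by (simp add: o_def)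
 show "fin_supp ?c" by (rule fs[OF assms(1)])
 have cs: "fin_supp (%nu. c (s nu))" using fin_supp_comp_inj[OF assms(1) inj(1)] by (simp add: o_def)
 have cs': "fin_supp (%nu. c (s (along nu alpha 1)))" using fin_supp_comp_inj[OF cs inj(2)] by (simp add: o_def)
 show "fin_supp ?G"
  by (intro fin_supp_add fs[OF fin_supp_Nop[OF assms(1,2)]] fs[OF cs] cs' fin_supp_scale cs)
 fix nu
 have s1: "along (s mu) alpha (-1) = s (along mu alpha 1)" for mu
  using assms(2) by (simp add: is_refl_def)
 have "Nop alpha s c (along nu alpha (-1)) - Nop alpha s c nu =
  c (along nu alpha (-1)) - c (s (along nu alpha (-1))) + (c nu - c (s nu))"
  using Nop_diff[OF assms(1,2), of "along nu alpha (-1)"] by simp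
 then show "?G nu - ?G (along nu alpha 1) = ?c nu - ?c (s nu) + (?c (along nu alpha 1) - ?c (s (along nu alpha 1)))"
  unfolding s1 by (simp add: algebra_simps)
qed (rule assms)

section \<open>Dunkl and Cherednik operators of type BC\<close>

text \<open>\<open>ee i\<close>, \<open>rm i j\<close>, \<open>rp i j\<close> and
  \<open>rl i\<close> are the roots of type BC: the short ones, the two kinds of medium length, and
  the long ones. Their reflections are \<open>fl\<close>, \<open>sw\<close>, \<open>ssw\<close> and
  again \<open>fl\<close>.\<close>

definition ee :: "nat => nat => int" where
 "ee i = (%k. if k = i then 1 else 0)"

definition rm :: "nat => nat => nat => int" where
 "rm i j = (%k. ee i k - ee j k)"

definition rp :: "nat => nat => nat => int" where
 "rp i j = (%k. ee i k + ee j k)"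

definition rl :: "nat => nat => int" where
 "rl i = (%k. 2 * ee i k)"

definition fl :: "nat => (nat => int) => nat => int" where
 "fl i mu = (%k. if k = i then - mu i else mu k)"

definition pm :: "(nat => nat) => (nat => int) => nat => int" where
 "pm sig mu = (%k. mu (sig k))"

definition sw :: "nat => nat => (nat => int) => nat => int" where
 "sw i j mu = (%k. if k = i then mu j else if k = j then mu i else mu k)"

definition ssw :: "nat => nat => (nat => int) => nat => int" where
 "ssw i j mu = (%k. if k = i then - mu j else if k = j then - mu i else mu k)"

lemma sw_pm: "sw i j = pm (Transposition.transpose i j)"
 by (auto simp: sw_def pm_def fun_eq_iff Transposition.transpose_def)

lemma is_reflI:
 assumes "alpha ~= (%_. 0)" "\<And>nu. s (s nu) = nu" "\<And>nu r. s (along nu alpha r) = along (s nu) alpha (- r)"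
  "\<And>nu. s nu = along nu alpha (m nu)"
 shows "is_refl alpha s"
 using assms unfolding is_refl_def by blast

lemma is_refl_rm: "i ~= j ==> is_refl (rm i j) (sw i j)"
 by (rule is_reflI[of _ _ "%nu. nu j - nu i"]) (auto simp: rm_def ee_def sw_def along_def fun_eq_iff)

lemma is_refl_rp: "i ~= j ==> is_refl (rp i j) (ssw i j)"
 by (rule is_reflI[of _ _ "%nu. - nu j - nu i"]) (auto simp: rp_def ee_def ssw_def along_def fun_eq_iff)

lemma is_refl_ee: "is_refl (ee i) (fl i)"
 by (rule is_reflI[of _ _ "%nu. - 2 * nu i"]) (auto simp: ee_def fl_def along_def fun_eq_iff)

lemma is_refl_rl: "is_refl (rl i) (fl i)"
 by (rule is_reflI[of _ _ "%nu. - nu i"]) (auto simp: rl_def ee_def fl_def along_def fun_eq_iff)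

lemma lp_ok_fin: "lp_ok n c ==> fin_supp c"
 by (simp add: lp_ok_def fin_supp_def)

lemma lp_ok_alt: "lp_ok n c \<longleftrightarrow> fin_supp c \<and> (\<forall>nu k. k >= n --> nu k ~= 0 --> c nu = 0)"
 unfolding lp_ok_def fin_supp_def by blast

lemma lp_ok_Nop:
 assumes "lp_ok n c" "is_refl alpha s" "\<And>k. k >= n ==> alpha k = 0"
 shows "lp_ok n (Nop alpha s c)"
 unfolding lp_ok_alt
proof (intro conjI allI impI)
 show "fin_supp (Nop alpha s c)" using fin_supp_Nop lp_ok_fin assms by blast
 fix nu :: "nat => int" and k assume k: "k >= n" "nu k ~= 0"
 show "Nop alpha s c nu = 0"
 proof (rule ccontr)
  assume "Nop alpha s c nu ~= 0"
  from Nop_between(1)[OF lp_ok_fin[OF assms(1)] assms(2) this] obtain r where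
   "c (along nu alpha r) ~= 0 \<or> c (s (along nu alpha r)) ~= 0" by (metis diff_self)
  moreover obtain m where "s (along nu alpha r) = along (along nu alpha r) alpha m"
   using assms(2) unfolding is_refl_def by blast
  ultimately have "along nu alpha r k = 0 \<or> along nu alpha (r + m) k = 0"
   using assms(1) k by (auto simp: lp_ok_def)
  then show False using assms(3)[OF k(1)] k(2) by (simp add: along_def)
 qed
qed

lemma lp_ok_comp:
 assumes "lp_ok n c" "inj s" "\<And>nu k. k >= n ==> s nu k = nu k"
 shows "lp_ok n (c \<circ> s)"
 using assms fin_supp_comp_inj[of c s] unfolding lp_ok_alt by auto

lemma lp_ok_lincomb:
 "lp_ok n c ==> lp_ok n d ==> lp_ok n (%nu. x * c nu + y * d nu)"
 using fin_supp_add[OF fin_supp_scale fin_supp_scale, of c d "%_. x" "%_. y"] unfolding lp_ok_alt by auto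

lemma lp_ok_sum:
 "finite A ==> (\<And>a. a \<in> A ==> lp_ok n (f a)) ==> lp_ok n (%nu. \<Sum>a\<in>A. f a nu)"
proof (induction A rule: finite_induct)
 case empty then show ?case by (simp add: lp_ok_def)
next
 case (insert a A)
 then have "lp_ok n (%nu. 1 * f a nu + 1*(\<Sum>a\<in>A. f a nu))" by (intro lp_ok_lincomb) auto
 then show ?case using insert by simp
qed

lemma lp_ok_add: "lp_ok n c ==> lp_ok n d ==> lp_ok n (%nu. c nu + d nu)"
 using lp_ok_lincomb[of n c d 1 1] by simp

lemma lp_ok_scale: "lp_ok n c ==> lp_ok n (%nu. g nu * c nu)"
 using fin_supp_scale[of c g] unfolding lp_ok_alt by auto

lemma inj_maps: "inj (fl i)" "inj (sw i j)" "inj (ssw i j)"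
 by (rule inj_on_inverseI[of _ "fl i"], simp add: fl_def fun_eq_iff,
   rule inj_on_inverseI[of _ "sw i j"], simp add: sw_def fun_eq_iff,
   rule inj_on_inverseI[of _ "ssw i j"], simp add: ssw_def fun_eq_iff)

lemma inj_pm: "sig permutes S ==> inj (pm sig)"
 by (rule injI) (metis pm_def permutes_inverses(1) ext)

text \<open>In terms of the Jacobi parameters, \<open>k1 = a - b\<close> and \<open>k2 = b + 1/2\<close>.\<close>

locale bc =
 fixes n :: nat and theta k1 k2 :: real
 assumes theta_pos: "theta > 0" and k1_nonneg: "k1 >= 0" and k2_nonneg: "k2 >= 0"
begin

text \<open>Heckman's form of the trigonometric Dunkl operator: \<open>z_i d/dz_i\<close> plus one
  term for each root involving \<open>i\<close>, with multiplicities \<open>theta\<close>,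
  \<open>k1\<close>, \<open>k2\<close>. The long root carries \<open>k2\<close> instead of
  \<open>k2/2\<close> because its coordinate \<open>i\<close> is 2. No ordering of the variables
  enters, which is the source of the equivariance.\<close>

definition Sop :: "nat => lpoly => lpoly" where
 "Sop i c nu = of_int (nu i) * c nu
   + of_real (theta/2)*(\<Sum>j\<in>{..<n}-{i}. Nop (rm i j) (sw i j) c nu + Nop (rp i j) (ssw i j) c nu)
   + of_real (k1/2) * Nop (ee i) (fl i) c nu + of_real k2 * Nop (rl i) (fl i) c nu"

definition rho0 :: real where "rho0 = k1/2 + k2"

text \<open>Cherednik's form. For a positive root, \<open>Nop\<close> minus the reflection is
  \<open>2 / (1 - z^(-alpha))\<close> applied to \<open>f - s f\<close>, minus the identity, so this
  is the usual divided difference operator shifted by a constant. For \<open>j < i\<close> the root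
  \<open>rm i j\<close> is negative, whence the other sign.\<close>

definition Yop :: "nat => lpoly => lpoly" where
 "Yop i c nu = Sop i c nu
   - of_real (theta/2)*((\<Sum>j\<in>{i<..<n}. c (sw i j nu)) - (\<Sum>j<i. c (sw i j nu)) + (\<Sum>j\<in>{..<n}-{i}. c (ssw i j nu)))
   - of_real rho0 * c (fl i nu)"

lemma lp_ok_roots:
 assumes "lp_ok n c" "i < n"
 shows "j < n ==> j ~= i ==> lp_ok n (Nop (rm i j) (sw i j) c)"
  "j < n ==> j ~= i ==> lp_ok n (Nop (rp i j) (ssw i j) c)"
  "lp_ok n (Nop (ee i) (fl i) c)" "lp_ok n (Nop (rl i) (fl i) c)"
proof -
 show "lp_ok n (Nop (rm i j) (sw i j) c)" if "j < n" "j ~= i"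
  by (rule lp_ok_Nop[OF assms(1) is_refl_rm]) (use assms(2) that in \<open>auto simp: rm_def ee_def\<close>)
 show "lp_ok n (Nop (rp i j) (ssw i j) c)" if "j < n" "j ~= i"
  by (rule lp_ok_Nop[OF assms(1) is_refl_rp]) (use assms(2) that in \<open>auto simp: rp_def ee_def\<close>)
 show "lp_ok n (Nop (ee i) (fl i) c)"
  by (rule lp_ok_Nop[OF assms(1) is_refl_ee]) (use assms(2) in \<open>auto simp: ee_def\<close>)
 show "lp_ok n (Nop (rl i) (fl i) c)"
  by (rule lp_ok_Nop[OF assms(1) is_refl_rl]) (use assms(2) in \<open>auto simp: rl_def ee_def\<close>)
qed

lemma lp_ok_Sop:
 assumes "lp_ok n c" "i < n" shows "lp_ok n (Sop i c)"
 unfolding Sop_def[abs_def]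
 by (intro lp_ok_add lp_ok_sum lp_ok_scale lp_ok_roots assms) auto

lemma Sop_lincomb:
 assumes "lp_ok n c" "lp_ok n d" "i < n"
 shows "Sop i (%nu. x * c nu + y * d nu) = (%nu. x * Sop i c nu + y * Sop i d nu)"
proof
 fix nu
 note L = Nop_lincomb[OF lp_ok_fin[OF assms(1)] lp_ok_fin[OF assms(2)]]
 have 1: "(\<Sum>j\<in>{..<n}-{i}. Nop (rm i j) (sw i j) (%nu. x * c nu + y * d nu) nu + Nop (rp i j) (ssw i j) (%nu. x * c nu + y * d nu) nu)
  = x*(\<Sum>j\<in>{..<n}-{i}. Nop (rm i j) (sw i j) c nu + Nop (rp i j) (ssw i j) c nu)
  + y*(\<Sum>j\<in>{..<n}-{i}. Nop (rm i j) (sw i j) d nu + Nop (rp i j) (ssw i j) d nu)"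
  unfolding sum_distrib_left sum.distrib[symmetric]
  by (rule sum.cong) (auto simp: L[OF is_refl_rm] L[OF is_refl_rp] algebra_simps)
 show "Sop i (%nu. x * c nu + y * d nu) nu = x * Sop i c nu + y * Sop i d nu"
  unfolding Sop_def 1 L[OF is_refl_ee] L[OF is_refl_rl] by (simp add: algebra_simps)
qed

lemma Sop_pm:
 assumes "sig permutes {..<n}" "lp_ok n c" "i < n"
 shows "Sop (sig i) (c \<circ> pm sig) = Sop i c \<circ> pm sig"
proof
 fix nu
 have inj: "sig a = sig b \<longleftrightarrow> a = b" for a b using permutes_inj[OF assms(1)] by (auto dest: injD)
 have 1: "Nop (rm (sig i) (sig j)) (sw (sig i) (sig j)) (c \<circ> pm sig) = Nop (rm i j) (sw i j) c \<circ> pm sig" for j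
  by (rule Nop_equivariant) (auto simp: pm_def along_def rm_def ee_def sw_def inj fun_eq_iff)
 have 2: "Nop (rp (sig i) (sig j)) (ssw (sig i) (sig j)) (c \<circ> pm sig) = Nop (rp i j) (ssw i j) c \<circ> pm sig" for j
  by (rule Nop_equivariant) (auto simp: pm_def along_def rp_def ee_def ssw_def inj fun_eq_iff)
 have 3: "Nop (ee (sig i)) (fl (sig i)) (c \<circ> pm sig) = Nop (ee i) (fl i) c \<circ> pm sig"
  by (rule Nop_equivariant) (auto simp: pm_def along_def ee_def fl_def inj fun_eq_iff)
 have 4: "Nop (rl (sig i)) (fl (sig i)) (c \<circ> pm sig) = Nop (rl i) (fl i) c \<circ> pm sig"
  by (rule Nop_equivariant) (auto simp: pm_def along_def rl_def ee_def fl_def inj fun_eq_iff)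
 have 5: "(\<Sum>j\<in>{..<n}-{sig i}. f j) = (\<Sum>j\<in>{..<n}-{i}. f (sig j))" for f :: "nat => complex"
  using permutes_inverses[OF assms(1)] permutes_in_image[OF assms(1)] permutes_in_image[OF permutes_inv[OF assms(1)]]
  by (intro sum.reindex_bij_witness[of _ sig "inv sig"]) (auto simp: inj)
 show "Sop (sig i) (c \<circ> pm sig) nu = (Sop i c \<circ> pm sig) nu"
  unfolding Sop_def 5 1 2 3 4 by (simp add: Sop_def pm_def)
qed

lemma Sop_fl:
 assumes "p < n" "lp_ok n c" "i < n"
 shows "Sop i (c \<circ> fl p) = (%nu. (if i = p then - 1 else 1) * Sop i c (fl p nu))"
proof
 fix nu
 note fs = lp_ok_fin[OF assms(2)]
 show "Sop i (c \<circ> fl p) nu = (if i = p then - 1 else 1) * Sop i c (fl p nu)"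
 proof (cases "i = p")
  case True
  have 1: "Nop (rm p j) (sw p j) (c \<circ> fl p) = Nop (%k. - rp p j k) (ssw p j) c \<circ> fl p" if "j ~= p" for j
   by (rule Nop_equivariant) (use that in \<open>auto simp: fl_def along_def rm_def rp_def ee_def sw_def ssw_def fun_eq_iff\<close>)
  have 2: "Nop (rp p j) (ssw p j) (c \<circ> fl p) = Nop (%k. - rm p j k) (sw p j) c \<circ> fl p" if "j ~= p" for j
   by (rule Nop_equivariant) (use that in \<open>auto simp: fl_def along_def rm_def rp_def ee_def sw_def ssw_def fun_eq_iff\<close>)
  have 3: "Nop (ee p) (fl p) (c \<circ> fl p) = Nop (%k. - ee p k) (fl p) c \<circ> fl p"
   by (rule Nop_equivariant) (auto simp: fl_def along_def ee_def fun_eq_iff)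
  have 4: "Nop (rl p) (fl p) (c \<circ> fl p) = Nop (%k. - rl p k) (fl p) c \<circ> fl p"
   by (rule Nop_equivariant) (auto simp: fl_def along_def rl_def ee_def fun_eq_iff)
  have 5: "(\<Sum>j\<in>{..<n}-{p}. Nop (rm p j) (sw p j) (c \<circ> fl p) nu + Nop (rp p j) (ssw p j) (c \<circ> fl p) nu)
   = - (\<Sum>j\<in>{..<n}-{p}. Nop (rm p j) (sw p j) c (fl p nu) + Nop (rp p j) (ssw p j) c (fl p nu))"
   unfolding sum_negf[symmetric]
   by (rule sum.cong) (auto simp: 1 2 Nop_neg[OF fs is_refl_rp] Nop_neg[OF fs is_refl_rm])
  show ?thesis
   unfolding True Sop_def 5 3 4 Nop_neg[OF fs is_refl_ee] Nop_neg[OF fs is_refl_rl]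
   by (simp add: fl_def algebra_simps)
 next
  case False
  have 1: "Nop (rm i j) (sw i j) (c \<circ> fl p) = Nop (rm i j) (sw i j) c \<circ> fl p" if "j ~= p" for j
   by (rule Nop_equivariant) (use that False in \<open>auto simp: fl_def along_def rm_def rp_def ee_def sw_def ssw_def fun_eq_iff\<close>)
  have 2: "Nop (rp i j) (ssw i j) (c \<circ> fl p) = Nop (rp i j) (ssw i j) c \<circ> fl p" if "j ~= p" for j
   by (rule Nop_equivariant) (use that False in \<open>auto simp: fl_def along_def rm_def rp_def ee_def sw_def ssw_def fun_eq_iff\<close>)
  have m1: "Nop (rm i p) (sw i p) (c \<circ> fl p) = Nop (rp i p) (ssw i p) c \<circ> fl p"
   by (rule Nop_equivariant) (use False in \<open>auto simp: fl_def along_def rm_def rp_def ee_def sw_def ssw_def fun_eq_iff\<close>)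
  have m2: "Nop (rp i p) (ssw i p) (c \<circ> fl p) = Nop (rm i p) (sw i p) c \<circ> fl p"
   by (rule Nop_equivariant) (use False in \<open>auto simp: fl_def along_def rm_def rp_def ee_def sw_def ssw_def fun_eq_iff\<close>)
  have 3: "Nop (ee i) (fl i) (c \<circ> fl p) = Nop (ee i) (fl i) c \<circ> fl p"
   by (rule Nop_equivariant) (use False in \<open>auto simp: fl_def along_def ee_def fun_eq_iff\<close>)
  have 4: "Nop (rl i) (fl i) (c \<circ> fl p) = Nop (rl i) (fl i) c \<circ> fl p"
   by (rule Nop_equivariant) (use False in \<open>auto simp: fl_def along_def rl_def ee_def fun_eq_iff\<close>)
  have 5: "Nop (rm i j) (sw i j) (c \<circ> fl p) nu + Nop (rp i j) (ssw i j) (c \<circ> fl p) nu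
   = Nop (rm i j) (sw i j) c (fl p nu) + Nop (rp i j) (ssw i j) c (fl p nu)" for j
   by (cases "j = p") (auto simp: 1 2 m1 m2)
  show ?thesis unfolding Sop_def 5 3 4 using False by (simp add: fl_def)
 qed
qed

text \<open>The order of the indices enters \<open>Yop\<close> only through the signs of the terms
  with \<open>sw\<close>. An adjacent transposition changes exactly one relative order, that of
  \<open>p\<close> and \<open>Suc p\<close>, and the two halves of \<open>theta\<close> coming from
  there add up.\<close>

lemma Yop_sw:
 assumes "Suc p < n" "lp_ok n c" "i < n"
 shows "i ~= p ==> i ~= Suc p ==> Yop i (c \<circ> sw p (Suc p)) nu = Yop i c (sw p (Suc p) nu)"
  and Yop_sw_left: "Yop p (c \<circ> sw p (Suc p)) nu = Yop (Suc p) c (sw p (Suc p) nu) - of_real theta * c nu"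
proof -
 define tau where "tau = Transposition.transpose p (Suc p)"
 have perm: "tau permutes {..<n}" unfolding tau_def using assms(1) by (intro permutes_swap_id) auto
 have swt: "sw p (Suc p) = pm tau" by (simp add: tau_def sw_pm)
 have tt: "tau p = Suc p" "tau (Suc p) = p" "\<And>j. j ~= p ==> j ~= Suc p ==> tau j = j" "\<And>j. tau (tau j) = j"
  by (auto simp: tau_def Transposition.transpose_def)
 have inj: "tau a = tau b \<longleftrightarrow> a = b" for a b by (metis tt(4))
 have tteq: "tau a = b \<longleftrightarrow> a = tau b" for a b by (metis tt(4))
 have e1: "pm tau (sw i j nu) = sw (tau i) (tau j) (pm tau nu)" for i j nu
  by (simp add: pm_def sw_def fun_eq_iff tteq tt(4))
 have e2: "pm tau (ssw i j nu) = ssw (tau i) (tau j) (pm tau nu)" for i j nu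
  by (simp add: pm_def ssw_def fun_eq_iff tteq tt(4))
 have e3: "pm tau (fl i nu) = fl (tau i) (pm tau nu)" for i nu
  by (simp add: pm_def fl_def fun_eq_iff tteq tt(4))
 have lt: "tau j < n \<longleftrightarrow> j < n" for j using permutes_in_image[OF perm, of j] by simp
 have ss: "(\<Sum>j\<in>{..<n}-{i}. f (tau j)) = (\<Sum>j\<in>{..<n}-{tau i}. f j)" for f :: "nat => complex" and i
  by (rule sum.reindex_bij_witness[of _ tau tau]) (auto simp: tt lt inj)
 show "Yop i (c \<circ> sw p (Suc p)) nu = Yop i c (sw p (Suc p) nu)" if i: "i ~= p" "i ~= Suc p"
 proof -
  have S: "Sop i (c \<circ> pm tau) nu = Sop i c (pm tau nu)"
   using Sop_pm[OF perm assms(2,3)] tt(3)[OF i] by simp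
  have lt2: "i < tau j \<longleftrightarrow> i < j" "tau j < i \<longleftrightarrow> j < i" for j
   using i by (auto simp: tau_def Transposition.transpose_def)
  have s1: "(\<Sum>j\<in>{i<..<n}. f (tau j)) = (\<Sum>j\<in>{i<..<n}. f j)" for f :: "nat => complex"
   by (rule sum.reindex_bij_witness[of _ tau tau]) (auto simp: tt lt inj lt2)
  have s2: "(\<Sum>j<i. f (tau j)) = (\<Sum>j<i. f j)" for f :: "nat => complex"
   by (rule sum.reindex_bij_witness[of _ tau tau]) (auto simp: tt lt inj lt2)
  show ?thesis
   unfolding Yop_def swt S
   using ss[of "%j. c (ssw i j (pm tau nu))" i] s1[of "%j. c (sw i j (pm tau nu))"] s2[of "%j. c (sw i j (pm tau nu))"]
   by (simp add: e1 e2 e3 tt(3)[OF i])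
 qed
 have S: "Sop p (c \<circ> pm tau) nu = Sop (Suc p) c (pm tau nu)"
  using Sop_pm[OF perm assms(2) assms(1)] tt by simp
 have ins: "{p<..<n} = insert (Suc p) {Suc p<..<n}" using assms(1) by auto
 have s1: "(\<Sum>j\<in>{p<..<n}. c (sw (Suc p) (tau j) (pm tau nu))) = c nu + (\<Sum>j\<in>{Suc p<..<n}. c (sw (Suc p) j (pm tau nu)))"
 proof -
  have "sw (Suc p) p (pm tau nu) = nu" by (auto simp: sw_def pm_def tt fun_eq_iff)
  moreover have "(\<Sum>j\<in>{Suc p<..<n}. c (sw (Suc p) (tau j) (pm tau nu))) = (\<Sum>j\<in>{Suc p<..<n}. c (sw (Suc p) j (pm tau nu)))"
   by (rule sum.cong) (auto simp: tt)
  ultimately show ?thesis unfolding ins by (simp add: tt)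
 qed
 have s2: "(\<Sum>j<Suc p. c (sw (Suc p) j (pm tau nu))) = (\<Sum>j<p. c (sw (Suc p) (tau j) (pm tau nu))) + c nu"
 proof -
  have "sw (Suc p) p (pm tau nu) = nu" by (auto simp: sw_def pm_def tt fun_eq_iff)
  moreover have "(\<Sum>j<p. c (sw (Suc p) (tau j) (pm tau nu))) = (\<Sum>j<p. c (sw (Suc p) j (pm tau nu)))"
   by (rule sum.cong) (auto simp: tt)
  ultimately show ?thesis by simp
 qed
 show "Yop p (c \<circ> sw p (Suc p)) nu = Yop (Suc p) c (sw p (Suc p) nu) - of_real theta * c nu"
  unfolding Yop_def swt S s2 o_apply
  using ss[of "%j. c (ssw (Suc p) j (pm tau nu))" p] s1
  by (simp add: e1 e2 e3 tt algebra_simps)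
qed

lemma Yop_sw_right:
 assumes "Suc p < n" "lp_ok n c"
 shows "Yop (Suc p) (c \<circ> sw p (Suc p)) nu = Yop p c (sw p (Suc p) nu) + of_real theta * c nu"
proof -
 have inv: "sw p (Suc p) (sw p (Suc p) nu) = nu" for nu by (auto simp: sw_def fun_eq_iff)
 have ok: "lp_ok n (c \<circ> sw p (Suc p))" using assms by (intro lp_ok_comp inj_maps) (auto simp: sw_def)
 have "(c \<circ> sw p (Suc p)) \<circ> sw p (Suc p) = c" by (auto simp: inv)
 with Yop_sw_left[OF assms(1) ok, of p "sw p (Suc p) nu"] assms(1) show ?thesis by (simp add: inv)
qed

text \<open>For \<open>i\<close> before the last index the flip exchanges two reflection terms that
  carry the same sign. For the last index every term is negated except the flip itself, which
  accounts for twice \<open>rho0\<close>.\<close>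

lemma Yop_fl_last:
 assumes "n > 0" "lp_ok n c" "i < n"
 shows "i ~= n - 1 ==> Yop i (c \<circ> fl (n-1)) nu = Yop i c (fl (n-1) nu)"
  and "Yop (n-1) (c \<circ> fl (n-1)) nu = - Yop (n-1) c (fl (n-1) nu) - 2 * of_real rho0 * c nu"
proof -
 define l where "l = n - 1"
 have l: "l < n" using assms(1) by (simp add: l_def)
 note F = Sop_fl[OF l assms(2)]
 show "Yop i (c \<circ> fl (n-1)) nu = Yop i c (fl (n-1) nu)" if "i ~= n - 1"
 proof -
  from that have il: "i < l" using assms(3) by (simp add: l_def)
  have 1: "fl l (sw i j nu) = sw i j (fl l nu)" "fl l (ssw i j nu) = ssw i j (fl l nu)" if "j ~= l" for j
   using that il by (auto simp: fl_def sw_def ssw_def fun_eq_iff)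
  have 2: "fl l (sw i l nu) = ssw i l (fl l nu)" "fl l (ssw i l nu) = sw i l (fl l nu)"
   using il by (auto simp: fl_def sw_def ssw_def fun_eq_iff)
  have 3: "fl l (fl i nu) = fl i (fl l nu)" using il by (auto simp: fl_def fun_eq_iff)
  have sA: "(\<Sum>j\<in>{i<..<n}. f j) = f l + (\<Sum>j\<in>{i<..<l}. f j)" for f :: "nat => complex"
  proof -
   have "{i<..<n} = insert l {i<..<l}" using il by (auto simp: l_def)
   then show ?thesis by simp
  qed
  have sB: "(\<Sum>j\<in>{..<n}-{i}. f j) = f l + (\<Sum>j\<in>{..<l}-{i}. f j)" for f :: "nat => complex"
  proof -
   have "{..<n}-{i} = insert l ({..<l}-{i})" using il by (auto simp: l_def)
   then show ?thesis by simp
  qed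
  show ?thesis
   unfolding Yop_def l_def[symmetric] F[OF assms(3)] sA sB using il by (simp add: 1 2 3)
 qed
 have 1: "fl l (sw l j nu) = ssw l j (fl l nu)" "fl l (ssw l j nu) = sw l j (fl l nu)" if "j ~= l" for j
  using that by (auto simp: fl_def sw_def ssw_def fun_eq_iff)
 have 2: "fl l (fl l nu) = nu" by (auto simp: fl_def fun_eq_iff)
 have e: "{l<..<n} = {}" "{..<n} - {l} = {..<l}" using assms(1) by (auto simp: l_def)
 show "Yop (n-1) (c \<circ> fl (n-1)) nu = - Yop (n-1) c (fl (n-1) nu) - 2 * of_real rho0 * c nu"
  unfolding Yop_def l_def[symmetric] F[OF l] e by (simp add: 1 2 algebra_simps)
qed

end

section \<open>The affine reflection \<open>f(z) -> z_0 f(1/z_0, z_1, ...)\<close> and its relation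
  with the \<open>Yop i\<close>\<close>

definition s0 :: "(nat => int) => nat => int" where
 "s0 nu = (%k. if k = 0 then 1 - nu 0 else nu k)"

text \<open>The value -1 at 0 matters: zero entries and ties count as not yet raised. With it
  \<open>bar\<close> matches the eigenvalues of the constant polynomial, and
  \<open>eps (1 - t) = - eps t\<close>, so that \<open>s0\<close> acts on \<open>bar\<close> by a
  plain reflection.\<close>

definition eps :: "int => real" where
 "eps t = (if t > 0 then 1 else - 1)"

context bc
begin

text \<open>\<open>s0\<close> is the flip of variable 0 followed by multiplication by
  \<open>z_0\<close>. The multiplication rules apply with \<open>beta = ee 0\<close>, on which the
  coroots of \<open>rm 0 j\<close>, \<open>rp 0 j\<close> and \<open>rl 0\<close> take the value 1
  and that of \<open>ee 0\<close> the value 2.\<close>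

lemma Nop_s0:
 assumes "lp_ok n c" "0 < j"
 defines "g \<equiv> c \<circ> fl 0"
 shows "Nop (rm 0 j) (sw 0 j) (c \<circ> s0) nu = Nop (rm 0 j) (sw 0 j) g (along nu (ee 0) (-1)) + g (sw 0 j (along nu (ee 0) (-1))) + c (s0 (sw 0 j nu))"
  and "Nop (rp 0 j) (ssw 0 j) (c \<circ> s0) nu = Nop (rp 0 j) (ssw 0 j) g (along nu (ee 0) (-1)) + g (ssw 0 j (along nu (ee 0) (-1))) + c (s0 (ssw 0 j nu))"
  and "Nop (ee 0) (fl 0) (c \<circ> s0) nu = Nop (ee 0) (fl 0) g (along nu (ee 0) (-1)) + c (along nu (ee 0) (-1)) + 2 * c nu + c (s0 (fl 0 nu))"
  and "Nop (rl 0) (fl 0) (c \<circ> s0) nu = Nop (rl 0) (fl 0) g (along nu (ee 0) (-1)) + c (along nu (ee 0) (-1)) + c (s0 (fl 0 nu))"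
proof -
 have fg: "fin_supp g" unfolding g_def by (rule fin_supp_comp_inj[OF lp_ok_fin[OF assms(1)] inj_maps(1)])
 have cs0: "c \<circ> s0 = (%nu. g (along nu (ee 0) (-1)))"
  by (auto simp: g_def fun_eq_iff s0_def fl_def along_def ee_def intro!: arg_cong[of _ _ c])
 have inj: "inj (%mu. along mu (ee 0) (-1))" by (auto simp: inj_def along_def fun_eq_iff)
 have ne: "(0::nat) ~= j" using assms(2) by simp
 have a1: "sw 0 j (along mu (ee 0) (-1)) = along (along (sw 0 j mu) (ee 0) (-1)) (rm 0 j) 1" for mu
  using ne by (auto simp: sw_def along_def ee_def rm_def fun_eq_iff)
 have a2: "ssw 0 j (along mu (ee 0) (-1)) = along (along (ssw 0 j mu) (ee 0) (-1)) (rp 0 j) 1" for mu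
  using ne by (auto simp: ssw_def along_def ee_def rp_def fun_eq_iff)
 have a4: "fl 0 (along mu (ee 0) (-1)) = along (along (fl 0 mu) (ee 0) (-1)) (rl 0) 1" for mu
  by (auto simp: fl_def along_def ee_def rl_def fun_eq_iff)
 have a3: "fl 0 (along mu (ee 0) (-1)) = along (fl 0 mu) (ee 0) 1" for mu
  by (auto simp: fl_def along_def ee_def fun_eq_iff)
 have b1: "fl 0 (sw 0 j (along (along nu (ee 0) (-1)) (rm 0 j) 1)) = s0 (sw 0 j nu)"
  using ne by (auto simp: sw_def along_def ee_def rm_def fl_def s0_def fun_eq_iff)
 have b2: "fl 0 (ssw 0 j (along (along nu (ee 0) (-1)) (rp 0 j) 1)) = s0 (ssw 0 j nu)"
  using ne by (auto simp: ssw_def along_def ee_def rp_def fl_def s0_def fun_eq_iff)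
 have b3: "fl 0 (fl 0 mu) = mu" for mu by (auto simp: fl_def fun_eq_iff)
 have b4: "along (along nu (ee 0) (-1)) (rl 0) 1 = s0 (fl 0 nu)"
  by (auto simp: along_def ee_def rl_def fl_def s0_def fun_eq_iff)
 have b5: "along nu (ee 0) 1 = s0 (fl 0 nu)"
  by (auto simp: along_def ee_def fl_def s0_def fun_eq_iff)
 show "Nop (rm 0 j) (sw 0 j) (c \<circ> s0) nu = Nop (rm 0 j) (sw 0 j) g (along nu (ee 0) (-1)) + g (sw 0 j (along nu (ee 0) (-1))) + c (s0 (sw 0 j nu))"
  unfolding cs0 Nop_mult1[OF fg is_refl_rm[OF ne] a1 inj] by (simp add: g_def b1)
 show "Nop (rp 0 j) (ssw 0 j) (c \<circ> s0) nu = Nop (rp 0 j) (ssw 0 j) g (along nu (ee 0) (-1)) + g (ssw 0 j (along nu (ee 0) (-1))) + c (s0 (ssw 0 j nu))"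
  unfolding cs0 Nop_mult1[OF fg is_refl_rp[OF ne] a2 inj] by (simp add: g_def b2)
 show "Nop (ee 0) (fl 0) (c \<circ> s0) nu = Nop (ee 0) (fl 0) g (along nu (ee 0) (-1)) + c (along nu (ee 0) (-1)) + 2 * c nu + c (s0 (fl 0 nu))"
  unfolding cs0 Nop_mult2[OF fg is_refl_ee a3] by (simp add: g_def b3 b5)
 show "Nop (rl 0) (fl 0) (c \<circ> s0) nu = Nop (rl 0) (fl 0) g (along nu (ee 0) (-1)) + c (along nu (ee 0) (-1)) + c (s0 (fl 0 nu))"
  unfolding cs0 Nop_mult1[OF fg is_refl_rl a4 inj] by (simp add: g_def b3 b4)
qed

lemma Yop_alt:
 assumes "i < n"
 shows "Yop i c nu = Sop i c nu
   - of_real (theta/2)*(\<Sum>j\<in>{..<n}-{i}. (if i < j then c (sw i j nu) else - c (sw i j nu)) + c (ssw i j nu))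
   - of_real rho0 * c (fl i nu)"
proof -
 have "{..<n}-{i} = {i<..<n} \<union> {..<i}" using assms by auto
 then have "(\<Sum>j\<in>{..<n}-{i}. if i < j then c (sw i j nu) else - c (sw i j nu)) =
  (\<Sum>j\<in>{i<..<n}. if i < j then c (sw i j nu) else - c (sw i j nu)) + (\<Sum>j<i. if i < j then c (sw i j nu) else - c (sw i j nu))"
  by (simp add: sum.union_disjoint disjoint_iff)
 also have "... = (\<Sum>j\<in>{i<..<n}. c (sw i j nu)) - (\<Sum>j<i. c (sw i j nu))"
  by (simp add: sum_negf[symmetric])
 finally show ?thesis by (simp add: Yop_def sum.distrib)
qed

text \<open>The boundary terms created by moving \<open>z_0\<close> past the roots either cancel the
  reflection terms of \<open>Yop\<close> or replace them by terms of opposite sign. What remains is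
  a unit from the derivative and \<open>k1\<close> from the middle term of the short root.\<close>

lemma Yop_s0:
 assumes "n > 0" "lp_ok n c"
 shows "Yop 0 (c \<circ> s0) nu = - Yop 0 c (s0 nu) + c (s0 nu) + of_real k1 * c nu"
  and "0 < i ==> i < n ==> Yop i (c \<circ> s0) nu = Yop i c (s0 nu)"
proof -
 define g where "g = c \<circ> fl 0"
 define v where "v = along nu (ee 0) (-1)"
 have fg: "fin_supp g" unfolding g_def by (rule fin_supp_comp_inj[OF lp_ok_fin[OF assms(2)] inj_maps(1)])
 note N = Nop_s0[OF assms(2), folded g_def, of _ nu, folded v_def]
 have s0v: "s0 nu = fl 0 v" by (auto simp: v_def along_def ee_def fl_def s0_def fun_eq_iff)
 have flv: "fl 0 (fl 0 v) = v" by (auto simp: fl_def fun_eq_iff)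
 have cs0: "c \<circ> s0 = (%nu. g (along nu (ee 0) (-1)))"
  by (auto simp: g_def fun_eq_iff s0_def fl_def along_def ee_def intro!: arg_cong[of _ _ c])
 have x1: "c (sw 0 j (fl 0 v)) = g (ssw 0 j v)" "c (ssw 0 j (fl 0 v)) = g (sw 0 j v)" if "0 < j" for j
  using that by (auto simp: g_def sw_def ssw_def fl_def fun_eq_iff intro!: arg_cong[of _ _ c])
 have F0: "Sop 0 c (fl 0 v) = - Sop 0 g v" using Sop_fl[OF assms(1) assms(2) assms(1)] by (simp add: g_def fun_eq_iff)
 have S0: "Sop 0 (c \<circ> s0) nu = Sop 0 g v + g v
  + of_real (theta/2)*(\<Sum>j\<in>{..<n}-{0}. g (sw 0 j v) + g (ssw 0 j v) + c (s0 (sw 0 j nu)) + c (s0 (ssw 0 j nu)))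
  + of_real rho0*(c v + c (s0 (fl 0 nu))) + of_real k1 * c nu"
 proof -
  have "(\<Sum>j\<in>{..<n}-{0}. Nop (rm 0 j) (sw 0 j) (c \<circ> s0) nu + Nop (rp 0 j) (ssw 0 j) (c \<circ> s0) nu) =
   (\<Sum>j\<in>{..<n}-{0}. Nop (rm 0 j) (sw 0 j) g v + Nop (rp 0 j) (ssw 0 j) g v)
   + (\<Sum>j\<in>{..<n}-{0}. g (sw 0 j v) + g (ssw 0 j v) + c (s0 (sw 0 j nu)) + c (s0 (ssw 0 j nu)))"
   unfolding sum.distrib[symmetric] by (rule sum.cong) (auto simp: N(1,2))
  moreover have "of_int (nu 0)*(c \<circ> s0) nu = of_int (v 0) * g v + g v"
   by (simp add: s0v g_def) (simp add: v_def along_def ee_def algebra_simps)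
  ultimately show ?thesis unfolding Sop_def N(3,4)[OF zero_less_one]
   by (simp add: rho0_def algebra_simps)
 qed
 show "Yop 0 (c \<circ> s0) nu = - Yop 0 c (s0 nu) + c (s0 nu) + of_real k1 * c nu"
 proof -
  have e1: "(\<Sum>j\<in>{..<n}-{0}. g (sw 0 j v) + g (ssw 0 j v) + c (s0 (sw 0 j nu)) + c (s0 (ssw 0 j nu))) =
    (\<Sum>j\<in>{..<n}-{0}. g (sw 0 j v) + g (ssw 0 j v)) + (\<Sum>j\<in>{..<n}-{0}. c (s0 (sw 0 j nu)) + c (s0 (ssw 0 j nu)))"
   by (simp add: sum.distrib)
  have e2: "(\<Sum>j\<in>{..<n}-{0}. (if 0 < j then (c \<circ> s0) (sw 0 j nu) else - (c \<circ> s0) (sw 0 j nu)) + (c \<circ> s0) (ssw 0 j nu))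
   = (\<Sum>j\<in>{..<n}-{0}. c (s0 (sw 0 j nu)) + c (s0 (ssw 0 j nu)))"
   by (rule sum.cong) auto
  have e3: "(\<Sum>j\<in>{..<n}-{0}. (if 0 < j then c (sw 0 j (fl 0 v)) else - c (sw 0 j (fl 0 v))) + c (ssw 0 j (fl 0 v)))
   = (\<Sum>j\<in>{..<n}-{0}. g (sw 0 j v) + g (ssw 0 j v))"
   by (rule sum.cong) (auto simp: x1)
  show ?thesis unfolding Yop_alt[OF assms(1)] S0 e1 e2 s0v e3 F0 flv
   by (simp add: g_def algebra_simps s0v)
 qed
 show "Yop i (c \<circ> s0) nu = Yop i c (s0 nu)" if i: "0 < i" "i < n"
 proof -
  have Fi: "Sop i c (fl 0 v) = Sop i g v" using Sop_fl[OF assms(1) assms(2) i(2)] i by (simp add: g_def fun_eq_iff)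
  have rmi: "rm i 0 = (%k. - rm 0 i k)" "rp i 0 = rp 0 i" "sw i 0 = sw 0 i" "ssw i 0 = ssw 0 i"
   using i by (auto simp: rm_def rp_def sw_def ssw_def fun_eq_iff)
  have fs: "fin_supp (c \<circ> s0)"
   by (rule fin_supp_comp_inj[OF lp_ok_fin[OF assms(2)] inj_on_inverseI[of _ s0]]) (auto simp: s0_def fun_eq_iff)
  have i0: "0 ~= i" using i by simp
  have A: "Nop (rm i 0) (sw i 0) (c \<circ> s0) nu + Nop (rp i 0) (ssw i 0) (c \<circ> s0) nu =
    (Nop (rm i 0) (sw i 0) g v + Nop (rp i 0) (ssw i 0) g v) + (g (ssw 0 i v) - g (sw 0 i v) + c (s0 (ssw i 0 nu)) - c (s0 (sw i 0 nu)))"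
   unfolding rmi Nop_neg[OF fs is_refl_rm[OF i0]] Nop_neg[OF fg is_refl_rm[OF i0]] N(1,2)[OF i(1)]
   by (simp add: algebra_simps)
  have B1: "Nop (rm i j) (sw i j) (c \<circ> s0) nu = Nop (rm i j) (sw i j) g v" if "j ~= 0" for j
  proof -
   have "Nop (rm i j) (sw i j) (g \<circ> (%nu. along nu (ee 0) (-1))) = Nop (rm i j) (sw i j) g \<circ> (%nu. along nu (ee 0) (-1))"
    by (rule Nop_equivariant) (use that i in \<open>auto simp: along_def rm_def ee_def sw_def fun_eq_iff\<close>)
   then show ?thesis unfolding cs0 v_def by (simp add: o_def fun_eq_iff)
  qed
  have B2: "Nop (rp i j) (ssw i j) (c \<circ> s0) nu = Nop (rp i j) (ssw i j) g v" if "j ~= 0" for j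
  proof -
   have "Nop (rp i j) (ssw i j) (g \<circ> (%nu. along nu (ee 0) (-1))) = Nop (rp i j) (ssw i j) g \<circ> (%nu. along nu (ee 0) (-1))"
    by (rule Nop_equivariant) (use that i in \<open>auto simp: along_def rp_def ee_def ssw_def fun_eq_iff\<close>)
   then show ?thesis unfolding cs0 v_def by (simp add: o_def fun_eq_iff)
  qed
  have B3: "Nop (ee i) (fl i) (c \<circ> s0) nu = Nop (ee i) (fl i) g v"
  proof -
   have "Nop (ee i) (fl i) (g \<circ> (%nu. along nu (ee 0) (-1))) = Nop (ee i) (fl i) g \<circ> (%nu. along nu (ee 0) (-1))"
    by (rule Nop_equivariant) (use i in \<open>auto simp: along_def ee_def fl_def fun_eq_iff\<close>)
   then show ?thesis unfolding cs0 v_def by (simp add: o_def fun_eq_iff)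
  qed
  have B4: "Nop (rl i) (fl i) (c \<circ> s0) nu = Nop (rl i) (fl i) g v"
  proof -
   have "Nop (rl i) (fl i) (g \<circ> (%nu. along nu (ee 0) (-1))) = Nop (rl i) (fl i) g \<circ> (%nu. along nu (ee 0) (-1))"
    by (rule Nop_equivariant) (use i in \<open>auto simp: along_def rl_def ee_def fl_def fun_eq_iff\<close>)
   then show ?thesis unfolding cs0 v_def by (simp add: o_def fun_eq_iff)
  qed
  have ins: "{..<n}-{i} = insert 0 ({0<..<n}-{i})" using i by auto
  have ss: "(\<Sum>j\<in>{..<n}-{i}. f j) = f 0 + (\<Sum>j\<in>{0<..<n}-{i}. f j)" for f :: "nat => complex"
   unfolding ins by simp
  have S: "Sop i (c \<circ> s0) nu = Sop i g v + of_real (theta/2)*(g (ssw 0 i v) - g (sw 0 i v) + c (s0 (ssw i 0 nu)) - c (s0 (sw i 0 nu)))"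
  proof -
   have "of_int (nu i)*(c \<circ> s0) nu = of_int (v i) * g v"
    using i by (simp add: s0v g_def) (simp add: v_def along_def ee_def)
   then show ?thesis unfolding Sop_def ss A B3 B4
    using sum.cong[OF refl, of "{0<..<n}-{i}" "%j. Nop (rm i j) (sw i j) (c \<circ> s0) nu + Nop (rp i j) (ssw i j) (c \<circ> s0) nu" "%j. Nop (rm i j) (sw i j) g v + Nop (rp i j) (ssw i j) g v"]
    by (simp add: B1 B2 algebra_simps)
  qed
  have y1: "s0 (sw i j nu) = sw i j (fl 0 v)" "s0 (ssw i j nu) = ssw i j (fl 0 v)" if "0 < j" for j
   unfolding s0v[symmetric] using that i by (auto simp: sw_def ssw_def s0_def fun_eq_iff)
  have y2: "s0 (fl i nu) = fl i (fl 0 v)"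
   unfolding s0v[symmetric] using i by (auto simp: fl_def s0_def fun_eq_iff)
  have e1: "(\<Sum>j\<in>{0<..<n}-{i}. (if i < j then (c \<circ> s0) (sw i j nu) else - (c \<circ> s0) (sw i j nu)) + (c \<circ> s0) (ssw i j nu)) =
   (\<Sum>j\<in>{0<..<n}-{i}. (if i < j then c (sw i j (fl 0 v)) else - c (sw i j (fl 0 v))) + c (ssw i j (fl 0 v)))"
   by (rule sum.cong) (auto simp: y1)
  show ?thesis unfolding Yop_alt[OF i(2)] S ss e1 s0v Fi
   using i by (simp add: y2 rmi x1 algebra_simps)
 qed
qed

section \<open>The spectral vectors \<open>bar eta\<close>\<close>

definition ord :: "(nat => int) => nat => nat => real" where
 "ord eta i j = (if i < j then eps (eta i - eta j) else - eps (eta j - eta i))"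

text \<open>The joint eigenvalue of the \<open>Yop i\<close> attached to \<open>eta\<close>:
  \<open>eta\<close> shifted by a Weyl image of the weighted half sum of positive roots, the image
  being fixed by the signs of \<open>eta\<close> on the roots. Ties are broken by the index through
  \<open>ord\<close>.\<close>

definition bar :: "(nat => int) => nat => real" where
 "bar eta i = of_int (eta i) + rho0 * eps (eta i) + theta/2*(\<Sum>j\<in>{..<n}-{i}. ord eta i j + eps (eta i + eta j))"

lemma rho0_nonneg: "rho0 >= 0" using k1_nonneg k2_nonneg by (simp add: rho0_def)

text \<open>With 0 counted as negative, no summand has the sign opposite to that of
  \<open>eta i\<close>. \<open>bar_less_iff\<close> and \<open>bar_sum_pos_iff\<close> do the same
  for differences and sums. These lemmas give the positive denominators of the raising operators and
  make \<open>eta\<close> recoverable from \<open>bar eta\<close>.\<close>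

lemma bar_pos_iff:
 assumes "i < n" shows "bar eta i > 0 \<longleftrightarrow> eta i > 0"
proof (cases "eta i > 0")
 case True
 have "(\<Sum>j\<in>{..<n}-{i}. ord eta i j + eps (eta i + eta j)) >= 0"
  using True by (intro sum_nonneg) (auto simp: ord_def eps_def)
 then have "theta/2*(\<Sum>j\<in>{..<n}-{i}. ord eta i j + eps (eta i + eta j)) >= 0" using theta_pos by simp
 then show ?thesis using True rho0_nonneg by (simp add: bar_def eps_def[of "eta i"])
next
 case False
 have "(\<Sum>j\<in>{..<n}-{i}. ord eta i j + eps (eta i + eta j)) <= 0"
  using False by (intro sum_nonpos) (auto simp: ord_def eps_def)
 then have "theta/2*(\<Sum>j\<in>{..<n}-{i}. ord eta i j + eps (eta i + eta j)) <= 0"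
  using theta_pos by (intro mult_nonneg_nonpos) auto
 then show ?thesis using False rho0_nonneg by (simp add: bar_def eps_def[of "eta i"])
qed

lemma bar_pair:
 assumes "i < n" "j < n" "i ~= j"
 shows "bar eta i = of_int (eta i) + rho0 * eps (eta i) + theta/2*(ord eta i j + eps (eta i + eta j) + (\<Sum>l\<in>{..<n}-{i,j}. ord eta i l + eps (eta i + eta l)))"
proof -
 have "{..<n}-{i} = insert j ({..<n}-{i,j})" using assms by auto
 then show ?thesis by (simp add: bar_def)
qed

lemma bar_less_iff:
 assumes "i < j" "j < n" shows "bar eta j < bar eta i \<longleftrightarrow> eta j < eta i"
proof -
 have lt: "i < n" "i ~= j" "j ~= i" using assms by auto
 have e: "{..<n}-{j,i} = {..<n}-{i,j}" by auto
 let ?A = "\<Sum>l\<in>{..<n}-{i,j}. ord eta i l + eps (eta i + eta l)"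
 let ?B = "\<Sum>l\<in>{..<n}-{i,j}. ord eta j l + eps (eta j + eta l)"
 have d: "bar eta i - bar eta j = of_int (eta i - eta j) + rho0*(eps (eta i) - eps (eta j)) + theta * eps (eta i - eta j) + theta/2*(?A - ?B)"
  unfolding bar_pair[OF lt(1) assms(2) lt(2)] bar_pair[OF assms(2) lt(1,3)] e
  using assms(1) by (simp add: ord_def algebra_simps)
 show ?thesis
 proof (cases "eta j < eta i")
  case True
  have "?B <= ?A" using True assms by (intro sum_mono) (auto simp: ord_def eps_def)
  then have "theta/2*(?A - ?B) >= 0" using theta_pos by simp
  moreover have "rho0*(eps (eta i) - eps (eta j)) >= 0"
   using True rho0_nonneg by (intro mult_nonneg_nonneg) (auto simp: eps_def)
  moreover have "of_int (eta i - eta j) > (0::real)" using True by simp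
  ultimately have "bar eta i - bar eta j > 0" unfolding d using True theta_pos by (simp add: eps_def[of "eta i - eta j"])
  then show ?thesis using True by simp
 next
  case False
  have "?A <= ?B" using False assms by (intro sum_mono) (auto simp: ord_def eps_def)
  then have "theta/2*(?A - ?B) <= 0" using theta_pos by (intro mult_nonneg_nonpos) auto
  moreover have "rho0*(eps (eta i) - eps (eta j)) <= 0"
   using False rho0_nonneg by (intro mult_nonneg_nonpos) (auto simp: eps_def)
  moreover have "of_int (eta i - eta j) <= (0::real)" using False by simp
  ultimately have "bar eta i - bar eta j <= 0" unfolding d using False theta_pos by (simp add: eps_def[of "eta i - eta j"])
  then show ?thesis using False by simp
 qed
qed

lemma bar_sum_pos_iff:
 assumes "i ~= j" "i < n" "j < n" shows "bar eta i + bar eta j > 0 \<longleftrightarrow> eta i + eta j > 0"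
proof -
 have e: "{..<n}-{j,i} = {..<n}-{i,j}" by auto
 have o: "ord eta i j + ord eta j i = 0" using assms by (auto simp: ord_def)
 let ?A = "\<Sum>l\<in>{..<n}-{i,j}. (ord eta i l + eps (eta j + eta l)) + (ord eta j l + eps (eta i + eta l))"
 have d: "bar eta i + bar eta j = of_int (eta i + eta j) + rho0*(eps (eta i) + eps (eta j)) + theta * eps (eta i + eta j) + theta/2*?A + theta/2*(ord eta i j + ord eta j i)"
  unfolding bar_pair[OF assms(2,3,1)] bar_pair[OF assms(3,2) assms(1)[symmetric]] e
  by (simp add: sum.distrib algebra_simps)
 show ?thesis
 proof (cases "eta i + eta j > 0")
  case True
  have "?A >= 0" using True assms by (intro sum_nonneg) (auto simp: ord_def eps_def)
  then have "theta/2*?A >= 0" using theta_pos by simp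
  moreover have "rho0*(eps (eta i) + eps (eta j)) >= 0"
   using True rho0_nonneg by (intro mult_nonneg_nonneg) (auto simp: eps_def)
  moreover have "of_int (eta i + eta j) > (0::real)" using True by linarith
  ultimately have "bar eta i + bar eta j > 0" unfolding d o using True theta_pos by (simp add: eps_def[of "eta i + eta j"])
  then show ?thesis using True by simp
 next
  case False
  have "?A <= 0" using False assms by (intro sum_nonpos) (auto simp: ord_def eps_def)
  then have "theta/2*?A <= 0" using theta_pos by (intro mult_nonneg_nonpos) auto
  moreover have "rho0*(eps (eta i) + eps (eta j)) <= 0"
   using False rho0_nonneg by (intro mult_nonneg_nonpos) (auto simp: eps_def)
  moreover have "of_int (eta i + eta j) <= (0::real)" using False by linarith
  ultimately have "bar eta i + bar eta j <= 0" unfolding d o using False theta_pos by (simp add: eps_def[of "eta i + eta j"])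
  then show ?thesis using False by simp
 qed
qed

text \<open>All signs occurring in \<open>bar\<close> are determined by \<open>bar\<close> itself
  through the three sign lemmas; once the signs agree, so do the remaining terms
  \<open>eta i\<close>.\<close>

lemma bar_inj:
 assumes "\<And>i. i < n ==> bar eta i = bar kappa i" "i < n"
 shows "eta i = kappa i"
proof -
 have e1: "eps (eta i) = eps (kappa i)"
  using bar_pos_iff[OF assms(2), of eta] bar_pos_iff[OF assms(2), of kappa] assms(1)[OF assms(2)] by (simp add: eps_def)
 have e2: "ord eta i j + eps (eta i + eta j) = ord kappa i j + eps (kappa i + kappa j)" if "j \<in> {..<n}-{i}" for j
 proof -
  have j: "j < n" "j ~= i" "i ~= j" using that by auto
  have "eps (eta i + eta j) = eps (kappa i + kappa j)"
   using bar_sum_pos_iff[OF j(3) assms(2) j(1), of eta] bar_sum_pos_iff[OF j(3) assms(2) j(1), of kappa] assms(1) assms(2) j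
   by (simp add: eps_def)
  moreover have "ord eta i j = ord kappa i j"
  proof (cases "i < j")
   case True
   then show ?thesis using bar_less_iff[OF True j(1), of eta] bar_less_iff[OF True j(1), of kappa] assms(1) assms(2) j
    by (simp add: ord_def eps_def)
  next
   case False
   then have "j < i" using j by simp
   then show ?thesis using bar_less_iff[OF \<open>j < i\<close> assms(2), of eta] bar_less_iff[OF \<open>j < i\<close> assms(2), of kappa] assms(1) assms(2) j
    by (simp add: ord_def eps_def)
  qed
  ultimately show ?thesis by simp
 qed
 have "(\<Sum>j\<in>{..<n}-{i}. ord eta i j + eps (eta i + eta j)) = (\<Sum>j\<in>{..<n}-{i}. ord kappa i j + eps (kappa i + kappa j))"
  by (rule sum.cong[OF refl e2])
 then have "real_of_int (eta i) = of_int (kappa i)"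
  using assms(1)[OF assms(2)] e1 unfolding bar_def by simp
 then show ?thesis by simp
qed

lemma bar_sw:
 assumes "Suc p < n" "eta p ~= eta (Suc p)" "i < n"
 shows "bar (sw p (Suc p) eta) i = bar eta (if i = p then Suc p else if i = Suc p then p else i)"
proof -
 define tau where "tau = (%i. if i = p then Suc p else if i = Suc p then p else i)"
 have sw: "sw p (Suc p) eta i = eta (tau i)" for i by (auto simp: sw_def tau_def)
 have "(\<Sum>j\<in>{..<n}-{i}. ord (sw p (Suc p) eta) i j + eps (eta (tau i) + eta (tau j))) =
   (\<Sum>j\<in>{..<n}-{tau i}. ord eta (tau i) j + eps (eta (tau i) + eta j))"
 proof (rule sum.reindex_bij_witness[of _ tau tau])
  fix j assume j: "j \<in> {..<n}-{i}"
  show "ord eta (tau i) (tau j) + eps (eta (tau i) + eta (tau j)) = ord (sw p (Suc p) eta) i j + eps (eta (tau i) + eta (tau j))"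
   using j assms(2) unfolding ord_def sw by (auto simp: tau_def eps_def)
 qed (use assms in \<open>auto simp: tau_def split: if_splits\<close>)
 then show ?thesis unfolding bar_def sw by (simp add: tau_def)
qed

lemma bar_fl_last:
 assumes "n > 0" "eta (n-1) ~= 0" "i < n"
 shows "bar (fl (n-1) eta) i = (if i = n-1 then - bar eta i else bar eta i)"
proof (cases "i = n - 1")
 case True
 have "(\<Sum>j\<in>{..<n}-{i}. ord (fl (n-1) eta) i j + eps (fl (n-1) eta i + fl (n-1) eta j)) =
  - (\<Sum>j\<in>{..<n}-{i}. ord eta i j + eps (eta i + eta j))"
  unfolding sum_negf[symmetric]
  by (rule sum.cong) (use True in \<open>auto simp: ord_def fl_def algebra_simps\<close>)
 moreover have "eps (- eta (n-1)) = - eps (eta (n-1))" using assms by (simp add: eps_def)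
 ultimately show ?thesis unfolding bar_def using True by (simp add: fl_def algebra_simps)
next
 case False
 have "(\<Sum>j\<in>{..<n}-{i}. ord (fl (n-1) eta) i j + eps (fl (n-1) eta i + fl (n-1) eta j)) =
  (\<Sum>j\<in>{..<n}-{i}. ord eta i j + eps (eta i + eta j))"
  by (rule sum.cong) (use False assms in \<open>auto simp: ord_def fl_def algebra_simps\<close>)
 then show ?thesis unfolding bar_def using False by (simp add: fl_def)
qed

lemma bar_s0:
 assumes "i < n"
 shows "bar (s0 eta) i = (if i = 0 then 1 - bar eta i else bar eta i)"
proof (cases "i = 0")
 case True
 have "(\<Sum>j\<in>{..<n}-{i}. ord (s0 eta) i j + eps (s0 eta i + s0 eta j)) =
  - (\<Sum>j\<in>{..<n}-{i}. ord eta i j + eps (eta i + eta j))"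
  unfolding sum_negf[symmetric]
  by (rule sum.cong) (use True in \<open>auto simp: ord_def s0_def eps_def\<close>)
 moreover have "eps (1 - eta 0) = - eps (eta 0)" by (simp add: eps_def)
 ultimately show ?thesis unfolding bar_def using True by (simp add: s0_def algebra_simps)
next
 case False
 have "(\<Sum>j\<in>{..<n}-{i}. ord (s0 eta) i j + eps (s0 eta i + s0 eta j)) =
  (\<Sum>j\<in>{..<n}-{i}. ord eta i j + eps (eta i + eta j))"
  by (rule sum.cong) (use False in \<open>auto simp: ord_def s0_def eps_def\<close>)
 then show ?thesis unfolding bar_def using False by (simp add: s0_def)
qed

end

section \<open>Raising operators and nonnegative eigenfunctions\<close>

context bc
begin

lemma Yop_lincomb:
 assumes "lp_ok n c" "lp_ok n d" "i < n"
 shows "Yop i (%nu. x * c nu + y * d nu) nu = x * Yop i c nu + y * Yop i d nu"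
 unfolding Yop_def Sop_lincomb[OF assms] by (simp add: sum.distrib sum_distrib_left algebra_simps)

text \<open>Nonsymmetric Jacobi polynomials, without normalisation and without control of the support.\<close>

definition good :: "(nat => int) => lpoly => bool" where
 "good eta E \<longleftrightarrow> lp_ok n E \<and> (\<forall>mu. E mu \<in> \<real>\<^sub>\<ge>\<^sub>0) \<and> (\<exists>mu. E mu ~= 0) \<and>
   (\<forall>i<n. \<forall>nu. Yop i E nu = of_real (bar eta i) * E nu)"

text \<open>Nonnegativity rules out cancellation: the coefficient of the combination at
  \<open>s mu\<close> is at least \<open>E mu\<close>, which is positive.\<close>

lemma good_combine:
 assumes "lp_ok n E" "\<And>mu. E mu \<in> \<real>\<^sub>\<ge>\<^sub>0" "E mu ~= 0" "\<And>nu. s (s nu) = nu" "\<And>nu k. k >= n ==> s nu k = nu k" "kappa >= 0"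
 defines "F \<equiv> %nu. 1*(E \<circ> s) nu + of_real kappa * E nu"
 shows "lp_ok n (E \<circ> s)" "lp_ok n F" "\<And>mu. F mu \<in> \<real>\<^sub>\<ge>\<^sub>0" "\<exists>mu. F mu ~= 0"
proof -
 have inj: "inj s" by (rule inj_on_inverseI[of _ s]) (simp add: assms)
 show ok: "lp_ok n (E \<circ> s)" by (rule lp_ok_comp[OF assms(1) inj assms(5)])
 show "lp_ok n F" unfolding F_def by (intro lp_ok_lincomb ok assms)
 show "F mu \<in> \<real>\<^sub>\<ge>\<^sub>0" for mu unfolding F_def using assms
  by (auto intro!: nonneg_Reals_add_I nonneg_Reals_mult_I)
 have "F (s mu) = E mu + of_real kappa * E (s mu)" by (simp add: F_def assms)
 moreover have "E mu + of_real kappa * E (s mu) ~= 0"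
 proof -
  obtain a b where ab: "E mu = of_real a" "a >= 0" "E (s mu) = of_real b" "b >= 0"
   using assms(2)[of mu] assms(2)[of "s mu"] by (auto elim!: nonneg_Reals_cases)
  then have "a > 0" "kappa * b >= 0" using assms by auto
  then have "a + kappa * b ~= 0" by linarith
  then show ?thesis unfolding ab(1,3) by (metis of_real_add of_real_mult of_real_eq_0_iff)
 qed
 ultimately show "\<exists>mu. F mu ~= 0" by (intro exI[of _ "s mu"]) simp
qed

lemma good_sw:
 assumes "Suc p < n" "eta p > eta (Suc p)" "good eta E"
 shows "\<exists>E'. good (sw p (Suc p) eta) E'"
proof -
 let ?s = "sw p (Suc p)"
 \<comment> \<open>Chosen so that \<open>kappa\<close> times the difference of the two eigenvalues
   absorbs the inhomogeneous term \<open>theta * c\<close> of the Hecke relation. It is nonnegative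
   because the step goes from \<open>eta p > eta (Suc p)\<close>; the reverse step would need a
   negative constant.\<close>
 define kappa where "kappa = theta/(bar eta p - bar eta (Suc p))"
 have pos: "bar eta p - bar eta (Suc p) > 0" using bar_less_iff[of p "Suc p" eta] assms by simp
 have kappa: "kappa*(bar eta p - bar eta (Suc p)) = theta" "kappa >= 0" using pos theta_pos by (auto simp: kappa_def)
 have kappac: "complex_of_real theta = of_real kappa*(of_real (bar eta p) - of_real (bar eta (Suc p)))"
  using kappa(1) by (metis of_real_diff of_real_mult)
 obtain mu where E: "lp_ok n E" "\<And>mu. E mu \<in> \<real>\<^sub>\<ge>\<^sub>0" "E mu ~= 0" and Y: "\<And>i nu. i < n ==> Yop i E nu = of_real (bar eta i) * E nu"
  using assms(3) by (auto simp: good_def)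
 define F where "F = (%nu. 1*(E \<circ> ?s) nu + of_real kappa * E nu)"
 have inv: "?s (?s nu) = nu" for nu by (auto simp: sw_def fun_eq_iff)
 note gc = good_combine[OF E inv _ kappa(2), folded F_def]
 have ge: "?s nu k = nu k" if "k >= n" for nu k using that assms(1) by (simp add: sw_def)
 have "Yop i F nu = of_real (bar (?s eta) i) * F nu" if i: "i < n" for i nu
 proof -
  have L: "Yop i F nu = Yop i (E \<circ> ?s) nu + of_real kappa * Yop i E nu"
   using Yop_lincomb[OF gc(1)[OF ge] E(1) i, of 1 "of_real kappa" nu] by (simp add: F_def)
  consider "i = p" | "i = Suc p" | "i ~= p" "i ~= Suc p" by blast
  then show ?thesis
  proof cases
   case 1
   show ?thesis unfolding 1 L[unfolded 1] Yop_sw_left[OF assms(1) E(1) i] Y[OF assms(1)] Y[OF i[unfolded 1]]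
    using bar_sw[of p eta p] assms by (simp add: F_def kappac algebra_simps)
  next
   case 2
   show ?thesis unfolding 2 L[unfolded 2] Yop_sw_right[OF assms(1) E(1)] Y[OF assms(1)] Y[OF Suc_lessD[OF assms(1)]]
    using bar_sw[of p eta "Suc p"] assms by (simp add: F_def kappac algebra_simps)
  next
   case 3
   show ?thesis unfolding L Yop_sw(1)[OF assms(1) E(1) i 3] Y[OF i]
    using bar_sw[of p eta i] assms i 3 by (simp add: F_def algebra_simps)
  qed
 qed
 then have "good (?s eta) F" using gc ge by (auto simp: good_def F_def)
 then show ?thesis by blast
qed

lemma good_fl:
 assumes "n > 0" "eta (n-1) > 0" "good eta E"
 shows "\<exists>E'. good (fl (n-1) eta) E'"
proof -
 let ?s = "fl (n-1)"
 have l: "n - 1 < n" using assms by simp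
 define kappa where "kappa = rho0/bar eta (n-1)"
 have pos: "bar eta (n-1) > 0" using bar_pos_iff[OF l, of eta] assms by simp
 have kappa: "kappa * bar eta (n-1) = rho0" "kappa >= 0" using pos rho0_nonneg by (auto simp: kappa_def)
 have kappac: "complex_of_real rho0 = of_real kappa * of_real (bar eta (n-1))"
  using kappa(1) by (metis of_real_mult)
 obtain mu where E: "lp_ok n E" "\<And>mu. E mu \<in> \<real>\<^sub>\<ge>\<^sub>0" "E mu ~= 0" and Y: "\<And>i nu. i < n ==> Yop i E nu = of_real (bar eta i) * E nu"
  using assms(3) by (auto simp: good_def)
 define F where "F = (%nu. 1*(E \<circ> ?s) nu + of_real kappa * E nu)"
 have inv: "?s (?s nu) = nu" for nu by (auto simp: fl_def fun_eq_iff)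
 note gc = good_combine[OF E inv _ kappa(2), folded F_def]
 have ge: "?s nu k = nu k" if "k >= n" for nu k using that assms(1) by (simp add: fl_def)
 have "Yop i F nu = of_real (bar (?s eta) i) * F nu" if i: "i < n" for i nu
 proof -
  have L: "Yop i F nu = Yop i (E \<circ> ?s) nu + of_real kappa * Yop i E nu"
   using Yop_lincomb[OF gc(1)[OF ge] E(1) i, of 1 "of_real kappa" nu] by (simp add: F_def)
  show ?thesis
  proof (cases "i = n - 1")
   case True
   show ?thesis unfolding True L[unfolded True] Yop_fl_last(2)[OF assms(1) E(1) i] Y[OF l]
    using bar_fl_last[OF assms(1), of eta "n-1"] assms by (simp add: F_def kappac algebra_simps)
  next
   case False
   show ?thesis unfolding L Yop_fl_last(1)[OF assms(1) E(1) i False] Y[OF i]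
    using bar_fl_last[OF assms(1), of eta i] assms i False by (simp add: F_def algebra_simps)
  qed
 qed
 then have "good (?s eta) F" using gc ge by (auto simp: good_def F_def)
 then show ?thesis by blast
qed

lemma good_s0:
 assumes "n > 0" "eta 0 <= 0" "good eta E"
 shows "\<exists>E'. good (s0 eta) E'"
proof -
 \<comment> \<open>The denominator is the gap between \<open>bar eta 0\<close> and its image
   \<open>1 - bar eta 0\<close> under \<open>s0\<close>; it is positive since
   \<open>eta 0 <= 0\<close> forces \<open>bar eta 0 <= 0\<close>.\<close>
 define kappa where "kappa = k1/(1 - 2 * bar eta 0)"
 have pos: "1 - 2 * bar eta 0 > 0" using bar_pos_iff[OF assms(1), of eta] assms by simp
 have kappa: "kappa*(1 - 2 * bar eta 0) = k1" "kappa >= 0" using pos k1_nonneg by (auto simp: kappa_def)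
 have kappac: "complex_of_real k1 = of_real kappa*(1 - 2 * of_real (bar eta 0))"
 proof -
  have "complex_of_real k1 = of_real (kappa*(1 - 2 * bar eta 0))" by (simp only: kappa(1))
  then show ?thesis by simp
 qed
 obtain mu where E: "lp_ok n E" "\<And>mu. E mu \<in> \<real>\<^sub>\<ge>\<^sub>0" "E mu ~= 0" and Y: "\<And>i nu. i < n ==> Yop i E nu = of_real (bar eta i) * E nu"
  using assms(3) by (auto simp: good_def)
 define F where "F = (%nu. 1*(E \<circ> s0) nu + of_real kappa * E nu)"
 have inv: "s0 (s0 nu) = nu" for nu by (auto simp: s0_def fun_eq_iff)
 note gc = good_combine[OF E inv _ kappa(2), folded F_def]
 have ge: "s0 nu k = nu k" if "k >= n" for nu k using that assms(1) by (simp add: s0_def)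
 have "Yop i F nu = of_real (bar (s0 eta) i) * F nu" if i: "i < n" for i nu
 proof -
  have L: "Yop i F nu = Yop i (E \<circ> s0) nu + of_real kappa * Yop i E nu"
   using Yop_lincomb[OF gc(1)[OF ge] E(1) i, of 1 "of_real kappa" nu] by (simp add: F_def)
  show ?thesis
  proof (cases "i = 0")
   case True
   have b: "bar (s0 eta) 0 = 1 - bar eta 0" using bar_s0[OF assms(1)] by simp
   show ?thesis unfolding True L[unfolded True] Yop_s0(1)[OF assms(1) E(1)] Y[OF assms(1)] b
    by (simp add: F_def kappac algebra_simps)
  next
   case False
   show ?thesis unfolding L Yop_s0(2)[OF assms(1) E(1) _ i] Y[OF i]
    using bar_s0[OF i, of eta] assms i False Yop_s0(2)[OF assms(1) E(1) _ i, of nu] Y[OF i, of "s0 nu"]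
    by (simp add: F_def algebra_simps)
  qed
 qed
 then have "good (s0 eta) F" using gc ge by (auto simp: good_def F_def)
 then show ?thesis by blast
qed

lemma good_zero: "good (%_. 0) (%mu. if mu = (%_. 0) then 1 else 0)" (is "good _ ?E")
proof -
 have N: "Nop alpha s ?E = (%nu. 0)" if "\<And>nu. s nu = (%_. 0) \<longleftrightarrow> nu = (%_. 0)" for alpha s
  by (rule ext) (simp add: Nop_def that)
 have z: "sw i j nu = (%_. 0) \<longleftrightarrow> nu = (%_. 0)" "ssw i j nu = (%_. 0) \<longleftrightarrow> nu = (%_. 0)" "fl i nu = (%_. 0) \<longleftrightarrow> nu = (%_. 0)" for i j and nu :: "nat => int"
  by (auto simp: sw_def ssw_def fl_def fun_eq_iff split: if_splits)
 have S: "Sop i ?E nu = 0" for i nu by (simp add: Sop_def N z)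
 have "Yop i ?E nu = of_real (bar (%_. 0) i)*?E nu" if "i < n" for i nu
 proof -
  have "(\<Sum>j\<in>{..<n}-{i}. (if i < j then ?E (sw i j nu) else - ?E (sw i j nu)) + ?E (ssw i j nu))
   = - (\<Sum>j\<in>{..<n}-{i}. of_real (ord (%_. 0) i j + eps 0))*?E nu"
   unfolding sum_distrib_right sum_negf[symmetric]
   by (rule sum.cong) (auto simp: z ord_def eps_def)
  then show ?thesis unfolding Yop_alt[OF that] S bar_def by (simp add: z eps_def)
 qed
 moreover have "lp_ok n ?E" by (auto simp: lp_ok_def)
 ultimately show ?thesis by (auto simp: good_def)
qed

text \<open>The raising steps are read backwards from \<open>eta\<close> to 0: sort decreasingly,
  flip a negative last entry, and on a nonzero partition apply \<open>s0\<close>, which lowers the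
  first entry by 1 in absolute value. Sorting and flipping keep the sum \<open>A\<close> of absolute
  values and increase the weighted sum \<open>W\<close>, which is at most \<open>n * A\<close>;
  \<open>s0\<close> decreases \<open>A\<close>. Hence the lexicographic measure.\<close>

theorem good_exists:
 assumes "\<And>k. k >= n ==> eta k = 0"
 shows "\<exists>E. good eta E"
proof -
 define A where "A = (%eta::nat => int. \<Sum>i<n. \<bar>eta i\<bar>)"
 define W where "W = (%eta::nat => int. \<Sum>i<n. int (n - i) * eta i)"
 have AW: "W eta <= int n * A eta" for eta
  unfolding W_def A_def sum_distrib_left
 proof (rule sum_mono)
  fix i
  have "int (n - i) * eta i <= int (n - i)*\<bar>eta i\<bar>" by (rule mult_left_mono) auto
  also have "... <= int n*\<bar>eta i\<bar>" by (rule mult_right_mono) auto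
  finally show "int (n - i) * eta i <= int n*\<bar>eta i\<bar>" .
 qed
 have A0: "A eta >= 0" for eta unfolding A_def by (intro sum_nonneg) auto
 let ?r = "measures [%eta. nat (A eta), %eta. nat (int n * A eta - W eta)]"
 have wf: "wf ?r" by simp
 show ?thesis using assms
 proof (induction eta rule: wf_induct_rule[OF wf])
  case (1 eta)
  show ?case
  proof (cases "\<exists>p. Suc p < n \<and> eta p < eta (Suc p)")
   case True
   then obtain p where p: "Suc p < n" "eta p < eta (Suc p)" by blast
   define kappa where "kappa = sw p (Suc p) eta"
   have split: "(\<Sum>i<n. f i) = f p + f (Suc p) + (\<Sum>i\<in>{..<n}-{p,Suc p}. f i)" for f :: "nat => int"
   proof -
    have "{..<n} = insert p (insert (Suc p) ({..<n}-{p,Suc p}))" using p by auto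
    then have "(\<Sum>i<n. f i) = (\<Sum>i\<in>insert p (insert (Suc p) ({..<n}-{p,Suc p})). f i)" by metis
    then show ?thesis by simp
   qed
   have rest: "(\<Sum>i\<in>{..<n}-{p,Suc p}. g i (kappa i)) = (\<Sum>i\<in>{..<n}-{p,Suc p}. g i (eta i))" for g :: "nat => int => int"
    by (rule sum.cong) (auto simp: kappa_def sw_def)
   have Ak: "A kappa = A eta" unfolding A_def split using rest[of "%_ x. \<bar>x\<bar>"] by (simp add: kappa_def sw_def)
   have "W kappa - W eta = int (n - p)*(eta (Suc p) - eta p) + int (n - Suc p)*(eta p - eta (Suc p))"
    unfolding W_def split using rest[of "%i x. int (n - i) * x"] by (simp add: kappa_def sw_def algebra_simps)
   also have "int (n - p) = int (n - Suc p) + 1" using p by simp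
   finally have "W kappa > W eta" using p by (simp add: algebra_simps)
   then have "(kappa, eta) \<in> ?r" using Ak AW[of kappa] by (simp add: measures_lesseq)
   moreover have "kappa k = 0" if "k >= n" for k using 1(2)[OF that] that p by (simp add: kappa_def sw_def)
   ultimately obtain E where "good kappa E" using 1(1) by blast
   moreover have "sw p (Suc p) kappa = eta" by (auto simp: kappa_def sw_def fun_eq_iff)
   moreover have "kappa p > kappa (Suc p)" using p by (simp add: kappa_def sw_def)
   ultimately show ?thesis using good_sw[OF p(1), of kappa E] by simp
  next
   case False
   have dec: "eta j <= eta i" if "i <= j" "j < n" for i j
    using that
   proof (induction j rule: dec_induct)
    case (step j)
    then show ?case using False by force
   qed simp
   show ?thesis
   proof (cases "n > 0 \<and> eta (n-1) < 0")
    case True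
    define kappa where "kappa = fl (n-1) eta"
    have split: "(\<Sum>i<n. f i) = f (n-1) + (\<Sum>i<n-1. f i)" for f :: "nat => int"
     using True sum.lessThan_Suc[of f "n-1"] by simp
    have rest: "(\<Sum>i<n-1. g i (kappa i)) = (\<Sum>i<n-1. g i (eta i))" for g :: "nat => int => int"
     by (rule sum.cong) (auto simp: kappa_def fl_def)
    have Ak: "A kappa = A eta" unfolding A_def split using rest[of "%_ x. \<bar>x\<bar>"] by (simp add: kappa_def fl_def)
    have "W kappa - W eta = int (n - (n - 1))*(- 2 * eta (n-1))"
     unfolding W_def split using rest[of "%i x. int (n - i) * x"] by (simp add: kappa_def fl_def algebra_simps)
    also have "... > 0" using True by simp
    finally have "W kappa > W eta" by simp
    then have "(kappa, eta) \<in> ?r" using Ak AW[of kappa] by (simp add: measures_lesseq)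
    moreover have "kappa k = 0" if "k >= n" for k using 1(2)[OF that] that True by (auto simp: kappa_def fl_def)
    ultimately obtain E where "good kappa E" using 1(1) by blast
    moreover have "fl (n-1) kappa = eta" by (auto simp: kappa_def fl_def fun_eq_iff)
    moreover have "kappa (n-1) > 0" using True by (simp add: kappa_def fl_def)
    ultimately show ?thesis using good_fl[of kappa E] True by simp
   next
    case nneg: False
    show ?thesis
    proof (cases "n > 0 \<and> eta 0 > 0")
     case True
     define kappa where "kappa = s0 eta"
     have split: "(\<Sum>i<n. f i) = f 0 + (\<Sum>i\<in>{0<..<n}. f i)" for f :: "nat => int"
     proof -
      have "{..<n} = insert 0 {0<..<n}" using True by auto
      then show ?thesis by simp
     qed
     have "(\<Sum>i\<in>{0<..<n}. \<bar>kappa i\<bar>) = (\<Sum>i\<in>{0<..<n}. \<bar>eta i\<bar>)"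
      by (rule sum.cong) (auto simp: kappa_def s0_def)
     then have "A kappa < A eta" unfolding A_def split using True by (simp add: kappa_def s0_def)
     then have "(kappa, eta) \<in> ?r" using A0[of kappa] by (simp add: measures_less)
     moreover have "kappa k = 0" if "k >= n" for k using 1(2)[OF that] that True by (simp add: kappa_def s0_def)
     ultimately obtain E where "good kappa E" using 1(1) by blast
     moreover have "s0 kappa = eta" by (auto simp: kappa_def s0_def fun_eq_iff)
     moreover have "kappa 0 <= 0" using True by (simp add: kappa_def s0_def)
     ultimately show ?thesis using good_s0[of kappa E] True by simp
    next
     case z: False
     have "eta k = 0" for k
     proof (cases "k < n")
      case True
      then show ?thesis using dec[of 0 k] dec[of k "n-1"] nneg z by force
     qed (use 1(2) in auto)
     then have "eta = (%_. 0)" by auto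
     then show ?thesis using good_zero by metis
    qed
   qed
  qed
 qed
qed

end

section \<open>Lexicographic order on exponents and leading terms\<close>

definition lexle :: "nat => (nat => int) => (nat => int) => bool" where
 "lexle n mu nu \<longleftrightarrow> lex_less n mu nu \<or> (\<forall>i<n. mu i = nu i)"

definition wact :: "(nat => nat) => nat set => (nat => int) => nat => int" where
 "wact sig A mu = (%k. if k \<in> A then - mu (sig k) else mu (sig k))"

lemma lex_total: "lexle n mu nu \<or> lex_less n nu mu"
proof (cases "\<forall>i<n. mu i = nu i")
 case False
 then obtain i where i: "i < n \<and> mu i ~= nu i" by blast
 define k where "k = (LEAST k. k < n \<and> mu k ~= nu k)"
 have k: "k < n" "mu k ~= nu k" using LeastI[of "%k. k < n \<and> mu k ~= nu k", OF i] by (auto simp: k_def)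
 have "mu j = nu j" if "j < k" for j using not_less_Least[of j "%k. k < n \<and> mu k ~= nu k"] that k by (auto simp: k_def)
 then show ?thesis using k unfolding lexle_def lex_less_def by (metis linorder_neqE)
qed (simp add: lexle_def)

lemma lex_asym: "lex_less n mu nu ==> \<not> lexle n nu mu"
 unfolding lexle_def lex_less_def by (metis less_asym less_irrefl linorder_neqE_nat)

lemma lex_trans: "lex_less n mu nu ==> lex_less n nu xi ==> lex_less n mu xi"
proof -
 assume "lex_less n mu nu" "lex_less n nu xi"
 then obtain k l where k: "k < n" "\<forall>i<k. mu i = nu i" "mu k < nu k" and l: "l < n" "\<forall>i<l. nu i = xi i" "nu l < xi l"
  by (auto simp: lex_less_def)
 show ?thesis unfolding lex_less_def
  by (rule exI[of _ "min k l"]) (use k l in \<open>cases k l rule: linorder_cases; auto simp: min_def\<close>)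
qed

lemma lex_cong: "(\<And>i. i < n ==> mu i = mu' i) ==> (\<And>i. i < n ==> nu i = nu' i) ==> lex_less n mu nu = lex_less n mu' nu'"
 unfolding lex_less_def by (metis less_trans)

lemma lexle_cong: "(\<And>i. i < n ==> mu i = mu' i) ==> (\<And>i. i < n ==> nu i = nu' i) ==> lexle n mu nu = lexle n mu' nu'"
 using lex_cong[of n mu mu' nu nu'] unfolding lexle_def by auto

lemma lexle_trans: "lexle n mu nu ==> lexle n nu xi ==> lexle n mu xi"
 using lex_trans[of n mu nu xi] lex_cong[of n mu nu xi xi] lex_cong[of n mu mu nu xi] unfolding lexle_def by auto

lemma lexle_refl [simp]: "lexle n mu mu" by (simp add: lexle_def)

lemma finite_lex_max:
 "finite T ==> T ~= {} ==> \<exists>m\<in>T. \<forall>x\<in>T. lexle n x m"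
proof (induction T rule: finite_ne_induct)
 case (insert x T)
 then obtain m where m: "m \<in> T" "\<forall>y\<in>T. lexle n y m" by blast
 show ?case
 proof (cases "lexle n x m")
  case False
  then have "lexle n m x" using lex_total[of n x m] by (auto simp: lexle_def)
  then have "\<forall>y\<in>insert x T. lexle n y x" using m(2) lexle_trans lexle_refl by blast
  then show ?thesis by blast
 qed (use m in auto)
qed simp

lemma finite_lex_min:
 "finite T ==> T ~= {} ==> \<exists>m\<in>T. \<forall>x\<in>T. lexle n m x"
proof (induction T rule: finite_ne_induct)
 case (insert x T)
 then obtain m where m: "m \<in> T" "\<forall>y\<in>T. lexle n m y" by blast
 show ?case
 proof (cases "lexle n m x")
  case False
  then have "lexle n x m" using lex_total[of n m x] by (auto simp: lexle_def)
  then have "\<forall>y\<in>insert x T. lexle n x y" using m(2) lexle_trans lexle_refl by blast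
  then show ?thesis by blast
 qed (use m in auto)
qed simp

definition lexpos :: "nat => (nat => int) => bool" where
 "lexpos n beta \<longleftrightarrow> (\<forall>mu r q. r < q --> lex_less n (along mu beta r) (along mu beta q))"

lemma lexposI: "k < n ==> (\<And>i. i < k ==> beta i = 0) ==> beta k > 0 ==> lexpos n beta"
 unfolding lexpos_def lex_less_def along_def by (intro allI impI exI[of _ k]) auto

lemma lexposD:
 assumes "lexpos n beta"
 shows "q > 0 ==> lex_less n mu (along mu beta q)" "q < 0 ==> lex_less n (along mu beta q) mu"
 using assms unfolding lexpos_def by (metis along_0)+

lemma lex_line:
 assumes "k < n" "beta k ~= 0"
 shows "lexpos n beta \<or> lexpos n (%i. - beta i)"
proof -
 define m where "m = (LEAST k. beta k ~= 0)"
 have m: "beta m ~= 0" using LeastI[of "%k. beta k ~= 0", OF assms(2)] by (simp add: m_def)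
 have mn: "m < n" using Least_le[of "%k. beta k ~= 0", OF assms(2)] assms(1) by (simp add: m_def)
 have z: "beta i = 0" if "i < m" for i using not_less_Least[of i "%k. beta k ~= 0"] that by (auto simp: m_def)
 show ?thesis using lexposI[of m n beta] lexposI[of m n "%i. - beta i"] m mn z by force
qed

lemma wact_along: "wact sig A (along mu alpha r) = along (wact sig A mu) (wact sig A alpha) r"
 by (auto simp: wact_def along_def)

lemma along_minus: "along nu (%k. - alpha k) r = along nu alpha (- r)"
 by (simp add: along_def)

context bc
begin

text \<open>A lexicographic substitute for the convex hull of a Weyl orbit: it is stable under the
  Weyl group and convex along root lines, hence preserved by the \<open>Sop i\<close>. The members
  of \<open>Orb omega\<close> play the role of its extreme points.\<close>

definition PP :: "(nat => int) => (nat => int) set" where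
 "PP omega = {mu. \<forall>sig A. sig permutes {..<n} --> lexle n (wact sig A mu) omega}"

definition Orb :: "(nat => int) => (nat => int) => bool" where
 "Orb omega kappa \<longleftrightarrow> (\<exists>sig A. sig permutes {..<n} \<and> (\<forall>k<n. wact sig A kappa k = omega k))"

lemma PP_fl: "mu \<in> PP omega ==> fl p mu \<in> PP omega"
proof -
 assume a: "mu \<in> PP omega"
 have "wact sig A (fl p mu) = wact sig {k. (k \<in> A) ~= (sig k = p)} mu" for sig A
  by (auto simp: wact_def fl_def fun_eq_iff)
 then show ?thesis using a by (auto simp: PP_def)
qed

lemma PP_pm: "mu \<in> PP omega ==> tau permutes {..<n} ==> pm tau mu \<in> PP omega"
proof -
 assume a: "mu \<in> PP omega" "tau permutes {..<n}"
 have "wact sig A (pm tau mu) = wact (tau \<circ> sig) A mu" for sig A by (auto simp: wact_def pm_def fun_eq_iff)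
 then show ?thesis using a permutes_compose[OF _ a(2)] by (auto simp: PP_def)
qed

lemma Orb_fl: "Orb omega kappa ==> Orb omega (fl p kappa)"
proof -
 assume "Orb omega kappa"
 then obtain sig A where s: "sig permutes {..<n}" "\<forall>k<n. wact sig A kappa k = omega k" by (auto simp: Orb_def)
 have "wact sig {k. (k \<in> A) ~= (sig k = p)} (fl p kappa) = wact sig A kappa" by (auto simp: wact_def fl_def fun_eq_iff)
 then show ?thesis using s unfolding Orb_def by metis
qed

lemma Orb_sw: "Orb omega kappa ==> i < n ==> j < n ==> Orb omega (sw i j kappa)"
proof -
 assume "Orb omega kappa" and ij: "i < n" "j < n"
 then obtain sig A where s: "sig permutes {..<n}" "\<forall>k<n. wact sig A kappa k = omega k" by (auto simp: Orb_def)
 let ?t = "Transposition.transpose i j"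
 have "?t permutes {..<n}" using ij by (intro permutes_swap_id) auto
 then have "(?t \<circ> sig) permutes {..<n}" using permutes_compose[OF s(1)] by blast
 moreover have "wact (?t \<circ> sig) A (sw i j kappa) = wact sig A kappa" by (auto simp: wact_def sw_pm pm_def fun_eq_iff)
 ultimately show ?thesis using s unfolding Orb_def by metis
qed

lemma ssw_alt: "i ~= j ==> ssw i j mu = fl i (fl j (sw i j mu))"
 by (auto simp: ssw_def fl_def sw_def fun_eq_iff)

definition isroot :: "(nat => int) => ((nat => int) => nat => int) => bool" where
 "isroot alpha s \<longleftrightarrow> is_refl alpha s \<and> (\<exists>k<n. alpha k ~= 0) \<and> (\<forall>omega. \<forall>mu\<in>PP omega. s mu \<in> PP omega) \<and> (\<forall>omega kappa. Orb omega kappa --> Orb omega (s kappa))"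

lemma PP_sw: "mu \<in> PP omega ==> i < n ==> j < n ==> sw i j mu \<in> PP omega"
 unfolding sw_pm by (intro PP_pm permutes_swap_id) auto

lemma roots:
 assumes "i < n"
 shows "j < n ==> i ~= j ==> isroot (rm i j) (sw i j)" "j < n ==> i ~= j ==> isroot (rp i j) (ssw i j)"
  "isroot (ee i) (fl i)" "isroot (rl i) (fl i)"
 unfolding isroot_def
proof goal_cases
 case 1 then show ?case using assms PP_sw Orb_sw is_refl_rm by (auto intro!: exI[of _ i] simp: rm_def ee_def)
next
 case 2 then show ?case using assms PP_sw Orb_sw PP_fl Orb_fl is_refl_rp
  by (auto intro!: exI[of _ i] simp: rp_def ee_def ssw_alt)
next
 case 3 then show ?case using assms PP_fl Orb_fl is_refl_ee by (auto intro!: exI[of _ i] simp: ee_def)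
next
 case 4 then show ?case using assms PP_fl Orb_fl is_refl_rl by (auto intro!: exI[of _ i] simp: rl_def ee_def)
qed

lemma isroot_neg: "isroot alpha s ==> isroot (%k. - alpha k) s"
 using is_refl_neg by (auto simp: isroot_def)

lemma wact_nonzero:
 assumes "sig permutes {..<n}" "k < n" "alpha k ~= 0"
 shows "\<exists>k'<n. wact sig A alpha k' ~= 0"
proof (intro exI conjI)
 show "inv sig k < n" using permutes_in_image[OF permutes_inv[OF assms(1)], of k] assms(2) by simp
 show "wact sig A alpha (inv sig k) ~= 0" using permutes_inverses(1)[OF assms(1)] assms(3) by (simp add: wact_def)
qed

text \<open>Every signed permutation of a root line is lexicographically monotone along the line, so
  the image of an intermediate point is dominated by the image of one of the two outer
  points.\<close>

lemma PP_between:
 assumes "along nu alpha r \<in> PP omega" "along nu alpha q \<in> PP omega" "r >= 0" "q <= 0" "\<exists>k<n. alpha k ~= 0"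
 shows "nu \<in> PP omega"
 unfolding PP_def mem_Collect_eq
proof (intro allI impI)
 fix sig A assume s: "sig permutes {..<n}"
 let ?w = "wact sig A nu" and ?b = "wact sig A alpha"
 have 1: "lexle n (along ?w ?b r) omega" "lexle n (along ?w ?b q) omega"
  using assms(1,2) s by (auto simp: PP_def wact_along[symmetric])
 obtain k where "k < n" "?b k ~= 0" using wact_nonzero[OF s] assms(5) by blast
 from lex_line[of k n ?b, OF this] show "lexle n ?w omega"
 proof
  assume "lexpos n ?b"
  then have "r > 0 ==> lex_less n ?w (along ?w ?b r)" by (rule lexposD)
  then show ?thesis using 1 assms(3) lexle_trans[of n ?w "along ?w ?b r" omega]
   by (cases "r = 0") (auto simp: lexle_def)
 next
  assume "lexpos n (%i. - ?b i)"
  then have "q < 0 ==> lex_less n ?w (along ?w (%i. - ?b i) (-q))" by (intro lexposD(1)) auto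
  then have "q < 0 ==> lex_less n ?w (along ?w ?b q)" by (simp add: along_minus)
  then show ?thesis using 1 assms(4) lexle_trans[of n ?w "along ?w ?b q" omega]
   by (cases "q = 0") (auto simp: lexle_def)
 qed
qed

lemma anti_PP:
 fixes c :: lpoly
 assumes "isroot alpha s" "\<And>mu. c mu ~= 0 ==> mu \<in> PP omega" "c x - c (s x) ~= 0"
 shows "x \<in> PP omega" "s x \<in> PP omega"
proof -
 have cl: "\<And>mu. mu \<in> PP omega ==> s mu \<in> PP omega" and inv: "s (s x) = x"
  using assms(1) by (auto simp: isroot_def is_refl_def)
 have "c x ~= 0 \<or> c (s x) ~= 0" using assms(3) by auto
 then show "x \<in> PP omega" "s x \<in> PP omega" using assms(2) cl inv by metis+
qed

lemma Nop_PP: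
 assumes "isroot alpha s" "fin_supp c" "\<And>mu. c mu ~= 0 ==> mu \<in> PP omega" "Nop alpha s c nu ~= 0"
 shows "nu \<in> PP omega"
proof -
 have r: "is_refl alpha s" "\<exists>k<n. alpha k ~= 0" using assms(1) by (auto simp: isroot_def)
 obtain x y where "x >= 0" "c (along nu alpha x) - c (s (along nu alpha x)) ~= 0" "y <= 0" "c (along nu alpha y) - c (s (along nu alpha y)) ~= 0"
  using Nop_between[OF assms(2) r(1) assms(4)] by blast
 then show ?thesis using anti_PP(1)[OF assms(1,3)] PP_between[of nu alpha x omega y] r(2) by blast
qed

lemma Sop_PP:
 assumes "lp_ok n c" "\<And>mu. c mu ~= 0 ==> mu \<in> PP omega" "i < n" "Sop i c nu ~= 0"
 shows "nu \<in> PP omega"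
proof (rule ccontr)
 assume n: "nu \<notin> PP omega"
 have 1: "c nu = 0" using n assms(2) by blast
 have 2: "Nop alpha s c nu = 0" if "isroot alpha s" for alpha s using Nop_PP[OF that lp_ok_fin[OF assms(1)] assms(2)] n by blast
 have "Sop i c nu = 0" unfolding Sop_def using 1 2[OF roots(1)] 2[OF roots(2)] 2[OF roots(3)] 2[OF roots(4)] assms(3)
  by auto
 then show False using assms(4) by simp
qed

text \<open>A point beyond \<open>kappa\<close> and its mirror image lie on opposite sides of
  \<open>kappa\<close>, since \<open>m >= 0\<close>. In the frame where \<open>kappa\<close> becomes
  \<open>omega\<close>, one of them exceeds \<open>omega\<close>, whereas a nonzero term of the
  series needs both in \<open>PP omega\<close>.\<close>

lemma Nop_extremal:
 assumes "isroot alpha s" "fin_supp c" "\<And>mu. c mu ~= 0 ==> mu \<in> PP omega" "Orb omega kappa" "s kappa = along kappa alpha (- m)" "m >= 0"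
 shows "Nop alpha s c kappa = c kappa - c (s kappa)"
proof -
 have r: "is_refl alpha s" "\<exists>k<n. alpha k ~= 0" using assms(1) by (auto simp: isroot_def)
 obtain sig A where s: "sig permutes {..<n}" "\<forall>k<n. wact sig A kappa k = omega k" using assms(4) by (auto simp: Orb_def)
 let ?w = "wact sig A kappa" and ?b = "wact sig A alpha"
 have "c (along kappa alpha (1 + int q)) - c (s (along kappa alpha (1 + int q))) = 0" for q
 proof (rule ccontr)
  assume n: "\<not> ?thesis"
  have sx: "s (along kappa alpha (1 + int q)) = along kappa alpha (- m - 1 - int q)"
  proof -
   have "s (along kappa alpha (1 + int q)) = along (s kappa) alpha (- (1 + int q))" using r(1) by (simp add: is_refl_def)
   then show ?thesis unfolding assms(5) along_along by (simp only: minus_add_distrib diff_conv_add_uminus add.assoc)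
  qed
  have "along kappa alpha (1 + int q) \<in> PP omega" "along kappa alpha (- m - 1 - int q) \<in> PP omega"
   using anti_PP[OF assms(1,3) n] sx by auto
  then have "lexle n (along ?w ?b (1 + int q)) omega" "lexle n (along ?w ?b (- m - 1 - int q)) omega"
   using s(1) by (auto simp: PP_def wact_along[symmetric])
  then have le: "lexle n (along ?w ?b (1 + int q)) ?w" "lexle n (along ?w ?b (- m - 1 - int q)) ?w"
   using lexle_cong[of n _ _ omega ?w] s(2) by (metis)+
  obtain k where "k < n" "?b k ~= 0" using wact_nonzero[OF s(1)] r(2) by blast
  from lex_line[of k n ?b, OF this] show False
  proof
   assume "lexpos n ?b"
   then have "lex_less n ?w (along ?w ?b (1 + int q))" by (rule lexposD) simp
   then show False using le(1) lex_asym by force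
  next
   assume "lexpos n (%i. - ?b i)"
   then have "lex_less n ?w (along ?w (%i. - ?b i) (m + 1 + int q))"
    by (rule lexposD) (use assms(6) in simp)
   moreover have "along ?w (%i. - ?b i) (m + 1 + int q) = along ?w ?b (- m - 1 - int q)"
    by (auto simp: along_def algebra_simps)
   ultimately show False using le(2) lex_asym by force
  qed
 qed
 then show ?thesis by (simp add: Nop_def)
qed

text \<open>If \<open>m > 0\<close>, the reflected exponent is smaller than the minimal
  \<open>kappa\<close> and has coefficient 0; if \<open>m < 0\<close>, its coefficient is cancelled
  by the subtracted reflection; if \<open>m = 0\<close>, only the subtracted term remains. The three
  cases leave exactly the sign \<open>eps m\<close>, including \<open>eps 0 = -1\<close>.\<close>

lemma Nop_minimal:
 assumes "isroot alpha s" "lexpos n alpha" "fin_supp c" "\<And>mu. c mu ~= 0 ==> mu \<in> PP omega" "Orb omega kappa"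
  "s kappa = along kappa alpha (- m)" "\<And>mu. c mu ~= 0 ==> Orb omega mu ==> \<not> lex_less n mu kappa"
 shows "Nop alpha s c kappa - c (s kappa) = of_real (eps m) * c kappa"
proof (cases "m >= 0")
 case True
 have N: "Nop alpha s c kappa = c kappa - c (s kappa)" by (rule Nop_extremal[OF assms(1,3,4,5,6) True])
 show ?thesis
 proof (cases "m = 0")
  case False
  then have "m > 0" using True by simp
  then have "lex_less n (s kappa) kappa" unfolding assms(6) using assms(2) by (intro lexposD(2)) auto
  moreover have "Orb omega (s kappa)" using assms(1,5) by (simp add: isroot_def)
  ultimately have "c (s kappa) = 0" using assms(7) by blast
  then show ?thesis using N \<open>m > 0\<close> by (simp add: eps_def)
 qed (use N assms(6) in \<open>simp add: eps_def\<close>)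
next
 case False
 have e: "s kappa = along kappa (%k. - alpha k) (- (- m))" unfolding along_minus using assms(6) by simp
 have "Nop (%k. - alpha k) s c kappa = c kappa - c (s kappa)"
  by (rule Nop_extremal[OF isroot_neg[OF assms(1)] assms(3,4,5) e]) (use False in auto)
 moreover have "is_refl alpha s" using assms(1) by (simp add: isroot_def)
 ultimately have "- Nop alpha s c kappa = c kappa - c (s kappa)" using Nop_neg[OF assms(3)] by simp
 then have "Nop alpha s c kappa = - (c kappa - c (s kappa))" by (metis minus_minus)
 then show ?thesis using False by (simp add: eps_def)
qed

text \<open>Take \<open>omega\<close> as the largest Weyl image of a support point and
  \<open>kappa\<close> as the smallest support point in the orbit of \<open>omega\<close>. Comparing
  coefficients at \<open>kappa\<close> in the eigenvalue equations gives
  \<open>bar eta = bar kappa\<close>, and injectivity of \<open>bar\<close> gives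
  \<open>kappa = eta\<close>.\<close>

theorem good_leading:
 assumes "good eta E" "\<And>k. k >= n ==> eta k = 0"
 shows "\<exists>omega. (\<forall>mu. E mu ~= 0 --> mu \<in> PP omega) \<and> Orb omega eta \<and> E eta ~= 0"
proof -
 have ok: "lp_ok n E" and Y: "\<And>i nu. i < n ==> Yop i E nu = of_real (bar eta i) * E nu"
  using assms(1) by (auto simp: good_def)
 obtain mu0 where mu0: "E mu0 ~= 0" using assms(1) by (auto simp: good_def)
 define T where "T = (%(mu,sig,A). wact sig A mu) ` ({mu. E mu ~= 0} \<times> {sig. sig permutes {..<n}} \<times> Pow {..<n})"
 have finS: "finite {mu. E mu ~= 0}" using ok by (simp add: lp_ok_def)
 have "finite T" unfolding T_def using finite_permutations[of "{..<n}"] finS by auto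
 moreover have "T ~= {}" using mu0 permutes_id[of "{..<n}"] unfolding T_def by blast
 ultimately obtain omega where omega: "omega \<in> T" "\<And>x. x \<in> T ==> lexle n x omega" using finite_lex_max by metis
 have PP: "mu \<in> PP omega" if "E mu ~= 0" for mu
  unfolding PP_def mem_Collect_eq
 proof (intro allI impI)
  fix sig A assume s: "sig permutes {..<n}"
  have "wact sig (A \<inter> {..<n}) mu \<in> T" using that s unfolding T_def by (intro image_eqI[of _ _ "(mu,sig,A \<inter> {..<n})"]) auto
  then have "lexle n (wact sig (A \<inter> {..<n}) mu) omega" by (rule omega)
  then show "lexle n (wact sig A mu) omega" using lexle_cong[of n "wact sig (A \<inter> {..<n}) mu" "wact sig A mu" omega omega] by (simp add: wact_def)
 qed
 define K where "K = {mu. E mu ~= 0 \<and> Orb omega mu}"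
 have "K ~= {}" using omega(1) unfolding T_def K_def Orb_def by auto
 moreover have "finite K" unfolding K_def by (rule finite_subset[OF _ finS]) auto
 ultimately obtain kappa where "kappa \<in> K" and mn: "\<And>x. x \<in> K ==> lexle n kappa x" using finite_lex_min by metis
 then have kappa: "E kappa ~= 0" "Orb omega kappa" by (auto simp: K_def)
 have mn': "\<not> lex_less n mu kappa" if "E mu ~= 0" "Orb omega mu" for mu
  using mn[of mu] that lex_asym by (auto simp: K_def)
 note M = Nop_minimal[OF _ _ lp_ok_fin[OF ok] PP kappa(2) _ mn']
 have "bar eta i = bar kappa i" if i: "i < n" for i
 proof -
  have A: "Nop (rm i j) (sw i j) E kappa - (if i < j then E (sw i j kappa) else - E (sw i j kappa)) = of_real (ord kappa i j) * E kappa"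
   if "j < n" "j ~= i" for j
  proof (cases "i < j")
   case True
   have "lexpos n (rm i j)" using True i by (intro lexposI[of i]) (auto simp: rm_def ee_def)
   moreover have "sw i j kappa = along kappa (rm i j) (- (kappa i - kappa j))"
    using True by (auto simp: sw_def along_def rm_def ee_def)
   ultimately have "Nop (rm i j) (sw i j) E kappa - E (sw i j kappa) = of_real (eps (kappa i - kappa j)) * E kappa"
    by (intro M[OF roots(1)[OF i that(1) less_imp_neq[OF True]]])
   then show ?thesis using True by (simp add: ord_def)
  next
   case False
   then have ji: "j < i" using that by simp
   have "lexpos n (rm j i)" using ji that by (intro lexposI[of j]) (auto simp: rm_def ee_def)
   moreover have "sw j i kappa = along kappa (rm j i) (- (kappa j - kappa i))"
    using ji by (auto simp: sw_def along_def rm_def ee_def)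
   ultimately have 1: "Nop (rm j i) (sw j i) E kappa - E (sw j i kappa) = of_real (eps (kappa j - kappa i)) * E kappa"
    by (intro M[OF roots(1)[OF that(1) i less_imp_neq[OF ji]]])
   have e: "sw j i = sw i j" "rm i j = (%k. - rm j i k)" by (auto simp: sw_def rm_def fun_eq_iff)
   have 2: "Nop (rm i j) (sw i j) E kappa = - Nop (rm j i) (sw j i) E kappa"
    using Nop_neg[OF lp_ok_fin[OF ok] is_refl_rm, of j i] that by (simp add: e)
   have "Nop (rm i j) (sw i j) E kappa - - E (sw i j kappa) = - (of_real (eps (kappa j - kappa i)) * E kappa)"
    unfolding 2 1[symmetric] by (simp add: e)
   then show ?thesis using False by (simp add: ord_def)
  qed
  have B: "Nop (rp i j) (ssw i j) E kappa - E (ssw i j kappa) = of_real (eps (kappa i + kappa j)) * E kappa"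
   if "j < n" "j ~= i" for j
  proof -
   have "lexpos n (rp i j)" using that i by (intro lexposI[of "min i j"]) (auto simp: rp_def ee_def min_def split: if_splits)
   moreover have "ssw i j kappa = along kappa (rp i j) (- (kappa i + kappa j))"
    using that by (auto simp: ssw_def along_def rp_def ee_def)
   ultimately show ?thesis by (intro M[OF roots(2)[OF i that(1) that(2)[symmetric]]])
  qed
  have C: "Nop (ee i) (fl i) E kappa - E (fl i kappa) = of_real (eps (kappa i)) * E kappa"
  proof -
   have "lexpos n (ee i)" using i by (intro lexposI[of i]) (auto simp: ee_def)
   moreover have "fl i kappa = along kappa (ee i) (- (2 * kappa i))" by (auto simp: fl_def along_def ee_def)
   ultimately have "Nop (ee i) (fl i) E kappa - E (fl i kappa) = of_real (eps (2 * kappa i)) * E kappa" by (intro M[OF roots(3)[OF i]])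
   then show ?thesis by (simp add: eps_def)
  qed
  have D: "Nop (rl i) (fl i) E kappa - E (fl i kappa) = of_real (eps (kappa i)) * E kappa"
  proof -
   have "lexpos n (rl i)" using i by (intro lexposI[of i]) (auto simp: rl_def ee_def)
   moreover have "fl i kappa = along kappa (rl i) (- (kappa i))" by (auto simp: fl_def along_def rl_def ee_def)
   ultimately show ?thesis by (intro M[OF roots(4)[OF i]])
  qed
  have S: "(\<Sum>j\<in>{..<n}-{i}. Nop (rm i j) (sw i j) E kappa + Nop (rp i j) (ssw i j) E kappa) -
    (\<Sum>j\<in>{..<n}-{i}. (if i < j then E (sw i j kappa) else - E (sw i j kappa)) + E (ssw i j kappa))
   = of_real (\<Sum>j\<in>{..<n}-{i}. ord kappa i j + eps (kappa i + kappa j)) * E kappa"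
   unfolding sum_subtractf[symmetric] of_real_sum sum_distrib_right
  proof (rule sum.cong[OF refl])
   fix j assume j: "j \<in> {..<n} - {i}"
   show "Nop (rm i j) (sw i j) E kappa + Nop (rp i j) (ssw i j) E kappa -
     ((if i < j then E (sw i j kappa) else - E (sw i j kappa)) + E (ssw i j kappa)) =
     complex_of_real (ord kappa i j + eps (kappa i + kappa j)) * E kappa"
    using A[of j] B[of j] j by (simp add: algebra_simps)
  qed
  have "of_real (bar eta i) * E kappa = Yop i E kappa" using Y[OF i] by simp
  also have "... = of_int (kappa i) * E kappa
   + of_real (theta/2)*((\<Sum>j\<in>{..<n}-{i}. Nop (rm i j) (sw i j) E kappa + Nop (rp i j) (ssw i j) E kappa) -
    (\<Sum>j\<in>{..<n}-{i}. (if i < j then E (sw i j kappa) else - E (sw i j kappa)) + E (ssw i j kappa)))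
   + of_real (k1/2)*(Nop (ee i) (fl i) E kappa - E (fl i kappa)) + of_real k2*(Nop (rl i) (fl i) E kappa - E (fl i kappa))"
   unfolding Yop_alt[OF i] Sop_def by (simp add: rho0_def algebra_simps)
  also have "... = of_real (bar kappa i) * E kappa" unfolding S C D by (simp add: bar_def rho0_def algebra_simps)
  finally show ?thesis using kappa(1) by simp
 qed
 then have "eta i = kappa i" if "i < n" for i using bar_inj[of eta kappa i] that by blast
 moreover have "eta i = kappa i" if "\<not> i < n" for i using assms(2) that ok kappa(1) by (simp add: lp_ok_def)
 ultimately have "eta = kappa" by blast
 then show ?thesis using kappa PP by blast
qed

text \<open>Pigeonhole: if a signed permutation of \<open>lam\<close> first exceeded
  \<open>lam\<close> at position \<open>k\<close>, then \<open>sig\<close> would map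
  \<open>k\<close> together with all indices of entries larger than \<open>lam k\<close> injectively
  into the set of those indices.\<close>

lemma dominant_PP:
 assumes "is_partition_len n lam"
 shows "int \<circ> lam \<in> PP (int \<circ> lam)"
 unfolding PP_def mem_Collect_eq
proof (intro allI impI)
 fix sig A assume s: "sig permutes {..<n}"
 show "lexle n (wact sig A (int \<circ> lam)) (int \<circ> lam)"
 proof (rule ccontr)
  assume "\<not> ?thesis"
  then obtain k where k: "k < n" "\<forall>i<k. int (lam i) = wact sig A (int \<circ> lam) i" "int (lam k) < wact sig A (int \<circ> lam) k"
   using lex_total unfolding lex_less_def by fastforce
  have le: "wact sig A (int \<circ> lam) i <= int (lam (sig i))" for i by (auto simp: wact_def)
  define J where "J = {j. lam k < lam j}"
  have dec: "lam j <= lam i" if "i <= j" for i j using assms that by (auto simp: is_partition_len_def)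
  have Jk: "J \<subseteq> {..<k}" using dec[of k] by (force simp: J_def not_le)
  have "sig ` (insert k J) \<subseteq> J"
  proof
   fix x assume "x \<in> sig ` (insert k J)"
   then obtain i where i: "x = sig i" "i = k \<or> i \<in> J" by auto
   show "x \<in> J"
   proof (cases "i = k")
    case True
    then show ?thesis using k(3) le[of k] i by (simp add: J_def)
   next
    case False
    then have "i \<in> J" "i < k" using i Jk by auto
    then have "int (lam k) < int (lam i)" "int (lam i) = wact sig A (int \<circ> lam) i" using k(2) by (auto simp: J_def)
    then show ?thesis using le[of i] i by (simp add: J_def)
   qed
  qed
  moreover have finJ: "finite J" using Jk finite_subset by blast
  ultimately have "card (sig ` (insert k J)) <= card J" by (intro card_mono) auto
  moreover have "card (sig ` (insert k J)) = card (insert k J)"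
   by (rule card_image) (rule inj_on_subset[OF permutes_inj[OF s]], simp)
  moreover have "k \<notin> J" by (simp add: J_def)
  ultimately show False using finJ by simp
 qed
qed

lemma good_leading_dominant:
 assumes "is_partition_len n lam" "good (int \<circ> lam) E"
 shows "E mu ~= 0 ==> mu \<in> PP (int \<circ> lam)" "E (int \<circ> lam) ~= 0"
proof -
 let ?h = "int \<circ> lam"
 have z: "?h k = 0" if "k >= n" for k using assms(1) that by (simp add: is_partition_len_def)
 obtain omega where omega: "\<And>mu. E mu ~= 0 ==> mu \<in> PP omega" "Orb omega ?h" and ne: "E ?h ~= 0" using good_leading[OF assms(2) z] by blast
 obtain sig A where s: "sig permutes {..<n}" "\<forall>k<n. wact sig A ?h k = omega k" using omega(2) by (auto simp: Orb_def)
 have "lexle n (wact sig A ?h) ?h" using dominant_PP[OF assms(1)] s(1) by (auto simp: PP_def)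
 then have 1: "lexle n omega ?h" using lexle_cong[of n "wact sig A ?h" omega ?h ?h] s(2) by simp
 show "E ?h ~= 0" by (rule ne)
 show "mu \<in> PP ?h" if "E mu ~= 0"
  using omega(1)[OF that] lexle_trans[OF _ 1] by (auto simp: PP_def)
qed

end

section \<open>Symmetrisation and power sums of the Dunkl operators\<close>

context bc
begin

lemma lp_ok_fl: "lp_ok n c ==> p < n ==> lp_ok n (c \<circ> fl p)"
 by (rule lp_ok_comp[OF _ inj_maps(1)]) (auto simp: fl_def)

lemma lp_ok_pm: "lp_ok n c ==> sig permutes {..<n} ==> lp_ok n (c \<circ> pm sig)"
 by (rule lp_ok_comp[OF _ inj_pm]) (auto simp: pm_def permutes_def)

lemma lp_ok_Sop_pow: "lp_ok n c ==> i < n ==> lp_ok n ((Sop i ^^ m) c)"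
 by (induction m) (auto intro: lp_ok_Sop)

lemma Sop_pow_lincomb:
 assumes "lp_ok n c" "lp_ok n d" "i < n"
 shows "(Sop i ^^ m) (%nu. x * c nu + y * d nu) = (%nu. x*(Sop i ^^ m) c nu + y*(Sop i ^^ m) d nu)"
proof (induction m)
 case (Suc m)
 then show ?case
  using Sop_lincomb[OF lp_ok_Sop_pow[OF assms(1,3), of m] lp_ok_Sop_pow[OF assms(2,3), of m] assms(3)] by simp
qed simp

lemma Sop_scale:
 assumes "lp_ok n c" "i < n"
 shows "Sop i (%nu. x * c nu) = (%nu. x * Sop i c nu)"
 using Sop_lincomb[OF assms(1,1,2), of x 0] by simp

lemma Sop_pow_pm:
 assumes "sig permutes {..<n}" "lp_ok n c" "i < n"
 shows "(Sop (sig i) ^^ m) (c \<circ> pm sig) = (Sop i ^^ m) c \<circ> pm sig"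
proof (induction m)
 case (Suc m)
 then show ?case using Sop_pm[OF assms(1) lp_ok_Sop_pow[OF assms(2,3), of m] assms(3)] by (simp add: comp_def)
qed simp

lemma Sop_pow_fl:
 assumes "p < n" "lp_ok n c" "i < n"
 shows "(Sop i ^^ m) (c \<circ> fl p) = (%nu. (if i = p then - 1 else 1) ^ m*((Sop i ^^ m) c) (fl p nu))"
proof (induction m)
 case (Suc m)
 let ?c = "(Sop i ^^ m) c" and ?s = "if i = p then - 1 else (1::complex)"
 have ok: "lp_ok n ?c" by (rule lp_ok_Sop_pow[OF assms(2,3)])
 have "(Sop i ^^ Suc m) (c \<circ> fl p) = Sop i (%nu. ?s ^ m*(?c \<circ> fl p) nu)" using Suc by (simp add: comp_def)
 also have "... = (%nu. ?s ^ m * Sop i (?c \<circ> fl p) nu)" by (rule Sop_scale[OF lp_ok_fl[OF ok assms(1)] assms(3)])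
 finally show ?case unfolding Sop_fl[OF assms(1) ok assms(3)] by (auto simp: comp_def)
qed auto

text \<open>Even powers are taken because \<open>Sop i\<close> changes sign under the flip of
  variable \<open>i\<close>; the sum is then invariant under the whole Weyl group.\<close>

definition Dop :: "nat => lpoly => lpoly" where
 "Dop k c nu = (\<Sum>i<n. ((Sop i ^^ (2*k)) c) nu)"

lemma Dop_lincomb:
 assumes "lp_ok n c" "lp_ok n d"
 shows "Dop k (%nu. x * c nu + y * d nu) = (%nu. x * Dop k c nu + y * Dop k d nu)"
 by (rule ext) (simp add: Dop_def Sop_pow_lincomb[OF assms] sum.distrib sum_distrib_left)

lemma Dop_sum:
 assumes "finite A" "\<And>a. a \<in> A ==> lp_ok n (f a)"
 shows "Dop k (%nu. \<Sum>a\<in>A. f a nu) = (%nu. \<Sum>a\<in>A. Dop k (f a) nu)"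
 using assms
proof (induction A rule: finite_induct)
 case empty
 have z: "lp_ok n (%_. 0)" by (simp add: lp_ok_def)
 show ?case using Dop_lincomb[OF z z, of k 0 0] by simp
next
 case (insert a A)
 then have "Dop k (%nu. 1 * f a nu + 1*(\<Sum>a\<in>A. f a nu)) = (%nu. 1 * Dop k (f a) nu + 1 * Dop k (%nu. \<Sum>a\<in>A. f a nu) nu)"
  by (intro Dop_lincomb lp_ok_sum) auto
 then show ?case using insert by simp
qed

lemma Dop_pm:
 assumes "sig permutes {..<n}" "lp_ok n c"
 shows "Dop k (c \<circ> pm sig) = Dop k c \<circ> pm sig"
proof
 fix nu
 have "(\<Sum>i<n. ((Sop i ^^ (2*k)) (c \<circ> pm sig)) nu) = (\<Sum>i<n. ((Sop (sig i) ^^ (2*k)) (c \<circ> pm sig)) nu)"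
  using permutes_in_image[OF assms(1)] permutes_inverses[OF assms(1)] permutes_in_image[OF permutes_inv[OF assms(1)]]
  by (intro sum.reindex_bij_witness[of _ sig "inv sig"]) auto
 also have "... = (\<Sum>i<n. ((Sop i ^^ (2*k)) c) (pm sig nu))"
  by (rule sum.cong) (auto simp: Sop_pow_pm[OF assms])
 finally show "Dop k (c \<circ> pm sig) nu = (Dop k c \<circ> pm sig) nu" by (simp add: Dop_def)
qed

lemma Dop_fl:
 assumes "p < n" "lp_ok n c"
 shows "Dop k (c \<circ> fl p) = Dop k c \<circ> fl p"
proof
 fix nu
 have "(\<Sum>i<n. ((Sop i ^^ (2*k)) (c \<circ> fl p)) nu) = (\<Sum>i<n. ((Sop i ^^ (2*k)) c) (fl p nu))"
  by (rule sum.cong) (auto simp: Sop_pow_fl[OF assms])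
 then show "Dop k (c \<circ> fl p) nu = (Dop k c \<circ> fl p) nu" by (simp add: Dop_def)
qed

definition Wg :: "((nat => nat) \<times> nat set) set" where
 "Wg = {sig. sig permutes {..<n}} \<times> Pow {..<n}"

definition Sym :: "lpoly => lpoly" where
 "Sym c mu = (\<Sum>(sig,A)\<in>Wg. c (wact sig A mu))"

lemma finite_Wg: "finite Wg" by (simp add: Wg_def finite_permutations)

lemma comp_wact_rule:
 assumes "sig permutes {..<n}" "A \<subseteq> {..<n}"
  and "P c" "\<And>c p. P c ==> p < n ==> P (c \<circ> fl p)" "\<And>c sig. P c ==> sig permutes {..<n} ==> P (c \<circ> pm sig)"
 shows "P (c \<circ> wact sig A)"
proof -
 have "finite A" using assms(2) finite_subset by blast
 then have "P (c \<circ> wact id A)" using assms(2)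
 proof (induction A rule: finite_induct)
  case empty
  have "wact id {} = id" by (auto simp: wact_def)
  then show ?case using assms(3) by (simp add: comp_def id_def)
 next
  case (insert p A)
  have "wact id (insert p A) = wact id A \<circ> fl p" using insert(2) by (auto simp: wact_def fl_def fun_eq_iff)
  moreover have "P (c \<circ> wact id A)" using insert by (simp add: comp_def id_def)
  then have "P ((c \<circ> wact id A) \<circ> fl p)" using insert assms(4) by auto
  ultimately show ?case by (simp add: comp_def id_def)
 qed
 then have "P ((c \<circ> wact id A) \<circ> pm sig)" using assms by auto
 moreover have "c \<circ> wact id A \<circ> pm sig = c \<circ> wact sig A" by (auto simp: wact_def pm_def fun_eq_iff id_def)
 ultimately show ?thesis by simp
qed

lemma lp_ok_wact: "lp_ok n c ==> (sig,A) \<in> Wg ==> lp_ok n (c \<circ> wact sig A)"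
 by (rule comp_wact_rule[where P = "lp_ok n"]) (simp_all add: Wg_def lp_ok_fl lp_ok_pm)

lemma Dop_wact:
 assumes "lp_ok n c" "(sig,A) \<in> Wg" shows "Dop k (c \<circ> wact sig A) = Dop k c \<circ> wact sig A"
proof -
 have "finite A" "A \<subseteq> {..<n}" using assms(2) finite_subset by (auto simp: Wg_def)
 then have 1: "Dop k (c \<circ> wact id A) = Dop k c \<circ> wact id A \<and> lp_ok n (c \<circ> wact id A)"
 proof (induction A rule: finite_induct)
  case empty
  have "wact id {} = id" by (auto simp: wact_def)
  then show ?case using assms by (simp add: comp_def id_def)
 next
  case (insert p A)
  have "wact id (insert p A) = wact id A \<circ> fl p" using insert(2) by (auto simp: wact_def fl_def fun_eq_iff)
  then show ?case using insert Dop_fl[of p "c \<circ> wact id A" k] lp_ok_fl[of "c \<circ> wact id A" p] by (simp add: comp_def id_def)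
 qed
 have "wact sig A = wact id A \<circ> pm sig" by (auto simp: wact_def pm_def fun_eq_iff)
 then show ?thesis using 1 Dop_pm[of sig "c \<circ> wact id A" k] assms(2) by (simp add: o_assoc Wg_def)
qed

lemma Sym_alt: "Sym c = (%mu. \<Sum>w\<in>Wg. (c \<circ> wact (fst w) (snd w)) mu)"
 by (auto simp: Sym_def split_def)

lemma lp_ok_Sym: "lp_ok n c ==> lp_ok n (Sym c)"
 unfolding Sym_alt by (intro lp_ok_sum finite_Wg lp_ok_wact) auto

lemma Dop_Sym:
 assumes "lp_ok n c" shows "Dop k (Sym c) = Sym (Dop k c)"
proof -
 have "Dop k (Sym c) = (%nu. \<Sum>w\<in>Wg. Dop k (c \<circ> wact (fst w) (snd w)) nu)"
  unfolding Sym_alt by (rule Dop_sum[OF finite_Wg]) (metis assms lp_ok_wact prod.collapse)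
 also have "... = Sym (Dop k c)" unfolding Sym_alt
  by (intro ext sum.cong) (use Dop_wact[OF assms] in auto)
 finally show ?thesis .
qed

lemma Sym_lincomb: "Sym (%nu. x * c nu + y * d nu) = (%nu. x * Sym c nu + y * Sym d nu)"
 by (rule ext) (simp add: Sym_alt sum.distrib sum_distrib_left)

lemma Sym_comp_fl:
 assumes "p < n" shows "Sym (c \<circ> fl p) = Sym c"
proof
 fix mu
 define f where "f = (%A. {k\<in>{..<n}. (k \<in> A) ~= (k = p)})"
 have ff: "f (f A) = A" if "A \<subseteq> {..<n}" for A using that by (auto simp: f_def)
 have w: "fl p (wact sig A mu) = wact sig (f A) mu" if "A \<subseteq> {..<n}" for sig A
  using that assms by (auto simp: wact_def fl_def f_def fun_eq_iff)
 show "Sym (c \<circ> fl p) mu = Sym c mu" unfolding Sym_alt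
  by (rule sum.reindex_bij_witness[of _ "%w. (fst w, f (snd w))" "%w. (fst w, f (snd w))"])
   (auto simp: Wg_def w ff, auto simp: f_def)
qed

lemma Sym_comp_pm:
 assumes "tau permutes {..<n}" shows "Sym (c \<circ> pm tau) = Sym c"
proof
 fix mu
 note inv = permutes_inverses[OF assms]
 have w: "pm tau (wact sig A mu) = wact (sig \<circ> tau) (tau -` A) mu" for sig A
  by (auto simp: wact_def pm_def fun_eq_iff)
 have im: "tau x < n \<longleftrightarrow> x < n" "inv tau x < n \<longleftrightarrow> x < n" for x
  using permutes_in_image[OF assms, of x] permutes_in_image[OF permutes_inv[OF assms], of x] by auto
 show "Sym (c \<circ> pm tau) mu = Sym c mu" unfolding Sym_alt
 proof (rule sum.reindex_bij_witness[of _ "%w. (fst w \<circ> inv tau, inv tau -` snd w)" "%w. (fst w \<circ> tau, tau -` snd w)"])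
  fix a assume a: "a \<in> Wg"
  show "(fst (fst a \<circ> tau, tau -` snd a) \<circ> inv tau, inv tau -` snd (fst a \<circ> tau, tau -` snd a)) = a"
   by (cases a) (auto simp: fun_eq_iff inv)
  show "(fst a \<circ> tau, tau -` snd a) \<in> Wg"
   using a permutes_compose[OF assms, of "fst a"] im by (auto simp: Wg_def)
  show "(c \<circ> wact (fst (fst a \<circ> tau, tau -` snd a)) (snd (fst a \<circ> tau, tau -` snd a))) mu = (c \<circ> pm tau \<circ> wact (fst a) (snd a)) mu"
   by (simp add: w)
 next
  fix b assume b: "b \<in> Wg"
  show "(fst (fst b \<circ> inv tau, inv tau -` snd b) \<circ> tau, tau -` snd (fst b \<circ> inv tau, inv tau -` snd b)) = b"
   by (cases b) (auto simp: fun_eq_iff inv)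
  show "(fst b \<circ> inv tau, inv tau -` snd b) \<in> Wg"
   using b permutes_compose[OF permutes_inv[OF assms], of "fst b"] im by (auto simp: Wg_def)
 qed
qed

lemma Sym_fl:
 assumes "p < n" shows "Sym c \<circ> fl p = Sym c"
proof
 fix mu
 define f where "f = (%w::(nat => nat) \<times> nat set. (fst w, {k\<in>{..<n}. (k \<in> snd w) ~= (fst w k = p)}))"
 have w: "wact (fst w) (snd w) (fl p mu) = wact (fst (f w)) (snd (f w)) mu" if "w \<in> Wg" for w
 proof -
  have "fst w permutes {..<n}" using that by (auto simp: Wg_def)
  then have "fst w k = p ==> k < n" for k using assms permutes_in_image[of "fst w" "{..<n}" k] by auto
  then show ?thesis using that by (auto simp: wact_def fl_def f_def fun_eq_iff Wg_def)
 qed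
 have fW: "f w \<in> Wg" if "w \<in> Wg" for w using that by (auto simp: f_def Wg_def)
 have ff: "f (f w) = w" if "w \<in> Wg" for w using that by (cases w) (auto simp: f_def Wg_def)
 show "(Sym c \<circ> fl p) mu = Sym c mu" unfolding Sym_alt
  by (simp, rule sum.reindex_bij_witness[of _ f f]) (auto simp: w ff fW)
qed

lemma Sym_pm:
 assumes "tau permutes {..<n}" shows "Sym c \<circ> pm tau = Sym c"
proof
 fix mu
 note inv = permutes_inverses[OF assms]
 have w: "wact sig A (pm tau mu) = wact (tau \<circ> sig) A mu" for sig A by (auto simp: wact_def pm_def fun_eq_iff)
 show "(Sym c \<circ> pm tau) mu = Sym c mu" unfolding Sym_alt
  by (simp, rule sum.reindex_bij_witness[of _ "%w. (inv tau \<circ> fst w, snd w)" "%w. (tau \<circ> fst w, snd w)"])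
   (auto simp: w Wg_def fun_eq_iff inv intro: permutes_compose[OF _ assms] permutes_compose[OF _ permutes_inv[OF assms]])
qed

text \<open>The span of the Weyl translates of \<open>E\<close>. It is stable under every
  \<open>Sop i\<close>, because \<open>Sop i E\<close> is \<open>Yop i E\<close> plus reflected
  copies of \<open>E\<close>, and \<open>Sym\<close> maps it into the multiples of
  \<open>Sym E\<close>. In this way \<open>Dop k\<close> acts on \<open>Sym E\<close> by a scalar,
  although a single \<open>Sop i\<close> need not act on \<open>E\<close> by one.\<close>

inductive_set Uspan :: "lpoly => lpoly set" for E where
 base: "E \<in> Uspan E"
| lin: "c \<in> Uspan E ==> d \<in> Uspan E ==> (%nu. x * c nu + y * d nu) \<in> Uspan E"
| flp: "c \<in> Uspan E ==> p < n ==> c \<circ> fl p \<in> Uspan E"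
| per: "c \<in> Uspan E ==> sig permutes {..<n} ==> c \<circ> pm sig \<in> Uspan E"

lemma Uspan_ok: "c \<in> Uspan E ==> lp_ok n E ==> lp_ok n c"
 by (induction rule: Uspan.induct) (auto intro: lp_ok_lincomb lp_ok_fl lp_ok_pm)

lemma Uspan_Sym: "c \<in> Uspan E ==> \<exists>x. Sym c = (%nu. x * Sym E nu)"
proof (induction rule: Uspan.induct)
 case base then show ?case by (intro exI[of _ 1]) simp
next
 case (lin c d x y)
 then obtain u v where "Sym c = (%nu. u * Sym E nu)" "Sym d = (%nu. v * Sym E nu)" by blast
 then show ?case by (intro exI[of _ "x * u + y * v"]) (simp add: Sym_lincomb algebra_simps)
next
 case (flp c p)
 then show ?case using Sym_comp_fl[of p c] by (simp add: comp_def)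
next
 case (per c sig)
 then show ?case using Sym_comp_pm[of sig c] by (simp add: comp_def)
qed

lemma Uspan_scale: "c \<in> Uspan E ==> (%nu. x * c nu) \<in> Uspan E"
 using Uspan.lin[of c E c x 0] by simp

lemma Uspan_add: "c \<in> Uspan E ==> d \<in> Uspan E ==> (%nu. c nu + d nu) \<in> Uspan E"
 using Uspan.lin[of c E d 1 1] by simp

lemma Uspan_sum: "finite A ==> (\<And>a. a \<in> A ==> f a \<in> Uspan E) ==> (%nu. \<Sum>a\<in>A. f a nu) \<in> Uspan E"
proof (induction A rule: finite_induct)
 case empty
 then show ?case using Uspan_scale[OF Uspan.base[of E], of 0] by simp
next
 case (insert a A)
 then show ?case using Uspan_add[of "f a" E "%nu. \<Sum>a\<in>A. f a nu"] by simp
qed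

lemma Uspan_Sop:
 assumes "lp_ok n E" "\<And>i nu. i < n ==> Yop i E nu = y i * E nu" "c \<in> Uspan E" "i < n"
 shows "Sop i c \<in> Uspan E"
 using assms(3,4)
proof (induction arbitrary: i rule: Uspan.induct)
 case base
 have "Sop i E nu = y i * E nu + of_real (theta/2)*(\<Sum>j\<in>{..<n}-{i}. (if i < j then 1 else -1)*(E \<circ> sw i j) nu + (E \<circ> ssw i j) nu)
   + of_real rho0*(E \<circ> fl i) nu" for nu
 proof -
  have "(\<Sum>j\<in>{..<n}-{i}. (if i < j then 1 else -1)*(E \<circ> sw i j) nu + (E \<circ> ssw i j) nu) =
   (\<Sum>j\<in>{..<n}-{i}. (if i < j then E (sw i j nu) else - E (sw i j nu)) + E (ssw i j nu))"
   by (rule sum.cong) auto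
  then show ?thesis using assms(2)[OF base, of nu] unfolding Yop_alt[OF base] by (simp add: algebra_simps)
 qed
 moreover have "(%nu. y i * E nu + of_real (theta/2)*(\<Sum>j\<in>{..<n}-{i}. (if i < j then 1 else -1)*(E \<circ> sw i j) nu + (E \<circ> ssw i j) nu)
   + of_real rho0*(E \<circ> fl i) nu) \<in> Uspan E"
 proof (intro Uspan_add Uspan_scale Uspan_sum Uspan.base Uspan.flp base)
  fix j assume j: "j \<in> {..<n} - {i}"
  have sw: "E \<circ> sw i j \<in> Uspan E" unfolding sw_pm
   by (intro Uspan.per Uspan.base permutes_swap_id) (use base j in auto)
  then show "E \<circ> sw i j \<in> Uspan E" .
  have "E \<circ> ssw i j = ((E \<circ> fl i) \<circ> fl j) \<circ> sw i j" using j by (auto simp: fun_eq_iff ssw_alt)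
  moreover have "((E \<circ> fl i) \<circ> fl j) \<circ> sw i j \<in> Uspan E" unfolding sw_pm
   by (intro Uspan.per Uspan.flp Uspan.base permutes_swap_id) (use base j in auto)
  ultimately show "E \<circ> ssw i j \<in> Uspan E" by simp
 qed auto
 ultimately show ?case by (metis (no_types, lifting) ext)
next
 case (lin c d x y)
 then show ?case using Sop_lincomb[OF Uspan_ok[OF _ assms(1)] Uspan_ok[OF _ assms(1)]] by (simp add: Uspan.lin)
next
 case (flp c p)
 have "(%nu. (if i = p then - 1 else 1)*(Sop i c \<circ> fl p) nu) \<in> Uspan E"
  by (intro Uspan_scale Uspan.flp flp)
 then show ?case using Sop_fl[OF flp(2) Uspan_ok[OF flp(1) assms(1)] flp(4)] by (simp add: comp_def)
next
 case (per c sig)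
 have i: "inv sig i < n" using permutes_in_image[OF permutes_inv[OF per(2)], of i] per(4) by simp
 have "Sop (sig (inv sig i)) (c \<circ> pm sig) = Sop (inv sig i) c \<circ> pm sig"
  by (rule Sop_pm[OF per(2) Uspan_ok[OF per(1) assms(1)] i])
 then show ?case using per Uspan.per[OF per(3)[OF i] per(2)] permutes_inverses(1)[OF per(2)] by (simp add: comp_def)
qed

theorem sym_eigenfunction:
 assumes "is_partition_len n lam"
 shows "\<exists>F. lp_ok n F \<and> (\<forall>mu. F mu \<in> \<real>\<^sub>\<ge>\<^sub>0) \<and> F (int \<circ> lam) ~= 0 \<and> (\<forall>mu. F mu ~= 0 --> mu \<in> PP (int \<circ> lam)) \<and>
   (\<forall>p<n. F \<circ> fl p = F) \<and> (\<forall>sig. sig permutes {..<n} --> F \<circ> pm sig = F) \<and> (\<forall>k. \<exists>x. Dop k F = (%nu. x * F nu))"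
proof -
 let ?h = "int \<circ> lam"
 obtain E where E: "good ?h E" using good_exists[of ?h] assms by (auto simp: is_partition_len_def)
 have ok: "lp_ok n E" and nn: "\<And>mu. E mu \<in> \<real>\<^sub>\<ge>\<^sub>0" and Y: "\<And>i nu. i < n ==> Yop i E nu = of_real (bar ?h i) * E nu"
  using E by (auto simp: good_def)
 note L = good_leading_dominant[OF assms E]
 define F where "F = Sym E"
 have "lp_ok n F" unfolding F_def by (rule lp_ok_Sym[OF ok])
 moreover have nonneg: "F mu \<in> \<real>\<^sub>\<ge>\<^sub>0" for mu
  using nn unfolding F_def Sym_alt complex_nonneg_Reals_iff by (auto intro!: sum_nonneg)
 moreover have "F ?h ~= 0"
 proof -
  have "(id, {}) \<in> Wg" by (auto simp: Wg_def permutes_id)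
  moreover have "wact id {} ?h = ?h" by (auto simp: wact_def)
  moreover have "Re (E ?h) > 0"
   using nn[of ?h] L(2) by (auto simp: complex_nonneg_Reals_iff complex_eq_iff)
  moreover have "Re (F ?h) = (\<Sum>w\<in>Wg. Re (E (wact (fst w) (snd w) ?h)))" by (simp add: F_def Sym_alt)
  moreover have "\<And>w. Re (E (wact (fst w) (snd w) ?h)) >= 0" using nn by (simp add: complex_nonneg_Reals_iff)
  ultimately have "Re (F ?h) > 0" using finite_Wg sum_pos2[of Wg "(id,{})" "%w. Re (E (wact (fst w) (snd w) ?h))"] by auto
  then show ?thesis by auto
 qed
 moreover have "mu \<in> PP ?h" if "F mu ~= 0" for mu
 proof -
  obtain sig A where w: "(sig,A) \<in> Wg" "E (wact sig A mu) ~= 0"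
   using \<open>F mu ~= 0\<close> unfolding F_def Sym_def by (metis (mono_tags, lifting) case_prod_conv prod.collapse sum.neutral)
  have s: "sig permutes {..<n}" using w by (auto simp: Wg_def)
  have "wact sig A mu \<in> PP ?h" by (rule L(1)[OF w(2)])
  then have *: "lexle n (wact tau B (wact sig A mu)) ?h" if "tau permutes {..<n}" for tau B using that by (auto simp: PP_def)
  show ?thesis unfolding PP_def mem_Collect_eq
  proof (intro allI impI)
   fix tau B assume t: "tau permutes {..<n}"
   have "(inv sig \<circ> tau) permutes {..<n}" by (rule permutes_compose[OF t permutes_inv[OF s]])
   moreover have "wact (inv sig \<circ> tau) {k. (k \<in> B) ~= (inv sig (tau k) \<in> A)} (wact sig A mu) = wact tau B mu"
    by (auto simp: wact_def permutes_inverses(1)[OF s])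
   ultimately show "lexle n (wact tau B mu) ?h" using * by metis
  qed
 qed
 moreover have "F \<circ> fl p = F" if "p < n" for p unfolding F_def by (rule Sym_fl[OF that])
 moreover have "F \<circ> pm sig = F" if "sig permutes {..<n}" for sig unfolding F_def by (rule Sym_pm[OF that])
 moreover have "\<exists>x. Dop k F = (%nu. x * F nu)" for k
 proof -
  have pw: "(Sop i ^^ m) E \<in> Uspan E" if "i < n" for i m
   by (induction m) (auto intro: Uspan.base Uspan_Sop[OF ok Y _ that])
  have "Dop k E \<in> Uspan E" unfolding Dop_def[abs_def] by (intro Uspan_sum pw) auto
  then show ?thesis using Dop_Sym[OF ok] Uspan_Sym unfolding F_def by metis
 qed
 ultimately show ?thesis by blast
qed

text \<open>The coefficient of \<open>(Sop i ^^ m) F\<close> at the leading exponent, relative to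
  that of \<open>F\<close>. The recursion alternates because the flip of variable \<open>i\<close>
  multiplies \<open>(Sop i ^^ m) F\<close> by \<open>(-1)^m\<close>: from an even step only the
  larger indices contribute, from an odd step only the smaller ones.\<close>

fun vv :: "(nat => nat) => nat => nat => real" where
 "vv lam 0 i = 1"
| "vv lam (Suc m) i = (if even m
   then (real (lam i) + theta*(real n - 1 - real i)) * vv lam m i - theta*(\<Sum>j\<in>{i<..<n}. vv lam m j)
   else (real (lam i) + theta*(real n - 1 - real i) + 2 * rho0) * vv lam m i + theta*(\<Sum>j<i. vv lam m j))"

definition EE :: "(nat => nat) => nat => real" where
 "EE lam k = (\<Sum>i<n. vv lam (2*k) i)"

text \<open>For an invariant \<open>F\<close> the functions \<open>(Sop i ^^ m) F\<close> are
  permuted among themselves by the Weyl group, up to the sign \<open>(-1)^m\<close> when their own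
  variable is flipped.\<close>

lemma inv_Sop_pow:
 assumes "lp_ok n F" "\<And>p. p < n ==> F \<circ> fl p = F" "\<And>sig. sig permutes {..<n} ==> F \<circ> pm sig = F" "i < n" "j < n" "i ~= j"
 shows "(Sop i ^^ m) F (fl i nu) = (-1) ^ m*(Sop i ^^ m) F nu"
  "(Sop i ^^ m) F (fl j nu) = (Sop i ^^ m) F nu"
  "(Sop i ^^ m) F (sw i j nu) = (Sop j ^^ m) F nu"
  "(Sop i ^^ m) F (ssw i j nu) = (-1) ^ m*(Sop j ^^ m) F nu"
proof -
 have 1: "(Sop i ^^ m) F nu = (-1) ^ m*(Sop i ^^ m) F (fl i nu)" if "i < n" for i nu
  using fun_cong[OF Sop_pow_fl[OF that assms(1) that, of m], of nu] unfolding assms(2)[OF that] by simp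
 have m1: "(-1::complex) ^ m*((-1) ^ m * x) = x" for x by (simp flip: mult.assoc power_mult_distrib)
 show fi: "(Sop i ^^ m) F (fl i nu) = (-1) ^ m*(Sop i ^^ m) F nu" for nu using 1[OF assms(4), of nu] m1 by metis
 have 2: "(Sop j ^^ m) F (fl i nu) = (Sop j ^^ m) F nu" if "i < n" "j < n" "i ~= j" for i j nu
  using fun_cong[OF Sop_pow_fl[OF that(1) assms(1) that(2), of m], of nu] that unfolding assms(2)[OF that(1)] by simp
 then show fj: "(Sop i ^^ m) F (fl j nu) = (Sop i ^^ m) F nu" for nu using assms by blast
 let ?t = "Transposition.transpose i j"
 have p: "?t permutes {..<n}" using assms by (intro permutes_swap_id) auto
 have "(Sop (?t j) ^^ m) (F \<circ> pm ?t) = (Sop j ^^ m) F \<circ> pm ?t" by (rule Sop_pow_pm[OF p assms(1,5)])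
 then have 3: "(Sop i ^^ m) F nu = (Sop j ^^ m) F (sw i j nu)" for nu
  unfolding assms(3)[OF p] by (metis comp_apply sw_pm transpose_apply_second)
 have "sw i j (sw i j nu) = nu" for nu by (auto simp: sw_def fun_eq_iff)
 then show s: "(Sop i ^^ m) F (sw i j nu) = (Sop j ^^ m) F nu" for nu using 3[of "sw i j nu"] by simp
 have "(Sop i ^^ m) F (ssw i j nu) = (-1) ^ m*(Sop i ^^ m) F (sw i j nu)"
  using assms(6) by (simp add: ssw_alt fi fj)
 then show "(Sop i ^^ m) F (ssw i j nu) = (-1) ^ m*(Sop j ^^ m) F nu" by (simp add: s)
qed

text \<open>At an extremal exponent each divided difference has only two terms, and invariance
  identifies the reflected coefficient of \<open>(Sop i ^^ m) F\<close> with that of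
  \<open>(Sop j ^^ m) F\<close> at the same exponent, up to sign. The values at the leading exponent
  therefore form a closed recursion.\<close>

lemma Sop_pow_leading:
 assumes "is_partition_len n lam" "lp_ok n F" "\<And>mu. F mu ~= 0 ==> mu \<in> PP (int \<circ> lam)"
  "\<And>p. p < n ==> F \<circ> fl p = F" "\<And>sig. sig permutes {..<n} ==> F \<circ> pm sig = F" "i < n"
 shows "(Sop i ^^ m) F (int \<circ> lam) = of_real (vv lam m i) * F (int \<circ> lam)"
 using assms(6)
proof (induction m arbitrary: i)
 case (Suc m)
 let ?h = "int \<circ> lam"
 let ?c = "(Sop i ^^ m) F"
 note i = Suc(2)
 have ok: "lp_ok n ?c" by (rule lp_ok_Sop_pow[OF assms(2) i])
 have PP: "mu \<in> PP ?h" if "?c mu ~= 0" for mu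
  using that
 proof (induction m arbitrary: mu)
  case (Suc m)
  then show ?case using Sop_PP[OF lp_ok_Sop_pow[OF assms(2) i, of m] _ i] by simp
 qed (use assms(3) in auto)
 have orb: "Orb ?h ?h" unfolding Orb_def by (intro exI[of _ id] exI[of _ "{}"]) (auto simp: wact_def permutes_id)
 have X: "Nop alpha s ?c ?h = ?c ?h - ?c (s ?h)" if "isroot alpha s" "s ?h = along ?h alpha (- q)" "q >= 0" for alpha s q
  by (rule Nop_extremal[OF that(1) lp_ok_fin[OF ok] _ orb that(2,3)]) (rule PP)
 have dec: "lam j <= lam i" if "i <= j" for i j using assms(1) that by (auto simp: is_partition_len_def)
 let ?v = "%j. of_real (vv lam m j) * F ?h"
 have IH: "\<And>j. j < n ==> (Sop j ^^ m) F ?h = ?v j" using Suc(1) by blast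
 have A: "Nop (rm i j) (sw i j) ?c ?h = (if i < j then 1 else -1)*(?v i - ?v j)" if j: "j < n" "j ~= i" for j
 proof -
  have s: "?c (sw i j ?h) = ?v j" using inv_Sop_pow(3)[OF assms(2,4,5) i j(1)] j IH[OF j(1)] by simp
  show ?thesis
  proof (cases "i < j")
   case True
   have e: "sw i j ?h = along ?h (rm i j) (- (?h i - ?h j))"
    using True by (auto simp: sw_def along_def rm_def ee_def)
   have "Nop (rm i j) (sw i j) ?c ?h = ?c ?h - ?c (sw i j ?h)"
    by (rule X[OF roots(1)[OF i j(1) j(2)[symmetric]] e]) (use True dec[of i j] in auto)
   then show ?thesis using True IH[OF i] s by simp
  next
   case False
   have e: "sw i j ?h = along ?h (%k. - rm i j k) (- (?h j - ?h i))"
    using j by (auto simp: sw_def along_def rm_def ee_def)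
   have "Nop (%k. - rm i j k) (sw i j) ?c ?h = ?c ?h - ?c (sw i j ?h)"
    by (rule X[OF isroot_neg[OF roots(1)[OF i j(1) j(2)[symmetric]]] e]) (use False j dec[of j i] in auto)
   then have "- Nop (rm i j) (sw i j) ?c ?h = ?v i - ?v j"
    using Nop_neg[OF lp_ok_fin[OF ok] is_refl_rm] j IH[OF i] s by simp
   then have "Nop (rm i j) (sw i j) ?c ?h = - (?v i - ?v j)" by (metis minus_minus)
   then show ?thesis using False by simp
  qed
 qed
 have B: "Nop (rp i j) (ssw i j) ?c ?h = ?v i - (-1)^m*?v j" if j: "j < n" "j ~= i" for j
 proof -
  have s: "?c (ssw i j ?h) = (-1)^m*?v j" using inv_Sop_pow(4)[OF assms(2,4,5) i j(1)] j IH[OF j(1)] by simp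
  have e: "ssw i j ?h = along ?h (rp i j) (- (?h i + ?h j))"
   using j by (auto simp: ssw_def along_def rp_def ee_def)
  have "Nop (rp i j) (ssw i j) ?c ?h = ?c ?h - ?c (ssw i j ?h)"
   by (rule X[OF roots(2)[OF i j(1) j(2)[symmetric]] e]) (use j in auto)
  then show ?thesis using IH[OF i] s by simp
 qed
 have fi: "?c (fl i ?h) = (-1)^m*?v i"
 proof -
  have "?v i = (-1)^m*?c (fl i ?h)"
   using fun_cong[OF Sop_pow_fl[OF i assms(2) i, of m], of ?h] unfolding assms(4)[OF i] IH[OF i] by simp
  then show ?thesis by (simp add: left_minus_one_mult_self)
 qed
 have C: "Nop (ee i) (fl i) ?c ?h = ?v i - (-1)^m*?v i"
 proof -
  have e: "fl i ?h = along ?h (ee i) (- (2*?h i))" by (auto simp: fl_def along_def ee_def)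
  have "Nop (ee i) (fl i) ?c ?h = ?c ?h - ?c (fl i ?h)" by (rule X[OF roots(3)[OF i] e]) auto
  then show ?thesis using IH[OF i] fi by simp
 qed
 have D: "Nop (rl i) (fl i) ?c ?h = ?v i - (-1)^m*?v i"
 proof -
  have e: "fl i ?h = along ?h (rl i) (- (?h i))" by (auto simp: fl_def along_def rl_def ee_def)
  have "Nop (rl i) (fl i) ?c ?h = ?c ?h - ?c (fl i ?h)" by (rule X[OF roots(4)[OF i] e]) auto
  then show ?thesis using IH[OF i] fi by simp
 qed
 have set: "{..<n} - {i} = {i<..<n} \<union> {..<i}" using i by auto
 have ss: "(\<Sum>j\<in>{..<n}-{i}. f j) = (\<Sum>j\<in>{i<..<n}. f j) + (\<Sum>j<i. f j)" for f :: "nat => complex"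
  unfolding set by (rule sum.union_disjoint) auto
 have c: "card {i<..<n} = n - 1 - i" by simp
 have cc: "of_nat (n - Suc i) = (of_nat n - 1 - of_nat i :: complex)" using i by (simp add: of_nat_diff)
 have "(\<Sum>j\<in>{..<n}-{i}. Nop (rm i j) (sw i j) ?c ?h + Nop (rp i j) (ssw i j) ?c ?h) =
  (\<Sum>j\<in>{i<..<n}. (?v i - ?v j) + (?v i - (-1)^m*?v j)) + (\<Sum>j<i. - (?v i - ?v j) + (?v i - (-1)^m*?v j))"
  unfolding ss using i by (intro arg_cong2[of _ _ _ _ "(+)"] sum.cong) (auto simp: A B)
 also have "... = 2*(of_nat n - 1 - of_nat i)*?v i - (1 + (-1)^m)*(\<Sum>j\<in>{i<..<n}. ?v j) + (1 - (-1)^m)*(\<Sum>j<i. ?v j)"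
  by (simp add: sum.distrib sum_subtractf sum_distrib_left cc algebra_simps sum_negf)
 finally have S: "(\<Sum>j\<in>{..<n}-{i}. Nop (rm i j) (sw i j) ?c ?h + Nop (rp i j) (ssw i j) ?c ?h) =
  2*(of_nat n - 1 - of_nat i)*?v i - (1 + (-1)^m)*(\<Sum>j\<in>{i<..<n}. ?v j) + (1 - (-1)^m)*(\<Sum>j<i. ?v j)" .
 have "(Sop i ^^ Suc m) F ?h = Sop i ?c ?h" by simp
 also have "... = of_real (vv lam (Suc m) i) * F ?h"
  unfolding Sop_def S C D IH[OF i]
  by (cases "even m") (simp_all add: rho0_def sum_distrib_right sum_distrib_left algebra_simps)
 finally show ?case .
qed simp

text \<open>The span argument only shows that some scalar exists. Comparison at the leading
  exponent, where \<open>F\<close> does not vanish, identifies it.\<close>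

theorem Dop_eigenvalue:
 assumes "is_partition_len n lam" "lp_ok n F" "\<And>mu. F mu ~= 0 ==> mu \<in> PP (int \<circ> lam)"
  "\<And>p. p < n ==> F \<circ> fl p = F" "\<And>sig. sig permutes {..<n} ==> F \<circ> pm sig = F"
  "F (int \<circ> lam) ~= 0" "Dop k F = (%nu. x * F nu)"
 shows "Dop k F = (%nu. of_real (EE lam k) * F nu)"
proof -
 have "x * F (int \<circ> lam) = Dop k F (int \<circ> lam)" using assms(7) by simp
 also have "... = of_real (EE lam k) * F (int \<circ> lam)"
  unfolding Dop_def EE_def of_real_sum sum_distrib_right
  by (rule sum.cong[OF refl]) (use Sop_pow_leading[OF assms(1-5)] in auto)
 finally show ?thesis using assms(6,7) by simp
qed

end

section \<open>Self-adjointness on the torus\<close>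

abbreviation circ :: "real measure" where
 "circ \<equiv> restrict_space lborel {0..2*pi}"

lemma space_circ [simp]: "space circ = {0..2*pi}"
 by (simp add: space_restrict_space)

lemma finite_measure_circ: "finite_measure circ"
 by (rule finite_measureI) (simp add: emeasure_restrict_space)

lemma psf_circ: "product_sigma_finite (%_::nat. circ)"
 by (rule product_sigma_finite.intro) (use finite_measure_circ finite_measure.axioms(1) in blast)

interpretation C: product_sigma_finite "%_::nat. circ"
 by (rule psf_circ)

lemma measurable_circ_borel: "(%x. x) \<in> borel_measurable circ"
 by (simp add: measurable_restrict_space1)

lemma measurable_coord [measurable]: "i < n ==> (%t. t i) \<in> borel_measurable (torus_measure n)"
 unfolding torus_measure_def
 using measurable_compose[OF measurable_component_singleton[of i "{..<n}" "%_. circ"] measurable_circ_borel] by simp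

lemma space_torus: "space (torus_measure n) = PiE {..<n} (%_. {0..2*pi})"
 by (simp add: torus_measure_def space_PiM)

lemma finite_measure_torus: "finite_measure (torus_measure n)"
proof (rule finite_measureI)
 have "emeasure (torus_measure n) (space (torus_measure n)) = (\<Prod>i<n. emeasure circ {0..2*pi})"
  unfolding space_torus unfolding torus_measure_def
  by (rule C.emeasure_PiM) (auto simp: sets_restrict_space_iff)
 also have "... ~= \<infinity>" by (simp add: emeasure_restrict_space ennreal_power)
 finally show "emeasure (torus_measure n) (space (torus_measure n)) ~= \<infinity>" .
qed

lemma integrable_torus_bounded:
 fixes f :: "(nat => real) => 'b::{banach, second_countable_topology}"
 assumes "f \<in> borel_measurable (torus_measure n)" "\<And>t. norm (f t) <= B"
 shows "integrable (torus_measure n) f"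
 by (rule finite_measure.integrable_const_bound[OF finite_measure_torus _ assms(1), of B]) (auto simp: assms(2))

lemma emeasure_circ_reflect:
 assumes "X \<in> sets circ"
 shows "emeasure circ {x \<in> {0..2*pi}. 2*pi - x \<in> X} = emeasure circ X"
  and "{x \<in> {0..2*pi}. 2*pi - x \<in> X} \<in> sets circ"
proof -
 have X: "X \<in> sets borel" "X \<subseteq> {0..2*pi}" using assms by (auto simp: sets_restrict_space_iff)
 let ?Y = "{x \<in> {0..2*pi}. 2*pi - x \<in> X}"
 have eq: "?Y = (%x. 2*pi + (-1) * x) -` X" using X(2) by auto
 have [measurable]: "X \<in> sets borel" by (rule X)
 have "(%x::real. 2*pi + (-1) * x) \<in> borel_measurable borel" by measurable
 from measurable_sets_borel[OF this X(1)] have Y: "?Y \<in> sets borel" unfolding eq .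
 then show "?Y \<in> sets circ" by (auto simp: sets_restrict_space_iff)
 have "emeasure lborel X = (\<integral>\<^sup>+x. indicator X x \<partial>lborel)" by simp
 also have "... = \<bar>-1::real\<bar>*(\<integral>\<^sup>+x. indicator X (2*pi + (-1) * x) \<partial>lborel)"
  by (rule nn_integral_real_affine) auto
 also have "... = (\<integral>\<^sup>+x. indicator ?Y x \<partial>lborel)"
  unfolding eq by (simp add: indicator_def)
 also have "... = emeasure lborel ?Y" using Y by simp
 finally show "emeasure circ ?Y = emeasure circ X" using X Y by (subst (1 2) emeasure_restrict_space) auto
qed

text \<open>Signed permutations of the angles, with \<open>2*pi - t\<close> in place of
  \<open>- t\<close> so that the cube is preserved. The linear version is \<open>mp\<close>; on
  characters with integer exponents the two agree, which is \<open>cis_ap_map\<close>.\<close>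

definition torus_map :: "nat => (nat => nat) => nat set => (nat => real) => nat => real" where
 "torus_map n sig A t = (\<lambda>k\<in>{..<n}. if k \<in> A then 2*pi - t (sig k) else t (sig k))"

lemma torus_map_distr:
 assumes s: "sig permutes {..<n}"
 shows "torus_map n sig A \<in> measurable (torus_measure n) (torus_measure n)"
  and "distr (torus_measure n) (torus_measure n) (torus_map n sig A) = torus_measure n"
proof -
 have im: "sig k < n \<longleftrightarrow> k < n" for k using permutes_in_image[OF s, of k] by simp
 show m: "torus_map n sig A \<in> measurable (torus_measure n) (torus_measure n)"
 proof -
  have "(%t. \<lambda>k\<in>{..<n}. if k \<in> A then 2*pi - t (sig k) else t (sig k)) \<in> measurable (torus_measure n) (PiM {..<n} (%_. circ))"
  proof (rule measurable_restrict)
   fix k assume k: "k \<in> {..<n}"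
   show "(%t. if k \<in> A then 2*pi - t (sig k) else t (sig k)) \<in> measurable (torus_measure n) circ"
   proof (rule measurable_restrict_space2)
    have "(%t. t (sig k)) \<in> borel_measurable (torus_measure n)" using k im by (intro measurable_coord) auto
    then show "(%t. if k \<in> A then 2*pi - t (sig k) else t (sig k)) \<in> measurable (torus_measure n) lborel"
     by (cases "k \<in> A") auto
    show "(%t. if k \<in> A then 2*pi - t (sig k) else t (sig k)) \<in> space (torus_measure n) \<rightarrow> {0..2*pi}"
    proof
     fix t assume "t \<in> space (torus_measure n)"
     then have "t (sig k) \<in> {0..2*pi}" using k im unfolding space_torus by (auto simp: PiE_def Pi_def)
     then show "(if k \<in> A then 2*pi - t (sig k) else t (sig k)) \<in> {0..2*pi}" by auto
    qed
   qed
  qed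
  then show ?thesis unfolding torus_map_def[abs_def] by (simp add: torus_measure_def)
 qed
 have "distr (torus_measure n) (torus_measure n) (torus_map n sig A) = PiM {..<n} (%_. circ)"
 proof (rule C.PiM_eqI)
  show "finite {..<n}" by simp
  show "sets (distr (torus_measure n) (torus_measure n) (torus_map n sig A)) = sets (PiM {..<n} (%_. circ))"
   by (simp add: torus_measure_def)
  fix X :: "nat => real set" assume X: "\<And>i. i \<in> {..<n} ==> X i \<in> sets circ"
  define Z where "Z = (%k. if k \<in> A then {x \<in> {0..2*pi}. 2*pi - x \<in> X k} else X k)"
  have Z: "Z k \<in> sets circ" "emeasure circ (Z k) = emeasure circ (X k)" if "k < n" for k
   using emeasure_circ_reflect[of "X k"] X[of k] that by (auto simp: Z_def)
  have Xs: "X k \<subseteq> {0..2*pi}" if "k < n" for k using X[of k] that by (auto simp: sets_restrict_space_iff)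
  have Zs: "Z k \<subseteq> {0..2*pi}" if "k < n" for k using Xs that by (auto simp: Z_def)
  have inv: "inv sig k < n \<longleftrightarrow> k < n" for k using permutes_in_image[OF permutes_inv[OF s], of k] by simp
  have set_eq: "torus_map n sig A -` PiE {..<n} X \<inter> space (torus_measure n) = PiE {..<n} (%i. Z (inv sig i))"
  proof (intro set_eqI iffI)
   fix t assume t: "t \<in> torus_map n sig A -` PiE {..<n} X \<inter> space (torus_measure n)"
   then have 1: "t \<in> PiE {..<n} (%_. {0..2*pi})" by (simp add: space_torus)
   have "t i \<in> Z (inv sig i)" if i: "i < n" for i
   proof -
    have "torus_map n sig A t (inv sig i) \<in> X (inv sig i)" using t inv i by auto
    then show ?thesis using i inv 1 permutes_inverses(1)[OF s] by (auto simp: torus_map_def Z_def PiE_def Pi_def split: if_splits)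
   qed
   then show "t \<in> PiE {..<n} (%i. Z (inv sig i))" using 1 by (auto simp: PiE_def Pi_def)
  next
   fix t assume t: "t \<in> PiE {..<n} (%i. Z (inv sig i))"
   have "t i \<in> {0..2*pi}" if "i < n" for i using t Zs[of "inv sig i"] inv that by (auto simp: PiE_def Pi_def)
   then have 1: "t \<in> space (torus_measure n)" unfolding space_torus using t by (auto simp: PiE_def Pi_def)
   have "torus_map n sig A t k \<in> X k" if k: "k < n" for k
   proof -
    have "t (sig k) \<in> Z (inv sig (sig k))" using t im k by (auto simp: PiE_def Pi_def)
    then show ?thesis using k permutes_inverses(2)[OF s] by (auto simp: torus_map_def Z_def split: if_splits)
   qed
   then show "t \<in> torus_map n sig A -` PiE {..<n} X \<inter> space (torus_measure n)"
    using 1 by (auto simp: torus_map_def PiE_def Pi_def)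
  qed
  have "emeasure (distr (torus_measure n) (torus_measure n) (torus_map n sig A)) (PiE {..<n} X) =
   emeasure (torus_measure n) (PiE {..<n} (%i. Z (inv sig i)))"
   unfolding set_eq[symmetric] by (rule emeasure_distr[OF m]) (use X in \<open>auto simp: torus_measure_def intro: sets_PiM_I_finite\<close>)
  also have "... = (\<Prod>i<n. emeasure circ (Z (inv sig i)))"
   unfolding torus_measure_def by (rule C.emeasure_PiM) (use Z inv in auto)
  also have "... = (\<Prod>k<n. emeasure circ (Z k))"
   using permutes_inverses[OF s] inv im
   by (intro prod.reindex_bij_witness[of _ sig "inv sig"]) auto
  also have "... = (\<Prod>k<n. emeasure circ (X k))" by (rule prod.cong) (use Z in auto)
  finally show "emeasure (distr (torus_measure n) (torus_measure n) (torus_map n sig A)) (PiE {..<n} X) = (\<Prod>k<n. emeasure circ (X k))" .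
 qed
 then show "distr (torus_measure n) (torus_measure n) (torus_map n sig A) = torus_measure n" by (simp add: torus_measure_def)
qed

lemma torus_integral_invariant:
 fixes h :: "(nat => real) => complex"
 assumes "sig permutes {..<n}" "h \<in> borel_measurable (torus_measure n)"
 shows "(LINT t|torus_measure n. h (torus_map n sig A t)) = (LINT t|torus_measure n. h t)"
 using integral_distr[OF torus_map_distr(1)[OF assms(1)] assms(2), of A] torus_map_distr(2)[OF assms(1), of A] by simp

lemma integral_circ_derivative:
 fixes G :: "real => complex"
 assumes "\<And>x. (G has_vector_derivative G' x) (at x)" "continuous_on UNIV G'" "G 0 = G (2*pi)"
 shows "(LINT x|circ. G' x) = 0"
proof -
 have "(LINT x|circ. G' x) = (LINT x|lborel. indicator {0..2*pi} x *\<^sub>R G' x)"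
  by (subst integral_restrict_space) auto
 also have "... = integral {0..2*pi} G'"
  using set_borel_integral_eq_integral(2)[of "{0..2*pi}" G'] borel_integrable_atLeastAtMost'[of 0 "2*pi" G']
   continuous_on_subset[OF assms(2)] by (simp add: set_lebesgue_integral_def)
 also have "(G' has_integral G (2*pi) - G 0) {0..2*pi}"
  by (rule fundamental_theorem_of_calculus) (auto intro: has_vector_derivative_at_within assms)
 then have "integral {0..2*pi} G' = 0" using assms(3) by (simp add: integral_unique)
 finally show ?thesis .
qed

lemma torus_integral_derivative:
 fixes G :: "(nat => real) => complex"
 assumes "i < n" "\<And>t x. ((%x. G (t(i:=x))) has_vector_derivative G' (t(i:=x))) (at x)"
  "\<And>t. continuous_on UNIV (%x. G' (t(i:=x)))" "\<And>t. G (t(i:=0)) = G (t(i:=2*pi))"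
  "integrable (torus_measure n) G'"
 shows "(LINT t|torus_measure n. G' t) = 0"
proof -
 have ins: "{..<n} = insert i ({..<n}-{i})" using assms(1) by auto
 have e: "torus_measure n = PiM (insert i ({..<n}-{i})) (%_. circ)" unfolding torus_measure_def using ins by simp
 have "(LINT t|torus_measure n. G' t) = (LINT t|PiM ({..<n}-{i}) (%_. circ). LINT x|circ. G' (t(i:=x)))"
  unfolding e by (rule C.product_integral_insert) (use assms(5) e in auto)
 also have "... = (LINT t|PiM ({..<n}-{i}) (%_. circ). 0)"
  by (rule Bochner_Integration.integral_cong[OF refl], rule integral_circ_derivative[of "%x. G (_(i:=x))"]) (use assms in auto)
 finally show ?thesis by simp
qed

text \<open>By Fubini it is enough that every slice in one coordinate is null. This removes the zero
  hyperplanes of the weight.\<close>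

lemma torus_AE_countable:
 assumes "i < n" "Measurable.pred (torus_measure n) Q" "\<And>t. countable {x. \<not> Q (t(i:=x))}"
 shows "AE t in torus_measure n. Q t"
proof -
 let ?B = "{t \<in> space (torus_measure n). \<not> Q t}"
 have ins: "{..<n} = insert i ({..<n}-{i})" using assms(1) by auto
 have e: "torus_measure n = PiM (insert i ({..<n}-{i})) (%_. circ)" unfolding torus_measure_def using ins by simp
 have B: "?B \<in> sets (torus_measure n)" using assms(2) by measurable
 have "emeasure (torus_measure n) ?B = (\<integral>\<^sup>+t. indicator ?B t \<partial>torus_measure n)" using B by simp
 also have "... = (\<integral>\<^sup>+t. (\<integral>\<^sup>+x. indicator ?B (t(i:=x)) \<partial>circ) \<partial>PiM ({..<n}-{i}) (%_. circ))"
  unfolding e by (rule C.product_nn_integral_insert) (use B e in auto)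
 also have "... = (\<integral>\<^sup>+t. 0 \<partial>PiM ({..<n}-{i}) (%_. circ))"
 proof (rule nn_integral_cong)
  fix t
  have c: "countable {x. \<not> Q (t(i:=x))}" by (rule assms)
  then have "AE x in lborel. Q (t(i:=x))" by (intro AE_I'[OF countable_imp_null_set_lborel[OF c]]) auto
  then have "AE x in circ. Q (t(i:=x))" by (auto simp: AE_restrict_space_iff)
  then have "AE x in circ. indicator ?B (t(i:=x)) = (0::ennreal)" by eventually_elim auto
  then show "(\<integral>\<^sup>+x. indicator ?B (t(i:=x)) \<partial>circ) = 0"
   by (subst nn_integral_cong_AE) auto
 qed
 finally have "emeasure (torus_measure n) ?B = 0" by simp
 then show ?thesis using B by (intro AE_I[where N="?B"]) auto
qed

section \<open>Laurent polynomials as trigonometric polynomials\<close>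

definition ap :: "nat => (nat => int) => (nat => real) => real" where
 "ap n mu t = (\<Sum>i<n. of_int (mu i) * t i)"

definition tev :: "nat => lpoly => (nat => real) => complex" where
 "tev n c t = (\<Sum>mu | c mu ~= 0. c mu * cis (ap n mu t))"

lemma prod_cis: "finite A ==> (\<Prod>i\<in>A. cis (f i)) = cis (\<Sum>i\<in>A. f i)"
 by (induction A rule: finite_induct) (auto simp: cis_mult)

lemma lp_eval_cis: "lp_eval n c (%i. cis (t i)) = tev n c t"
 by (simp add: lp_eval_def tev_def ap_def cis_power_int prod_cis)

lemma tev_superset: "finite T ==> {mu. c mu ~= 0} \<subseteq> T ==> tev n c t = (\<Sum>mu\<in>T. c mu * cis (ap n mu t))"
 unfolding tev_def by (rule sum.mono_neutral_left) auto

lemma measurable_tev [measurable]: "tev n c \<in> borel_measurable (torus_measure n)"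
 unfolding tev_def[abs_def] ap_def cis_conv_exp by (intro borel_measurable_sum borel_measurable_times borel_measurable_const measurable_compose[OF _ borel_measurable_exp] measurable_compose[OF _ borel_measurable_of_real] measurable_coord) auto

lemma norm_tev_le: "norm (tev n c t) <= (\<Sum>mu | c mu ~= 0. norm (c mu))"
 unfolding tev_def by (rule order_trans[OF norm_sum]) (simp add: norm_mult)

lemma cis_has_vector_derivative:
 "((%x. cis (a * x + b)) has_vector_derivative (\<i> * of_real a * cis (a * x + b))) (at x)"
proof -
 have "((%z. exp (\<i>*(of_real a * z + of_real b))) has_field_derivative
  exp (\<i>*(of_real a * of_real x + of_real b))*(\<i> * of_real a)) (at (of_real x))"
  by (auto intro!: derivative_eq_intros)
 from has_vector_derivative_real_field[OF this] show ?thesis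
  by (simp add: cis_conv_exp mult.commute)
qed

lemma integral_circ_cis: "(LINT x|circ. cis (of_int m * x)) = (if m = 0 then of_real (2*pi) else 0)"
proof (cases "m = 0")
 case True
 have "measure circ {0..2*pi} = 2*pi" by (simp add: measure_restrict_space)
 then show ?thesis using True by (simp add: scaleR_conv_of_real)
next
 case False
 have "((%x. cis (of_int m * x)/(\<i> * of_int m)) has_vector_derivative cis (of_int m * x)) (at x)" for x :: real
  using has_vector_derivative_mult_left[OF cis_has_vector_derivative[of "of_int m" 0 x], of "1/(\<i> * of_int m)"] False
  by (simp add: field_simps)
 then have "(LINT x|circ. cis (of_int m * x)) = 0"
  by (rule integral_circ_derivative) (auto intro!: continuous_intros simp: cis_multiple_2pi mult.commute[of _ "2*pi"])
 then show ?thesis using False by simp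
qed

lemma torus_integral_char:
 assumes "\<And>k. k >= n ==> mu k = 0"
 shows "(LINT t|torus_measure n. cis (ap n mu t)) = (if mu = (%_. 0) then of_real ((2*pi)^n) else 0)"
proof -
 have "(LINT t|torus_measure n. cis (ap n mu t)) = (LINT t|PiM {..<n} (%_. circ). (\<Prod>i<n. cis (of_int (mu i) * t i)))"
  by (simp add: torus_measure_def ap_def prod_cis)
 also have "... = (\<Prod>i<n. LINT x|circ. cis (of_int (mu i) * x))"
 proof (rule C.product_integral_prod)
  fix i
  have "(%x. cis (of_int (mu i) * x)) \<in> borel_measurable circ"
  proof (intro measurable_restrict_space1)
   have "continuous_on UNIV (%x::real. cis (of_int (mu i) * x))" unfolding cis_conv_exp by (intro continuous_intros)
   then show "(%x. cis (of_int (mu i) * x)) \<in> borel_measurable lborel" by (simp add: borel_measurable_continuous_onI)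
  qed
  then show "integrable circ (%x. cis (of_int (mu i) * x))"
   by (intro finite_measure.integrable_const_bound[OF finite_measure_circ, of _ 1]) auto
 qed simp
 also have "... = (\<Prod>i<n. if mu i = 0 then of_real (2*pi) else 0)" by (simp only: integral_circ_cis)
 also have "... = (if mu = (%_. 0) then of_real ((2*pi)^n) else 0)"
 proof (cases "mu = (%_. 0)")
  case False
  then obtain i where "mu i ~= 0" by auto
  moreover have "i < n" using assms[of i] calculation by (meson not_less)
  ultimately show ?thesis using False by (auto simp: prod_zero_iff)
 qed simp
 finally show ?thesis .
qed

lemma tev_coeff:
 fixes c :: lpoly
 assumes "lp_ok n c" "\<And>k. k >= n ==> mu k = 0"
 shows "(LINT t|torus_measure n. tev n c t * cis (- ap n mu t)) = of_real ((2*pi)^n) * c mu"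
proof -
 let ?S = "{nu. c nu ~= 0}"
 have fin: "finite ?S" using assms(1) by (simp add: lp_ok_def)
 have e: "tev n c t * cis (- ap n mu t) = (\<Sum>nu\<in>?S. c nu * cis (ap n (%k. nu k - mu k) t))" for t
  unfolding tev_def sum_distrib_right
 proof (rule sum.cong[OF refl])
  fix nu
  have "ap n (%k. nu k - mu k) t = ap n nu t + - ap n mu t" by (simp add: ap_def sum_subtractf left_diff_distrib)
  then show "c nu * cis (ap n nu t) * cis (- ap n mu t) = c nu * cis (ap n (%k. nu k - mu k) t)"
   by (simp add: cis_mult mult.assoc)
 qed
 have int: "integrable (torus_measure n) (%t. c nu * cis (ap n (%k. nu k - mu k) t))" for nu
 proof -
  have "(%t. cis (ap n (%k. nu k - mu k) t)) = tev n (%x. if x = (%k. nu k - mu k) then 1 else 0)" by (auto simp: tev_def)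
  then have "(%t. cis (ap n (%k. nu k - mu k) t)) \<in> borel_measurable (torus_measure n)" by simp
  then show ?thesis by (intro integrable_mult_right integrable_torus_bounded[of _ _ 1]) auto
 qed
 have "(LINT t|torus_measure n. tev n c t * cis (- ap n mu t)) = (\<Sum>nu\<in>?S. c nu*(LINT t|torus_measure n. cis (ap n (%k. nu k - mu k) t)))"
  unfolding e by (subst Bochner_Integration.integral_sum) (use int in auto)
 also have "... = (\<Sum>nu\<in>?S. c nu*(if nu = mu then of_real ((2*pi)^n) else 0))"
 proof (rule sum.cong[OF refl])
  fix nu assume "nu \<in> ?S"
  then have "\<And>k. k >= n ==> nu k = 0" using assms(1) by (auto simp: lp_ok_def)
  then have "(LINT t|torus_measure n. cis (ap n (%k. nu k - mu k) t)) = (if (%k. nu k - mu k) = (%_. 0) then of_real ((2*pi)^n) else 0)"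
   using assms(2) by (intro torus_integral_char) auto
  moreover have "((%k. nu k - mu k) = (%_. 0)) = (nu = mu)" by (auto simp: fun_eq_iff)
  ultimately show "c nu*(LINT t|torus_measure n. cis (ap n (%k. nu k - mu k) t)) = c nu*(if nu = mu then of_real ((2*pi)^n) else 0)" by simp
 qed
 also have "... = of_real ((2*pi)^n) * c mu"
  using fin by (cases "c mu = 0") (auto simp: if_distrib sum.delta' cong: if_cong)
 finally show ?thesis .
qed

lemma tev_AE_zero:
 assumes "lp_ok n c" "AE t in torus_measure n. tev n c t = 0"
 shows "c = (%_. 0)"
proof
 fix mu
 show "c mu = 0"
 proof (cases "\<forall>k\<ge>n. mu k = 0")
  case True
  have "(LINT t|torus_measure n. tev n c t * cis (- ap n mu t)) = (LINT t|torus_measure n. 0)"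
  proof (rule integral_cong_AE)
   have "(%t. cis (- ap n mu t)) = tev n (%x. if x = (%k. - mu k) then 1 else 0)"
    by (auto simp: tev_def ap_def sum_negf)
   then have "(%t. cis (- ap n mu t)) \<in> borel_measurable (torus_measure n)" by simp
   then show "(%t. tev n c t * cis (- ap n mu t)) \<in> borel_measurable (torus_measure n)" by measurable
   show "AE t in torus_measure n. tev n c t * cis (- ap n mu t) = 0" using assms(2) by eventually_elim simp
  qed simp
  then show ?thesis using tev_coeff[OF assms(1), of mu] True by simp
 qed (use assms(1) in \<open>auto simp: lp_ok_def\<close>)
qed

lemma tev_lincomb:
 assumes "fin_supp c" "fin_supp d"
 shows "tev n (%nu. x * c nu + y * d nu) t = x * tev n c t + y * tev n d t"
proof -
 let ?T = "{mu. c mu ~= 0} \<union> {mu. d mu ~= 0}"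
 have fin: "finite ?T" using assms by (simp add: fin_supp_def)
 show ?thesis
  by (subst (1 2 3) tev_superset[OF fin]) (auto simp: sum.distrib sum_distrib_left algebra_simps)
qed

lemma tev_add: "fin_supp c ==> fin_supp d ==> tev n (%nu. c nu + d nu) t = tev n c t + tev n d t"
 using tev_lincomb[of c d n 1 1 t] by simp

lemma tev_diff: "fin_supp c ==> fin_supp d ==> tev n (%nu. c nu - d nu) t = tev n c t - tev n d t"
 using tev_lincomb[of c d n 1 "-1" t] by simp

lemma fin_supp_sum: "finite A ==> (\<And>a. a \<in> A ==> fin_supp (f a)) ==> fin_supp (%nu. \<Sum>a\<in>A. f a nu)"
proof (induction A rule: finite_induct)
 case (insert a A)
 then show ?case using fin_supp_add[of "f a" "%nu. \<Sum>a\<in>A. f a nu"] by simp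
qed (simp add: fin_supp_def)

lemma tev_comp:
 assumes "\<And>mu. s (s mu) = mu" "\<And>mu. ap n (s mu) t = ap n mu t'"
 shows "tev n (c \<circ> s) t = tev n c t'"
 unfolding tev_def
 by (rule sum.reindex_bij_witness[of _ s s]) (auto simp: assms assms(2)[symmetric])

lemma tev_shift:
 assumes "fin_supp g"
 shows "tev n (%nu. g (along nu alpha 1)) t = cis (- ap n alpha t) * tev n g t"
proof -
 have a: "ap n (along mu alpha 1) t = ap n mu t + ap n alpha t" for mu
  by (simp add: ap_def along_def sum.distrib distrib_right)
 have b: "cis (- x)*(c * cis (y + x)) = c * cis y" for x y c
 proof -
  have "cis (- x) * cis (y + x) = cis y" by (simp add: cis_mult)
  then show ?thesis by (metis mult.left_commute)
 qed
 show ?thesis unfolding tev_def sum_distrib_left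
  by (rule sum.reindex_bij_witness[of _ "%mu. along mu alpha (-1)" "%mu. along mu alpha 1"]) (auto simp: a b)
qed

text \<open>This is \<open>cot (x/2)\<close>: on the circle, \<open>(1 + z) / (1 - z)\<close> at
  \<open>z = cis (- x)\<close> equals \<open>- \<i> * kap x\<close>.\<close>

definition kap :: "real => real" where "kap x = sin x/(1 - cos x)"

lemma cis_quotient:
 assumes "cos x ~= 1"
 shows "(1 - cis (- x))*(- \<i> * of_real (kap x)) = 1 + cis (- x)"
proof -
 have c: "1 - cos x ~= 0" using assms by simp
 have K1: "kap x*(1 - cos x) = sin x" using c by (simp add: kap_def)
 have "sin x * sin x = (1 + cos x)*(1 - cos x)"
  using sin_cos_squared_add[of x] by (simp add: power2_eq_square algebra_simps)
 then have "kap x * sin x = (1 + cos x)*(1 - cos x)/(1 - cos x)" by (simp add: kap_def)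
 then have K2: "kap x * sin x = 1 + cos x" unfolding nonzero_mult_div_cancel_right[OF c] .
 show ?thesis using K1 K2 by (simp add: complex_eq_iff algebra_simps)
qed

text \<open>Off the hyperplane of the root the defining difference equation can be divided by
  \<open>1 - cis (- x)\<close>, so there the operator multiplies the antisymmetric part by a
  cotangent.\<close>

lemma tev_Nop:
 assumes "fin_supp c" "is_refl alpha s" "cos (ap n alpha t) ~= 1"
 shows "tev n (Nop alpha s c) t = - \<i> * of_real (kap (ap n alpha t))*(tev n c t - tev n (c \<circ> s) t)"
proof -
 let ?x = "ap n alpha t" and ?G = "Nop alpha s c" and ?d = "%nu. c nu - c (s nu)"
 have fG: "fin_supp ?G" by (rule fin_supp_Nop[OF assms(1,2)])
 have fd: "fin_supp ?d" by (rule fin_supp_anti[OF assms(1,2)])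
 have injA: "inj (%nu. along nu alpha 1)" by (auto simp: inj_def along_def fun_eq_iff)
 have sh: "fin_supp (%nu. g (along nu alpha 1))" if "fin_supp g" for g
  using fin_supp_comp_inj[OF that injA] by (simp add: o_def)
 have "(%nu. ?G nu - ?G (along nu alpha 1)) = (%nu. ?d nu + ?d (along nu alpha 1))"
  by (rule ext) (rule Nop_diff[OF assms(1,2)])
 then have "tev n (%nu. ?G nu - ?G (along nu alpha 1)) t = tev n (%nu. ?d nu + ?d (along nu alpha 1)) t" by simp
 then have e: "(1 - cis (- ?x)) * tev n ?G t = (1 + cis (- ?x)) * tev n ?d t"
  unfolding tev_diff[OF fG sh[OF fG]] tev_add[OF fd sh[OF fd]] tev_shift[OF fG] tev_shift[OF fd]
  by (simp add: algebra_simps)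
 have d: "tev n ?d t = tev n c t - tev n (c \<circ> s) t"
  using tev_diff[OF assms(1) fin_supp_comp_inj[OF assms(1) is_refl_inj[OF assms(2)]]] by simp
 have "cis (- ?x) ~= 1" using assms(3) by (auto simp: complex_eq_iff)
 then have nz: "1 - cis (- ?x) ~= 0" by simp
 have "(1 - cis (- ?x)) * tev n ?G t = (1 - cis (- ?x))*(- \<i> * of_real (kap ?x) * tev n ?d t)"
  unfolding e cis_quotient[OF assms(3), symmetric] by (simp add: algebra_simps)
 then have "tev n ?G t = - \<i> * of_real (kap ?x) * tev n ?d t" using mult_left_cancel[OF nz] by blast
 then show ?thesis by (simp add: d)
qed

definition mp :: "(nat => nat) => nat set => (nat => real) => nat => real" where
 "mp sig A t = (%k. if k \<in> A then - t (sig k) else t (sig k))"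

lemma cis_ap_map: "cis (ap n mu (torus_map n sig A t)) = cis (ap n mu (mp sig A t))"
proof -
 have "ap n mu (torus_map n sig A t) = ap n mu (mp sig A t) + 2 * pi * of_int (\<Sum>k<n. if k \<in> A then mu k else 0)"
  unfolding ap_def of_int_sum sum_distrib_left sum.distrib[symmetric]
  by (rule sum.cong) (auto simp: torus_map_def mp_def algebra_simps)
 then show ?thesis by (simp add: cis_mult[symmetric] del: of_int_sum)
qed

lemma torus_integral_mp:
 fixes h :: "(nat => real) => complex"
 assumes "sig permutes {..<n}" "h \<in> borel_measurable (torus_measure n)" "\<And>t. h (torus_map n sig A t) = h (mp sig A t)"
 shows "(LINT t|torus_measure n. h (mp sig A t)) = (LINT t|torus_measure n. h t)"
 using torus_integral_invariant[OF assms(1,2), of A] assms(3) by simp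

lemma ap_sw:
 assumes "i < n" "j < n" shows "ap n (sw i j mu) t = ap n mu (mp (Transposition.transpose i j) {} t)"
proof -
 let ?t = "Transposition.transpose i j"
 have "ap n (sw i j mu) t = (\<Sum>k<n. of_int (mu (?t k)) * t k)" by (simp add: ap_def sw_pm pm_def)
 also have "... = (\<Sum>k<n. of_int (mu k) * t (?t k))"
  by (rule sum.reindex_bij_witness[of _ ?t ?t]) (use assms in \<open>auto simp: Transposition.transpose_def\<close>)
 finally show ?thesis by (simp add: ap_def mp_def)
qed

lemma ap_fl: "ap n (fl i mu) t = ap n mu (mp id {i} t)"
 unfolding ap_def by (rule sum.cong) (auto simp: fl_def mp_def)

lemma ap_ssw:
 assumes "i < n" "j < n" "i ~= j" shows "ap n (ssw i j mu) t = ap n mu (mp (Transposition.transpose i j) {i,j} t)"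
proof -
 let ?t = "Transposition.transpose i j"
 have "ap n (ssw i j mu) t = (\<Sum>k<n. of_int (if k = i \<or> k = j then - mu (?t k) else mu k) * t k)"
  unfolding ap_def by (rule sum.cong) (use assms in \<open>auto simp: ssw_def\<close>)
 also have "... = (\<Sum>k<n. of_int (mu k)*(if k \<in> {i,j} then - t (?t k) else t (?t k)))"
  by (rule sum.reindex_bij_witness[of _ ?t ?t]) (use assms in \<open>auto simp: Transposition.transpose_def\<close>)
 finally show ?thesis by (simp add: ap_def mp_def)
qed

lemma ap_roots:
 assumes "i < n"
 shows "ap n (ee i) t = t i" "ap n (rl i) t = 2 * t i" "j < n ==> ap n (rm i j) t = t i - t j" "j < n ==> ap n (rp i j) t = t i + t j"
proof -
 have e: "(\<Sum>k<n. of_int (ee i k) * t k) = t i" if "i < n" for i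
  using that by (simp add: ee_def if_distrib[of of_int] if_distrib[of "%x. x*_"] sum.delta' cong: if_cong)
 show "ap n (ee i) t = t i" using e[OF assms] by (simp add: ap_def)
 show "ap n (rl i) t = 2 * t i" using e[OF assms] by (simp add: ap_def rl_def sum_distrib_left[symmetric] mult.assoc)
 show "ap n (rm i j) t = t i - t j" if "j < n" using e[OF assms] e[OF that] by (simp add: ap_def rm_def left_diff_distrib sum_subtractf)
 show "ap n (rp i j) t = t i + t j" if "j < n" using e[OF assms] e[OF that] by (simp add: ap_def rp_def distrib_right sum.distrib)
qed

lemma measurable_ap [measurable]: "ap n mu \<in> borel_measurable (torus_measure n)"
 unfolding ap_def[abs_def] by (intro borel_measurable_sum borel_measurable_times borel_measurable_const measurable_coord) auto

lemma countable_cos_eq_1: "a ~= 0 ==> countable {x::real. cos (a * x + b) = 1}"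
proof -
 assume a: "a ~= 0"
 have "{x. cos (a * x + b) = 1} \<subseteq> range (%m::int. (of_int m*2 * pi - b)/a)"
 proof
  fix x assume "x \<in> {x. cos (a * x + b) = 1}"
  then obtain m :: int where "a * x + b = of_int m*2 * pi" by (auto simp: cos_one_2pi_int)
  then have "x = (of_int m*2 * pi - b)/a" using a by (simp add: field_simps)
  then show "x \<in> range (%m::int. (of_int m*2 * pi - b)/a)" by blast
 qed
 then show ?thesis by (rule countable_subset) auto
qed

lemma ap_upd: "i < n ==> ap n mu (t(i:=x)) = of_int (mu i) * x + (\<Sum>k\<in>{..<n}-{i}. of_int (mu k) * t k)"
proof -
 assume i: "i < n"
 have "ap n mu (t(i:=x)) = of_int (mu i) * x + (\<Sum>k\<in>{..<n}-{i}. of_int (mu k)*(t(i:=x)) k)"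
  unfolding ap_def using i by (subst sum.remove[of _ i]) auto
 also have "(\<Sum>k\<in>{..<n}-{i}. of_int (mu k)*(t(i:=x)) k) = (\<Sum>k\<in>{..<n}-{i}. of_int (mu k) * t k)"
  by (rule sum.cong) auto
 finally show ?thesis .
qed

lemma AE_cos_ap:
 assumes "i < n" "mu i ~= 0"
 shows "AE t in torus_measure n. cos (ap n mu t) ~= 1"
proof (rule torus_AE_countable[OF assms(1)])
 show "Measurable.pred (torus_measure n) (%t. cos (ap n mu t) ~= 1)" by measurable
 fix t
 show "countable {x. \<not> cos (ap n mu (t(i := x))) ~= 1}"
  using countable_cos_eq_1[of "of_int (mu i)"] assms by (simp add: ap_upd)
qed

lemma tev_deriv:
 assumes "i < n" "fin_supp c"
 shows "((%x. tev n c (t(i:=x))) has_vector_derivative \<i> * tev n (%nu. of_int (nu i) * c nu) (t(i:=x))) (at x)"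
proof -
 let ?S = "{mu. c mu ~= 0}"
 have fin: "finite ?S" using assms(2) by (simp add: fin_supp_def)
 have "((%x. \<Sum>mu\<in>?S. c mu * cis (ap n mu (t(i:=x)))) has_vector_derivative (\<Sum>mu\<in>?S. c mu*(\<i> * of_real (of_int (mu i)) * cis (ap n mu (t(i:=x)))))) (at x)"
  unfolding ap_upd[OF assms(1)]
  by (intro has_vector_derivative_sum has_vector_derivative_mult_right cis_has_vector_derivative)
 moreover have "tev n (%nu. of_int (nu i) * c nu) (t(i:=x)) = (\<Sum>mu\<in>?S. of_int (mu i) * c mu * cis (ap n mu (t(i:=x))))"
  by (rule tev_superset[OF fin]) auto
 ultimately show ?thesis by (simp add: tev_def sum_distrib_left algebra_simps)
qed

lemma tev_continuous: "i < n ==> fin_supp c ==> continuous_on UNIV (%x. tev n c (t(i:=x)))"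
 by (auto simp: continuous_on_eq_continuous_at intro: has_vector_derivative_continuous[OF tev_deriv])

lemma tev_periodic: "i < n ==> cis (ap n mu (t(i:=0))) = cis (ap n mu (t(i:=2*pi)))"
 using cis_multiple_2pi[of "of_int (mu i)"] by (simp add: ap_upd cis_mult[symmetric] algebra_simps)

section \<open>The regularised weight and integration by parts\<close>

definition Lg :: "real => real => real" where "Lg e x = ln (2 - 2 * cos x + e)"

text \<open>The derivative of \<open>Lg e\<close>, the logarithm of
  \<open>|1 - cis x|^2 + e\<close>. It is smooth for \<open>e > 0\<close> and becomes
  \<open>kap\<close> for \<open>e = 0\<close>.\<close>

definition cc :: "real => real => real" where "cc e x = 2 * sin x/(2 - 2 * cos x + e)"

lemma Lg_deriv: "e > 0 ==> (Lg e has_real_derivative cc e x) (at x)"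
proof -
 assume "e > 0"
 then have "2 - 2 * cos x + e > 0" using cos_le_one[of x] by linarith
 then show ?thesis unfolding Lg_def[abs_def] cc_def by (auto intro!: derivative_eq_intros simp: field_simps)
qed

lemma cc_bound: "e > 0 ==> \<bar>cc e x\<bar> <= 2/e"
proof -
 assume e: "e > 0"
 have "2*\<bar>sin x\<bar> <= 2" using abs_sin_le_one[of x] by simp
 moreover have "e <= 2 - 2 * cos x + e" using cos_le_one[of x] by linarith
 ultimately have "2*\<bar>sin x\<bar>/(2 - 2 * cos x + e) <= 2/e" using e by (intro frac_le) auto
 then show ?thesis using e cos_le_one[of x] by (simp add: cc_def abs_mult)
qed

text \<open>Supplies a bound independent of \<open>e\<close>: \<open>kap\<close> times an
  antisymmetrised product is the evaluation of Laurent polynomials and hence bounded.\<close>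

lemma cc_le_kap: "e > 0 ==> cos x ~= 1 ==> \<bar>cc e x\<bar> <= \<bar>kap x\<bar>"
proof -
 assume e: "e > 0" "cos x ~= 1"
 then have c: "1 - cos x > 0" using cos_le_one[of x] by linarith
 have "2*\<bar>sin x\<bar>/(2 - 2 * cos x + e) <= 2*\<bar>sin x\<bar>/(2*(1 - cos x))"
  using e c by (intro divide_left_mono) auto
 also have "2*\<bar>sin x\<bar>/(2*(1 - cos x)) = \<bar>sin x\<bar>/(1 - cos x)" by (rule mult_divide_mult_cancel_left) simp
 finally show ?thesis using e c by (simp add: cc_def kap_def abs_mult)
qed

context bc
begin

text \<open>The logarithm of the weight for \<open>e = 0\<close>. Every unordered pair occurs twice,
  hence \<open>theta/2\<close>. The factors of one variable are written as
  \<open>|1 - z|^(2*k1)\<close> and \<open>|1 - z^2|^(2*k2)\<close>, one for each root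
  length.\<close>

definition Vw :: "real => (nat => real) => real" where
 "Vw e t = theta/2*(\<Sum>i<n. \<Sum>j\<in>{..<n}-{i}. Lg e (ap n (rm i j) t) + Lg e (ap n (rp i j) t))
   + (\<Sum>i<n. k1 * Lg e (ap n (ee i) t) + k2 * Lg e (ap n (rl i) t))"

lemma Lg_even: "Lg e (- x) = Lg e x" by (simp add: Lg_def)

lemma Vw_mp:
 assumes "sig permutes {..<n}" shows "Vw e (mp sig A t) = Vw e t"
proof -
 have im: "sig k < n \<longleftrightarrow> k < n" "inv sig k < n \<longleftrightarrow> k < n" for k
  using permutes_in_image[OF assms, of k] permutes_in_image[OF permutes_inv[OF assms], of k] by auto
 have inj: "sig a = sig b \<longleftrightarrow> a = b" for a b using permutes_inj[OF assms] by (auto dest: injD)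
 have re: "(\<Sum>i<n. f (sig i)) = (\<Sum>i<n. f i)" for f :: "nat => real"
  by (rule sum.reindex_bij_witness[of _ "inv sig" sig]) (auto simp: permutes_inverses[OF assms] im)
 have re2: "(\<Sum>j\<in>{..<n}-{i}. f (sig j)) = (\<Sum>j\<in>{..<n}-{sig i}. f j)" for f :: "nat => real" and i
  by (rule sum.reindex_bij_witness[of _ "inv sig" sig]) (auto simp: permutes_inverses[OF assms] im inj)
 have E: "Lg e (- x - y) = Lg e (x + y)" "Lg e (y - x) = Lg e (x - y)" "Lg e (- x + y) = Lg e (x - y)" for x y
  using Lg_even[of e "x + y"] Lg_even[of e "x - y"] by (simp_all add: algebra_simps)
 have 1: "(\<Sum>j\<in>{..<n}-{i}. Lg e (ap n (rm i j) (mp sig A t)) + Lg e (ap n (rp i j) (mp sig A t))) =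
   (\<Sum>j\<in>{..<n}-{i}. Lg e (ap n (rm (sig i) (sig j)) t) + Lg e (ap n (rp (sig i) (sig j)) t))" if "i < n" for i
 proof (rule sum.cong[OF refl])
  fix j assume "j \<in> {..<n} - {i}"
  then show "Lg e (ap n (rm i j) (mp sig A t)) + Lg e (ap n (rp i j) (mp sig A t)) =
    Lg e (ap n (rm (sig i) (sig j)) t) + Lg e (ap n (rp (sig i) (sig j)) t)"
   using that E[of "t (sig i)" "t (sig j)"] im by (auto simp: ap_roots mp_def)
 qed
 have 2: "(\<Sum>i<n. \<Sum>j\<in>{..<n}-{i}. Lg e (ap n (rm i j) (mp sig A t)) + Lg e (ap n (rp i j) (mp sig A t))) =
  (\<Sum>i<n. \<Sum>j\<in>{..<n}-{i}. Lg e (ap n (rm i j) t) + Lg e (ap n (rp i j) t))"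
  using re[of "%i. \<Sum>j\<in>{..<n}-{i}. Lg e (ap n (rm i j) t) + Lg e (ap n (rp i j) t)"]
  by (simp add: 1 re2[of "%j. Lg e (ap n (rm _ j) t) + Lg e (ap n (rp _ j) t)"])
 have 3: "(\<Sum>i<n. k1 * Lg e (ap n (ee i) (mp sig A t)) + k2 * Lg e (ap n (rl i) (mp sig A t))) =
  (\<Sum>i<n. k1 * Lg e (ap n (ee (sig i)) t) + k2 * Lg e (ap n (rl (sig i)) t))"
  by (rule sum.cong) (auto simp: ap_roots mp_def im Lg_even)
 show ?thesis unfolding Vw_def 2 3 using re[of "%i. k1 * Lg e (ap n (ee i) t) + k2 * Lg e (ap n (rl i) t)"] by simp
qed

lemma Lg_cis: "cis x = cis y ==> Lg e x = Lg e y"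
 by (simp add: Lg_def complex_eq_iff)

lemma Vw_map: "Vw e (torus_map n sig A t) = Vw e (mp sig A t)"
 unfolding Vw_def Lg_cis[OF cis_ap_map] by simp

lemma tev_map: "tev n c (torus_map n sig A t) = tev n c (mp sig A t)"
 unfolding tev_def cis_ap_map by simp

lemma cc_map: "cc e (ap n mu (torus_map n sig A t)) = cc e (ap n mu (mp sig A t))"
 using cis_ap_map[of n mu sig A t] by (simp add: cc_def complex_eq_iff)

lemma measurable_Lg [measurable]: "Lg e \<in> borel_measurable borel"
 unfolding Lg_def[abs_def] by measurable

lemma measurable_cc [measurable]: "cc e \<in> borel_measurable borel"
 unfolding cc_def[abs_def] by measurable

lemma measurable_Vw [measurable]: "Vw e \<in> borel_measurable (torus_measure n)"
 unfolding Vw_def[abs_def] by measurable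

definition Vbound :: real where "Vbound = (theta * n * n + n*(k1 + k2)) * ln 5"

lemma Vw_le:
 assumes "0 <= e" "e <= 1" shows "Vw e t <= Vbound"
proof -
 have L: "Lg e x <= ln 5" for x
 proof -
  have "- 1 <= cos x" "cos x <= 1" by auto
  then have "2 - 2 * cos x + e >= 0" "2 - 2 * cos x + e <= 5" using assms by linarith+
  then show ?thesis unfolding Lg_def by (cases "2 - 2 * cos x + e = 0") auto
 qed
 have "(\<Sum>j\<in>{..<n}-{i}. Lg e (ap n (rm i j) t) + Lg e (ap n (rp i j) t)) <= 2 * n * ln 5" for i
 proof -
  have "(\<Sum>j\<in>{..<n}-{i}. Lg e (ap n (rm i j) t) + Lg e (ap n (rp i j) t)) <= real (card ({..<n}-{i}))*(2 * ln 5)"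
   using L by (intro sum_bounded_above) (smt (verit))
  also have "... <= real n*(2 * ln 5)" using card_Diff1_le[of "{..<n}" i] by (intro mult_right_mono) auto
  finally show ?thesis by (simp add: algebra_simps)
 qed
 then have "(\<Sum>i<n. \<Sum>j\<in>{..<n}-{i}. Lg e (ap n (rm i j) t) + Lg e (ap n (rp i j) t)) <= real (card {..<n})*(2 * n * ln 5)"
  by (intro sum_bounded_above) auto
 then have 1: "theta/2*(\<Sum>i<n. \<Sum>j\<in>{..<n}-{i}. Lg e (ap n (rm i j) t) + Lg e (ap n (rp i j) t)) <= theta/2*(real n*(2 * n * ln 5))"
  using theta_pos by (intro mult_left_mono) auto
 have "k1 * Lg e x + k2 * Lg e y <= (k1 + k2) * ln 5" for x y
  using mult_left_mono[OF L[of x] k1_nonneg] mult_left_mono[OF L[of y] k2_nonneg] by (simp add: algebra_simps)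
 then have "(\<Sum>i<n. k1 * Lg e (ap n (ee i) t) + k2 * Lg e (ap n (rl i) t)) <= real (card {..<n})*((k1 + k2) * ln 5)"
  by (intro sum_bounded_above) auto
 then show ?thesis using 1 unfolding Vw_def Vbound_def by (simp add: algebra_simps)
qed

definition dV :: "real => nat => (nat => real) => real" where
 "dV e i t = theta*(\<Sum>j\<in>{..<n}-{i}. cc e (ap n (rm i j) t) + cc e (ap n (rp i j) t))
   + k1 * cc e (ap n (ee i) t) + 2 * k2 * cc e (ap n (rl i) t)"

lemma Vw_deriv:
 assumes "e > 0" "i < n"
 shows "((%x. Vw e (t(i:=x))) has_real_derivative dV e i (t(i:=x))) (at x)"
proof -
 let ?c = "%alpha. cc e (ap n alpha (t(i:=x)))"
 have L: "((%x. Lg e (ap n alpha (t(i:=x)))) has_real_derivative ?c alpha * of_int (alpha i)) (at x)" for alpha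
 proof -
  have "((%x. Lg e (of_int (alpha i) * x + (\<Sum>k\<in>{..<n}-{i}. of_int (alpha k) * t k))) has_real_derivative
    cc e (of_int (alpha i) * x + (\<Sum>k\<in>{..<n}-{i}. of_int (alpha k) * t k)) * of_int (alpha i)) (at x)"
   by (rule DERIV_chain2[OF Lg_deriv[OF assms(1)]]) (auto intro!: derivative_eq_intros)
  then show ?thesis by (simp add: ap_upd[OF assms(2)])
 qed
 let ?f = "%a b. ?c (rm a b) * of_int (rm a b i) + ?c (rp a b) * of_int (rp a b i)"
 have D: "((%x. Vw e (t(i:=x))) has_real_derivative
   theta/2*(\<Sum>a<n. \<Sum>b\<in>{..<n}-{a}. ?f a b) + (\<Sum>a<n. k1*(?c (ee a) * of_int (ee a i)) + k2*(?c (rl a) * of_int (rl a i)))) (at x)"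
  unfolding Vw_def by (intro DERIV_add DERIV_cmult DERIV_sum L)
 have S1: "(\<Sum>a<n. k1*(?c (ee a) * of_int (ee a i)) + k2*(?c (rl a) * of_int (rl a i))) = k1*?c (ee i) + 2 * k2*?c (rl i)"
 proof -
  have "(\<Sum>a<n. k1*(?c (ee a) * of_int (ee a i)) + k2*(?c (rl a) * of_int (rl a i))) =
   (k1*(?c (ee i) * of_int (ee i i)) + k2*(?c (rl i) * of_int (rl i i))) + (\<Sum>a\<in>{..<n}-{i}. k1*(?c (ee a) * of_int (ee a i)) + k2*(?c (rl a) * of_int (rl a i)))"
   using assms(2) by (subst sum.remove[of _ i]) auto
  moreover have "(\<Sum>a\<in>{..<n}-{i}. k1*(?c (ee a) * of_int (ee a i)) + k2*(?c (rl a) * of_int (rl a i))) = 0"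
   by (rule sum.neutral) (auto simp: ee_def rl_def)
  ultimately show ?thesis by (simp add: ee_def[of i] rl_def[of i])
 qed
 \<comment> \<open>The variable \<open>i\<close> occurs once as the first index of a pair and once
   as the second. The two contributions agree because \<open>cc\<close> is odd.\<close>
 have S2: "(\<Sum>a<n. \<Sum>b\<in>{..<n}-{a}. ?f a b) = 2*(\<Sum>j\<in>{..<n}-{i}. ?c (rm i j) + ?c (rp i j))"
 proof -
  have A: "(\<Sum>b\<in>{..<n}-{i}. ?f i b) = (\<Sum>j\<in>{..<n}-{i}. ?c (rm i j) + ?c (rp i j))"
   by (rule sum.cong) (auto simp: rm_def[of i] rp_def[of i] ee_def)
  have odd: "cc e (- x) = - cc e x" for x by (simp add: cc_def)
  have B: "(\<Sum>b\<in>{..<n}-{a}. ?f a b) = ?c (rm i a) + ?c (rp i a)" if a: "a \<in> {..<n}-{i}" for a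
  proof -
   have "(\<Sum>b\<in>{..<n}-{a}. ?f a b) = ?f a i + (\<Sum>b\<in>{..<n}-{a}-{i}. ?f a b)"
    using assms(2) a by (subst sum.remove[of _ i]) auto
   also have "(\<Sum>b\<in>{..<n}-{a}-{i}. ?f a b) = 0" using a by (intro sum.neutral) (auto simp: rm_def rp_def ee_def)
   also have "?f a i = ?c (rm i a) + ?c (rp i a)"
   proof -
    let ?u = "t(i:=x)"
    have aa: "a < n" "a ~= i" using a by auto
    have r: "rm a i i = -1" "rp a i i = 1" using aa by (auto simp: rm_def rp_def ee_def)
    have "?c (rm a i) = - ?c (rm i a)" unfolding ap_roots(3)[OF aa(1) assms(2)] ap_roots(3)[OF assms(2) aa(1)]
     using odd[of "?u i - ?u a"] by (simp del: fun_upd_apply)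
    moreover have "?c (rp a i) = ?c (rp i a)" unfolding ap_roots(4)[OF aa(1) assms(2)] ap_roots(4)[OF assms(2) aa(1)]
     by (simp only: add.commute)
    ultimately show ?thesis by (simp add: r)
   qed
   finally show ?thesis by (simp only: add_0_right)
  qed
  have "(\<Sum>a<n. \<Sum>b\<in>{..<n}-{a}. ?f a b) = (\<Sum>b\<in>{..<n}-{i}. ?f i b) + (\<Sum>a\<in>{..<n}-{i}. \<Sum>b\<in>{..<n}-{a}. ?f a b)"
   using assms(2) by (subst sum.remove[of _ i]) auto
  also have "(\<Sum>a\<in>{..<n}-{i}. \<Sum>b\<in>{..<n}-{a}. ?f a b) = (\<Sum>j\<in>{..<n}-{i}. ?c (rm i j) + ?c (rp i j))"
   by (rule sum.cong[OF refl B])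
  finally show ?thesis unfolding A mult_2 .
 qed
 show ?thesis using D unfolding S1 S2 dV_def by (simp add: algebra_simps)
qed

end

lemma measurable_cis [measurable]: "cis \<in> borel_measurable borel"
proof -
 have "continuous_on UNIV cis" unfolding cis_conv_exp by (intro continuous_intros)
 then show ?thesis by (rule borel_measurable_continuous_onI)
qed

lemma sum_pairs_symmetric:
 fixes f :: "nat => nat => real"
 assumes "\<And>i j. f i j = f j i"
 shows "(\<Sum>i<n. \<Sum>j\<in>{..<n}-{i}. f i j) = 2*(\<Sum>i<n. \<Sum>j\<in>{i<..<n}. f i j)"
proof -
 have "(\<Sum>j\<in>{..<n}-{i}. f i j) = (\<Sum>j\<in>{i<..<n}. f i j) + (\<Sum>j<i. f i j)" if "i < n" for i
 proof -
  have "{..<n}-{i} = {i<..<n} \<union> {..<i}" using that by auto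
  then show ?thesis by (simp add: sum.union_disjoint disjoint_iff)
 qed
 then have "(\<Sum>i<n. \<Sum>j\<in>{..<n}-{i}. f i j) = (\<Sum>i<n. \<Sum>j\<in>{i<..<n}. f i j) + (\<Sum>i<n. \<Sum>j<i. f i j)"
  by (simp add: sum.distrib)
 also have "(\<Sum>i<n. \<Sum>j<i. f i j) = (\<Sum>j<n. \<Sum>i\<in>{j<..<n}. f i j)"
  unfolding sum.Sigma[OF finite_lessThan ballI[OF finite_lessThan]] sum.Sigma[OF finite_lessThan ballI[OF finite_greaterThanLessThan]]
  by (rule sum.reindex_bij_witness[of _ "%(j,i). (i,j)" "%(i,j). (j,i)"]) auto
 also have "... = (\<Sum>i<n. \<Sum>j\<in>{i<..<n}. f i j)" by (subst assms) simp
 finally show ?thesis by simp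
qed

lemma cmod_cis_diff: "(cmod (cis x - cis y))\<^sup>2 = 2 - 2 * cos (x - y)"
proof -
 have "(cmod (cis x - cis y))\<^sup>2 = (cos x - cos y)\<^sup>2 + (sin x - sin y)\<^sup>2" by (simp add: cmod_power2)
 also have "... = (cos x ^ 2 + sin x ^ 2) + (cos y ^ 2 + sin y ^ 2) - 2*(cos x * cos y + sin x * sin y)"
  by (simp add: power2_eq_square algebra_simps)
 finally show ?thesis by (simp add: cos_diff)
qed

lemma powr_cmod: "u ~= 0 ==> cmod u powr (2 * r) = exp (r * ln ((cmod u)\<^sup>2))"
 by (simp add: powr_def ln_realpow)

context bc
begin

definition ip :: "lpoly => lpoly => complex" where
 "ip c d = (LINT t|torus_measure n. tev n c t * cnj (tev n d t) * of_real (exp (Vw 0 t)))"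

definition wt :: "real => (nat => real) => complex" where
 "wt e t = of_real (exp (Vw e t))"

lemma measurable_wt [measurable]: "wt e \<in> borel_measurable (torus_measure n)"
 unfolding wt_def[abs_def] by measurable

lemma norm_wt: "0 <= e ==> e <= 1 ==> norm (wt e t) <= exp Vbound"
 using Vw_le by (simp add: wt_def)

text \<open>The points where no factor of the weight vanishes. Elsewhere \<open>ln 0 = 0\<close> can
  make \<open>exp (Vw 0 t)\<close> differ from the weight; those points form a null set.\<close>

definition reg :: "(nat => real) => bool" where
 "reg t \<longleftrightarrow> (\<forall>i\<in>{..<n}. cos (ap n (ee i) t) ~= 1 \<and> cos (ap n (rl i) t) ~= 1 \<and>
   (\<forall>j\<in>{..<n}-{i}. cos (ap n (rm i j) t) ~= 1 \<and> cos (ap n (rp i j) t) ~= 1))"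

lemma AE_reg: "AE t in torus_measure n. reg t"
proof -
 have "AE t in torus_measure n. cos (ap n (ee i) t) ~= 1 \<and> cos (ap n (rl i) t) ~= 1 \<and>
   (\<forall>j\<in>{..<n}-{i}. cos (ap n (rm i j) t) ~= 1 \<and> cos (ap n (rp i j) t) ~= 1)" if i: "i < n" for i
 proof (intro AE_conjI AE_finite_allI)
  show "AE t in torus_measure n. cos (ap n (ee i) t) ~= 1" by (rule AE_cos_ap[OF i]) (simp add: ee_def)
  show "AE t in torus_measure n. cos (ap n (rl i) t) ~= 1" by (rule AE_cos_ap[OF i]) (simp add: rl_def ee_def)
  fix j assume j: "j \<in> {..<n} - {i}"
  show "AE t in torus_measure n. cos (ap n (rm i j) t) ~= 1" by (rule AE_cos_ap[OF i]) (use j in \<open>auto simp: rm_def ee_def\<close>)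
  show "AE t in torus_measure n. cos (ap n (rp i j) t) ~= 1" by (rule AE_cos_ap[OF i]) (use j in \<open>auto simp: rp_def ee_def\<close>)
 qed auto
 then show ?thesis unfolding reg_def by (intro AE_finite_allI) auto
qed

lemma wt_tendsto:
 assumes "reg t" shows "(%m. wt (1/(real m + 1)) t) \<longlonglongrightarrow> wt 0 t"
proof -
 have e: "(%m. 1/(real m + 1)) \<longlonglongrightarrow> 0" using LIMSEQ_inverse_real_of_nat by (simp add: inverse_eq_divide add.commute)
 have L: "(%m. Lg (1/(real m + 1)) x) \<longlonglongrightarrow> Lg 0 x" if "cos x ~= 1" for x
 proof -
  have "(%m. ln (2 - 2 * cos x + 1/(real m + 1))) \<longlonglongrightarrow> ln (2 - 2 * cos x + 0)"
   using that by (intro tendsto_ln tendsto_add tendsto_const e) auto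
  then show ?thesis by (simp add: Lg_def)
 qed
 show ?thesis unfolding wt_def Vw_def using assms unfolding reg_def
  by (intro tendsto_of_real tendsto_exp tendsto_add tendsto_mult tendsto_const tendsto_sum L) auto
qed

text \<open>It differs from twice the product of \<open>c\<close> and \<open>cnj d\<close> by a term
  that is even under \<open>s\<close> and so integrates to 0 against the odd factor
  \<open>cc\<close>. Unlike the product itself, each summand contains a difference that vanishes on
  the hyperplane of the root and compensates the pole of \<open>kap\<close>.\<close>

definition Xt :: "((nat => int) => nat => int) => lpoly => lpoly => (nat => real) => complex" where
 "Xt s c d t = (tev n c t - tev n (c \<circ> s) t) * cnj (tev n d t) + tev n c t * cnj (tev n d t - tev n (d \<circ> s) t)"

lemma measurable_cnj [measurable]: "cnj \<in> borel_measurable borel"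
 by (intro borel_measurable_continuous_onI continuous_intros)

lemma integrable_weighted:
 assumes "k \<in> borel_measurable (torus_measure n)" "\<And>t. \<bar>k t\<bar> <= K" "0 <= e" "e <= 1"
 shows "integrable (torus_measure n) (%t. of_real (k t)*(tev n c t * cnj (tev n d t)) * wt e t)"
proof (rule integrable_torus_bounded)
 have [measurable]: "k \<in> borel_measurable (torus_measure n)" by (rule assms)
 show "(%t. of_real (k t)*(tev n c t * cnj (tev n d t)) * wt e t) \<in> borel_measurable (torus_measure n)" by measurable
 fix t
 have K: "0 <= K" using assms(2)[of t] by linarith
 show "norm (of_real (k t)*(tev n c t * cnj (tev n d t)) * wt e t) <=
   K*((\<Sum>mu | c mu ~= 0. norm (c mu))*(\<Sum>mu | d mu ~= 0. norm (d mu))) * exp Vbound"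
  unfolding norm_mult complex_mod_cnj norm_of_real
  by (intro mult_mono assms norm_tev_le norm_wt mult_nonneg_nonneg sum_nonneg K) auto
qed

lemma root_symmetrize:
 assumes "sig permutes {..<n}" "\<And>mu t. ap n (s mu) t = ap n mu (mp sig A t)" "\<And>mu. s (s mu) = mu"
  "\<And>t. ap n alpha (mp sig A t) = - ap n alpha t" "0 < e" "e <= 1"
 shows "(LINT t|torus_measure n. of_real (cc e (ap n alpha t))*(tev n c t * cnj (tev n d t)) * wt e t) =
   1/2*(LINT t|torus_measure n. of_real (cc e (ap n alpha t)) * Xt s c d t * wt e t)"
proof -
 let ?M = "torus_measure n" and ?k = "%t. complex_of_real (cc e (ap n alpha t))"
 define h where "h = (%t. ?k t*(tev n (c \<circ> s) t * cnj (tev n d t)) * wt e t)"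
 have mh: "h \<in> borel_measurable ?M" unfolding h_def by measurable
 have tv: "tev n c (mp sig A t) = tev n (c \<circ> s) t" for c t
  by (rule tev_comp[symmetric]) (use assms in auto)
 have css: "(c \<circ> s) \<circ> s = c" using assms(3) by auto
 have "(LINT t|?M. h (mp sig A t)) = (LINT t|?M. h t)"
  by (rule torus_integral_mp[OF assms(1) mh]) (simp add: h_def wt_def tev_map cc_map Vw_map)
 moreover have "h (mp sig A t) = - (?k t*(tev n c t * cnj (tev n (d \<circ> s) t)) * wt e t)" for t
  unfolding h_def tv css assms(4) by (simp add: wt_def Vw_mp[OF assms(1)] cc_def)
 ultimately have eq: "(LINT t|?M. ?k t*(tev n (c \<circ> s) t * cnj (tev n d t)) * wt e t) =
   - (LINT t|?M. ?k t*(tev n c t * cnj (tev n (d \<circ> s) t)) * wt e t)" by (simp add: h_def)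
 have int: "integrable ?M (%t. ?k t*(tev n c t * cnj (tev n d t)) * wt e t)" for c d
  by (rule integrable_weighted[of _ "2/e"]) (use assms cc_bound in auto)
 have "(LINT t|?M. ?k t * Xt s c d t * wt e t) =
  (LINT t|?M. 2*(?k t*(tev n c t * cnj (tev n d t)) * wt e t) - (?k t*(tev n (c \<circ> s) t * cnj (tev n d t)) * wt e t
    + ?k t*(tev n c t * cnj (tev n (d \<circ> s) t)) * wt e t))"
  by (rule Bochner_Integration.integral_cong) (auto simp: Xt_def algebra_simps)
 also have "... = 2*(LINT t|?M. ?k t*(tev n c t * cnj (tev n d t)) * wt e t) - ((LINT t|?M. ?k t*(tev n (c \<circ> s) t * cnj (tev n d t)) * wt e t)
    + (LINT t|?M. ?k t*(tev n c t * cnj (tev n (d \<circ> s) t)) * wt e t))"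
  by (subst Bochner_Integration.integral_diff Bochner_Integration.integral_add integral_mult_right_zero; (intro integrable_mult_right Bochner_Integration.integrable_add int)?)+ simp
 also have "... = 2*(LINT t|?M. ?k t*(tev n c t * cnj (tev n d t)) * wt e t)" unfolding eq by simp
 finally show ?thesis by simp
qed

text \<open>Dominated convergence as the regularisation is removed: \<open>cc\<close> is dominated
  by \<open>kap\<close>, and \<open>kap\<close> times \<open>Xt\<close> is, almost everywhere, a
  combination of evaluations of \<open>Nop alpha s c\<close>, \<open>Nop alpha s d\<close>,
  \<open>c\<close> and \<open>d\<close>, which are bounded.\<close>

lemma root_limit:
 assumes "is_refl alpha s" "lp_ok n c" "lp_ok n d" "AE t in torus_measure n. cos (ap n alpha t) ~= 1"
 shows "(%m. LINT t|torus_measure n. of_real (cc (1/(real m + 1)) (ap n alpha t)) * Xt s c d t * wt (1/(real m + 1)) t)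
  \<longlonglongrightarrow> (LINT t|torus_measure n. \<i>*(tev n (Nop alpha s c) t * cnj (tev n d t) - tev n c t * cnj (tev n (Nop alpha s d) t)) * wt 0 t)"
proof -
 let ?M = "torus_measure n" and ?e = "%m. 1/(real m + 1)"
 let ?Z = "%t. \<i>*(tev n (Nop alpha s c) t * cnj (tev n d t) - tev n c t * cnj (tev n (Nop alpha s d) t))"
 note fs = lp_ok_fin[OF assms(2)] lp_ok_fin[OF assms(3)]
 have Z: "?Z t = of_real (kap (ap n alpha t)) * Xt s c d t" if "cos (ap n alpha t) ~= 1" for t
  unfolding tev_Nop[OF fs(1) assms(1) that] tev_Nop[OF fs(2) assms(1) that] Xt_def by (simp add: algebra_simps)
 define B where "B = (\<Sum>mu | Nop alpha s c mu ~= 0. norm (Nop alpha s c mu))*(\<Sum>mu | d mu ~= 0. norm (d mu)) + (\<Sum>mu | c mu ~= 0. norm (c mu))*(\<Sum>mu | Nop alpha s d mu ~= 0. norm (Nop alpha s d mu))"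
 have nZ: "norm (?Z t) <= B" for t
 proof -
  have "norm (?Z t) <= norm (tev n (Nop alpha s c) t * cnj (tev n d t)) + norm (tev n c t * cnj (tev n (Nop alpha s d) t))"
   unfolding norm_mult norm_ii mult_1_left by (metis norm_mult norm_triangle_ineq4)
  also have "... <= B" unfolding B_def norm_mult complex_mod_cnj
   by (intro add_mono mult_mono norm_tev_le norm_ge_zero sum_nonneg)
  finally show ?thesis .
 qed
 have mX: "Xt s c d \<in> borel_measurable ?M" unfolding Xt_def[abs_def] by measurable
 have e: "?e \<longlonglongrightarrow> 0" using LIMSEQ_inverse_real_of_nat by (simp add: inverse_eq_divide add.commute)
 show ?thesis
 proof (rule integral_dominated_convergence[where w = "%_. B * exp Vbound"])
  show "(%t. ?Z t * wt 0 t) \<in> borel_measurable ?M" by measurable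
  show "(%t. of_real (cc (?e m) (ap n alpha t)) * Xt s c d t * wt (?e m) t) \<in> borel_measurable ?M" for m using mX by measurable
  show "integrable ?M (%_. B * exp Vbound)" by (rule integrable_torus_bounded[of _ _ "\<bar>B * exp Vbound\<bar>"]) auto
  show "AE t in ?M. (%m. of_real (cc (?e m) (ap n alpha t)) * Xt s c d t * wt (?e m) t) \<longlonglongrightarrow> ?Z t * wt 0 t"
   using assms(4) AE_reg
  proof eventually_elim
   case (elim t)
   have "(%m. cc (?e m) (ap n alpha t)) \<longlonglongrightarrow> 2 * sin (ap n alpha t)/(2 - 2 * cos (ap n alpha t) + 0)"
    unfolding cc_def using elim by (intro tendsto_divide tendsto_add tendsto_const e) auto
   also have "2 * sin (ap n alpha t)/(2 - 2 * cos (ap n alpha t) + 0) = kap (ap n alpha t)"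
   proof -
    have "2 * sin x/(2*(1 - cos x)) = sin x/(1 - cos x)" for x :: real by (rule mult_divide_mult_cancel_left) simp
    then show ?thesis by (simp add: kap_def)
   qed
   finally have "(%m. cc (?e m) (ap n alpha t)) \<longlonglongrightarrow> kap (ap n alpha t)" .
   then have "(%m. of_real (cc (?e m) (ap n alpha t)) * Xt s c d t * wt (?e m) t) \<longlonglongrightarrow> of_real (kap (ap n alpha t)) * Xt s c d t * wt 0 t"
    by (intro tendsto_mult tendsto_of_real tendsto_const wt_tendsto elim)
   then show ?case by (simp only: Z[OF elim(1)])
  qed
  fix m
  have em: "0 < ?e m" "?e m <= 1" by (auto simp: field_simps)
  show "AE t in ?M. norm (of_real (cc (?e m) (ap n alpha t)) * Xt s c d t * wt (?e m) t) <= B * exp Vbound"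
   using assms(4)
  proof eventually_elim
   case (elim t)
   have "norm (of_real (cc (?e m) (ap n alpha t)) * Xt s c d t) <= norm (?Z t)"
    unfolding Z[OF elim] norm_mult norm_of_real by (intro mult_right_mono cc_le_kap em elim) auto
   also have "... <= B" by (rule nZ)
   finally have "norm (of_real (cc (?e m) (ap n alpha t)) * Xt s c d t) * norm (wt (?e m) t) <= B * exp Vbound"
    using em norm_wt[of "?e m" t] by (intro mult_mono) (auto intro: order_trans[OF norm_ge_zero])
   then show ?case by (simp add: norm_mult)
  qed
 qed
qed

lemma main_limit:
 shows "(%m. LINT t|torus_measure n. of_real 1*(tev n c t * cnj (tev n d t)) * wt (1/(real m + 1)) t)
  \<longlonglongrightarrow> (LINT t|torus_measure n. of_real 1*(tev n c t * cnj (tev n d t)) * wt 0 t)"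
proof (rule integral_dominated_convergence[where w = "%_. (\<Sum>mu | c mu ~= 0. norm (c mu))*(\<Sum>mu | d mu ~= 0. norm (d mu)) * exp Vbound"])
 let ?M = "torus_measure n" and ?e = "%m. 1/(real m + 1)"
 show "(%t. of_real 1*(tev n c t * cnj (tev n d t)) * wt 0 t) \<in> borel_measurable ?M" by measurable
 show "(%t. of_real 1*(tev n c t * cnj (tev n d t)) * wt (?e m) t) \<in> borel_measurable ?M" for m by measurable
 show "integrable ?M (%_. (\<Sum>mu | c mu ~= 0. norm (c mu))*(\<Sum>mu | d mu ~= 0. norm (d mu)) * exp Vbound)"
  by (rule integrable_torus_bounded[of _ _ "\<bar>(\<Sum>mu | c mu ~= 0. norm (c mu))*(\<Sum>mu | d mu ~= 0. norm (d mu)) * exp Vbound\<bar>"]) auto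
 show "AE t in ?M. (%m. of_real 1*(tev n c t * cnj (tev n d t)) * wt (?e m) t) \<longlonglongrightarrow> of_real 1*(tev n c t * cnj (tev n d t)) * wt 0 t"
  using AE_reg by eventually_elim (intro tendsto_mult tendsto_const wt_tendsto)
 fix m
 have em: "0 <= ?e m" "?e m <= 1" by (auto simp: field_simps)
 show "AE t in ?M. norm (of_real 1*(tev n c t * cnj (tev n d t)) * wt (?e m) t) <= (\<Sum>mu | c mu ~= 0. norm (c mu))*(\<Sum>mu | d mu ~= 0. norm (d mu)) * exp Vbound"
  unfolding norm_mult complex_mod_cnj of_real_1 norm_one mult_1_left
  by (intro AE_I2 mult_mono norm_tev_le norm_wt em mult_nonneg_nonneg sum_nonneg) auto
qed

text \<open>The derivative of the product of \<open>c\<close>, \<open>cnj d\<close> and the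
  regularised weight in one angle integrates to 0 by periodicity. For \<open>e > 0\<close> this is
  legitimate however small the exponents of the weight are.\<close>

lemma parts_identity:
 assumes "lp_ok n c" "lp_ok n d" "i < n" "0 < e" "e <= 1"
 defines "I \<equiv> %alpha. LINT t|torus_measure n. of_real (cc e (ap n alpha t))*(tev n c t * cnj (tev n d t)) * wt e t"
  and "J \<equiv> %c d. LINT t|torus_measure n. of_real 1*(tev n c t * cnj (tev n d t)) * wt e t"
 shows "\<i>*(J (%nu. of_int (nu i) * c nu) d - J c (%nu. of_int (nu i) * d nu))
   + of_real theta*(\<Sum>j\<in>{..<n}-{i}. I (rm i j) + I (rp i j)) + of_real k1 * I (ee i) + 2 * of_real k2 * I (rl i) = 0"
proof -
 let ?M = "torus_measure n"
 let ?dc = "%nu. of_int (nu i) * c nu" and ?dd = "%nu. of_int (nu i) * d nu"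
 note fs = lp_ok_fin[OF assms(1)] lp_ok_fin[OF assms(2)]
 have fs': "fin_supp ?dc" "fin_supp ?dd" using fs by (auto intro: fin_supp_scale)
 define G where "G = (%t. tev n c t * cnj (tev n d t) * wt e t)"
 define Q where "Q = (%k c d t. of_real (k t)*(tev n c t * cnj (tev n d t)) * wt e t)"
 define G' where "G' = (%t. \<i>*(Q (%_. 1) ?dc d t - Q (%_. 1) c ?dd t) + Q (dV e i) c d t)"
 have der: "((%x. G (t(i:=x))) has_vector_derivative G' (t(i:=x))) (at x)" for t x
 proof -
  have 1: "((%x. tev n c (t(i:=x))) has_vector_derivative \<i> * tev n ?dc (t(i:=x))) (at x)" by (rule tev_deriv[OF assms(3) fs(1)])
  have 2: "((%x. cnj (tev n d (t(i:=x)))) has_vector_derivative cnj (\<i> * tev n ?dd (t(i:=x)))) (at x)"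
   by (rule bounded_linear.has_vector_derivative[OF bounded_linear_cnj tev_deriv[OF assms(3) fs(2)]])
  have "((%x. exp (Vw e (t(i:=x)))) has_real_derivative exp (Vw e (t(i:=x))) * dV e i (t(i:=x))) (at x)"
   by (rule DERIV_fun_exp[OF Vw_deriv[OF assms(4,3)]])
  then have 3: "((%x. wt e (t(i:=x))) has_vector_derivative of_real (exp (Vw e (t(i:=x))) * dV e i (t(i:=x)))) (at x)"
   unfolding wt_def by (intro has_vector_derivative_of_real) (simp add: has_real_derivative_iff_has_vector_derivative)
  show ?thesis unfolding G_def
   by (rule has_vector_derivative_eq_rhs[OF has_vector_derivative_mult[OF has_vector_derivative_mult[OF 1 2] 3]])
    (simp add: G'_def Q_def wt_def algebra_simps)
 qed
 have cont: "continuous_on UNIV (%x. G' (t(i:=x)))" for t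
 proof -
  have cV: "continuous_on UNIV (%x. Vw e (t(i:=x)))"
   by (auto simp: continuous_on_eq_continuous_at intro: DERIV_isCont[OF Vw_deriv[OF assms(4,3)]])
  have "continuous_on UNIV (%x. cc e (ap n alpha (t(i:=x))))" for alpha
  proof -
   have "2 - 2 * cos y + e ~= 0" for y using cos_le_one[of y] assms(4) by linarith
   then show ?thesis unfolding cc_def ap_upd[OF assms(3)] by (intro continuous_intros) auto
  qed
  then have cdV: "continuous_on UNIV (%x. dV e i (t(i:=x)))" unfolding dV_def by (intro continuous_intros)
  show ?thesis unfolding G'_def Q_def wt_def
   by (intro continuous_intros tev_continuous[OF assms(3)] fs fs' cV cdV)
 qed
 have per: "G (t(i:=0)) = G (t(i:=2*pi))" for t
 proof -
  have "tev n c (t(i:=0)) = tev n c (t(i:=2*pi))" for c unfolding tev_def tev_periodic[OF assms(3)] ..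
  moreover have "Vw e (t(i:=0)) = Vw e (t(i:=2*pi))" unfolding Vw_def Lg_cis[OF tev_periodic[OF assms(3)]] ..
  ultimately show ?thesis by (simp add: G_def wt_def)
 qed
 have iQ: "integrable ?M (Q k c d)" if "k \<in> borel_measurable ?M" "\<And>t. \<bar>k t\<bar> <= K" for k K c d
  unfolding Q_def by (rule integrable_weighted[OF that]) (use assms in auto)
 have iQ1: "integrable ?M (Q (%_. 1) c d)" for c d by (rule iQ[of _ 1]) auto
 have iQc: "integrable ?M (Q (%t. cc e (ap n alpha t)) c d)" for alpha by (rule iQ[of _ "2/e"]) (use cc_bound assms in auto)
 have QdV: "Q (dV e i) c d = (%t. of_real theta*(\<Sum>j\<in>{..<n}-{i}. Q (%t. cc e (ap n (rm i j) t)) c d t + Q (%t. cc e (ap n (rp i j) t)) c d t)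
   + of_real k1 * Q (%t. cc e (ap n (ee i) t)) c d t + 2 * of_real k2 * Q (%t. cc e (ap n (rl i) t)) c d t)"
  by (auto simp: Q_def dV_def algebra_simps sum_distrib_left sum_distrib_right sum.distrib)
 have iS: "integrable ?M (%t. of_real theta*(\<Sum>j\<in>{..<n}-{i}. Q (%t. cc e (ap n (rm i j) t)) c d t + Q (%t. cc e (ap n (rp i j) t)) c d t))"
  by (intro integrable_mult_right Bochner_Integration.integrable_sum Bochner_Integration.integrable_add iQc)
 have iV: "integrable ?M (Q (dV e i) c d)"
  unfolding QdV by (intro Bochner_Integration.integrable_add iS integrable_mult_right iQc)
 have iG: "integrable ?M G'" unfolding G'_def
  by (intro Bochner_Integration.integrable_add iV integrable_mult_right Bochner_Integration.integrable_diff iQ1)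
 have "(LINT t|?M. G' t) = 0" by (rule torus_integral_derivative[OF assms(3) der cont per iG])
 moreover have "(LINT t|?M. G' t) = \<i>*((LINT t|?M. Q (%_. 1) ?dc d t) - (LINT t|?M. Q (%_. 1) c ?dd t)) + (LINT t|?M. Q (dV e i) c d t)"
  unfolding G'_def using iQ1 iV by simp
 moreover have "(LINT t|?M. Q (dV e i) c d t) = of_real theta*(\<Sum>j\<in>{..<n}-{i}. I (rm i j) + I (rp i j)) + of_real k1 * I (ee i) + 2 * of_real k2 * I (rl i)"
 proof -
  have IQ: "I alpha = (LINT t|?M. Q (%t. cc e (ap n alpha t)) c d t)" for alpha by (simp add: I_def Q_def)
  have iA: "integrable ?M (%t. Q (%t. cc e (ap n (rm i j) t)) c d t + Q (%t. cc e (ap n (rp i j) t)) c d t)" for j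
   by (intro Bochner_Integration.integrable_add iQc)
  have "(LINT t|?M. Q (dV e i) c d t) = (LINT t|?M. of_real theta*(\<Sum>j\<in>{..<n}-{i}. Q (%t. cc e (ap n (rm i j) t)) c d t + Q (%t. cc e (ap n (rp i j) t)) c d t))
   + (LINT t|?M. of_real k1 * Q (%t. cc e (ap n (ee i) t)) c d t) + (LINT t|?M. 2 * of_real k2 * Q (%t. cc e (ap n (rl i) t)) c d t)"
   unfolding QdV
   by (subst Bochner_Integration.integral_add, intro Bochner_Integration.integrable_add iS integrable_mult_right iQc, intro integrable_mult_right iQc,
     subst Bochner_Integration.integral_add, intro iS, intro integrable_mult_right iQc, rule refl)
  also have "(LINT t|?M. of_real theta*(\<Sum>j\<in>{..<n}-{i}. Q (%t. cc e (ap n (rm i j) t)) c d t + Q (%t. cc e (ap n (rp i j) t)) c d t)) =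
    of_real theta*(\<Sum>j\<in>{..<n}-{i}. LINT t|?M. Q (%t. cc e (ap n (rm i j) t)) c d t + Q (%t. cc e (ap n (rp i j) t)) c d t)"
   unfolding integral_mult_right_zero by (subst Bochner_Integration.integral_sum) (use iA in auto)
  also have "(\<Sum>j\<in>{..<n}-{i}. LINT t|?M. Q (%t. cc e (ap n (rm i j) t)) c d t + Q (%t. cc e (ap n (rp i j) t)) c d t) = (\<Sum>j\<in>{..<n}-{i}. I (rm i j) + I (rp i j))"
   unfolding IQ by (rule sum.cong[OF refl], rule Bochner_Integration.integral_add[OF iQc iQc])
  finally show ?thesis unfolding integral_mult_right_zero IQ[symmetric] .
 qed
 ultimately show ?thesis unfolding J_def Q_def by (simp add: algebra_simps)
qed

lemma fl_id_permutes: "id permutes {..<n}" by (rule permutes_id)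

lemma parts_sym:
 assumes "lp_ok n c" "lp_ok n d" "i < n" "0 < e" "e <= 1"
 defines "X \<equiv> %alpha s. LINT t|torus_measure n. of_real (cc e (ap n alpha t)) * Xt s c d t * wt e t"
  and "J \<equiv> %c d. LINT t|torus_measure n. of_real 1*(tev n c t * cnj (tev n d t)) * wt e t"
 shows "\<i>*(J (%nu. of_int (nu i) * c nu) d - J c (%nu. of_int (nu i) * d nu))
   + of_real (theta/2)*(\<Sum>j\<in>{..<n}-{i}. X (rm i j) (sw i j) + X (rp i j) (ssw i j)) + of_real (k1/2) * X (ee i) (fl i) + of_real k2 * X (rl i) (fl i) = 0"
proof -
 let ?I = "%alpha. LINT t|torus_measure n. of_real (cc e (ap n alpha t))*(tev n c t * cnj (tev n d t)) * wt e t"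
 have 1: "?I (rm i j) = 1/2 * X (rm i j) (sw i j)" if j: "j \<in> {..<n}-{i}" for j
  unfolding X_def
 proof (rule root_symmetrize[OF _ ap_sw])
  show "Transposition.transpose i j permutes {..<n}" using j assms(3) by (intro permutes_swap_id) auto
  show "ap n (rm i j) (mp (Transposition.transpose i j) {} t) = - ap n (rm i j) t" for t
   using j assms(3) by (simp add: ap_roots mp_def)
 qed (use j assms in \<open>auto simp: sw_def fun_eq_iff\<close>)
 have 2: "?I (rp i j) = 1/2 * X (rp i j) (ssw i j)" if j: "j \<in> {..<n}-{i}" for j
  unfolding X_def
 proof (rule root_symmetrize[OF _ ap_ssw])
  show "Transposition.transpose i j permutes {..<n}" using j assms(3) by (intro permutes_swap_id) auto
  show "ap n (rp i j) (mp (Transposition.transpose i j) {i,j} t) = - ap n (rp i j) t" for t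
   using j assms(3) by (simp add: ap_roots mp_def)
 qed (use j assms in \<open>auto simp: ssw_def fun_eq_iff\<close>)
 have 3: "?I (ee i) = 1/2 * X (ee i) (fl i)" unfolding X_def
  by (rule root_symmetrize[OF fl_id_permutes ap_fl]) (use assms in \<open>auto simp: fl_def fun_eq_iff ap_roots mp_def\<close>)
 have 4: "?I (rl i) = 1/2 * X (rl i) (fl i)" unfolding X_def
  by (rule root_symmetrize[OF fl_id_permutes ap_fl]) (use assms in \<open>auto simp: fl_def fun_eq_iff ap_roots mp_def\<close>)
 have 5: "(\<Sum>j\<in>{..<n}-{i}. ?I (rm i j) + ?I (rp i j)) = 1/2*(\<Sum>j\<in>{..<n}-{i}. X (rm i j) (sw i j) + X (rp i j) (ssw i j))"
  unfolding sum_distrib_left by (rule sum.cong[OF refl]) (simp only: 1 2 distrib_left)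
 show ?thesis using parts_identity[OF assms(1-5)] unfolding 3 4 5 by (simp add: J_def)
qed

end

context bc
begin

lemma ip_wt: "ip c d = (LINT t|torus_measure n. of_real 1*(tev n c t * cnj (tev n d t)) * wt 0 t)"
 by (simp add: ip_def wt_def)

lemma ip_integrable: "integrable (torus_measure n) (%t. tev n c t * cnj (tev n d t) * wt 0 t)"
 using integrable_weighted[of "%_. 1" 1 0 c d] by simp

lemma ip_lincomb:
 assumes "lp_ok n c" "lp_ok n d"
 shows "ip (%nu. x * c nu + y * d nu) g = x * ip c g + y * ip d g"
proof -
 have "ip (%nu. x * c nu + y * d nu) g = (LINT t|torus_measure n. x*(tev n c t * cnj (tev n g t) * wt 0 t) + y*(tev n d t * cnj (tev n g t) * wt 0 t))"
  unfolding ip_wt tev_lincomb[OF lp_ok_fin[OF assms(1)] lp_ok_fin[OF assms(2)]]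
  by (rule Bochner_Integration.integral_cong) (auto simp: algebra_simps)
 also have "... = x * ip c g + y * ip d g"
  using ip_integrable[of c g] ip_integrable[of d g] by (simp add: ip_wt)
 finally show ?thesis .
qed

lemma ip_cnj: "cnj (ip c d) = ip d c"
proof -
 have "cnj (ip c d) = (LINT t|torus_measure n. cnj (tev n c t * cnj (tev n d t) * of_real (exp (Vw 0 t))))"
  unfolding ip_def by (rule integral_bounded_linear[OF bounded_linear_cnj ip_integrable[unfolded wt_def], symmetric])
 then show ?thesis by (simp add: ip_def mult.commute)
qed

lemma ip_lincomb_right:
 assumes "lp_ok n c" "lp_ok n d"
 shows "ip g (%nu. x * c nu + y * d nu) = cnj x * ip g c + cnj y * ip g d"
 unfolding ip_cnj[of _ g, symmetric] ip_lincomb[OF assms] by simp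

lemma ip_scale: "lp_ok n c ==> ip (%nu. x * c nu) g = x * ip c g"
 using ip_lincomb[of c c x 0 g] by simp

lemma ip_scale_right: "lp_ok n c ==> ip g (%nu. x * c nu) = cnj x * ip g c"
 using ip_lincomb_right[of c c g x 0] by simp

lemma ip_sum:
 assumes "finite A" "\<And>a. a \<in> A ==> lp_ok n (f a)"
 shows "ip (%nu. \<Sum>a\<in>A. f a nu) g = (\<Sum>a\<in>A. ip (f a) g)"
 using assms
proof (induction A rule: finite_induct)
 case empty
 show ?case by (simp add: ip_def tev_def)
next
 case (insert a A)
 have "ip (%nu. 1 * f a nu + 1*(\<Sum>a\<in>A. f a nu)) g = 1 * ip (f a) g + 1 * ip (%nu. \<Sum>a\<in>A. f a nu) g"
  by (intro ip_lincomb lp_ok_sum) (use insert in auto)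
 then show ?case using insert by simp
qed

lemma ip_Sop:
 assumes "lp_ok n c" "i < n"
 shows "ip (Sop i c) d = ip (%nu. of_int (nu i) * c nu) d
   + of_real (theta/2)*(\<Sum>j\<in>{..<n}-{i}. ip (Nop (rm i j) (sw i j) c) d + ip (Nop (rp i j) (ssw i j) c) d)
   + of_real (k1/2) * ip (Nop (ee i) (fl i) c) d + of_real k2 * ip (Nop (rl i) (fl i) c) d"
proof -
 note R = lp_ok_roots[OF assms]
 have a: "ip (%nu. c nu + c' nu) d = ip c d + ip c' d" if "lp_ok n c" "lp_ok n c'" for c c'
  using ip_lincomb[OF that, of 1 1 d] by simp
 have okD: "lp_ok n (%nu. of_int (nu i) * c nu)" by (rule lp_ok_scale[OF assms(1)])
 have okp: "lp_ok n (%nu. Nop (rm i j) (sw i j) c nu + Nop (rp i j) (ssw i j) c nu)" if "j \<in> {..<n}-{i}" for j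
  by (rule lp_ok_add[OF R(1,2)]) (use that in auto)
 have okS: "lp_ok n (%nu. \<Sum>j\<in>{..<n}-{i}. Nop (rm i j) (sw i j) c nu + Nop (rp i j) (ssw i j) c nu)"
  by (rule lp_ok_sum) (use okp in auto)
 have S: "ip (%nu. \<Sum>j\<in>{..<n}-{i}. Nop (rm i j) (sw i j) c nu + Nop (rp i j) (ssw i j) c nu) d =
   (\<Sum>j\<in>{..<n}-{i}. ip (Nop (rm i j) (sw i j) c) d + ip (Nop (rp i j) (ssw i j) c) d)"
  using okp by (subst ip_sum) (auto intro!: sum.cong a R)
 show ?thesis unfolding Sop_def[abs_def]
  by (simp only: a lp_ok_add okD okS lp_ok_scale R(3,4) ip_scale S)
qed

text \<open>Letting the regularisation tend to 0 in \<open>parts_sym\<close> turns each root term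
  into \<open>\<i>\<close> times the defect of self-adjointness of the corresponding
  \<open>Nop\<close>, with exactly the multiplicities of \<open>Sop i\<close>. The defects thus
  cancel that of the derivative term.\<close>

theorem Sop_adjoint:
 assumes "lp_ok n c" "lp_ok n d" "i < n"
 shows "ip (Sop i c) d = ip c (Sop i d)"
proof -
 let ?e = "%m. 1/(real m + 1)" and ?M = "torus_measure n"
 let ?dc = "%nu. of_int (nu i) * c nu" and ?dd = "%nu. of_int (nu i) * d nu"
 have em: "0 < ?e m" "?e m <= 1" for m by (auto simp: field_simps)
 define X where "X = (%m alpha s. LINT t|?M. of_real (cc (?e m) (ap n alpha t)) * Xt s c d t * wt (?e m) t)"
 define J where "J = (%m c d. LINT t|?M. of_real 1*(tev n c t * cnj (tev n d t)) * wt (?e m) t)"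
 define Z where "Z = (%alpha s. \<i>*(ip (Nop alpha s c) d - ip c (Nop alpha s d)))"
 have XZ: "(%m. X m alpha s) \<longlonglongrightarrow> Z alpha s" if "is_refl alpha s" "alpha i ~= 0" for alpha s
 proof -
  have "(LINT t|?M. \<i>*(tev n (Nop alpha s c) t * cnj (tev n d t) - tev n c t * cnj (tev n (Nop alpha s d) t)) * wt 0 t)
   = (LINT t|?M. \<i>*(tev n (Nop alpha s c) t * cnj (tev n d t) * wt 0 t - tev n c t * cnj (tev n (Nop alpha s d) t) * wt 0 t))"
   by (rule Bochner_Integration.integral_cong) (auto simp: algebra_simps)
  also have "... = Z alpha s" using ip_integrable by (simp add: Z_def ip_wt)
  finally show ?thesis using root_limit[OF that(1) assms(1,2) AE_cos_ap[OF assms(3), of alpha, OF that(2)]] unfolding X_def by simp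
 qed
 have JJ: "(%m. J m c d) \<longlonglongrightarrow> ip c d" for c d unfolding J_def ip_wt by (rule main_limit)
 have lim: "(%m. \<i>*(J m ?dc d - J m c ?dd)
   + of_real (theta/2)*(\<Sum>j\<in>{..<n}-{i}. X m (rm i j) (sw i j) + X m (rp i j) (ssw i j)) + of_real (k1/2) * X m (ee i) (fl i) + of_real k2 * X m (rl i) (fl i))
  \<longlonglongrightarrow> \<i>*(ip ?dc d - ip c ?dd)
   + of_real (theta/2)*(\<Sum>j\<in>{..<n}-{i}. Z (rm i j) (sw i j) + Z (rp i j) (ssw i j)) + of_real (k1/2) * Z (ee i) (fl i) + of_real k2 * Z (rl i) (fl i)"
 proof (intro tendsto_add tendsto_mult tendsto_const tendsto_diff tendsto_sum JJ)
  fix j assume j: "j \<in> {..<n} - {i}"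
  show "(%m. X m (rm i j) (sw i j)) \<longlonglongrightarrow> Z (rm i j) (sw i j)"
   by (rule XZ[OF is_refl_rm]) (use j in \<open>auto simp: rm_def ee_def\<close>)
  show "(%m. X m (rp i j) (ssw i j)) \<longlonglongrightarrow> Z (rp i j) (ssw i j)"
   by (rule XZ[OF is_refl_rp]) (use j in \<open>auto simp: rp_def ee_def\<close>)
 next
  show "(%m. X m (ee i) (fl i)) \<longlonglongrightarrow> Z (ee i) (fl i)" by (rule XZ[OF is_refl_ee]) (simp add: ee_def)
  show "(%m. X m (rl i) (fl i)) \<longlonglongrightarrow> Z (rl i) (fl i)" by (rule XZ[OF is_refl_rl]) (simp add: rl_def ee_def)
 qed
 have "\<i>*(J m ?dc d - J m c ?dd)
   + of_real (theta/2)*(\<Sum>j\<in>{..<n}-{i}. X m (rm i j) (sw i j) + X m (rp i j) (ssw i j)) + of_real (k1/2) * X m (ee i) (fl i) + of_real k2 * X m (rl i) (fl i) = 0" for m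
  unfolding J_def X_def by (rule parts_sym[OF assms em])
 then have z0: "\<i>*(ip ?dc d - ip c ?dd)
   + of_real (theta/2)*(\<Sum>j\<in>{..<n}-{i}. Z (rm i j) (sw i j) + Z (rp i j) (ssw i j)) + of_real (k1/2) * Z (ee i) (fl i) + of_real k2 * Z (rl i) (fl i) = 0"
  using lim by (simp add: LIMSEQ_const_iff)
 define S1 where "S1 = (\<Sum>j\<in>{..<n}-{i}. ip (Nop (rm i j) (sw i j) c) d + ip (Nop (rp i j) (ssw i j) c) d)"
 define S2 where "S2 = (\<Sum>j\<in>{..<n}-{i}. ip c (Nop (rm i j) (sw i j) d) + ip c (Nop (rp i j) (ssw i j) d))"
 have SZ: "(\<Sum>j\<in>{..<n}-{i}. Z (rm i j) (sw i j) + Z (rp i j) (ssw i j)) = \<i>*(S1 - S2)"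
  unfolding Z_def S1_def S2_def sum_subtractf[symmetric] sum_distrib_left by (rule sum.cong) (auto simp: algebra_simps)
 have z: "\<i>*(ip (Sop i c) d - (ip c ?dd
   + of_real (theta/2)*(\<Sum>j\<in>{..<n}-{i}. ip c (Nop (rm i j) (sw i j) d) + ip c (Nop (rp i j) (ssw i j) d))
   + of_real (k1/2) * ip c (Nop (ee i) (fl i) d) + of_real k2 * ip c (Nop (rl i) (fl i) d))) = 0"
  using z0[unfolded SZ] unfolding ip_Sop[OF assms(1,3)] Z_def S1_def[symmetric] S2_def[symmetric] by (simp add: algebra_simps)
 have "ip c (Sop i d) = cnj (ip (Sop i d) c)" by (simp add: ip_cnj)
 also have "... = ip c ?dd
   + of_real (theta/2)*(\<Sum>j\<in>{..<n}-{i}. ip c (Nop (rm i j) (sw i j) d) + ip c (Nop (rp i j) (ssw i j) d))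
   + of_real (k1/2) * ip c (Nop (ee i) (fl i) d) + of_real k2 * ip c (Nop (rl i) (fl i) d)"
  unfolding ip_Sop[OF assms(2,3)] by (simp add: ip_cnj)
 finally show ?thesis using z by simp
qed

lemma Sop_pow_adjoint:
 assumes "lp_ok n c" "lp_ok n d" "i < n"
 shows "ip ((Sop i ^^ m) c) d = ip c ((Sop i ^^ m) d)"
 using assms(2)
proof (induction m arbitrary: d)
 case (Suc m)
 have "ip ((Sop i ^^ Suc m) c) d = ip ((Sop i ^^ m) c) (Sop i d)"
  using Sop_adjoint[OF lp_ok_Sop_pow[OF assms(1,3)] Suc(2) assms(3)] by simp
 also have "... = ip c ((Sop i ^^ m) (Sop i d))" by (rule Suc(1)[OF lp_ok_Sop[OF Suc(2) assms(3)]])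
 finally show ?case by (simp add: funpow_swap1)
qed simp

lemma Dop_adjoint:
 assumes "lp_ok n c" "lp_ok n d"
 shows "ip (Dop k c) d = ip c (Dop k d)"
proof -
 have D: "ip (Dop k c) d = (\<Sum>i<n. ip ((Sop i ^^ (2*k)) c) d)" if "lp_ok n c" for c d
  unfolding Dop_def[abs_def] by (rule ip_sum) (auto intro: lp_ok_Sop_pow that)
 have "ip c (Dop k d) = cnj (ip (Dop k d) c)" by (simp add: ip_cnj)
 also have "... = (\<Sum>i<n. ip c ((Sop i ^^ (2*k)) d))" unfolding D[OF assms(2)] by (simp add: ip_cnj)
 also have "... = (\<Sum>i<n. ip ((Sop i ^^ (2*k)) c) d)" by (rule sum.cong) (auto simp: Sop_pow_adjoint[OF assms])
 finally show ?thesis using D[OF assms(1)] by simp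
qed

lemma ip_definite:
 assumes "lp_ok n c" "ip c c = 0"
 shows "c = (%_. 0)"
proof -
 let ?f = "%t. (cmod (tev n c t))\<^sup>2 * exp (Vw 0 t)"
 have e: "tev n c t * cnj (tev n c t) * of_real (exp (Vw 0 t)) = of_real (?f t)" for t
  by (simp only: complex_norm_square of_real_mult)
 have int: "integrable (torus_measure n) (%t. complex_of_real (?f t))"
  using ip_integrable[of c c] unfolding wt_def e .
 have "complex_of_real (LINT t|torus_measure n. ?f t) = ip c c"
  unfolding ip_def e by (rule integral_complex_of_real[symmetric])
 then have "(LINT t|torus_measure n. ?f t) = 0" using assms(2) by simp
 moreover have "integrable (torus_measure n) ?f" using int by (simp only: complex_of_real_integrable_eq)
 ultimately have "AE t in torus_measure n. ?f t = 0"
  by (subst (asm) integral_nonneg_eq_0_iff_AE) auto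
 then have "AE t in torus_measure n. tev n c t = 0" by eventually_elim auto
 then show ?thesis by (rule tev_AE_zero[OF assms(1)])
qed

text \<open>With these parameters \<open>2a + 1 = 2(k1 + k2)\<close> and
  \<open>2b + 1 = 2 k2\<close>. The factors \<open>|1 - z|^(2 k2)\<close> and
  \<open>|1 + z|^(2 k2)\<close> combine to \<open>|1 - z^2|^(2 k2)\<close>, the contribution of the
  long root.\<close>

lemma bc_weight_reg:
 assumes "reg t"
 shows "bc_weight n theta (k1 + k2 - 1/2) (k2 - 1/2) (%i. cis (t i)) = exp (Vw 0 t)"
proof -
 have neq: "cis x ~= cis y" if "cos (x - y) ~= 1" for x y
 proof
  assume "cis x = cis y"
  then have "(cmod (cis x - cis y))\<^sup>2 = 0" by simp
  then show False using that cmod_cis_diff[of x y] by simp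
 qed
 have P: "cmod (cis (t i) - cis (t j)) powr (2*theta) * cmod (1 - cis (t i) * cis (t j)) powr (2*theta)
   = exp (theta*(Lg 0 (t i - t j) + Lg 0 (t i + t j)))" if ij: "i < n" "j \<in> {i<..<n}" for i j
 proof -
  have "cos (ap n (rm i j) t) ~= 1" "cos (ap n (rp i j) t) ~= 1" using assms ij unfolding reg_def by auto
  then have c: "cos (t i - t j) ~= 1" "cos (t i + t j) ~= 1" using ij by (auto simp: ap_roots)
  have 1: "cis (t i) - cis (t j) ~= 0" using neq[OF c(1)] by simp
  have e: "1 - cis (t i) * cis (t j) = cis 0 - cis (t i + t j)" by (simp add: cis_mult)
  have 2: "cis 0 - cis (t i + t j) ~= 0" using neq[of 0 "t i + t j"] c(2) cos_minus[of "t i + t j"] by (simp add: algebra_simps)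
  have 3: "cos (0 - (t i + t j)) = cos (t i + t j)" using cos_minus[of "t i + t j"] by simp
  show ?thesis unfolding e powr_cmod[OF 1] powr_cmod[OF 2] cmod_cis_diff 3 Lg_def
   by (simp add: exp_add[symmetric] algebra_simps)
 qed
 have Q: "cmod (1 - cis (t i)) powr (2*(k1 + k2 - 1/2)+1) * cmod (1 + cis (t i)) powr (2*(k2 - 1/2)+1)
   = exp (k1 * Lg 0 (t i) + k2 * Lg 0 (2 * t i))" if i: "i < n" for i
 proof -
  have "cos (ap n (ee i) t) ~= 1" "cos (ap n (rl i) t) ~= 1" using assms i unfolding reg_def by auto
  then have c: "cos (t i) ~= 1" "cos (2 * t i) ~= 1" using i by (auto simp: ap_roots)
  have f: "cis 0 - cis (2 * t i) = (1 - cis (t i))*(1 + cis (t i))"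
   using cis_mult[of "t i" "t i"] by (simp add: algebra_simps)
  have 2: "cis 0 - cis (2 * t i) ~= 0" using neq[of 0 "2 * t i"] c(2) by simp
  then have nz: "1 - cis (t i) ~= 0" "1 + cis (t i) ~= 0" unfolding f by auto
  have l: "ln ((cmod (1 - cis (t i)))\<^sup>2) = Lg 0 (t i)" using cmod_cis_diff[of 0 "t i"] by (simp add: Lg_def)
  have "ln ((cmod (cis 0 - cis (2 * t i)))\<^sup>2) = Lg 0 (2 * t i)" using cmod_cis_diff[of 0 "2 * t i"] by (simp add: Lg_def)
  moreover have "ln ((cmod (cis 0 - cis (2 * t i)))\<^sup>2) = ln ((cmod (1 - cis (t i)))\<^sup>2) + ln ((cmod (1 + cis (t i)))\<^sup>2)"
   unfolding f norm_mult power_mult_distrib using nz by (intro ln_mult_pos) auto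
  ultimately have l2: "ln ((cmod (1 + cis (t i)))\<^sup>2) = Lg 0 (2 * t i) - Lg 0 (t i)" using l by simp
  have e1: "2*(k1 + k2 - 1/2)+1 = 2*(k1 + k2)" "2*(k2 - 1/2)+1 = 2 * k2" by simp_all
  show ?thesis unfolding e1 powr_cmod[OF nz(1)] powr_cmod[OF nz(2)] l l2 by (simp add: exp_add[symmetric] algebra_simps)
 qed
 let ?f = "%i j. Lg 0 (t i - t j) + Lg 0 (t i + t j)"
 have A: "(\<Prod>i<n. \<Prod>j\<in>{i<..<n}. cmod (cis (t i) - cis (t j)) powr (2*theta) * cmod (1 - cis (t i) * cis (t j)) powr (2*theta))
  = exp (\<Sum>i<n. \<Sum>j\<in>{i<..<n}. theta*?f i j)"
  unfolding exp_sum[OF finite_lessThan] exp_sum[OF finite_greaterThanLessThan] by (intro prod.cong refl) (use P in auto)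
 have B: "(\<Prod>i<n. cmod (1 - cis (t i)) powr (2*(k1 + k2 - 1/2)+1) * cmod (1 + cis (t i)) powr (2*(k2 - 1/2)+1))
  = exp (\<Sum>i<n. k1 * Lg 0 (t i) + k2 * Lg 0 (2 * t i))"
  unfolding exp_sum[OF finite_lessThan] by (intro prod.cong refl) (use Q in auto)
 have "?f i j = ?f j i" for i j using Lg_even[of 0 "t i - t j"] by (simp add: add.commute)
 from sum_pairs_symmetric[of ?f n, OF this]
 have C: "(\<Sum>i<n. \<Sum>j\<in>{i<..<n}. theta*?f i j) = theta/2*(\<Sum>i<n. \<Sum>j\<in>{..<n}-{i}. ?f i j)"
  by (simp add: sum_distrib_left[symmetric])
 have D: "Vw 0 t = theta/2*(\<Sum>i<n. \<Sum>j\<in>{..<n}-{i}. ?f i j) + (\<Sum>i<n. k1 * Lg 0 (t i) + k2 * Lg 0 (2 * t i))"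
  unfolding Vw_def by (intro arg_cong2[of _ _ _ _ "(+)"] arg_cong2[of _ _ _ _ "(*)"] sum.cong refl) (auto simp: ap_roots)
 show ?thesis unfolding bc_weight_def A B C D exp_add ..
qed

lemma lp_inner_ip: "lp_inner n theta (k1 + k2 - 1/2) (k2 - 1/2) c d = ip c d"
 unfolding lp_inner_def ip_def lp_eval_cis
proof (rule integral_cong_AE)
 have m: "(%t. bc_weight n theta (k1 + k2 - 1/2) (k2 - 1/2) (%i. cis (t i))) \<in> borel_measurable (torus_measure n)"
  unfolding bc_weight_def by measurable
 then show "(%t. tev n c t * cnj (tev n d t) * complex_of_real (bc_weight n theta (k1 + k2 - 1/2) (k2 - 1/2) (%i. cis (t i)))) \<in> borel_measurable (torus_measure n)"
  by measurable
 show "(%t. tev n c t * cnj (tev n d t) * complex_of_real (exp (Vw 0 t))) \<in> borel_measurable (torus_measure n)" by measurable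
 show "AE t in torus_measure n. tev n c t * cnj (tev n d t) * complex_of_real (bc_weight n theta (k1 + k2 - 1/2) (k2 - 1/2) (%i. cis (t i))) =
   tev n c t * cnj (tev n d t) * complex_of_real (exp (Vw 0 t))"
  using AE_reg by eventually_elim (simp add: bc_weight_reg)
qed

end

section \<open>The eigenvalues and their generating function\<close>

lemma sum_triangle_swap:
 fixes f :: "nat => real"
 shows "(\<Sum>i<n. \<Sum>j\<in>{i<..<n}. f j) = (\<Sum>j<n. real j * f j)" "(\<Sum>i<n. \<Sum>j<i. f j) = (\<Sum>j<n. (real n - 1 - real j) * f j)"
proof -
 have "(\<Sum>i<n. \<Sum>j\<in>{i<..<n}. f j) = (\<Sum>i<n. \<Sum>j\<in>{j. j < n \<and> i < j}. f j)"
  by (intro sum.cong refl arg_cong2[where f=sum]) auto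
 also have "... = (\<Sum>j<n. \<Sum>i\<in>{i. i < n \<and> i < j}. f j)"
  using sum.swap_restrict[of "{..<n}" "{..<n}" "%i j. f j" "%i j. i < j"] by (simp add: Int_def conj_commute)
 also have "... = (\<Sum>j<n. real j * f j)"
 proof (intro sum.cong refl)
  fix j assume "j \<in> {..<n}"
  then have "{i. i < n \<and> i < j} = {..<j}" by auto
  then show "(\<Sum>i\<in>{i. i < n \<and> i < j}. f j) = real j * f j" by simp
 qed
 finally show "(\<Sum>i<n. \<Sum>j\<in>{i<..<n}. f j) = (\<Sum>j<n. real j * f j)" .
 show "(\<Sum>i<n. \<Sum>j<i. f j) = (\<Sum>j<n. (real n - 1 - real j) * f j)"
  by (induction n) (auto simp: algebra_simps sum.distrib sum_subtractf simp flip: sum_distrib_left)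
qed

context bc
begin

text \<open>A bound for the l1 operator norm of one step of \<open>vv\<close> in both parities. The
  column sums are \<open>aa lam j + theta * j\<close> and
  \<open>aa lam j + 2 * rho0 + theta*(n - 1 - j)\<close>. The summand 1 only ensures
  \<open>Kb lam >= 1\<close>.\<close>

definition Kb :: "(nat => nat) => real" where
 "Kb lam = real (lam 0) + 2 * theta * real n + 2 * rho0 + 1"

definition aa :: "(nat => nat) => nat => real" where
 "aa lam i = real (lam i) + theta*(real n - 1 - real i)"

definition ll :: "(nat => nat) => nat => real" where
 "ll lam i = aa lam i + rho0"

lemma vv_even: "vv lam (2 * k + 1) i = aa lam i * vv lam (2*k) i - theta*(\<Sum>j\<in>{i<..<n}. vv lam (2*k) j)"
 by (simp add: aa_def)

lemma vv_odd: "vv lam (2 * Suc k) i = (aa lam i + 2 * rho0) * vv lam (2*k+1) i + theta*(\<Sum>j<i. vv lam (2*k+1) j)"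
proof -
 have e: "2 * Suc k = Suc (2*k+1)" by simp
 have "odd (2*k+1)" by simp
 then show ?thesis unfolding e vv.simps(2)[of lam "2*k+1" i] by (simp only: aa_def if_False)
qed

lemma Kb_ge_1: "Kb lam >= 1" using rho0_nonneg theta_pos by (simp add: Kb_def)

lemma vv_l1:
 assumes "is_partition_len n lam"
 shows "(\<Sum>i<n. \<bar>vv lam (Suc m) i\<bar>) <= Kb lam*(\<Sum>i<n. \<bar>vv lam m i\<bar>)"
proof -
 have dec: "real (lam i) <= real (lam 0)" for i using assms(1) by (auto simp: is_partition_len_def)
 have a0: "aa lam i >= 0" if "i < n" for i using that theta_pos by (simp add: aa_def)
 have th: "theta*(real n - 1 - real i) <= theta * real n" "theta * real i <= theta * real n" if "i < n" for i
  using theta_pos that by (intro mult_left_mono; simp)+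
 have fin: "(\<Sum>i<n. c i*\<bar>vv lam m i\<bar>) <= Kb lam*(\<Sum>i<n. \<bar>vv lam m i\<bar>)" if "\<And>i. i < n ==> c i <= Kb lam" for c
  unfolding sum_distrib_left using that by (intro sum_mono mult_right_mono) auto
 show ?thesis
 proof (cases "even m")
  case True
  have "(\<Sum>i<n. \<bar>vv lam (Suc m) i\<bar>) <= (\<Sum>i<n. aa lam i*\<bar>vv lam m i\<bar> + theta*(\<Sum>j\<in>{i<..<n}. \<bar>vv lam m j\<bar>))"
  proof (rule sum_mono)
   fix i assume i: "i \<in> {..<n}"
   have "\<bar>vv lam (Suc m) i\<bar> <= \<bar>aa lam i * vv lam m i\<bar> + \<bar>theta*(\<Sum>j\<in>{i<..<n}. vv lam m j)\<bar>"
    using True by (simp add: aa_def)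
   also have "... <= aa lam i*\<bar>vv lam m i\<bar> + theta*(\<Sum>j\<in>{i<..<n}. \<bar>vv lam m j\<bar>)"
    unfolding abs_mult using a0[of i] i theta_pos by (intro add_mono mult_mono sum_abs) auto
   finally show "\<bar>vv lam (Suc m) i\<bar> <= aa lam i*\<bar>vv lam m i\<bar> + theta*(\<Sum>j\<in>{i<..<n}. \<bar>vv lam m j\<bar>)" .
  qed
  also have "... = (\<Sum>i<n. (aa lam i + theta * real i)*\<bar>vv lam m i\<bar>)"
   unfolding sum.distrib sum_distrib_left[symmetric] sum_triangle_swap by (simp add: sum.distrib[symmetric] sum_distrib_left algebra_simps)
  also have "... <= Kb lam*(\<Sum>i<n. \<bar>vv lam m i\<bar>)"
  proof (rule fin)
   fix i assume "i < n"
   then show "aa lam i + theta * real i <= Kb lam" using dec[of i] th[of i] rho0_nonneg unfolding aa_def Kb_def by linarith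
  qed
  finally show ?thesis .
 next
  case False
  have "(\<Sum>i<n. \<bar>vv lam (Suc m) i\<bar>) <= (\<Sum>i<n. (aa lam i + 2 * rho0)*\<bar>vv lam m i\<bar> + theta*(\<Sum>j<i. \<bar>vv lam m j\<bar>))"
  proof (rule sum_mono)
   fix i assume i: "i \<in> {..<n}"
   have "\<bar>vv lam (Suc m) i\<bar> <= \<bar>(aa lam i + 2 * rho0) * vv lam m i\<bar> + \<bar>theta*(\<Sum>j<i. vv lam m j)\<bar>"
    using False by (simp add: aa_def)
   also have "... <= (aa lam i + 2 * rho0)*\<bar>vv lam m i\<bar> + theta*(\<Sum>j<i. \<bar>vv lam m j\<bar>)"
    unfolding abs_mult using a0[of i] i theta_pos rho0_nonneg by (intro add_mono mult_mono sum_abs) auto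
   finally show "\<bar>vv lam (Suc m) i\<bar> <= (aa lam i + 2 * rho0)*\<bar>vv lam m i\<bar> + theta*(\<Sum>j<i. \<bar>vv lam m j\<bar>)" .
  qed
  also have "... = (\<Sum>i<n. (aa lam i + 2 * rho0 + theta*(real n - 1 - real i))*\<bar>vv lam m i\<bar>)"
   unfolding sum.distrib sum_distrib_left[symmetric] sum_triangle_swap by (simp add: sum.distrib[symmetric] sum_distrib_left algebra_simps)
  also have "... <= Kb lam*(\<Sum>i<n. \<bar>vv lam m i\<bar>)"
  proof (rule fin)
   fix i assume "i < n"
   then show "aa lam i + 2 * rho0 + theta*(real n - 1 - real i) <= Kb lam" using dec[of i] th[of i] rho0_nonneg unfolding aa_def Kb_def by linarith
  qed
  finally show ?thesis .
 qed
qed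

lemma vv_bound:
 assumes "is_partition_len n lam" "i < n"
 shows "\<bar>vv lam m i\<bar> <= real n * Kb lam ^ m"
proof -
 have "(\<Sum>i<n. \<bar>vv lam m i\<bar>) <= real n * Kb lam ^ m"
 proof (induction m)
  case (Suc m)
  have "Kb lam*(\<Sum>i<n. \<bar>vv lam m i\<bar>) <= Kb lam*(real n * Kb lam ^ m)" using Suc Kb_ge_1[of lam] by (intro mult_left_mono) auto
  then show ?case using vv_l1[OF assms(1), of m] by (simp add: mult_ac del: vv.simps)
 qed simp
 moreover have "\<bar>vv lam m i\<bar> <= (\<Sum>i<n. \<bar>vv lam m i\<bar>)" using assms(2) by (intro member_le_sum) auto
 ultimately show ?thesis by linarith
qed

definition RR :: "(nat => nat) => real => real" where
 "RR lam w = (\<Sum>k. EE lam k/w ^ (k+1))"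

lemma vv_summable:
 assumes "is_partition_len n lam" "i < n" "w > (Kb lam)\<^sup>2"
 shows "summable (%k. vv lam (2*k) i/w ^ (k+1))" "summable (%k. vv lam (2*k+1) i/w ^ (k+1))"
proof -
 let ?K = "Kb lam"
 have K: "?K >= 1" by (rule Kb_ge_1)
 have w: "w > 0" using assms(3) by (smt (verit) zero_le_power2)
 define q where "q = ?K\<^sup>2/w"
 have q: "0 <= q" "q < 1" using w assms(3) by (auto simp: q_def)
 have gs: "summable (%k. real n*(?K/w) * q ^ k)" by (intro summable_mult summable_geometric) (use q in auto)
 have b: "\<bar>vv lam (2*k+e) i/w ^ (k+1)\<bar> <= real n*(?K/w) * q ^ k" if "e <= 1" for k e
 proof -
  have "\<bar>vv lam (2*k+e) i\<bar> <= real n*?K ^ (2*k+e)" by (rule vv_bound[OF assms(1,2)])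
  also have "... <= real n*?K ^ (2*k+1)" using K that by (intro mult_left_mono power_increasing) auto
  finally have "\<bar>vv lam (2*k+e) i\<bar>/w^(k+1) <= real n*?K ^ (2*k+1)/w^(k+1)" using w by (intro divide_right_mono) auto
  also have "... = real n*(?K/w) * q ^ k" by (simp add: q_def power_divide power_mult power_add)
  finally show ?thesis using w by (simp add: abs_divide)
 qed
 show "summable (%k. vv lam (2*k) i/w ^ (k+1))"
  by (rule summable_comparison_test'[OF gs, of 0]) (use b[of 0] in auto)
 show "summable (%k. vv lam (2*k+1) i/w ^ (k+1))"
  by (rule summable_comparison_test'[OF gs, of 0]) (use b[of 1] in auto)
qed

text \<open>In passing to the next row the sums \<open>X\<close> and \<open>Y\<close> mix, but when
  \<open>sig\<close> is a root of this quadratic equation the combination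
  \<open>Y + theta * sig * X\<close> is multiplied by a scalar factor.\<close>

lemma transfer_step:
 fixes w sig a b x y X Y r :: real
 assumes "y = a * x - theta*(X - x)" "w * x = b * y + Y" "b = a + 2 * r" "w = sig\<^sup>2 + (2 * r - theta) * sig"
 shows "(Y + theta * y + theta * sig*(X - x))*(w - (a + theta) * b) = (sig - a - theta)*(sig + b - theta)*(Y + theta * sig * X)"
proof -
 have Y: "Y = w * x - b * y" using assms(2) by simp
 show ?thesis unfolding Y assms(1) assms(4) assms(3) by algebra
qed

text \<open>The generating functions \<open>x i\<close> and \<open>y i\<close> of the even and odd
  steps solve a triangular system. For \<open>w = u^2 - c^2\<close> both roots
  \<open>sig = u - c\<close> and \<open>sig = - u - c\<close> lead to a product over the rows. After
  the last row \<open>X\<close> is empty, so the left sides coincide, and equating the right sides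
  eliminates \<open>Y\<close>.\<close>

theorem product_formula:
 assumes "is_partition_len n lam" "u\<^sup>2 - (rho0 - theta/2)\<^sup>2 > (Kb lam)\<^sup>2"
 defines "c \<equiv> rho0 - theta/2"
 defines "R \<equiv> RR lam (u\<^sup>2 - c\<^sup>2)"
 shows "(1 + theta*(u - c) * R)*(\<Prod>i<n. (u - theta/2)\<^sup>2 - (ll lam i)\<^sup>2) = (1 - theta*(u + c) * R)*(\<Prod>i<n. (u + theta/2)\<^sup>2 - (ll lam i)\<^sup>2)"
  and "summable (%k. EE lam k/(u\<^sup>2 - c\<^sup>2) ^ (k+1))"
proof -
 define w where "w = u\<^sup>2 - c\<^sup>2"
 have w: "w > (Kb lam)\<^sup>2" using assms(2) by (simp add: w_def c_def)
 have w0: "w > 0" using w by (smt (verit) zero_le_power2)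
 define x where "x = (%i. \<Sum>k. vv lam (2*k) i/w ^ (k+1))"
 define y where "y = (%i. \<Sum>k. vv lam (2*k+1) i/w ^ (k+1))"
 note sx = vv_summable(1)[OF assms(1) _ w] and sy = vv_summable(2)[OF assms(1) _ w]
 have y: "y i = aa lam i * x i - theta*(\<Sum>j\<in>{i<..<n}. x j)" if i: "i < n" for i
 proof -
  have "(%k. aa lam i*(vv lam (2*k) i/w^(k+1)) - theta*(\<Sum>j\<in>{i<..<n}. vv lam (2*k) j/w^(k+1))) sums (aa lam i * x i - theta*(\<Sum>j\<in>{i<..<n}. x j))"
   unfolding x_def by (intro sums_diff sums_mult sums_sum summable_sums sx) (use i in auto)
  moreover have "(%k. aa lam i*(vv lam (2*k) i/w^(k+1)) - theta*(\<Sum>j\<in>{i<..<n}. vv lam (2*k) j/w^(k+1))) = (%k. vv lam (2*k+1) i/w^(k+1))"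
   unfolding vv_even by (auto simp: diff_divide_distrib sum_divide_distrib[symmetric])
  ultimately show ?thesis unfolding y_def by (simp add: sums_iff)
 qed
 have x: "w * x i = (aa lam i + 2 * rho0) * y i + (1 + theta*(\<Sum>j<i. y j))" if i: "i < n" for i
 proof -
  have "(%k. (aa lam i + 2 * rho0)*(vv lam (2*k+1) i/w^(k+1)) + theta*(\<Sum>j<i. vv lam (2*k+1) j/w^(k+1))) sums ((aa lam i + 2 * rho0) * y i + theta*(\<Sum>j<i. y j))"
   unfolding y_def by (intro sums_add sums_mult sums_sum summable_sums sy) (use i in auto)
  moreover have "(%k. (aa lam i + 2 * rho0)*(vv lam (2*k+1) i/w^(k+1)) + theta*(\<Sum>j<i. vv lam (2*k+1) j/w^(k+1))) = (%k. vv lam (2 * Suc k) i/w^(k+1))"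
   unfolding vv_odd by (auto simp: add_divide_distrib sum_divide_distrib[symmetric])
  ultimately have s: "(%k. vv lam (2 * Suc k) i/w^(k+1)) sums ((aa lam i + 2 * rho0) * y i + theta*(\<Sum>j<i. y j))" by simp
  have "x i = vv lam 0 i/w + (\<Sum>k. vv lam (2 * Suc k) i/w^(Suc k+1))"
   unfolding x_def using suminf_split_head[OF sx[OF i]] by simp
  moreover have "(%k. vv lam (2 * Suc k) i/w^(Suc k+1)) sums (((aa lam i + 2 * rho0) * y i + theta*(\<Sum>j<i. y j))/w)"
   using sums_divide[OF s, of w] by (simp add: mult.commute)
  ultimately have "x i = 1/w + ((aa lam i + 2 * rho0) * y i + theta*(\<Sum>j<i. y j))/w" by (simp add: sums_iff)
  then show ?thesis using w0 by (simp add: field_simps)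
 qed
 have EEs: "(%k. EE lam k/w^(k+1)) sums (\<Sum>i<n. x i)"
 proof -
  have "(%k. \<Sum>i<n. vv lam (2*k) i/w^(k+1)) sums (\<Sum>i<n. x i)"
   unfolding x_def by (intro sums_sum summable_sums sx) auto
  then show ?thesis by (simp add: EE_def sum_divide_distrib)
 qed
 then show "summable (%k. EE lam k/(u\<^sup>2 - c\<^sup>2) ^ (k+1))" by (simp add: w_def sums_iff)
 have R: "R = (\<Sum>i<n. x i)" using EEs by (simp add: R_def RR_def w_def sums_iff)
 define X where "X = (%i. \<Sum>j\<in>{i..<n}. x j)"
 define Y where "Y = (%i. 1 + theta*(\<Sum>j<i. y j))"
 have step: "(Y (Suc i) + theta * sig * X (Suc i))*(w - (aa lam i + theta)*(aa lam i + 2 * rho0)) =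
   (sig - aa lam i - theta)*(sig + (aa lam i + 2 * rho0) - theta)*(Y i + theta * sig * X i)"
  if i: "i < n" and sig: "w = sig\<^sup>2 + (2 * rho0 - theta) * sig" for i sig
 proof -
  have Xi: "X i = x i + X (Suc i)" unfolding X_def using i by (simp add: sum.atLeast_Suc_lessThan)
  have ii: "{i<..<n} = {Suc i..<n}" by auto
  have "y i = aa lam i * x i - theta*(X i - x i)" using y[OF i] unfolding ii Xi by (simp add: X_def)
  moreover have "w * x i = (aa lam i + 2 * rho0) * y i + Y i" using x[OF i] by (simp add: Y_def)
  ultimately have "(Y i + theta * y i + theta * sig*(X i - x i))*(w - (aa lam i + theta)*(aa lam i + 2 * rho0)) =
   (sig - aa lam i - theta)*(sig + (aa lam i + 2 * rho0) - theta)*(Y i + theta * sig * X i)"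
   by (rule transfer_step) (use sig in auto)
  moreover have "Y (Suc i) = Y i + theta * y i" by (simp add: Y_def algebra_simps)
  moreover have "X (Suc i) = X i - x i" using Xi by simp
  ultimately show ?thesis by simp
 qed
 have prod: "(Y m + theta * sig * X m)*(\<Prod>i<m. w - (aa lam i + theta)*(aa lam i + 2 * rho0)) =
   (\<Prod>i<m. (sig - aa lam i - theta)*(sig + (aa lam i + 2 * rho0) - theta))*(1 + theta * sig * R)"
  if "m <= n" and sig: "w = sig\<^sup>2 + (2 * rho0 - theta) * sig" for m sig
  using that(1)
 proof (induction m)
  case 0
  show ?case by (simp add: Y_def X_def R atLeast0LessThan)
 next
  case (Suc m)
  have m: "m < n" using Suc by simp
  have "(Y (Suc m) + theta * sig * X (Suc m))*(\<Prod>i<Suc m. w - (aa lam i + theta)*(aa lam i + 2 * rho0)) =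
   ((Y (Suc m) + theta * sig * X (Suc m))*(w - (aa lam m + theta)*(aa lam m + 2 * rho0)))*(\<Prod>i<m. w - (aa lam i + theta)*(aa lam i + 2 * rho0))"
   by simp
  also have "... = (sig - aa lam m - theta)*(sig + (aa lam m + 2 * rho0) - theta)*((Y m + theta * sig * X m)*(\<Prod>i<m. w - (aa lam i + theta)*(aa lam i + 2 * rho0)))"
   unfolding step[OF m sig] by (simp only: mult.assoc)
  also have "... = (sig - aa lam m - theta)*(sig + (aa lam m + 2 * rho0) - theta)*((\<Prod>i<m. (sig - aa lam i - theta)*(sig + (aa lam i + 2 * rho0) - theta))*(1 + theta * sig * R))"
   using Suc by simp
  finally show ?case by simp
 qed
 have X0: "X n = 0" by (simp add: X_def)
 have s1: "w = (u - c)\<^sup>2 + (2 * rho0 - theta)*(u - c)" "w = (- u - c)\<^sup>2 + (2 * rho0 - theta)*(- u - c)"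
  by (auto simp: w_def c_def power2_eq_square algebra_simps)
 have eq: "(\<Prod>i<n. (u - c - aa lam i - theta)*(u - c + (aa lam i + 2 * rho0) - theta))*(1 + theta*(u - c) * R) =
  (\<Prod>i<n. (- u - c - aa lam i - theta)*(- u - c + (aa lam i + 2 * rho0) - theta))*(1 + theta*(- u - c) * R)"
  using prod[OF order_refl s1(1)] prod[OF order_refl s1(2)] unfolding X0 by simp
 have e1: "(u - c - aa lam i - theta)*(u - c + (aa lam i + 2 * rho0) - theta) = (u - theta/2)\<^sup>2 - (ll lam i)\<^sup>2" for i
  by (simp add: c_def ll_def power2_eq_square algebra_simps)
 have e2: "(- u - c - aa lam i - theta)*(- u - c + (aa lam i + 2 * rho0) - theta) = (u + theta/2)\<^sup>2 - (ll lam i)\<^sup>2" for i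
  by (simp add: c_def ll_def power2_eq_square algebra_simps)
 have e3: "1 + theta*(- u - c) * R = 1 - theta*(u + c) * R" by (simp add: algebra_simps)
 show "(1 + theta*(u - c) * R)*(\<Prod>i<n. (u - theta/2)\<^sup>2 - (ll lam i)\<^sup>2) = (1 - theta*(u + c) * R)*(\<Prod>i<n. (u + theta/2)\<^sup>2 - (ll lam i)\<^sup>2)"
  using eq unfolding e1 e2 e3 by (metis mult.commute)
qed

lemma ll_nonneg: "i < n ==> ll lam i >= 0"
 using theta_pos rho0_nonneg by (simp add: ll_def aa_def)

lemma ll_strict: "is_partition_len n lam ==> i < j ==> ll lam j < ll lam i"
proof -
 assume a: "is_partition_len n lam" "i < j"
 have "real (lam j) <= real (lam i)" using a by (auto simp: is_partition_len_def)
 moreover have "theta * real i < theta * real j" using a theta_pos by simp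
 ultimately show ?thesis by (simp add: ll_def aa_def algebra_simps)
qed

lemma ll_le_Kb: "is_partition_len n lam ==> i < n ==> ll lam i < Kb lam"
proof -
 assume a: "is_partition_len n lam" "i < n"
 have "real (lam i) <= real (lam 0)" using a by (auto simp: is_partition_len_def)
 moreover have "theta*(real n - 1 - real i) <= 2 * theta * real n" using theta_pos a(2) by (simp add: algebra_simps)
 ultimately show ?thesis using rho0_nonneg by (simp add: ll_def aa_def Kb_def)
qed

text \<open>Equal eigenvalues give equal generating functions, so for large arguments the ratio of
  the two products is periodic with period \<open>theta\<close>. It tends to 1 at infinity, hence
  equals 1. The nonnegative, strictly decreasing \<open>ll\<close> are then read off from the
  zeros.\<close>

theorem EE_inj:
 assumes "is_partition_len n lam" "is_partition_len n mu" "\<And>k. EE lam k = EE mu k"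
 shows "lam = mu"
proof -
 define c where "c = rho0 - theta/2"
 define P where "P = (%lam u. \<Prod>i<n. u\<^sup>2 - (ll lam i)\<^sup>2)"
 define v0 where "v0 = Kb lam + Kb mu + \<bar>c\<bar>"
 have K: "Kb lam >= 1" "Kb mu >= 1" using Kb_ge_1 by auto
 have Ppos: "P lam v > 0" "P mu v > 0" if "v >= v0" for v
  unfolding P_def using that K ll_le_Kb[OF assms(1)] ll_le_Kb[OF assms(2)] ll_nonneg
  by (auto intro!: prod_pos power_strict_mono simp: v0_def) (smt (verit))+
 have per: "P lam v/P mu v = P lam (v + theta)/P mu (v + theta)" if v: "v >= v0" for v
 proof -
  define u where "u = v + theta/2"
  define R where "R = RR lam (u\<^sup>2 - c\<^sup>2)"
  have Rm: "R = RR mu (u\<^sup>2 - c\<^sup>2)" by (simp add: R_def RR_def assms(3))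
  have uv: "u - theta/2 = v" "u + theta/2 = v + theta" by (simp_all add: u_def)
  have uu: "u >= v0" using v theta_pos by (simp add: u_def)
  have big: "u\<^sup>2 - c\<^sup>2 > k\<^sup>2" if k: "0 <= k" "k < Kb lam + Kb mu" for k
  proof -
   have "k + \<bar>c\<bar> < u" using uu k by (simp add: v0_def)
   then have "(k + \<bar>c\<bar>)\<^sup>2 < u\<^sup>2" using k by (intro power_strict_mono) auto
   moreover have "(k + \<bar>c\<bar>)\<^sup>2 >= k\<^sup>2 + c\<^sup>2" using k by (simp add: power2_eq_square algebra_simps)
   ultimately show ?thesis by simp
  qed
  have f1: "(1 + theta*(u - c) * R) * P lam v = (1 - theta*(u + c) * R) * P lam (v + theta)"
   using product_formula(1)[OF assms(1), of u, folded c_def] big[of "Kb lam"] K unfolding uv R_def[symmetric] P_def by simp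
  have f2: "(1 + theta*(u - c) * R) * P mu v = (1 - theta*(u + c) * R) * P mu (v + theta)"
   using product_formula(1)[OF assms(2), of u, folded c_def] big[of "Kb mu"] K unfolding uv Rm[symmetric] P_def by simp
  define A where "A = 1 + theta*(u - c) * R"
  define B where "B = 1 - theta*(u + c) * R"
  have pos: "P lam v > 0" "P mu v > 0" "P lam (v + theta) > 0" "P mu (v + theta) > 0"
   using Ppos[of v] Ppos[of "v + theta"] v theta_pos by auto
  have fA: "A * P lam v = B * P lam (v + theta)" "A * P mu v = B * P mu (v + theta)" using f1 f2 by (simp_all add: A_def B_def)
  have "A ~= 0"
  proof
   assume "A = 0"
   then have "B = 0" using fA(1) pos by auto
   moreover have "A - B = theta*(2 * u) * R" by (simp add: A_def B_def algebra_simps)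
   ultimately have "theta*(2 * u) * R = 0" using \<open>A = 0\<close> by simp
   moreover have "u > 0" using uu K by (simp add: v0_def)
   ultimately have "R = 0" using theta_pos by simp
   then show False using \<open>A = 0\<close> by (simp add: A_def)
  qed
  have "A*(P lam v * P mu (v + theta)) = B * P lam (v + theta) * P mu (v + theta)" using fA(1) by (simp add: mult.assoc[symmetric])
  also have "... = A*(P mu v * P lam (v + theta))" using fA(2) by (simp add: algebra_simps)
  finally have "P lam v * P mu (v + theta) = P mu v * P lam (v + theta)" using \<open>A ~= 0\<close> by simp
  then show ?thesis using pos by (simp add: field_simps)
 qed
 have eq1: "P lam v = P mu v" if v: "v >= v0" for v
 proof -
  have it: "P lam v/P mu v = P lam (v + real m * theta)/P mu (v + real m * theta)" for m
  proof (induction m)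
   case (Suc m)
   have "v + real m * theta >= v0" using v theta_pos by (simp add: add_increasing2)
   from per[OF this] Suc show ?case by (simp add: algebra_simps)
  qed simp
  have "((%x::real. (x\<^sup>2 - a)/(x\<^sup>2 - b)) \<longlongrightarrow> 1) at_top" for a b :: real by real_asymp
  then have "((%x. \<Prod>i<n. (x\<^sup>2 - (ll lam i)\<^sup>2)/(x\<^sup>2 - (ll mu i)\<^sup>2)) \<longlongrightarrow> (\<Prod>i<n. 1)) at_top"
   by (intro tendsto_prod)
  then have lim: "((%x. P lam x/P mu x) \<longlongrightarrow> 1) at_top" by (simp add: P_def prod_dividef)
  have "filterlim (%m. v + real m * theta) at_top sequentially" using theta_pos by real_asymp
  from filterlim_compose[OF lim this] have "(%m. P lam v/P mu v) \<longlonglongrightarrow> 1" by (simp add: it[symmetric])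
  then have "P lam v/P mu v = 1" by (simp add: LIMSEQ_const_iff)
  then show ?thesis using Ppos[OF v] by simp
 qed
 define pl where "pl = (%lam. \<Prod>i<n. [:- ((ll lam i)\<^sup>2), 0, 1:])"
 have ev: "poly (pl lam) v = P lam v" for lam v by (simp add: pl_def P_def poly_prod power2_eq_square algebra_simps)
 have "pl lam = pl mu"
 proof (rule ccontr)
  assume "pl lam ~= pl mu"
  then have "finite {v. poly (pl lam - pl mu) v = 0}" by (intro poly_roots_finite) auto
  moreover have "{v0..} \<subseteq> {v. poly (pl lam - pl mu) v = 0}" using eq1 by (auto simp: ev)
  ultimately show False using infinite_Ici[of v0] finite_subset by blast
 qed
 then have eq: "P lam v = P mu v" for v using ev by metis
 have mem: "\<exists>j<n. ll l2 j = ll l1 i" if "i < n" "P l1 = P l2" for i l1 l2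
 proof -
  have "P l1 (ll l1 i) = 0" unfolding P_def using that(1) by (intro prod_zero) auto
  then have "P l2 (ll l1 i) = 0" using that by simp
  then obtain j where "j < n" "(ll l1 i)\<^sup>2 - (ll l2 j)\<^sup>2 = 0" unfolding P_def by (auto simp: prod_zero_iff)
  then have "ll l2 j = ll l1 i" using ll_nonneg[OF that(1), of l1] ll_nonneg[of j l2] by (simp add: power2_eq_iff_nonneg)
  then show ?thesis using \<open>j < n\<close> by blast
 qed
 have main: "ll lam i = ll mu i" if "i < n" for i
  using that
 proof (induction i rule: less_induct)
  case (less i)
  have no: "\<not> ll l1 i > ll l2 i" if p: "is_partition_len n l1" "is_partition_len n l2" "P l1 = P l2" "\<And>j. j < i ==> ll l1 j = ll l2 j" for l1 l2
  proof
   assume gt: "ll l1 i > ll l2 i"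
   obtain j where j: "j < n" "ll l2 j = ll l1 i" using mem[OF less(2) p(3)] by blast
   consider "j < i" | "j = i" | "j > i" by linarith
   then show False
   proof cases
    case 1 then show False using p(4)[of j] ll_strict[OF p(1) 1] j by simp
   next
    case 2 then show False using gt j by simp
   next
    case 3 then show False using ll_strict[OF p(2) 3] gt j by simp
   qed
  qed
  have IH: "\<And>j. j < i ==> ll lam j = ll mu j" using less by auto
  have PP: "P lam = P mu" using eq by auto
  show ?case using no[OF assms(1,2) PP IH] no[OF assms(2,1) PP[symmetric] IH[symmetric]] by force
 qed
 show "lam = mu"
 proof
  fix i
  show "lam i = mu i"
  proof (cases "i < n")
   case True
   then show ?thesis using main[OF True] by (simp add: ll_def aa_def)
  next
   case False
   then show ?thesis using assms(1,2) by (simp add: is_partition_len_def)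
  qed
 qed
qed

end

section \<open>Identification with the Jacobi polynomials\<close>

lemma lp_eval_pm:
 assumes "sig permutes {..<n}"
 shows "lp_eval n (c \<circ> pm sig) z = lp_eval n c (z \<circ> sig)"
 unfolding lp_eval_def
proof (rule sum.reindex_bij_witness[of _ "pm (inv sig)" "pm sig"])
 fix a
 show "pm (inv sig) (pm sig a) = a" "pm sig (pm (inv sig) a) = a"
  by (auto simp: pm_def permutes_inverses[OF assms])
 have "(\<Prod>i<n. z (sig i) powi a (sig i)) = (\<Prod>i<n. z i powi a i)"
  by (rule prod.reindex_bij_witness[of _ "inv sig" sig])
   (auto simp: permutes_inverses[OF assms] permutes_in_image[OF assms, simplified] permutes_in_image[OF permutes_inv[OF assms], simplified])
 then show "c (pm sig a)*(\<Prod>i<n. (z \<circ> sig) i powi pm sig a i) = (c \<circ> pm sig) a*(\<Prod>i<n. z i powi a i)"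
  by (simp add: pm_def)
qed (auto simp: pm_def permutes_inverses[OF assms])

lemma lp_eval_fl:
 assumes "i < n"
 shows "lp_eval n (c \<circ> fl i) z = lp_eval n c (z(i := inverse (z i)))"
 unfolding lp_eval_def
proof (rule sum.reindex_bij_witness[of _ "fl i" "fl i"])
 fix a
 show ff: "fl i (fl i a) = a" "fl i (fl i a) = a" by (auto simp: fl_def)
 show "fl i a \<in> {alpha. (c \<circ> fl i) alpha ~= 0}" if "a \<in> {alpha. c alpha ~= 0}" using that ff by simp
 have "(\<Prod>k<n. (z(i := inverse (z i))) k powi fl i a k) = (\<Prod>k<n. z k powi a k)"
  by (rule prod.cong) (auto simp: fl_def power_int_minus power_int_inverse)
 then show "c (fl i a)*(\<Prod>k<n. (z(i := inverse (z i))) k powi fl i a k) = (c \<circ> fl i) a*(\<Prod>k<n. z k powi a k)" by simp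
qed (auto simp: fl_def)

lemma lp_eval_inj:
 assumes "lp_ok n c" "lp_ok n d" "\<And>z. (\<And>i. i < n ==> z i ~= 0) ==> lp_eval n c z = lp_eval n d z"
 shows "c = d"
proof -
 have "tev n (%nu. c nu - d nu) t = 0" for t
  unfolding tev_diff[OF lp_ok_fin[OF assms(1)] lp_ok_fin[OF assms(2)]] lp_eval_cis[symmetric] using assms(3) by simp
 moreover have "lp_ok n (%nu. c nu - d nu)" using lp_ok_lincomb[OF assms(1,2), of 1 "-1"] by simp
 ultimately have "(%nu. c nu - d nu) = (%_. 0)" by (intro tev_AE_zero) auto
 then show ?thesis by (auto simp: fun_eq_iff)
qed

definition coeff_inv :: "nat => lpoly => bool" where
 "coeff_inv n c \<longleftrightarrow> (\<forall>p<n. c \<circ> fl p = c) \<and> (\<forall>sig. sig permutes {..<n} --> c \<circ> pm sig = c)"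

lemma lp_ok_fl': "lp_ok n c ==> p < n ==> lp_ok n (c \<circ> fl p)"
 by (rule lp_ok_comp[OF _ inj_maps(1)]) (auto simp: fl_def)

lemma lp_ok_pm': "lp_ok n c ==> sig permutes {..<n} ==> lp_ok n (c \<circ> pm sig)"
 by (rule lp_ok_comp[OF _ inj_pm]) (auto simp: pm_def permutes_def)

lemma bc_invariant_iff:
 assumes "lp_ok n c"
 shows "bc_invariant n c \<longleftrightarrow> coeff_inv n c"
proof
 assume "coeff_inv n c"
 then show "bc_invariant n c" unfolding bc_invariant_def coeff_inv_def
  using lp_eval_pm[of _ n c] lp_eval_fl[of _ n c] by metis
next
 assume b: "bc_invariant n c"
 show "coeff_inv n c" unfolding coeff_inv_def
 proof (intro conjI allI impI)
  fix p assume p: "p < n"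
  show "c \<circ> fl p = c"
   by (rule lp_eval_inj[OF lp_ok_fl'[OF assms p] assms]) (use b p in \<open>auto simp: lp_eval_fl bc_invariant_def\<close>)
 next
  fix sig assume s: "sig permutes {..<n}"
  show "c \<circ> pm sig = c"
   by (rule lp_eval_inj[OF lp_ok_pm'[OF assms s] assms]) (use b s in \<open>auto simp: lp_eval_pm bc_invariant_def\<close>)
 qed
qed

lemma coeff_inv_lincomb: "coeff_inv n c ==> coeff_inv n d ==> coeff_inv n (%nu. x * c nu + y * d nu)"
 unfolding coeff_inv_def by (auto simp: fun_eq_iff)

text \<open>The lexicographic order is well founded on natural number vectors of fixed length,
  unlike on integer exponents. Induction over leading terms therefore runs through
  partitions.\<close>

lemma wf_lex_partitions: "wf {(mu, nu). lex_less n (int \<circ> mu) (int \<circ> nu)}"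
proof (rule wf_subset)
 show "wf (inv_image (lexn less_than n) (%mu. map mu [0..<n]))" by (intro wf_inv_image wf_lexn) simp
 show "{(mu, nu). lex_less n (int \<circ> mu) (int \<circ> nu)} \<subseteq> inv_image (lexn less_than n) (%mu. map mu [0..<n])"
 proof clarify
  fix mu nu :: "nat => nat" assume "lex_less n (int \<circ> mu) (int \<circ> nu)"
  then obtain k where k: "k < n" "\<And>i. i < k ==> mu i = nu i" "mu k < nu k" by (auto simp: lex_less_def)
  have "[0..<n] = [0..<k] @ k # [Suc k..<n]" using k(1) upt_add_eq_append[of 0 k "n - k"] upt_conv_Cons[of k n] by simp
  then have "map mu [0..<n] = map nu [0..<k] @ mu k # map mu [Suc k..<n]" "map nu [0..<n] = map nu [0..<k] @ nu k # map nu [Suc k..<n]"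
   using k(2) by auto
  then show "(mu, nu) \<in> inv_image (lexn less_than n) (%mu. map mu [0..<n])"
   unfolding in_inv_image lexn_conv using k(1,3) by auto
 qed
qed

text \<open>The lexicographically largest exponent of an invariant Laurent polynomial cannot be
  enlarged by a sign change or an adjacent transposition, so it is nonnegative and
  decreasing.\<close>

lemma leading_partition:
 assumes "lp_ok n c" "coeff_inv n c" "c ~= (%_. 0)"
 shows "\<exists>mu. is_partition_len n mu \<and> c (int \<circ> mu) ~= 0 \<and> (\<forall>alpha. c alpha ~= 0 --> alpha = int \<circ> mu \<or> lex_less n alpha (int \<circ> mu))"
proof -
 have "finite {alpha. c alpha ~= 0}" "{alpha. c alpha ~= 0} ~= {}" using assms by (auto simp: lp_ok_def)
 from finite_lex_max[OF this, of n] obtain nu where nu: "c nu ~= 0" "\<And>alpha. c alpha ~= 0 ==> lexle n alpha nu" by blast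
 have z: "alpha k = 0" if "c alpha ~= 0" "k >= n" for alpha k using assms(1) that by (auto simp: lp_ok_def)
 have nn: "nu i >= 0" if i: "i < n" for i
 proof (rule ccontr)
  assume "\<not> nu i >= 0"
  then have "lex_less n nu (fl i nu)" unfolding lex_less_def using i by (intro exI[of _ i]) (auto simp: fl_def)
  moreover have "c (fl i nu) = c nu" using assms(2) i by (auto simp: coeff_inv_def fun_eq_iff)
  ultimately show False using nu lex_asym by metis
 qed
 have step: "nu (Suc i) <= nu i" if i: "Suc i < n" for i
 proof (rule ccontr)
  assume "\<not> ?thesis"
  then have "lex_less n nu (sw i (Suc i) nu)" unfolding lex_less_def using i by (intro exI[of _ i]) (auto simp: sw_def)
  moreover have "c (sw i (Suc i) nu) = c nu"
  proof -
   have "Transposition.transpose i (Suc i) permutes {..<n}" using i by (intro permutes_swap_id) auto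
   then show ?thesis using assms(2) by (auto simp: coeff_inv_def fun_eq_iff sw_pm)
  qed
  ultimately show False using nu lex_asym by metis
 qed
 have all: "nu (Suc i) <= nu i" for i
 proof (cases "Suc i < n")
  case False
  then show ?thesis using z[OF nu(1), of "Suc i"] nn[of i] z[OF nu(1), of i] by (cases "i < n") auto
 qed (rule step)
 define mu where "mu = (%i. nat (nu i))"
 have "nu i >= 0" for i using nn[of i] z[OF nu(1), of i] by (cases "i < n") auto
 then have e: "int \<circ> mu = nu" by (auto simp: mu_def fun_eq_iff)
 have "mu j <= mu i" if "i <= j" for i j using that lift_Suc_antimono_le[of mu] all by (simp add: mu_def nat_mono)
 then have "is_partition_len n mu" using z[OF nu(1)] by (auto simp: is_partition_len_def mu_def)
 moreover have "alpha = nu \<or> lex_less n alpha nu" if "c alpha ~= 0" for alpha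
 proof -
  have "alpha i = nu i" if "\<forall>i<n. alpha i = nu i" for i using that z[OF \<open>c alpha ~= 0\<close>, of i] z[OF nu(1), of i] by (cases "i < n") auto
  then show ?thesis using nu(2)[OF that] unfolding lexle_def by blast
 qed
 ultimately show ?thesis using nu(1) e by metis
qed

context bc
begin

text \<open>Subtracting the multiple of \<open>J mu\<close> with the same leading coefficient leaves
  an invariant polynomial with a smaller leading partition. Well-founded induction thus reduces
  orthogonality to the members of the family.\<close>

lemma orthogonal_lower:
 assumes "\<And>mu. is_partition_len n mu ==> lp_ok n (J mu) \<and> coeff_inv n (J mu) \<and> J mu (int \<circ> mu) = 1 \<and>
   (\<forall>alpha. J mu alpha ~= 0 --> alpha = int \<circ> mu \<or> lex_less n alpha (int \<circ> mu))"
  "\<And>mu. is_partition_len n mu ==> lex_less n (int \<circ> mu) xi ==> ip G (J mu) = 0"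
  "lp_ok n c" "coeff_inv n c" "\<And>alpha. c alpha ~= 0 ==> lex_less n alpha xi"
 shows "ip G c = 0"
proof -
 have main: "ip G c = 0" if "is_partition_len n mu" "lp_ok n c" "coeff_inv n c" "\<And>alpha. c alpha ~= 0 ==> alpha = int \<circ> mu \<or> lex_less n alpha (int \<circ> mu)"
  "lex_less n (int \<circ> mu) xi" for mu c
  using that
 proof (induction mu arbitrary: c rule: wf_induct_rule[OF wf_lex_partitions[of n]])
  case (1 mu c)
  note J = assms(1)[OF 1(2)]
  define d where "d = (%\<nu>. 1 * c \<nu> + (- c (int \<circ> mu)) * J mu \<nu>)"
  have ok: "lp_ok n d" unfolding d_def by (intro lp_ok_lincomb 1) (use J in auto)
  have ci: "coeff_inv n d" unfolding d_def by (intro coeff_inv_lincomb 1) (use J in auto)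
  have dl: "lex_less n alpha (int \<circ> mu)" if "d alpha ~= 0" for alpha
  proof -
   have "alpha ~= int \<circ> mu" using that J by (auto simp: d_def)
   moreover have "c alpha ~= 0 \<or> J mu alpha ~= 0" using that by (auto simp: d_def)
   ultimately show ?thesis using 1(5) J by blast
  qed
  have "ip G d = 0"
  proof (cases "d = (%_. 0)")
   case True
   then show ?thesis by (simp add: ip_def tev_def)
  next
   case False
   from leading_partition[OF ok ci this] obtain nu where nu: "is_partition_len n nu" "d (int \<circ> nu) ~= 0"
    "\<And>alpha. d alpha ~= 0 ==> alpha = int \<circ> nu \<or> lex_less n alpha (int \<circ> nu)" by blast
   have "lex_less n (int \<circ> nu) (int \<circ> mu)" by (rule dl[OF nu(2)])
   then show ?thesis using 1(1)[of nu d] nu ok ci lex_trans[OF _ 1(6)] by blast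
  qed
  moreover have "ip G (J mu) = 0" by (rule assms(2)[OF 1(2) 1(6)])
  moreover have "ip G d = ip G c + cnj (- c (int \<circ> mu)) * ip G (J mu)"
   unfolding d_def using ip_lincomb_right[of c "J mu" G 1 "- c (int \<circ> mu)"] 1 J by simp
  ultimately show ?case by simp
 qed
 show ?thesis
 proof (cases "c = (%_. 0)")
  case True
  then show ?thesis by (simp add: ip_def tev_def)
 next
  case False
  from leading_partition[OF assms(3,4) this] obtain nu where nu: "is_partition_len n nu" "c (int \<circ> nu) ~= 0"
    "\<And>alpha. c alpha ~= 0 ==> alpha = int \<circ> nu \<or> lex_less n alpha (int \<circ> nu)" by blast
  then show ?thesis using main[OF nu(1) assms(3,4)] assms(5) by blast
 qed
qed

lemma PP_lex:
 assumes "mu \<in> PP (int \<circ> lam)" "\<And>k. k >= n ==> mu k = 0" "is_partition_len n lam"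
 shows "mu = int \<circ> lam \<or> lex_less n mu (int \<circ> lam)"
proof -
 have "wact id {} mu = mu" by (auto simp: wact_def)
 then have "lexle n mu (int \<circ> lam)" using assms(1) permutes_id[of "{..<n}"] unfolding PP_def mem_Collect_eq by metis
 moreover have "mu = int \<circ> lam" if "\<forall>i<n. mu i = (int \<circ> lam) i"
 proof
  fix i show "mu i = (int \<circ> lam) i" using that assms(2)[of i] assms(3) by (cases "i < n") (auto simp: is_partition_len_def)
 qed
 ultimately show ?thesis unfolding lexle_def by blast
qed

text \<open>Next to support, invariance and leading coefficient this records nonnegativity of the
  coefficients and the eigenvalue equations, the two facts on which the asymptotic part
  rests.\<close>

definition jac_prop :: "(nat => nat) => lpoly => bool" where
 "jac_prop lam F \<longleftrightarrow> lp_ok n F \<and> (\<forall>mu. F mu \<in> \<real>\<^sub>\<ge>\<^sub>0) \<and> F (int \<circ> lam) = 1 \<and> coeff_inv n F \<and>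
   (\<forall>alpha. F alpha ~= 0 --> alpha = int \<circ> lam \<or> lex_less n alpha (int \<circ> lam)) \<and>
   (\<forall>k. Dop k F = (%nu. of_real (EE lam k) * F nu))"

lemma jac_exists:
 assumes "is_partition_len n lam"
 shows "\<exists>F. jac_prop lam F"
proof -
 let ?h = "int \<circ> lam"
 obtain F where F: "lp_ok n F" "\<And>mu. F mu \<in> \<real>\<^sub>\<ge>\<^sub>0" "F ?h ~= 0" "\<And>mu. F mu ~= 0 ==> mu \<in> PP ?h"
   "\<And>p. p < n ==> F \<circ> fl p = F" "\<And>sig. sig permutes {..<n} ==> F \<circ> pm sig = F" "\<And>k. \<exists>x. Dop k F = (%nu. x * F nu)"
  using sym_eigenfunction[OF assms] by blast
 define q where "q = inverse (F ?h)"
 have q: "q \<in> \<real>\<^sub>\<ge>\<^sub>0" "q ~= 0" "q * F ?h = 1" unfolding q_def using F(2)[of ?h] F(3) by (auto intro: nonneg_Reals_inverse_I)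
 define G where "G = (%nu. q * F nu)"
 have "lp_ok n G" unfolding G_def by (rule lp_ok_scale[OF F(1)])
 moreover have "G mu \<in> \<real>\<^sub>\<ge>\<^sub>0" for mu unfolding G_def using q F(2) by (auto intro: nonneg_Reals_mult_I)
 moreover have "G ?h = 1" using q by (simp add: G_def)
 moreover have "coeff_inv n G"
 proof -
  have "coeff_inv n F" using F(5,6) by (simp add: coeff_inv_def)
  then show ?thesis using coeff_inv_lincomb[of n F F q 0] by (simp add: G_def)
 qed
 moreover have "alpha = ?h \<or> lex_less n alpha ?h" if "G alpha ~= 0" for alpha
  using PP_lex[OF F(4) _ assms] that F(1) q by (auto simp: G_def lp_ok_def)
 moreover have "Dop k G = (%nu. of_real (EE lam k) * G nu)" for k
 proof -
  obtain x where x: "Dop k F = (%nu. x * F nu)" using F(7) by blast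
  have "Dop k F = (%nu. of_real (EE lam k) * F nu)"
   by (rule Dop_eigenvalue[OF assms F(1) _ _ _ F(3) x]) (use F(4,5,6) in auto)
  then show ?thesis using Dop_lincomb[OF F(1,1), of k q 0] by (simp add: G_def algebra_simps)
 qed
 ultimately show ?thesis unfolding jac_prop_def by blast
qed

lemma jac_orthogonal:
 assumes "is_partition_len n lam" "is_partition_len n mu" "lam ~= mu" "jac_prop lam F" "jac_prop mu G"
 shows "ip F G = 0"
proof -
 obtain k where k: "EE lam k ~= EE mu k" using EE_inj[OF assms(1,2)] assms(3) by blast
 have F: "lp_ok n F" "Dop k F = (%nu. of_real (EE lam k) * F nu)" using assms(4) by (auto simp: jac_prop_def)
 have G: "lp_ok n G" "Dop k G = (%nu. of_real (EE mu k) * G nu)" using assms(5) by (auto simp: jac_prop_def)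
 have "of_real (EE lam k) * ip F G = ip (Dop k F) G" unfolding F(2) ip_scale[OF F(1)] ..
 also have "... = ip F (Dop k G)" by (rule Dop_adjoint[OF F(1) G(1)])
 also have "... = of_real (EE mu k) * ip F G" unfolding G(2) ip_scale_right[OF G(1)] by simp
 finally show ?thesis using k by simp
qed

text \<open>\<open>jacobi_poly\<close> is a definite description, so uniqueness of the family is
  part of the task. Corresponding members of two families differ by a \<open>d\<close> with only
  lower terms; both members are orthogonal to it, so \<open>ip d d = 0\<close>.\<close>

theorem jacobi_poly_jac:
 assumes "is_partition_len n lam"
 shows "jac_prop lam (jacobi_poly n theta (k1 + k2 - 1/2) (k2 - 1/2) lam)"
proof -
 let ?a = "k1 + k2 - 1/2" and ?b = "k2 - 1/2"
 define Jac where "Jac = (%lam. if is_partition_len n lam then (SOME F. jac_prop lam F) else (%_. 0))"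
 have J: "jac_prop lam (Jac lam)" if "is_partition_len n lam" for lam
  using someI_ex[OF jac_exists[OF that]] that by (simp add: Jac_def)
 have spec: "jacobi_family_spec n theta ?a ?b Jac"
  unfolding jacobi_family_spec_def lp_inner_ip
 proof (intro conjI allI impI)
  fix lam assume l: "is_partition_len n lam"
  show "lp_ok n (Jac lam)" "Jac lam (int \<circ> lam) = 1" using J[OF l] by (auto simp: jac_prop_def)
  show "bc_invariant n (Jac lam)" using J[OF l] bc_invariant_iff by (auto simp: jac_prop_def)
  show "alpha = int \<circ> lam \<or> lex_less n alpha (int \<circ> lam)" if "Jac lam alpha ~= 0" for alpha using J[OF l] that by (auto simp: jac_prop_def)
 next
  fix lam mu assume "is_partition_len n lam \<and> is_partition_len n mu \<and> lam ~= mu"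
  then show "ip (Jac lam) (Jac mu) = 0" using jac_orthogonal[of lam mu] J by blast
 next
  fix lam assume "\<not> is_partition_len n lam"
  then show "Jac lam = (%_. 0)" by (simp add: Jac_def)
 qed
 have uniq: "J' = Jac" if s: "jacobi_family_spec n theta ?a ?b J'" for J'
 proof
  fix lam
  show "J' lam = Jac lam"
  proof (cases "is_partition_len n lam")
   case True
   have fam: "lp_ok n (X mu) \<and> coeff_inv n (X mu) \<and> X mu (int \<circ> mu) = 1 \<and>
    (\<forall>alpha. X mu alpha ~= 0 --> alpha = int \<circ> mu \<or> lex_less n alpha (int \<circ> mu))"
    if "jacobi_family_spec n theta ?a ?b X" "is_partition_len n mu" for X mu
    using that bc_invariant_iff[of n "X mu"] unfolding jacobi_family_spec_def by blast
   define d where "d = (%nu. 1 * J' lam nu + (-1) * Jac lam nu)"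
   have ok: "lp_ok n d" unfolding d_def by (intro lp_ok_lincomb) (use fam[OF s True] fam[OF spec True] in auto)
   have ci: "coeff_inv n d" unfolding d_def by (intro coeff_inv_lincomb) (use fam[OF s True] fam[OF spec True] in auto)
   have dl: "lex_less n alpha (int \<circ> lam)" if "d alpha ~= 0" for alpha
   proof -
    have "alpha ~= int \<circ> lam" using that fam[OF s True] fam[OF spec True] by (auto simp: d_def)
    moreover have "J' lam alpha ~= 0 \<or> Jac lam alpha ~= 0" using that by (auto simp: d_def)
    ultimately show ?thesis using fam[OF s True] fam[OF spec True] by blast
   qed
   have z: "ip (X lam) d = 0" if X: "jacobi_family_spec n theta ?a ?b X" for X
   proof (rule orthogonal_lower[of X "int \<circ> lam", OF fam[OF X] _ ok ci dl])
    fix mu assume mu: "is_partition_len n mu" "lex_less n (int \<circ> mu) (int \<circ> lam)"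
    then have "lam ~= mu" by (auto simp: lex_less_def)
    then show "ip (X lam) (X mu) = 0" using X True mu unfolding jacobi_family_spec_def lp_inner_ip by blast
   qed auto
   have "ip d d = 1 * ip (J' lam) d + (-1) * ip (Jac lam) d"
    unfolding d_def by (rule ip_lincomb) (use fam[OF s True] fam[OF spec True] in auto)
   then have "ip d d = 0" using z[OF s] z[OF spec] by simp
   then have "d = (%_. 0)" by (rule ip_definite[OF ok])
   then show ?thesis by (auto simp: d_def fun_eq_iff)
  next
   case False
   then show ?thesis using s spec unfolding jacobi_family_spec_def by metis
  qed
 qed
 have "(THE J. jacobi_family_spec n theta ?a ?b J) = Jac" using spec uniq by (rule the_equality)
 then show ?thesis using J[OF assms] by (simp add: jacobi_poly_def)
qed

end

section \<open>Restriction to one variable\<close>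

text \<open>The expansion in \<open>x\<close> of a Laurent polynomial at \<open>z = (exp x, 1, ..., 1)\<close>.\<close>

definition line :: "lpoly => complex fps" where
 "line c = (\<Sum>mu | c mu ~= 0. fps_const (c mu) * fps_exp (of_int (mu 0)))"

lemma line_superset:
 "finite T ==> {mu. c mu ~= 0} \<subseteq> T ==> line c = (\<Sum>mu\<in>T. fps_const (c mu) * fps_exp (of_int (mu 0)))"
 unfolding line_def by (rule sum.mono_neutral_left) auto

lemma line_lincomb:
 assumes "fin_supp c" "fin_supp d"
 shows "line (%nu. x * c nu + y * d nu) = fps_const x * line c + fps_const y * line d"
proof -
 let ?T = "{mu. c mu ~= 0} \<union> {mu. d mu ~= 0}"
 have fin: "finite ?T" using assms by (simp add: fin_supp_def)
 have "(\<Sum>mu\<in>?T. fps_const (x * c mu + y * d mu) * fps_exp (of_int (mu 0))) =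
  (\<Sum>mu\<in>?T. fps_const x*(fps_const (c mu) * fps_exp (of_int (mu 0))) + fps_const y*(fps_const (d mu) * fps_exp (of_int (mu 0))))"
 proof (rule sum.cong[OF refl])
  fix mu
  have "fps_const (x * c mu + y * d mu) = fps_const x * fps_const (c mu) + fps_const y * fps_const (d mu)" by simp
  then show "fps_const (x * c mu + y * d mu) * fps_exp (of_int (mu 0)) =
   fps_const x*(fps_const (c mu) * fps_exp (of_int (mu 0))) + fps_const y*(fps_const (d mu) * fps_exp (of_int (mu 0)))"
   by (simp only: distrib_right mult.assoc)
 qed
 then show ?thesis
  by (subst (1 2 3) line_superset[OF fin]) (auto simp: sum.distrib sum_distrib_left)
qed

lemma line_add: "fin_supp c ==> fin_supp d ==> line (%nu. c nu + d nu) = line c + line d"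
 using line_lincomb[of c d 1 1] by simp

lemma line_diff: "fin_supp c ==> fin_supp d ==> line (%nu. c nu - d nu) = line c - line d"
 using line_lincomb[of c d 1 "-1"] by (simp flip: fps_const_neg)

lemma line_scale: "fin_supp c ==> line (%nu. x * c nu) = fps_const x * line c"
 using line_lincomb[of c c x 0] by simp

lemma line_sum:
 "finite A ==> (\<And>a. a \<in> A ==> fin_supp (f a)) ==> line (%nu. \<Sum>a\<in>A. f a nu) = (\<Sum>a\<in>A. line (f a))"
proof (induction A rule: finite_induct)
 case (insert a A)
 then show ?case using line_add[OF insert(4)[of a] fin_supp_sum[of A f]] by simp
qed (simp add: line_def)

lemma line_comp:
 assumes "\<And>mu. s (s mu) = mu" "\<And>mu. s mu 0 = mu 0"
 shows "line (c \<circ> s) = line c"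
 unfolding line_def by (rule sum.reindex_bij_witness[of _ s s]) (auto simp: assms)

lemma line_deriv:
 assumes "fin_supp c" shows "line (%nu. of_int (nu 0) * c nu) = fps_deriv (line c)"
proof -
 let ?S = "{mu. c mu ~= 0}"
 have fin: "finite ?S" using assms by (simp add: fin_supp_def)
 have "line (%nu. of_int (nu 0) * c nu) = (\<Sum>mu\<in>?S. fps_const (of_int (mu 0) * c mu) * fps_exp (of_int (mu 0)))"
  by (rule line_superset[OF fin]) auto
 also have "... = fps_deriv (line c)" unfolding line_def fps_deriv_sum
  by (rule sum.cong) (auto simp: mult.assoc[symmetric] mult.commute)
 finally show ?thesis .
qed

lemma line_shift:
 assumes "fin_supp g"
 shows "fps_exp (of_int (alpha 0)) * line (%nu. g (along nu alpha 1)) = line g"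
proof -
 have e: "fps_exp (of_int (alpha 0))*(fps_const c * fps_exp (of_int m)) = fps_const c * fps_exp (of_int (m + alpha 0))" for c :: complex and m
  unfolding of_int_add fps_exp_add_mult by (simp only: mult_ac)
 show ?thesis unfolding line_def sum_distrib_left
  by (rule sum.reindex_bij_witness[of _ "%mu. along mu alpha (-1)" "%mu. along mu alpha 1"]) (auto simp: e, auto simp: along_def)
qed

lemma line_Nop:
 assumes "fin_supp c" "is_refl alpha s"
 shows "(fps_exp (of_int (alpha 0)) - 1) * line (Nop alpha s c) = (fps_exp (of_int (alpha 0)) + 1)*(line c - line (c \<circ> s))"
proof -
 let ?G = "Nop alpha s c" and ?d = "%nu. c nu - c (s nu)" and ?E = "fps_exp (of_int (alpha 0)) :: complex fps"
 have fG: "fin_supp ?G" by (rule fin_supp_Nop[OF assms(1,2)])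
 have fd: "fin_supp ?d" by (rule fin_supp_anti[OF assms(1,2)])
 have injA: "inj (%nu. along nu alpha 1)" by (auto simp: inj_def along_def fun_eq_iff)
 have sh: "fin_supp (%nu. g (along nu alpha 1))" if "fin_supp g" for g
  using fin_supp_comp_inj[OF that injA] by (simp add: o_def)
 have "(%nu. ?G nu - ?G (along nu alpha 1)) = (%nu. ?d nu + ?d (along nu alpha 1))"
  by (rule ext) (rule Nop_diff[OF assms(1,2)])
 then have "line (%nu. ?G nu - ?G (along nu alpha 1)) = line (%nu. ?d nu + ?d (along nu alpha 1))" by simp
 then have "?E*(line ?G - line (%nu. ?G (along nu alpha 1))) = ?E*(line ?d + line (%nu. ?d (along nu alpha 1)))"
  by (simp add: line_diff[OF fG sh[OF fG]] line_add[OF fd sh[OF fd]])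
 then have "?E * line ?G - line ?G = ?E * line ?d + line ?d"
  unfolding right_diff_distrib distrib_left line_shift[OF fG] line_shift[OF fd] .
 moreover have "line ?d = line c - line (c \<circ> s)"
  using line_diff[OF assms(1) fin_supp_comp_inj[OF assms(1) is_refl_inj[OF assms(2)]]] by simp
 ultimately show ?thesis by (simp add: algebra_simps)
qed

text \<open>\<open>x * coth (m x / 2)\<close>.\<close>

definition Hc :: "nat => complex fps" where
 "Hc m = (fps_exp (of_nat m) + 1) * inverse (fps_shift 1 (fps_exp (of_nat m) - 1))"

lemma Hc_eq: "m > 0 ==> Hc m*(fps_exp (of_nat m) - 1) = fps_X*(fps_exp (of_nat m) + 1)"
proof -
 assume m: "m > 0"
 let ?D = "fps_exp (of_nat m) - 1 :: complex fps"
 let ?Q = "fps_shift 1 ?D"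
 have Q0: "fps_nth ?Q 0 ~= 0" using m by simp
 have "?D = fps_X*?Q"
 proof (rule fps_ext)
  fix k show "fps_nth ?D k = fps_nth (fps_X*?Q) k" by (cases k) auto
 qed
 then have "Hc m*?D = (fps_exp (of_nat m) + 1) * inverse ?Q*(fps_X*?Q)" by (simp add: Hc_def)
 also have "... = fps_X*(fps_exp (of_nat m) + 1)*(inverse ?Q*?Q)" by (simp only: mult_ac)
 also have "inverse ?Q*?Q = 1" using Q0 by (rule inverse_mult_eq_1)
 finally show ?thesis by simp
qed

lemma Hc_0: "m > 0 ==> fps_nth (Hc m) 0 = 2/of_nat m"
 by (simp add: Hc_def field_simps)

text \<open>On the line, \<open>z^alpha\<close> becomes \<open>exp (m x)\<close>. Multiplying by
  \<open>x\<close> removes the pole of the hyperbolic cotangent, so that the identity holds between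
  formal power series.\<close>

lemma line_Nop_Hc:
 assumes "fin_supp c" "is_refl alpha s" "alpha 0 = int m" "m > 0"
 shows "fps_X * line (Nop alpha s c) = Hc m*(line c - line (c \<circ> s))"
proof -
 let ?E = "fps_exp (of_nat m) :: complex fps"
 have nz: "?E - 1 ~= 0"
 proof
  assume "?E - 1 = 0"
  then have "fps_nth (?E - 1) 1 = fps_nth 0 1" by metis
  then show False using assms(4) by simp
 qed
 have "(?E - 1)*(fps_X * line (Nop alpha s c)) = fps_X*((?E - 1) * line (Nop alpha s c))" by (simp only: mult_ac)
 also have "... = fps_X*((?E + 1)*(line c - line (c \<circ> s)))" using line_Nop[OF assms(1,2)] assms(3) by simp
 also have "... = fps_X*(?E + 1)*(line c - line (c \<circ> s))" by (simp only: mult_ac)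
 also have "... = (?E - 1)*(Hc m*(line c - line (c \<circ> s)))"
  unfolding Hc_eq[OF assms(4), symmetric] by (simp only: mult_ac)
 finally show ?thesis using nz by simp
qed

lemma line_nth: "fps_nth (line c) k = (\<Sum>mu | c mu ~= 0. c mu * of_int (mu 0) ^ k)/fact k"
 unfolding line_def fps_sum_nth by (simp add: sum_divide_distrib)

context bc
begin

definition AA :: "lpoly => nat => complex fps" where
 "AA f m = line ((Sop 0 ^^ m) f)"

text \<open>On the line \<open>Sop 0\<close> sees only \<open>AA f m\<close> and the common
  restriction \<open>C m\<close> of all \<open>(Sop j ^^ m) f\<close> with \<open>j >= 1\<close>.
  For odd \<open>m\<close> the latter vanishes: flipping a variable that equals 1 changes the sign
  but not the restriction. For even \<open>m\<close> the eigenvalue equation expresses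
  \<open>C m\<close> through \<open>AA f m\<close> and \<open>AA f 0\<close>. The variable with
  index 1 requires \<open>n >= 2\<close>.\<close>

theorem line_recursion:
 assumes "n >= 2" "lp_ok n f" "coeff_inv n f" "\<And>k. Dop k f = (%nu. of_real (EE lam k) * f nu)"
 shows "fps_X * AA f (Suc (2*k)) = fps_X * fps_deriv (AA f (2*k)) + fps_const (of_real theta) * Hc 1*(fps_const (of_nat n) * AA f (2*k) - fps_const (of_real (EE lam k)) * AA f 0)"
  and "fps_X * AA f (Suc (Suc (2*k))) = fps_X * fps_deriv (AA f (Suc (2*k))) +
   (fps_const (of_real (theta*(real n - 1) + k1)) * Hc 1 + fps_const (of_real (2 * k2)) * Hc 2) * AA f (Suc (2*k))"
proof -
 have inv: "f \<circ> fl p = f" if "p < n" for p using assms(3) that by (simp add: coeff_inv_def)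
 have inv': "f \<circ> pm sig = f" if "sig permutes {..<n}" for sig using assms(3) that by (simp add: coeff_inv_def)
 have IS: "(Sop i ^^ m) f (fl i nu) = (-1) ^ m*(Sop i ^^ m) f nu"
  "(Sop i ^^ m) f (fl j nu) = (Sop i ^^ m) f nu"
  "(Sop i ^^ m) f (sw i j nu) = (Sop j ^^ m) f nu"
  "(Sop i ^^ m) f (ssw i j nu) = (-1) ^ m*(Sop j ^^ m) f nu"
  if "i < n" "j < n" "i ~= j" for i j m nu
  using inv_Sop_pow[OF assms(2) _ _ that, of m nu] inv inv' by blast+
 let ?S = "%i m. (Sop i ^^ m) f"
 define C where "C = (%m. line (?S 1 m))"
 have n0: "0 < n" "1 < n" using assms(1) by auto
 have Cj: "line (?S j m) = C m" if j: "0 < j" "j < n" for j m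
 proof (cases "j = 1")
  case False
  have "?S j m = ?S 1 m \<circ> sw 1 j" using IS(3)[OF n0(2) j(2)] False by (auto simp: fun_eq_iff)
  moreover have "line (?S 1 m \<circ> sw 1 j) = line (?S 1 m)" by (rule line_comp) (use j in \<open>auto simp: sw_def fun_eq_iff\<close>)
  ultimately show ?thesis by (simp add: C_def)
 qed (simp add: C_def)
 have Codd: "C m = 0" if "odd m" for m
 proof -
  have "?S 1 m \<circ> fl 1 = (%nu. (-1)^m*?S 1 m nu)" using IS(1)[OF n0(2) n0(1)] by (auto simp: fun_eq_iff)
  moreover have "line (?S 1 m \<circ> fl 1) = C m" unfolding C_def by (rule line_comp) (auto simp: fl_def fun_eq_iff)
  ultimately have "C m = fps_const ((-1)^m) * C m"
   using line_scale[OF lp_ok_fin[OF lp_ok_Sop_pow[OF assms(2) n0(2)]], of "(-1)^m" m] by (simp add: C_def)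
  then have "C m = - C m" using that by (simp flip: fps_const_neg)
  then have "2 * C m = 0" by (metis add.right_inverse mult_2)
  then show ?thesis by simp
 qed
 have step: "fps_X * AA f (Suc m) = fps_X * fps_deriv (AA f m)
   + fps_const (of_real (theta/2))*(of_nat (n - 1)*(Hc 1*(AA f m - C m) + Hc 1*(AA f m - fps_const ((-1)^m) * C m)))
   + fps_const (of_real (k1/2))*(Hc 1*(AA f m - fps_const ((-1)^m) * AA f m)) + fps_const (of_real k2)*(Hc 2*(AA f m - fps_const ((-1)^m) * AA f m))" for m
 proof -
  define c where "c = ?S 0 m"
  have hA: "AA f m = line c" by (simp add: AA_def c_def)
  have Sc: "Sop 0 c = (%nu. of_int (nu 0) * c nu + of_real (theta/2)*(\<Sum>j\<in>{..<n}-{0}. Nop (rm 0 j) (sw 0 j) c nu + Nop (rp 0 j) (ssw 0 j) c nu)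
   + of_real (k1/2) * Nop (ee 0) (fl 0) c nu + of_real k2 * Nop (rl 0) (fl 0) c nu)"
   by (rule ext) (rule Sop_def)
  have ok: "lp_ok n c" unfolding c_def by (rule lp_ok_Sop_pow[OF assms(2) n0(1)])
  note fs = lp_ok_fin[OF ok]
  note R = lp_ok_roots[OF ok n0(1)]
  have Lsw: "line (c \<circ> sw 0 j) = C m" if j: "0 < j" "j < n" for j
  proof -
   have "c \<circ> sw 0 j = ?S j m" using IS(3)[OF n0(1) j(2)] j by (auto simp: c_def fun_eq_iff)
   then show ?thesis using Cj[OF j] by simp
  qed
  have Lssw: "line (c \<circ> ssw 0 j) = fps_const ((-1)^m) * C m" if j: "0 < j" "j < n" for j
  proof -
   have "c \<circ> ssw 0 j = (%nu. (-1)^m*?S j m nu)" using IS(4)[OF n0(1) j(2)] j by (auto simp: c_def fun_eq_iff)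
   then show ?thesis using Cj[OF j] line_scale[OF lp_ok_fin[OF lp_ok_Sop_pow[OF assms(2) j(2)]]] by simp
  qed
  have Lfl: "line (c \<circ> fl 0) = fps_const ((-1)^m) * AA f m"
  proof -
   have "c \<circ> fl 0 = (%nu. (-1)^m * c nu)" using IS(1)[OF n0(1) n0(2)] by (auto simp: c_def fun_eq_iff)
   then show ?thesis using line_scale[OF fs] by (simp add: hA)
  qed
  have 1: "fps_X * line (Nop (rm 0 j) (sw 0 j) c) = Hc 1*(AA f m - C m)" if j: "j \<in> {..<n}-{0}" for j
   using line_Nop_Hc[OF fs is_refl_rm, of 0 j 1] Lsw j by (simp add: hA rm_def ee_def)
  have 2: "fps_X * line (Nop (rp 0 j) (ssw 0 j) c) = Hc 1*(AA f m - fps_const ((-1)^m) * C m)" if j: "j \<in> {..<n}-{0}" for j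
   using line_Nop_Hc[OF fs is_refl_rp, of 0 j 1] Lssw j by (simp add: hA rp_def ee_def)
  have 3: "fps_X * line (Nop (ee 0) (fl 0) c) = Hc 1*(AA f m - fps_const ((-1)^m) * AA f m)"
   using line_Nop_Hc[OF fs is_refl_ee, of 0 1] Lfl by (simp add: hA ee_def)
  have 4: "fps_X * line (Nop (rl 0) (fl 0) c) = Hc 2*(AA f m - fps_const ((-1)^m) * AA f m)"
   using line_Nop_Hc[OF fs is_refl_rl, of 0 2] Lfl by (simp add: hA rl_def ee_def)
  have fp: "fin_supp (%nu. Nop (rm 0 j) (sw 0 j) c nu + Nop (rp 0 j) (ssw 0 j) c nu)" if "j \<in> {..<n}-{0}" for j
   by (intro fin_supp_add lp_ok_fin[OF R(1)] lp_ok_fin[OF R(2)]) (use that in auto)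
  have fS: "fin_supp (%nu. \<Sum>j\<in>{..<n}-{0}. Nop (rm 0 j) (sw 0 j) c nu + Nop (rp 0 j) (ssw 0 j) c nu)"
   by (rule fin_supp_sum) (use fp in auto)
  have "AA f (Suc m) = line (Sop 0 c)" by (simp add: AA_def c_def)
  also have "... = fps_deriv (AA f m) + fps_const (of_real (theta/2))*(\<Sum>j\<in>{..<n}-{0}. line (Nop (rm 0 j) (sw 0 j) c) + line (Nop (rp 0 j) (ssw 0 j) c))
   + fps_const (of_real (k1/2)) * line (Nop (ee 0) (fl 0) c) + fps_const (of_real k2) * line (Nop (rl 0) (fl 0) c)"
  proof -
   have S: "line (%nu. \<Sum>j\<in>{..<n}-{0}. Nop (rm 0 j) (sw 0 j) c nu + Nop (rp 0 j) (ssw 0 j) c nu) =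
    (\<Sum>j\<in>{..<n}-{0}. line (Nop (rm 0 j) (sw 0 j) c) + line (Nop (rp 0 j) (ssw 0 j) c))"
    using fp by (subst line_sum) (auto intro!: sum.cong line_add lp_ok_fin[OF R(1)] lp_ok_fin[OF R(2)])
   show ?thesis unfolding Sc hA line_deriv[OF fs, symmetric]
    by (simp only: line_add fin_supp_add fin_supp_scale[OF fs] fin_supp_scale[OF fS] fin_supp_scale[OF lp_ok_fin[OF R(3)]] fin_supp_scale[OF lp_ok_fin[OF R(4)]]
      line_scale[OF fS] line_scale[OF lp_ok_fin[OF R(3)]] line_scale[OF lp_ok_fin[OF R(4)]] S)
  qed
  finally have "fps_X * AA f (Suc m) = fps_X * fps_deriv (AA f m) + fps_const (of_real (theta/2))*(\<Sum>j\<in>{..<n}-{0}. fps_X * line (Nop (rm 0 j) (sw 0 j) c) + fps_X * line (Nop (rp 0 j) (ssw 0 j) c))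
   + fps_const (of_real (k1/2))*(fps_X * line (Nop (ee 0) (fl 0) c)) + fps_const (of_real k2)*(fps_X * line (Nop (rl 0) (fl 0) c))"
   by (simp add: distrib_left sum_distrib_left mult.left_commute)
  also have "(\<Sum>j\<in>{..<n}-{0}. fps_X * line (Nop (rm 0 j) (sw 0 j) c) + fps_X * line (Nop (rp 0 j) (ssw 0 j) c)) =
   (\<Sum>j\<in>{..<n}-{0}. Hc 1*(AA f m - C m) + Hc 1*(AA f m - fps_const ((-1)^m) * C m))"
   by (rule sum.cong[OF refl]) (simp only: 1 2)
  also have "... = of_nat (n - 1)*(Hc 1*(AA f m - C m) + Hc 1*(AA f m - fps_const ((-1)^m) * C m))" using n0 by simp
  finally show ?thesis unfolding 3 4 .
 qed
 have nn: "(of_nat (n - 1) :: complex fps) = fps_const (of_nat n - 1)"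
  using n0 by (simp add: of_nat_diff fps_of_nat[symmetric] fps_const_sub[symmetric] del: fps_const_sub)
 have eig: "fps_const (of_nat n - 1) * C (2*k) = fps_const (of_real (EE lam k)) * AA f 0 - AA f (2*k)" for k
 proof -
  have ok: "fin_supp (?S i (2*k))" if "i < n" for i by (rule lp_ok_fin[OF lp_ok_Sop_pow[OF assms(2) that]])
  have "fps_const (of_real (EE lam k)) * AA f 0 = line (Dop k f)"
   unfolding assms(4) using line_scale[OF lp_ok_fin[OF assms(2)]] by (simp add: AA_def)
  also have "... = (\<Sum>i<n. line (?S i (2*k)))" unfolding Dop_def[abs_def] by (rule line_sum) (use ok in auto)
  also have "... = AA f (2*k) + (\<Sum>i\<in>{..<n}-{0}. line (?S i (2*k)))"
   using n0 by (subst sum.remove[of _ 0]) (auto simp: AA_def)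
  also have "(\<Sum>i\<in>{..<n}-{0}. line (?S i (2*k))) = (\<Sum>i\<in>{..<n}-{0}. C (2*k))" by (rule sum.cong) (auto simp: Cj)
  also have "... = of_nat (n - 1) * C (2*k)" using n0 by simp
  finally show ?thesis unfolding nn by simp
 qed
 show "fps_X * AA f (Suc (2*k)) = fps_X * fps_deriv (AA f (2*k)) + fps_const (of_real theta) * Hc 1*(fps_const (of_nat n) * AA f (2*k) - fps_const (of_real (EE lam k)) * AA f 0)"
 proof -
  have t2: "fps_const (complex_of_real theta) = 2 * fps_const (of_real (theta/2))" by (simp add: fps_numeral_fps_const)
  have e: "fps_const (of_nat n) * AA f (2*k) - fps_const (of_real (EE lam k)) * AA f 0 = fps_const (of_nat n - 1) * AA f (2*k) - fps_const (of_nat n - 1) * C (2*k)"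
   unfolding eig by (simp add: fps_const_sub[symmetric] algebra_simps del: fps_const_sub)
  show ?thesis unfolding e t2 step nn by (simp add: algebra_simps)
 qed
 show "fps_X * AA f (Suc (Suc (2*k))) = fps_X * fps_deriv (AA f (Suc (2*k))) +
   (fps_const (of_real (theta*(real n - 1) + k1)) * Hc 1 + fps_const (of_real (2 * k2)) * Hc 2) * AA f (Suc (2*k))"
 proof -
  have c: "fps_const (of_real (theta*(real n - 1) + k1)) = 2 * fps_const (complex_of_real (theta/2)) * fps_const (of_nat n - 1) + 2 * fps_const (of_real (k1/2))"
   "fps_const (complex_of_real (2 * k2)) = 2 * fps_const (of_real k2)"
   by (simp_all add: fps_numeral_fps_const)
  have m: "fps_const ((-1) ^ Suc (2*k)) * A = - A" for A :: "complex fps" by (simp flip: fps_const_neg)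
  show ?thesis unfolding step[of "Suc (2*k)"] Codd[of "Suc (2*k)", simplified] nn m c by (simp add: algebra_simps)
 qed
qed

end

section \<open>Scaling of the recursion in one variable\<close>

definition cv :: "(nat => complex fps) => bool" where
 "cv F \<longleftrightarrow> (\<forall>j. convergent (%n. fps_nth (F n) j))"

lemma cv_add: "cv F ==> cv G ==> cv (%n. F n + G n)"
 by (auto simp: cv_def intro: convergent_add)

lemma cv_diff: "cv F ==> cv G ==> cv (%n. F n - G n)"
 by (auto simp: cv_def intro: convergent_diff)

lemma cv_mult: "cv F ==> cv G ==> cv (%n. F n * G n)"
 by (auto simp: cv_def fps_mult_nth intro!: convergent_sum convergent_mult)

lemma cv_const: "convergent c ==> cv (%n. fps_const (c n))"
 unfolding cv_def
proof
 fix j assume "convergent c"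
 then show "convergent (%n. fps_nth (fps_const (c n)) j)" by (cases "j = 0") (auto simp: convergent_const)
qed

lemma cv_fixed: "cv (%n. F)"
 by (auto simp: cv_def convergent_const)

lemma cv_deriv: "cv F ==> cv (%n. fps_deriv (F n))"
 by (auto simp: cv_def intro!: convergent_mult convergent_const)

lemma cv_shift: "cv F ==> (\<And>n. fps_X * G n = F n) ==> cv G"
proof -
 assume F: "cv F" and e: "\<And>n. fps_X * G n = F n"
 have "fps_nth (G n) j = fps_nth (F n) (Suc j)" for n j unfolding e[symmetric] by simp
 then show ?thesis using F by (simp add: cv_def)
qed

text \<open>The restricted recursion along a sequence with \<open>N n\<close> variables; the
  parameters \<open>k1\<close> and \<open>k2\<close> appear as \<open>kappa1 n * N n\<close> and
  \<open>kappa2 n * N n\<close>, so that \<open>kappa1\<close> and \<open>kappa2\<close> have finite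
  limits.\<close>

locale rec_seq =
 fixes N :: "nat => real" and A :: "nat => nat => complex fps" and e :: "nat => nat => real"
  and theta :: real and kappa1 kappa2 :: "nat => real"
 assumes N2: "N n >= 2" and th: "theta > 0" and k1n: "kappa1 n >= 0" and k2n: "kappa2 n >= 0"
  and A0: "fps_nth (A n 0) 0 = 1" and e0: "e n 0 = N n"
  and even_rec: "fps_X * A n (Suc (2*k)) = fps_X * fps_deriv (A n (2*k)) +
   fps_const (of_real theta) * Hc 1*(fps_const (of_real (N n)) * A n (2*k) - fps_const (of_real (e n k)) * A n 0)"
  and odd_rec: "fps_X * A n (Suc (Suc (2*k))) = fps_X * fps_deriv (A n (Suc (2*k))) +
   (fps_const (of_real (theta*(N n - 1) + kappa1 n * N n)) * Hc 1 + fps_const (of_real (2*(kappa2 n * N n))) * Hc 2) * A n (Suc (2*k))"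
begin

text \<open>Each step of the recursion gains a factor \<open>N n\<close>, except the first one,
  which is a plain derivative; hence the exponent \<open>m - 1\<close>. For \<open>m = 0\<close> the
  truncated subtraction gives no factor.\<close>

definition B :: "nat => nat => complex fps" where
 "B n m = fps_const (of_real (1/N n ^ (m - 1))) * A n m"

definition eh :: "nat => nat => real" where
 "eh n k = e n k/N n ^ (2*k)"

definition G :: "nat => complex fps" where
 "G n = fps_const (of_real (theta*(1 - 1/N n) + kappa1 n)) * Hc 1 + fps_const (of_real (2 * kappa2 n)) * Hc 2"

lemma N0: "N n > 0" using N2[of n] by linarith

lemma B_1: "B n 1 = fps_deriv (A n 0)"
proof -
 have "fps_X * A n 1 = fps_X * fps_deriv (A n 0)" using even_rec[of n 0] e0 by simp
 then have "A n 1 = fps_deriv (A n 0)" by (metis fps_X_neq_zero mult_left_cancel)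
 then show ?thesis by (simp add: B_def)
qed

lemma B_odd: "fps_X * B n (Suc (Suc (2*k))) = fps_const (of_real (1/N n))*(fps_X * fps_deriv (B n (Suc (2*k)))) + G n * B n (Suc (2*k))"
proof -
 let ?c = "fps_const (complex_of_real (1/N n ^ Suc (2*k)))" and ?d = "fps_const (complex_of_real (1/N n ^ (2*k)))"
 let ?i = "fps_const (complex_of_real (1/N n))"
 have n0: "N n ~= 0" using N0[of n] by simp
 have c: "?c = ?i*?d" by simp
 have g: "?c*(fps_const (of_real (theta*(N n - 1) + kappa1 n * N n)) * Hc 1 + fps_const (of_real (2*(kappa2 n * N n))) * Hc 2) = ?d * G n"
 proof -
  have r: "1/N n ^ Suc (2*k)*(theta*(N n - 1) + kappa1 n * N n) = 1/N n ^ (2*k)*(theta*(1 - 1/N n) + kappa1 n)"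
   "1/N n ^ Suc (2*k)*(2*(kappa2 n * N n)) = 1/N n ^ (2*k)*(2 * kappa2 n)"
   using n0 by (simp_all add: field_simps)
  have "?c * fps_const (of_real (theta*(N n - 1) + kappa1 n * N n)) = ?d * fps_const (of_real (theta*(1 - 1/N n) + kappa1 n))"
   "?c * fps_const (of_real (2*(kappa2 n * N n))) = ?d * fps_const (of_real (2 * kappa2 n))"
   unfolding fps_const_mult of_real_mult[symmetric] r by simp_all
  then show ?thesis unfolding G_def distrib_left mult.assoc[symmetric] by simp
 qed
 have "fps_X * B n (Suc (Suc (2*k))) = ?c*(fps_X * A n (Suc (Suc (2*k))))" by (simp add: B_def mult.left_commute)
 also have "... = ?i*(fps_X*(?d * fps_deriv (A n (Suc (2*k))))) + ?d * G n * A n (Suc (2*k))"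
  unfolding odd_rec distrib_left mult.assoc[symmetric] g[symmetric] c by (simp add: algebra_simps)
 also have "?d * fps_deriv (A n (Suc (2*k))) = fps_deriv (B n (Suc (2*k)))" by (simp add: B_def)
 also have "?d * G n * A n (Suc (2*k)) = G n * B n (Suc (2*k))" by (simp add: B_def mult_ac)
 finally show ?thesis .
qed

lemma B_even: "fps_X * B n (Suc (2 * Suc k)) = fps_const (of_real (1/N n))*(fps_X * fps_deriv (B n (2 * Suc k)))
  + fps_const (of_real theta) * Hc 1*(B n (2 * Suc k) - fps_const (of_real (eh n (Suc k))) * A n 0)"
proof -
 let ?c = "fps_const (complex_of_real (1/N n ^ (2 * Suc k)))" and ?d = "fps_const (complex_of_real (1/N n ^ (2 * Suc k - 1)))"
 let ?i = "fps_const (complex_of_real (1/N n))"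
 have n0: "N n ~= 0" using N0[of n] by simp
 have c: "?c = ?i*?d" by simp
 have cn: "?c * fps_const (of_real (N n)) = ?d" using n0 by simp
 have ce: "?c * fps_const (of_real (e n (Suc k))) = fps_const (of_real (eh n (Suc k)))" by (simp add: eh_def)
 have Bd: "B n (2 * Suc k) = ?d * A n (2 * Suc k)" by (simp add: B_def)
 have "fps_X * B n (Suc (2 * Suc k)) = ?c*(fps_X * A n (Suc (2 * Suc k)))" by (simp add: B_def mult.left_commute)
 also have "... = ?c*(fps_X * fps_deriv (A n (2 * Suc k))) + fps_const (of_real theta) * Hc 1*((?c * fps_const (of_real (N n))) * A n (2 * Suc k) - (?c * fps_const (of_real (e n (Suc k)))) * A n 0)"
  unfolding even_rec by (simp only: algebra_simps)
 also have "... = ?i*(fps_X * fps_deriv (?d * A n (2 * Suc k))) + fps_const (of_real theta) * Hc 1*(?d * A n (2 * Suc k) - fps_const (of_real (eh n (Suc k))) * A n 0)"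
  unfolding cn ce unfolding c by (simp add: mult_ac)
 finally show ?thesis unfolding Bd .
qed

text \<open>The left side of \<open>B_even\<close> has no constant term, so the constant terms on
  the right must cancel. This solvability condition is what determines the eigenvalue from the
  series.\<close>

lemma eh_eq: "of_real (eh n (Suc k)) = fps_nth (B n (2 * Suc k)) 0"
proof -
 have "fps_nth (fps_X * B n (Suc (2 * Suc k))) 0 = of_real theta * fps_nth (Hc 1) 0*(fps_nth (B n (2 * Suc k)) 0 - of_real (eh n (Suc k)))"
  unfolding B_even by (simp add: A0 fps_mult_nth)
 then show ?thesis using th Hc_0[of 1] by simp
qed

text \<open>The eigenvalue that enters an even step is the constant term of a series already known
  to converge, so the recursion closes. Dividing by \<open>fps_X\<close> merely shifts
  coefficients.\<close>

theorem convergent_eh: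
 assumes "\<And>j. convergent (%n. fps_nth (A n 0) j)" "convergent (%n. 1/N n)" "convergent kappa1" "convergent kappa2"
 shows "convergent (%n. eh n (Suc k))"
proof -
 have of: "convergent (%n. complex_of_real (c n))" if "convergent c" for c
  using that by (simp add: convergent_of_real)
 have cG: "cv G" unfolding G_def[abs_def]
  by (intro cv_add cv_mult cv_const cv_fixed of convergent_add convergent_mult convergent_const convergent_diff assms)
 have cA: "cv (%n. A n 0)" using assms(1) by (simp add: cv_def)
 have ci: "cv (%n. fps_const (complex_of_real (1/N n)))" by (intro cv_const of assms)
 have ehc: "convergent (%n. eh n (Suc k))" if "cv (%n. B n (2 * Suc k))" for k
 proof -
  have "convergent (%n. fps_nth (B n (2 * Suc k)) 0)" using that by (simp add: cv_def)
  then have "convergent (%n. complex_of_real (eh n (Suc k)))" by (simp only: eh_eq)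
  then have "convergent (%n. Re (complex_of_real (eh n (Suc k))))"
   unfolding convergent_def using tendsto_Re by fast
  then show ?thesis by simp
 qed
 have odd: "cv (%n. B n (Suc (Suc (2*k))))" if "cv (%n. B n (Suc (2*k)))" for k
  by (rule cv_shift[OF _ B_odd]) (intro cv_add cv_mult cv_fixed cv_deriv ci cG that)
 have ev: "cv (%n. B n (Suc (2 * Suc k)))" if "cv (%n. B n (2 * Suc k))" for k
  by (rule cv_shift[OF _ B_even]) (intro cv_add cv_mult cv_diff cv_fixed cv_deriv cv_const of ci cA ehc that)
 have "cv (%n. B n (Suc (2*k)))" for k
 proof (induction k)
  case 0
  show ?case using cv_deriv[OF cA] by (simp add: B_1[simplified])
 next
  case (Suc k)
  then show ?case using ev[of k] odd[of k] by simp
 qed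
 then have "cv (%n. B n (2 * Suc k))" using odd[of k] by simp
 then show ?thesis by (rule ehc)
qed

lemma G_nth_0: "fps_nth (G n) 0 = of_real (2*(theta*(1 - 1/N n) + kappa1 n) + 2 * kappa2 n)"
 by (simp add: G_def Hc_0[of 1, simplified] Hc_0[of 2, simplified])

text \<open>A pivot bounded below uniformly in \<open>n\<close>: \<open>N n >= 2\<close> keeps
  \<open>1 - 1/N n\<close> at least 1/2. It prevents the top coefficient from being lost in the odd
  steps of \<open>bounded_coeffs\<close>.\<close>

lemma G0_ge: "2*(theta*(1 - 1/N n) + kappa1 n) + 2 * kappa2 n >= theta"
proof -
 have "1/N n <= 1/2" using N2[of n] by (intro divide_left_mono) auto
 then have "theta*(1 - 1/N n) >= theta*(1/2)" using th by (intro mult_left_mono) auto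
 then show ?thesis using k1n[of n] k2n[of n] unfolding distrib_left by linarith
qed

text \<open>Two steps of the recursion at lowest order. When the linear coefficient vanishes, as for
  symmetric weights, the first eigenvalue is an explicit positive factor times the second
  moment.\<close>

lemma eh_1: "eh n 1 = (1/N n + (2*(theta*(1 - 1/N n) + kappa1 n) + 2 * kappa2 n))*(2 * Re (fps_nth (A n 0) 2))"
 if "fps_nth (A n 0) 1 = 0"
proof -
 have "fps_nth (fps_X * B n (Suc (Suc (2*0)))) 1 = fps_nth (B n 2) 0" by (simp add: numeral_2_eq_2)
 then have "fps_nth (B n 2) 0 = fps_nth (fps_const (of_real (1/N n))*(fps_X * fps_deriv (B n (Suc (2*0)))) + G n * B n (Suc (2*0))) 1"
  unfolding B_odd by simp
 also have "... = of_real (1/N n) * fps_nth (B n 1 ) 1 + (fps_nth (G n) 0 * fps_nth (B n 1) 1 + fps_nth (G n) 1 * fps_nth (B n 1) 0)"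
  by (simp add: fps_mult_nth sum.atLeast_Suc_atMost)
 also have "fps_nth (B n 1) 0 = 0" unfolding B_1 using that by simp
 also have "fps_nth (B n 1) 1 = 2 * fps_nth (A n 0) 2" unfolding B_1 by (simp add: numeral_2_eq_2)
 finally have "of_real (eh n 1) = of_real (1/N n + (2*(theta*(1 - 1/N n) + kappa1 n) + 2 * kappa2 n))*(2 * fps_nth (A n 0) 2)"
  using eh_eq[of n 0] unfolding G_nth_0 by (simp add: algebra_simps numeral_2_eq_2)
 then have "Re (of_real (eh n 1)) = Re (of_real (1/N n + (2*(theta*(1 - 1/N n) + kappa1 n) + 2 * kappa2 n))*(2 * fps_nth (A n 0) 2))" by simp
 then show ?thesis unfolding times_complex.sel Re_complex_of_real Im_complex_of_real by simp
qed

text \<open>\<open>F\<close> is of order \<open>q^w\<close> uniformly in \<open>n\<close>. The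
  exponent acts as a grading in which the Taylor coefficient of order \<open>j\<close> has weight
  \<open>j\<close> and the scaled eigenvalue \<open>eh n k\<close> has weight
  \<open>2*k\<close>.\<close>

definition bd :: "(nat => real) => (nat => complex) => nat => bool" where
 "bd q F w \<longleftrightarrow> (\<exists>C\<ge>0. \<forall>n. cmod (F n) <= C * q n ^ w)"

lemma bd_add: "bd q F w ==> bd q F' w ==> bd q (%n. F n + F' n) w"
proof -
 assume "bd q F w" "bd q F' w"
 then obtain C C' where C: "C >= 0" "\<And>n. cmod (F n) <= C * q n ^ w" "C' >= 0" "\<And>n. cmod (F' n) <= C' * q n ^ w" by (auto simp: bd_def)
 have "cmod (F n + F' n) <= (C + C') * q n ^ w" for n
  using norm_triangle_ineq[of "F n" "F' n"] C(2)[of n] C(4)[of n] by (simp add: algebra_simps)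
 then show ?thesis unfolding bd_def using C by (intro exI[of _ "C + C'"]) auto
qed

lemma bd_mult:
 assumes "\<And>n. q n >= 1" "bd q F w" "bd q F' w'" shows "bd q (%n. F n * F' n) (w + w')"
proof -
 obtain C C' where C: "C >= 0" "\<And>n. cmod (F n) <= C * q n ^ w" "C' >= 0" "\<And>n. cmod (F' n) <= C' * q n ^ w'" using assms by (auto simp: bd_def)
 have "cmod (F n * F' n) <= (C * C') * q n ^ (w + w')" for n
 proof -
  have "0 <= q n" using assms(1)[of n] by linarith
  then have "cmod (F n * F' n) <= (C * q n ^ w)*(C' * q n ^ w')" unfolding norm_mult using C by (intro mult_mono) auto
  then show ?thesis by (simp add: power_add algebra_simps)
 qed
 then show ?thesis unfolding bd_def using C by (intro exI[of _ "C * C'"]) auto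
qed

lemma bd_mono: assumes "\<And>n. q n >= 1" "bd q F w" "w <= w'" shows "bd q F w'"
proof -
 obtain C where C: "C >= 0" "\<And>n. cmod (F n) <= C * q n ^ w" using assms by (auto simp: bd_def)
 have "cmod (F n) <= C * q n ^ w'" for n
  using C(2)[of n] mult_left_mono[OF power_increasing[OF assms(3) assms(1)[of n]] C(1)] by linarith
 then show ?thesis unfolding bd_def using C(1) by blast
qed

lemma bd_sum: "finite S ==> (\<And>i. i \<in> S ==> bd q (F i) w) ==> (\<And>n. q n >= 1) ==> bd q (%n. \<Sum>i\<in>S. F i n) w"
proof (induction S rule: finite_induct)
 case empty then show ?case by (auto simp: bd_def intro!: exI[of _ 0])
next
 case (insert i S)
 then show ?case using bd_add[of q "F i" w "%n. \<Sum>i\<in>S. F i n"] by simp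
qed

lemma bd_uminus: "bd q F w ==> bd q (%n. - F n) w"
 by (simp add: bd_def)

lemma bd_diff: "bd q F w ==> bd q F' w ==> bd q (%n. F n - F' n) w"
 using bd_add[of q F w "%n. - F' n"] bd_uminus[of q F' w] by simp

lemma bd_const: "(\<And>n. q n >= 1) ==> (\<And>n. cmod (F n) <= C) ==> bd q F 0"
 unfolding bd_def by (intro exI[of _ "\<bar>C\<bar>"]) (auto intro: order_trans[OF _ abs_ge_self])

lemma bd_scale: assumes "\<And>n. q n >= 1" "bd q F 0" "bd q F' w" shows "bd q (%n. F n * F' n) w"
 using bd_mult[OF assms] by simp

text \<open>The recursion respects the grading. The unknown coefficient of order \<open>J\<close>
  travels through \<open>B n m\<close> as the coefficient of order \<open>J - m\<close>, always with
  a factor bounded below; at \<open>m = J\<close> it sits in the constant term, which is an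
  eigenvalue of weight \<open>J\<close>. Solving for it gives the bound.\<close>

theorem bounded_coeffs:
 assumes q: "\<And>n. q n >= 1" and ehb: "\<And>k. \<exists>C. \<forall>n. \<bar>eh n (Suc k)\<bar> <= C * q n ^ (2 * Suc k)"
  and kb: "\<And>n. kappa1 n <= K" "\<And>n. kappa2 n <= K" and odd0: "\<And>n j. odd j ==> fps_nth (A n 0) j = 0"
 shows "bd q (%n. fps_nth (A n 0) j) j"
proof (induction j rule: less_induct)
 case (less J)
 note IH = less
 have ehb': "bd q (%n. of_real (eh n (Suc k))) (2 * Suc k)" for k
 proof -
  obtain C where C: "\<And>n. \<bar>eh n (Suc k)\<bar> <= C * q n ^ (2 * Suc k)" using ehb by blast
  have "0 <= q n ^ (2 * Suc k)" for n using q[of n] by simp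
  then have "\<bar>eh n (Suc k)\<bar> <= \<bar>C\<bar> * q n ^ (2 * Suc k)" for n using C[of n] by (meson abs_ge_self mult_right_mono order_trans)
  then show ?thesis unfolding bd_def by (intro exI[of _ "\<bar>C\<bar>"]) auto
 qed
 have iN: "bd q (%n. of_real (1/N n)) 0"
  by (rule bd_const[OF q, of _ 1]) (use N2 in \<open>auto simp: norm_divide abs_of_pos[OF N0] divide_le_eq_1 intro: order_trans[of 1 2]\<close>)
 have Gb: "bd q (%n. fps_nth (G n) i) 0" for i
 proof -
  have 1: "bd q (%n. of_real (theta*(1 - 1/N n) + kappa1 n)) 0"
  proof (rule bd_const[OF q, of _ "theta + K"])
   fix n
   have "1/N n <= 1" "1/N n >= 0" using N2[of n] by auto
   then have "0 <= theta*(1 - 1/N n)" "theta*(1 - 1/N n) <= theta" using th by (auto simp: mult_left_le)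
   then show "cmod (of_real (theta*(1 - 1/N n) + kappa1 n)) <= theta + K" unfolding norm_of_real using kb(1)[of n] k1n[of n] by simp
  qed
  have 2: "bd q (%n. of_real (2 * kappa2 n)) 0"
   by (rule bd_const[OF q, of _ "2 * K"]) (use kb(2) k2n in \<open>auto simp: norm_mult\<close>)
  have h: "bd q (%n. fps_nth (Hc m) i) 0" for m by (rule bd_const[OF q order_refl])
  show ?thesis unfolding G_def fps_add_nth fps_mult_left_const_nth
   by (intro bd_add bd_scale[OF q 1 h] bd_scale[OF q 2 h])
 qed
 have Hb: "bd q (%n. of_real theta * fps_nth (Hc 1) i) 0" for i by (rule bd_const[OF q order_refl])
 show ?case
 proof (cases "odd J \<or> J = 0")
  case True
  have "0 <= q n" for n using q[of n] by linarith
  then show ?thesis using True odd0 A0 by (auto simp: bd_def intro!: exI[of _ 1])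
 next
  case False
  then obtain k where Jk: "J = 2 * Suc k" by (metis dvdE not0_implies_Suc mult_0_right)
  define phi where "phi = (%n. fps_nth (A n 0) J)"
  \<comment> \<open>The invariant of the induction on \<open>m\<close>: coefficients of total weight
    below \<open>J\<close> have their expected order, and the one of total weight \<open>J\<close>
    is \<open>phi\<close> times a factor at least \<open>gamma\<close>, up to an error of order
    \<open>q^J\<close>.\<close>
  define Q where "Q = (%m. (\<forall>r. m + r < J --> bd q (%n. fps_nth (B n m) r) (m + r)) \<and>
    (\<exists>c gamma. gamma > 0 \<and> (\<forall>n. c n >= gamma) \<and> bd q (%n. fps_nth (B n m) (J - m) - of_real (c n) * phi n) J))"
  have step: "Q (Suc m)" if Qm: "Q m" and m: "1 <= m" "Suc m <= J"
   and rec: "\<And>n r. fps_nth (B n (Suc m)) r = of_real (real (Suc r)/N n) * fps_nth (B n m) (Suc r) + fps_nth (g n * B n m) (Suc r) - T n r"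
   and gb: "\<And>i. bd q (%n. fps_nth (g n) i) 0" and g0: "\<And>n. fps_nth (g n) 0 = of_real (g0 n)" "gamma0 > 0" "\<And>n. g0 n >= gamma0"
   and Tb: "\<And>r. Suc m + r <= J ==> bd q (%n. T n r) (Suc m + r)" for m g g0 gamma0 T
  proof -
   have exp: "fps_nth (B n (Suc m)) r = of_real (real (Suc r)/N n + g0 n) * fps_nth (B n m) (Suc r) + (\<Sum>i=1..Suc r. fps_nth (g n) i * fps_nth (B n m) (Suc r - i)) - T n r" for n r
    unfolding rec fps_mult_nth by (subst sum.atLeast_Suc_atMost) (auto simp: g0 algebra_simps)
   have fb: "bd q (%n. of_real (real (Suc r)/N n + g0 n)) 0" for r
   proof -
    have "bd q (%n. of_nat (Suc r) * of_real (1/N n) + fps_nth (g n) 0) 0"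
     by (intro bd_add gb bd_scale[OF q _ iN] bd_const[OF q order_refl])
    then show ?thesis by (simp add: g0)
   qed
   have Bb: "bd q (%n. fps_nth (B n m) r) (m + r)" if "m + r < J" for r using Qm that by (auto simp: Q_def)
   have rest: "bd q (%n. \<Sum>i=1..Suc r. fps_nth (g n) i * fps_nth (B n m) (Suc r - i)) (Suc m + r)" if r: "Suc m + r <= J" for r
   proof (rule bd_sum[OF _ _ q])
    fix i assume i: "i \<in> {1..Suc r}"
    have "bd q (%n. fps_nth (B n m) (Suc r - i)) (m + (Suc r - i))" by (rule Bb) (use i r in auto)
    then have "bd q (%n. fps_nth (B n m) (Suc r - i)) (Suc m + r)" by (rule bd_mono[OF q]) (use i in auto)
    then show "bd q (%n. fps_nth (g n) i * fps_nth (B n m) (Suc r - i)) (Suc m + r)" by (rule bd_scale[OF q gb])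
   qed simp
   show ?thesis unfolding Q_def
   proof (intro conjI allI impI)
    fix r assume r: "Suc m + r < J"
    have "bd q (%n. fps_nth (B n m) (Suc r)) (Suc m + r)" using Bb[of "Suc r"] r by simp
    then show "bd q (%n. fps_nth (B n (Suc m)) r) (Suc m + r)" unfolding exp
     by (intro bd_add bd_diff bd_scale[OF q fb] rest Tb) (use r in auto)
   next
    obtain c gamma where c: "gamma > 0" "\<And>n. c n >= gamma" "bd q (%n. fps_nth (B n m) (J - m) - of_real (c n) * phi n) J"
     using Qm by (auto simp: Q_def)
    define r where "r = J - Suc m"
    have r: "Suc r = J - m" "Suc m + r = J" using m by (auto simp: r_def)
    define c' where "c' = (%n. (real (Suc r)/N n + g0 n) * c n)"
    have "c' n >= gamma0 * gamma" for n
    proof -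
     have "real (Suc r)/N n >= 0" using N0[of n] by simp
     then show ?thesis unfolding c'_def using c(1) c(2)[of n] g0(2) g0(3)[of n] by (intro mult_mono) auto
    qed
    moreover have "bd q (%n. fps_nth (B n (Suc m)) (J - Suc m) - of_real (c' n) * phi n) J"
    proof -
     have e: "fps_nth (B n (Suc m)) (J - Suc m) - of_real (c' n) * phi n =
      of_real (real (Suc r)/N n + g0 n)*(fps_nth (B n m) (J - m) - of_real (c n) * phi n) + (\<Sum>i=1..Suc r. fps_nth (g n) i * fps_nth (B n m) (Suc r - i)) - T n r" for n
      unfolding r_def[symmetric] exp r(1)[symmetric] c'_def by (simp add: algebra_simps)
     show ?thesis unfolding e
      using rest[of r] Tb[of r] r(2) by (intro bd_add bd_diff bd_scale[OF q fb] c(3)) auto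
    qed
    ultimately show "\<exists>c gamma. gamma > 0 \<and> (\<forall>n. c n >= gamma) \<and> bd q (%n. fps_nth (B n (Suc m)) (J - Suc m) - of_real (c n) * phi n) J"
     using c(1) g0(2) by (intro exI[of _ c'] exI[of _ "gamma0 * gamma"]) auto
   qed
  qed
  have Q1: "Q 1" unfolding Q_def
  proof (intro conjI allI impI)
   fix r assume r: "1 + r < J"
   have "bd q (%n. of_nat (Suc r) * fps_nth (A n 0) (Suc r)) (Suc r)"
    using IH[of "Suc r"] r by (intro bd_scale[OF q bd_const[OF q order_refl]]) auto
   then show "bd q (%n. fps_nth (B n 1) r) (1 + r)" unfolding B_1 by simp
  next
   have "fps_nth (B n 1) (J - 1) - of_real (real J) * phi n = 0" for n unfolding B_1 using Jk by (simp add: phi_def)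
   then have "bd q (%n. fps_nth (B n 1) (J - 1) - of_real (real J) * phi n) J" by (auto simp: bd_def intro!: exI[of _ 0])
   then show "\<exists>c gamma. gamma > 0 \<and> (\<forall>n. c n >= gamma) \<and> bd q (%n. fps_nth (B n 1) (J - 1) - of_real (c n) * phi n) J"
    using Jk by (intro exI[of _ "%_. real J"] exI[of _ "real J"]) auto
  qed
  have nX: "fps_nth F r = fps_nth (fps_X * F) (Suc r)" for F :: "complex fps" and r by simp
  have Qodd: "Q (Suc (Suc (2*l)))" if "Q (Suc (2*l))" "Suc (Suc (2*l)) <= J" for l
  proof (rule step[OF that(1) _ that(2), of G "%_ _. 0" "%n. 2*(theta*(1 - 1/N n) + kappa1 n) + 2 * kappa2 n" theta])
   show "fps_nth (B n (Suc (Suc (2*l)))) r = of_real (real (Suc r)/N n) * fps_nth (B n (Suc (2*l))) (Suc r) + fps_nth (G n * B n (Suc (2*l))) (Suc r) - 0" for n r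
    unfolding nX[of "B n (Suc (Suc (2*l)))"] B_odd by (simp add: algebra_simps add_divide_distrib)
   show "bd q (%n. 0) (Suc (Suc (2 * l)) + r)" for r by (auto simp: bd_def intro!: exI[of _ 0])
  qed (use Gb G_nth_0 th G0_ge in auto)
  have Qeven: "Q (Suc (2 * Suc l))" if "Q (2 * Suc l)" "Suc (2 * Suc l) <= J" for l
  proof (rule step[OF that(1) _ that(2), of "%_. fps_const (of_real theta) * Hc 1" "%n r. of_real (eh n (Suc l)) * fps_nth (fps_const (of_real theta) * Hc 1 * A n 0) (Suc r)" "%n. 2 * theta" "2 * theta"])
   show "fps_nth (B n (Suc (2 * Suc l))) r = of_real (real (Suc r)/N n) * fps_nth (B n (2 * Suc l)) (Suc r) + fps_nth (fps_const (of_real theta) * Hc 1 * B n (2 * Suc l)) (Suc r)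
     - of_real (eh n (Suc l)) * fps_nth (fps_const (of_real theta) * Hc 1 * A n 0) (Suc r)" for n r
   proof -
    have "fps_const (of_real theta) * Hc 1*(B n (2 * Suc l) - fps_const (of_real (eh n (Suc l))) * A n 0) =
     fps_const (of_real theta) * Hc 1 * B n (2 * Suc l) - fps_const (of_real (eh n (Suc l)))*(fps_const (of_real theta) * Hc 1 * A n 0)"
     by (simp only: right_diff_distrib mult_ac)
    then show ?thesis unfolding nX[of "B n (Suc (2 * Suc l))"] B_even
     by (simp only: fps_add_nth fps_sub_nth fps_mult_left_const_nth) (simp add: algebra_simps add_divide_distrib)
   qed
   show "bd q (%n. fps_nth (fps_const (complex_of_real theta) * Hc 1) i) 0" for i by (rule bd_const[OF q order_refl])
   show "fps_nth (fps_const (complex_of_real theta) * Hc 1) 0 = of_real (2 * theta)" by (simp add: Hc_0[of 1, simplified])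
   fix r assume r: "Suc (2 * Suc l) + r <= J"
   have "bd q (%n. fps_nth (fps_const (of_real theta) * Hc 1 * A n 0) (Suc r)) (Suc r)"
    unfolding fps_mult_nth[of "fps_const (of_real theta) * Hc 1"]
   proof (rule bd_sum[OF _ _ q])
    fix i assume i: "i \<in> {0..Suc r}"
    have "bd q (%n. fps_nth (A n 0) (Suc r - i)) (Suc r - i)" by (rule IH) (use r in auto)
    then have "bd q (%n. fps_nth (A n 0) (Suc r - i)) (Suc r)" by (rule bd_mono[OF q]) auto
    then show "bd q (%n. fps_nth (fps_const (of_real theta) * Hc 1) i * fps_nth (A n 0) (Suc r - i)) (Suc r)"
     by (intro bd_scale[OF q bd_const[OF q order_refl]])
   qed simp
   from bd_mult[OF q ehb'[of l] this]
   show "bd q (%n. of_real (eh n (Suc l)) * fps_nth (fps_const (of_real theta) * Hc 1 * A n 0) (Suc r)) (Suc (2 * Suc l) + r)" by simp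
  qed (use th in auto)
  have "Suc (2*l) <= J ==> Q (Suc (2*l))" for l
  proof (induction l)
   case 0 then show ?case using Q1 by simp
  next
   case (Suc l)
   then show ?case using Qodd[of l] Qeven[of l] by simp
  qed
  then have "Q J" using Qodd[of k] Jk by simp
  then obtain c gamma where c: "gamma > 0" "\<And>n. c n >= gamma" "bd q (%n. fps_nth (B n J) 0 - of_real (c n) * phi n) J" by (auto simp: Q_def)
  have "bd q (%n. fps_nth (B n J) 0) J" using ehb'[of k] unfolding Jk eh_eq .
  from bd_diff[OF this c(3)] have "bd q (%n. of_real (c n) * phi n) J" by simp
  then obtain C where C: "C >= 0" "\<And>n. cmod (of_real (c n) * phi n) <= C * q n ^ J" by (auto simp: bd_def)
  have "cmod (phi n) <= C/gamma * q n ^ J" for n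
  proof -
   have "gamma * cmod (phi n) <= c n * cmod (phi n)" using c(2)[of n] by (intro mult_right_mono) auto
   also have "... = cmod (of_real (c n) * phi n)" using c(1) c(2)[of n] by (simp add: norm_mult)
   finally have "gamma * cmod (phi n) <= C * q n ^ J" using C(2)[of n] by linarith
   then show ?thesis using c(1) by (simp add: field_simps)
  qed
  then show ?thesis unfolding bd_def phi_def using C(1) c(1) by (intro exI[of _ "C/gamma"]) auto
 qed
qed

end

section \<open>Size bounds from the first eigenvalue\<close>

lemma chebyshev_dec:
 fixes f :: "nat => real"
 assumes "\<And>i j. i <= j ==> f j <= f i"
 shows "(\<Sum>i<n. f i*(real n - 1 - 2 * real i)) >= 0"
proof -
 \<comment> \<open>Pairing \<open>i\<close> with \<open>n - 1 - i\<close> makes both factors of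
   every product have the same sign.\<close>
 have "(\<Sum>i<n. f i*(real n - 1 - 2 * real i)) = (\<Sum>i<n. f (n - Suc i)*(real n - 1 - 2 * real (n - Suc i)))"
  by (rule sum.nat_diff_reindex[symmetric])
 also have "... = (\<Sum>i<n. - (f (n - Suc i)*(real n - 1 - 2 * real i)))"
  by (intro sum.cong refl) (auto simp: of_nat_diff algebra_simps)
 finally have "2*(\<Sum>i<n. f i*(real n - 1 - 2 * real i)) = (\<Sum>i<n. f i*(real n - 1 - 2 * real i)) + (\<Sum>i<n. - (f (n - Suc i)*(real n - 1 - 2 * real i)))"
  by simp
 also have "... = (\<Sum>i<n. (f i - f (n - Suc i))*(real n - 1 - 2 * real i))"
  by (simp add: sum.distrib[symmetric] algebra_simps)
 also have "... >= 0"
 proof (rule sum_nonneg)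
  fix i assume i: "i \<in> {..<n}"
  show "(f i - f (n - Suc i))*(real n - 1 - 2 * real i) >= 0"
  proof (cases "i <= n - Suc i")
   case True
   then show ?thesis using assms[of i "n - Suc i"] i by (intro mult_nonneg_nonneg) auto
  next
   case False
   then show ?thesis using assms[of "n - Suc i" i] i by (intro mult_nonpos_nonpos) auto
  qed
 qed
 finally show ?thesis by simp
qed

context bc
begin

lemma EE_0: "EE lam 0 = real n" by (simp add: EE_def)

lemma vv_1: "i < n ==> vv lam (Suc 0) i = real (lam i)"
 using vv_even[of lam 0 i] by (simp add: aa_def of_nat_diff algebra_simps)

lemma vv_2: "i < n ==> vv lam 2 i = (aa lam i + 2 * rho0) * real (lam i) + theta*(\<Sum>j<i. real (lam j))"
 using vv_odd[of lam 0 i] vv_1[of _ lam] by (simp del: vv.simps add: numeral_2_eq_2)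

text \<open>Each summand equals \<open>(ll lam i)^2\<close> minus the same square for the empty
  partition, the familiar quadratic eigenvalue.\<close>

lemma EE_1: "EE lam 1 = (\<Sum>i<n. real (lam i)*(aa lam i + 2 * rho0 + theta*(real n - 1 - real i)))"
proof -
 have "EE lam 1 = (\<Sum>i<n. (aa lam i + 2 * rho0) * real (lam i)) + theta*(\<Sum>i<n. \<Sum>j<i. real (lam j))"
  using vv_2 by (simp add: EE_def sum.distrib sum_distrib_left)
 then show ?thesis unfolding sum_triangle_swap by (simp add: sum.distrib[symmetric] sum_distrib_left algebra_simps)
qed

lemma EE_1_nonneg: "EE lam 1 >= 0"
 unfolding EE_1 using theta_pos rho0_nonneg by (intro sum_nonneg mult_nonneg_nonneg) (auto simp: aa_def)

lemma EE_1_ge_first: "n >= 1 ==> real (lam 0) ^ 2 <= EE lam 1"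
proof -
 assume n: "n >= 1"
 have "real (lam 0) ^ 2 <= real (lam 0)*(aa lam 0 + 2 * rho0 + theta*(real n - 1 - real 0))"
  unfolding power2_eq_square using n theta_pos rho0_nonneg by (intro mult_left_mono) (auto simp: aa_def)
 also have "... <= EE lam 1" unfolding EE_1 
  using n theta_pos rho0_nonneg by (intro member_le_sum) (auto simp: aa_def intro!: mult_nonneg_nonneg)
 finally show ?thesis .
qed

text \<open>Since the rows decrease, they put at least average weight on \<open>n - 1 - i\<close>,
  whose mean is half of \<open>n - 1\<close>. This converts the quadratic eigenvalue into a bound on
  the number of boxes.\<close>

lemma EE_1_ge_size:
 assumes "is_partition_len n lam" shows "theta*(real n - 1) * real (part_size n lam) <= EE lam 1"
proof -
 have "0 <= (\<Sum>i<n. real (lam i)*(real n - 1 - 2 * real i))"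
  by (rule chebyshev_dec) (use assms in \<open>auto simp: is_partition_len_def\<close>)
 moreover have "(\<Sum>i<n. real (lam i)*(2*(real n - 1 - real i))) = (\<Sum>i<n. real (lam i)*(real n - 1)) + (\<Sum>i<n. real (lam i)*(real n - 1 - 2 * real i))"
  unfolding sum.distrib[symmetric] by (intro sum.cong refl) (simp add: algebra_simps)
 ultimately have "theta*(\<Sum>i<n. real (lam i)*(real n - 1)) <= theta*(\<Sum>i<n. real (lam i)*(2*(real n - 1 - real i)))"
  using theta_pos by (intro mult_left_mono) auto
 also have "... <= EE lam 1" unfolding EE_1 sum_distrib_left
 proof (rule sum_mono)
  fix i assume "i \<in> {..<n}"
  have "theta*(real (lam i)*(2*(real n - 1 - real i))) = real (lam i)*(theta*(real n - 1 - real i) + theta*(real n - 1 - real i))" by (simp add: algebra_simps)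
  also have "... <= real (lam i)*(aa lam i + 2 * rho0 + theta*(real n - 1 - real i))"
   using rho0_nonneg by (intro mult_left_mono) (auto simp: aa_def)
  finally show "theta*(real (lam i)*(2*(real n - 1 - real i))) <= ..." .
 qed
 finally show ?thesis by (simp add: part_size_def sum_distrib_left sum_distrib_right mult_ac)
qed

text \<open>After two steps all entries of \<open>vv\<close> are nonnegative, so their l1 norm is
  \<open>EE lam 1\<close> itself; every further step costs at most a factor \<open>Kb lam\<close>.
  Keeping the factor \<open>EE lam 1\<close> makes the bound vanish for the empty partition.\<close>

lemma EE_bound:
 assumes "is_partition_len n lam"
 shows "\<bar>EE lam (Suc k)\<bar> <= Kb lam ^ (2*k) * EE lam 1"
proof -
 have "(\<Sum>i<n. \<bar>vv lam (m + 2) i\<bar>) <= Kb lam ^ m * EE lam 1" for m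
 proof (induction m)
  case 0
  have "\<bar>vv lam 2 i\<bar> = vv lam 2 i" if "i < n" for i
   unfolding vv_2[OF that] using that theta_pos rho0_nonneg by (intro abs_of_nonneg add_nonneg_nonneg mult_nonneg_nonneg sum_nonneg) (auto simp: aa_def)
  then have "(\<Sum>i<n. \<bar>vv lam 2 i\<bar>) = EE lam 1" unfolding EE_def by (intro sum.cong) auto
  then show ?case by (simp del: vv.simps add: numeral_2_eq_2)
 next
  case (Suc m)
  have "(\<Sum>i<n. \<bar>vv lam (Suc m + 2) i\<bar>) <= Kb lam*(\<Sum>i<n. \<bar>vv lam (m + 2) i\<bar>)" using vv_l1[OF assms, of "m + 2"] by simp
  also have "... <= Kb lam*(Kb lam ^ m * EE lam 1)" using Suc Kb_ge_1[of lam] by (intro mult_left_mono) auto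
  finally show ?case by simp
 qed
 from order_trans[OF sum_abs this[of "2*k"]] show ?thesis by (simp add: EE_def)
qed

end

section \<open>Moments of the coefficient weights\<close>

lemma convergent_approx:
 fixes M :: "nat => real"
 assumes "\<And>e. e > 0 ==> \<exists>D. convergent D \<and> (\<forall>\<^sub>F n in sequentially. \<bar>M n - D n\<bar> <= e)"
 shows "convergent M"
proof (rule Cauchy_convergent, rule metric_CauchyI)
 fix e :: real assume "e > 0"
 then obtain D where D: "convergent D" "\<forall>\<^sub>F n in sequentially. \<bar>M n - D n\<bar> <= e/4" using assms[of "e/4"] by auto
 obtain N1 where N1: "\<And>n. n >= N1 ==> \<bar>M n - D n\<bar> <= e/4" using D(2) by (auto simp: eventually_sequentially)
 obtain N2 where N2: "\<And>m n. m >= N2 ==> n >= N2 ==> dist (D m) (D n) < e/4"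
  using convergent_Cauchy[OF D(1)] \<open>e > 0\<close> metric_CauchyD[of D "e/4"] by auto
 have "dist (M m) (M n) < e" if "m >= max N1 N2" "n >= max N1 N2" for m n
 proof -
  have "\<bar>M m - D m\<bar> <= e/4" "\<bar>M n - D n\<bar> <= e/4" "\<bar>D m - D n\<bar> < e/4"
   using N1[of m] N1[of n] N2[of m n] that unfolding dist_real_def by auto
  then show ?thesis using \<open>e > 0\<close> unfolding dist_real_def by linarith
 qed
 then show "\<exists>K. \<forall>m\<ge>K. \<forall>n\<ge>K. dist (M m) (M n) < e" by blast
qed

lemma eventually_bounded_all:
 fixes M :: "nat => real"
 assumes "\<forall>\<^sub>F n in sequentially. M n <= B" shows "\<exists>B. \<forall>n. M n <= B"
proof -
 obtain N where N: "\<And>n. n >= N ==> M n <= B" using assms by (auto simp: eventually_sequentially)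
 have "M n <= Max (insert B (M ` {..<N}))" for n
  by (cases "n < N") (auto intro: Max_ge order_trans[OF N Max_ge])
 then show ?thesis by blast
qed

locale weights =
 fixes S :: "nat => 'a set" and p :: "nat => 'a => real" and x :: "'a => real" and h :: "real => real"
 assumes fin: "finite (S n)" and p_nonneg: "s \<in> S n ==> p n s >= 0" and p_sum: "(\<Sum>s\<in>S n. p n s) = 1"
  and lim: "(%n. \<Sum>s\<in>S n. p n s * cos (x s * t)) \<longlonglongrightarrow> h t" and cont: "continuous_on UNIV h"
begin

definition mo :: "nat => nat => real" where "mo k n = (\<Sum>s\<in>S n. p n s * x s ^ k)"

lemma h_0: "h 0 = 1"
 using lim[of 0] by (simp add: p_sum LIMSEQ_const_iff)

lemma averaged_one_minus_cos:
 fixes d y :: real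
 assumes d: "d > 0"
 shows "((%t. 1 - cos (y * t)) has_integral (if y = 0 then 0 else d - sin (y * d)/y)) {0..d}"
proof (cases "y = 0")
 case False
 have "((%t. 1 - cos (y * t)) has_integral ((d - sin (y * d)/y) - (0 - sin (y*0)/y))) {0..d}"
  by (rule fundamental_theorem_of_calculus[where f = "%t::real. t - sin (y * t)/y"]) (use d False in \<open>auto intro!: derivative_eq_intros simp: has_real_derivative_iff_has_vector_derivative[symmetric]\<close>)
 then show ?thesis using False by simp
qed simp

text \<open>The integral of \<open>1 - cos (y t)\<close> over \<open>[0, d]\<close> is at least
  \<open>d/2\<close> as soon as \<open>|y| >= 2/d\<close>, while the weighted integrals converge to
  that of \<open>1 - h\<close>, which is small compared with \<open>d\<close> by continuity of
  \<open>h\<close> at 0.\<close>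

lemma tight:
 assumes e: "e > 0"
 shows "\<exists>K>0. \<forall>\<^sub>F n in sequentially. (\<Sum>s\<in>{s\<in>S n. \<bar>x s\<bar> >= K}. p n s) <= e"
proof -
 have "isCont h 0" using cont by (simp add: continuous_on_eq_continuous_at)
 then obtain d0 where d0: "d0 > 0" "\<And>t. \<bar>t\<bar> < d0 ==> \<bar>h t - h 0\<bar> < e/4"
  using e unfolding continuous_at_eps_delta dist_real_def by (metis diff_zero divide_pos_pos zero_less_numeral)
 define d where "d = d0/2"
 have d: "d > 0" "1 - h t <= e/4" if "t \<in> {0..d}" for t
 proof -
  have "\<bar>t\<bar> < d0" using d0(1) that by (auto simp: d_def)
  from d0(2)[OF this] show "1 - h t <= e/4" unfolding h_0 by linarith
 qed (use d0 in \<open>simp add: d_def\<close>)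
 have d: "d > 0" "\<And>t. t \<in> {0..d} ==> 1 - h t <= e/4" using d d0(1) by (auto simp: d_def)
 define f where "f n t = (\<Sum>s\<in>S n. p n s*(1 - cos (x s * t)))" for n t
 define w where "w y = (if y = 0 then 0 else d - sin (y * d)/y)" for y
 have fint: "(f n has_integral (\<Sum>s\<in>S n. p n s * w (x s))) {0..d}" for n
  unfolding f_def w_def by (intro has_integral_sum fin has_integral_mult_right averaged_one_minus_cos d)
 have feq: "f n t = 1 - (\<Sum>s\<in>S n. p n s * cos (x s * t))" for n t
  unfolding f_def by (simp add: right_diff_distrib sum_subtractf p_sum)
 have fbd: "norm (f n t) <= 2" for n t
 proof -
  have "norm (f n t) <= (\<Sum>s\<in>S n. p n s*2)" unfolding f_def
  proof (rule order_trans[OF norm_sum sum_mono])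
   fix s assume "s \<in> S n"
   then show "norm (p n s*(1 - cos (x s * t))) <= p n s*2"
    using p_nonneg[of s n] cos_ge_minus_one[of "x s * t"] by (auto simp: abs_mult intro!: mult_left_mono)
  qed
  then show ?thesis by (simp add: sum_distrib_right[symmetric] p_sum)
 qed
 have int: "(%n. integral {0..d} (f n)) \<longlonglongrightarrow> integral {0..d} (%t. 1 - h t)" "(%t. 1 - h t) integrable_on {0..d}"
 proof -
  have i: "\<And>n. f n integrable_on {0..d}" using fint by blast
  have l: "\<And>t. t \<in> {0..d} ==> (%n. f n t) \<longlonglongrightarrow> 1 - h t" unfolding feq by (intro tendsto_diff tendsto_const lim)
  note dc = dominated_convergence[where f = f and h = "%_. 2", OF i integrable_const_ivl fbd l]
  show "(%n. integral {0..d} (f n)) \<longlonglongrightarrow> integral {0..d} (%t. 1 - h t)" "(%t. 1 - h t) integrable_on {0..d}"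
   using dc by simp_all
 qed
 have "integral {0..d} (%t. 1 - h t) <= integral {0..d} (%t. e/4)"
  using d int by (intro integral_le) auto
 also have "... < d * e/2" using d e by simp
 finally have "\<forall>\<^sub>F n in sequentially. integral {0..d} (f n) < d * e/2" using int(1) order_tendstoD(2) by blast
 then have "\<forall>\<^sub>F n in sequentially. (\<Sum>s\<in>{s\<in>S n. \<bar>x s\<bar> >= 2/d}. p n s) <= e"
 proof eventually_elim
  fix n assume n: "integral {0..d} (f n) < d * e/2"
  have w0: "w y >= 0" for y
   using has_integral_nonneg[OF averaged_one_minus_cos[OF d(1), of y]] by (simp add: w_def)
  have w1: "w y >= d/2" if "\<bar>y\<bar> >= 2/d" for y
  proof -
   have y: "\<bar>y\<bar> > 0" using that d by (smt (verit) divide_pos_pos)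
   have "sin (y * d)/y <= \<bar>sin (y * d)\<bar>/\<bar>y\<bar>" by (metis abs_divide abs_ge_self)
   also have "... <= 1/\<bar>y\<bar>" using y by (intro divide_right_mono) auto
   also have "... <= d/2" using that y d by (simp add: field_simps)
   finally show ?thesis using y by (simp add: w_def)
  qed
  have "(\<Sum>s\<in>{s\<in>S n. \<bar>x s\<bar> >= 2/d}. p n s)*(d/2) <= (\<Sum>s\<in>{s\<in>S n. \<bar>x s\<bar> >= 2/d}. p n s * w (x s))"
   unfolding sum_distrib_right using w1 p_nonneg by (intro sum_mono mult_left_mono) auto
  also have "... <= (\<Sum>s\<in>S n. p n s * w (x s))"
   using fin p_nonneg w0 by (intro sum_mono2) auto
  also have "... = integral {0..d} (f n)" using integral_unique[OF fint[of n]] by simp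
  finally have "(\<Sum>s\<in>{s\<in>S n. \<bar>x s\<bar> >= 2/d}. p n s)*(d/2) <= e*(d/2)" using n by (simp add: mult.commute)
  then show "(\<Sum>s\<in>{s\<in>S n. \<bar>x s\<bar> >= 2/d}. p n s) <= e" using d(1) by (simp only: mult_le_cancel_right_pos half_gt_zero)
 qed
 then show ?thesis using d by (intro exI[of _ "2/d"]) auto
qed

text \<open>By tightness only a small fraction of the mass lies outside \<open>[-K, K]\<close>. Its
  contribution to the second moment is estimated by the fourth moment, that is, by the square of the
  second; with a small enough fraction this can be absorbed on the left.\<close>

lemma second_moment_bounded:
 assumes "\<And>n. mo 4 n <= C*(1 + mo 2 n)^2"
 shows "\<exists>B. \<forall>n. mo 2 n <= B"
proof -
 define D where "D = max C 1"
 have D: "D > 0" by (simp add: D_def)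
 have m4: "mo 4 n <= D*(1 + mo 2 n)^2" for n
  using assms[of n] mult_right_mono[of C D "(1 + mo 2 n)^2"] by (simp add: D_def)
 obtain K where K: "K > 0" "\<forall>\<^sub>F n in sequentially. (\<Sum>s\<in>{s\<in>S n. \<bar>x s\<bar> >= K}. p n s) <= 1/(4 * D)"
  using tight[of "1/(4*D)"] D by auto
 from K(2) have "\<forall>\<^sub>F n in sequentially. mo 2 n <= 1 + 2 * K^2"
 proof eventually_elim
  fix n assume n: "(\<Sum>s\<in>{s\<in>S n. \<bar>x s\<bar> >= K}. p n s) <= 1/(4 * D)"
  define m where "m = 1 + mo 2 n"
  have m: "m > 0" unfolding m_def mo_def using p_nonneg by (smt (verit) sum_nonneg mult_nonneg_nonneg zero_le_power2)
  \<comment> \<open>Balances the two tail terms: the fourth moment term and the mass term, the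
    latter with tolerance \<open>1/(4*D)\<close>, are each at most \<open>m/4\<close>, so half of
    \<open>m\<close> remains on the left.\<close>
  define eta where "eta = 1/(4 * D * m)"
  have eta: "eta > 0" using D m by (simp add: eta_def)
  have amgm: "y^2 <= eta * y^4 + 1/(4*eta)" for y :: real
  proof -
   have "0 <= eta*(y^2 - 1/(2*eta))^2" using eta by simp
   also have "... = eta * y^4 - y^2 + 1/(4*eta)" using eta by (simp add: power2_eq_square field_simps power4_eq_xxxx)
   finally show ?thesis by simp
  qed
  have "mo 2 n <= (\<Sum>s\<in>S n. p n s * K^2 + (eta*(p n s * x s ^ 4) + (if \<bar>x s\<bar> >= K then p n s/(4*eta) else 0)))"
   unfolding mo_def
  proof (rule sum_mono)
   fix s assume s: "s \<in> S n"
   show "p n s * x s ^ 2 <= p n s * K^2 + (eta*(p n s * x s ^ 4) + (if \<bar>x s\<bar> >= K then p n s/(4*eta) else 0))"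
   proof (cases "\<bar>x s\<bar> >= K")
    case True
    have "p n s * x s ^ 2 <= p n s*(eta * x s ^ 4 + 1/(4*eta))" using amgm p_nonneg[OF s] by (intro mult_left_mono)
    moreover have "p n s * K^2 >= 0" using p_nonneg[OF s] by simp
    ultimately show ?thesis using True by (simp add: algebra_simps)
   next
    case False
    have "x s ^ 2 <= K^2" using False K by (simp add: abs_le_square_iff[symmetric])
    then have "p n s * x s ^ 2 <= p n s * K^2" using p_nonneg[OF s] by (intro mult_left_mono)
    moreover have "eta*(p n s * x s ^ 4) >= 0" using p_nonneg[OF s] eta by simp
    ultimately show ?thesis using False by simp
   qed
  qed
  also have "... = K^2 + eta * mo 4 n + (\<Sum>s\<in>{s\<in>S n. \<bar>x s\<bar> >= K}. p n s)/(4*eta)"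
   using fin[of n] by (simp add: sum.distrib sum_distrib_right[symmetric] sum_distrib_left[symmetric] p_sum mo_def sum_divide_distrib sum.If_cases Int_def)
  also have "... <= K^2 + eta*(D * m^2) + (1/(4 * D))/(4*eta)"
   using m4[of n] n eta by (intro add_mono mult_left_mono divide_right_mono) (auto simp: m_def)
  also have "... = K^2 + m/4 + m/4" using D m by (simp add: eta_def power2_eq_square field_simps)
  finally show "mo 2 n <= 1 + 2 * K^2" unfolding m_def by (simp add: field_simps)
 qed
 then show ?thesis by (rule eventually_bounded_all)
qed

text \<open>The lower even moments converge by induction and odd powers are absent from the cosine
  series. The transform at a fixed small \<open>t\<close> then determines the moment of order
  \<open>2*k\<close> up to an error controlled by \<open>t\<close> and the bounded moment of order
  \<open>2*k + 2\<close>.\<close>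

lemma moments_convergent:
 assumes "\<And>k. \<exists>B. \<forall>n. mo (2*k) n <= B"
 shows "convergent (mo (2*k))"
proof (induction k rule: less_induct)
 case (less k)
 obtain B where B: "\<And>n. mo (2 * Suc k) n <= B" using assms[of "Suc k"] by blast
 have e0: "mo (2 * Suc k) n >= 0" for n unfolding mo_def using p_nonneg by (intro sum_nonneg mult_nonneg_nonneg zero_le_even_power) auto
 have B0: "B >= 0" using B[of 0] e0[of 0] by linarith
 define a where "a = \<bar>cos_coeff (2*k)\<bar>"
 have a: "a > 0" by (simp add: a_def cos_coeff_def)
 show ?case
 proof (rule convergent_approx)
  fix e :: real assume e: "e > 0"
  \<comment> \<open>Makes the remainder \<open>t^(2*k + 2) * B\<close> at most \<open>e\<close>
    after division by the coefficient of the moment, whose absolute value is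
    \<open>a * t^(2*k)\<close>.\<close>
  define t where "t = min 1 (a * e/(B + 1))"
  have t: "t > 0" "t <= 1" "t * B <= a * e"
  proof -
   show "t > 0" "t <= 1" using e a B0 by (auto simp: t_def)
   have "t * B <= a * e/(B + 1) * B" using B0 by (intro mult_right_mono) (auto simp: t_def)
   also have "... <= a * e" using B0 e a by (simp add: field_simps)
   finally show "t * B <= a * e" .
  qed
  define P where "P n = (\<Sum>s\<in>S n. p n s * cos (x s * t))" for n
  define D where "D n = (P n - (\<Sum>m<2*k. cos_coeff m * t^m * mo m n))/(cos_coeff (2*k) * t^(2*k))" for n
  have "convergent (%n. cos_coeff m * t^m * mo m n)" if "m < 2*k" for m
  proof (cases "even m")
   case True
   then obtain j where "m = 2*j" by blast
   then show ?thesis using less[of j] that by (intro convergent_mult convergent_const) (auto simp: comp_def)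
  qed (simp add: cos_coeff_def convergent_const)
  then have "convergent (%n. \<Sum>m<2*k. cos_coeff m * t^m * mo m n)" by (intro convergent_sum) auto
  then have "convergent D" unfolding D_def divide_inverse
   using lim[of t] by (intro convergent_mult convergent_diff convergent_const) (auto simp: P_def convergent_def)
  moreover have "\<bar>mo (2*k) n - D n\<bar> <= e" for n
  proof -
   have cs: "\<bar>cos y - (\<Sum>m<2*k. cos_coeff m * y^m) - cos_coeff (2*k) * y^(2*k)\<bar> <= y^(2 * Suc k)" for y
   proof -
    obtain c where c: "cos y = (\<Sum>m<2 * Suc k. cos_coeff m * y^m) + cos (c + 1/2 * real (2 * Suc k) * pi)/fact (2 * Suc k) * y^(2 * Suc k)"
     using Maclaurin_cos_expansion[of y "2 * Suc k"] by auto
    have "(\<Sum>m<2 * Suc k. cos_coeff m * y^m) = (\<Sum>m<2*k. cos_coeff m * y^m) + cos_coeff (2*k) * y^(2*k)" by (simp add: cos_coeff_def)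
    then have e: "cos y - (\<Sum>m<2*k. cos_coeff m * y^m) - cos_coeff (2*k) * y^(2*k) = cos (c + 1/2 * real (2 * Suc k) * pi)/fact (2 * Suc k) * y^(2 * Suc k)"
     using c by linarith
    have "even (2 * Suc k)" by simp
    then have "\<bar>cos y - (\<Sum>m<2*k. cos_coeff m * y^m) - cos_coeff (2*k) * y^(2*k)\<bar> = \<bar>cos (c + 1/2 * real (2 * Suc k) * pi)/fact (2 * Suc k)\<bar> * y^(2 * Suc k)"
     unfolding e abs_mult power_abs by (simp only: power_even_abs)
    also have "\<bar>cos (c + 1/2 * real (2 * Suc k) * pi)/fact (2 * Suc k)\<bar> <= 1/1"
     unfolding abs_divide by (intro frac_le) (auto simp: fact_ge_1 simp del: fact_Suc)
    finally show ?thesis using zero_le_even_power[of "2 * Suc k" y] by (simp only: mult_right_mono div_by_1 mult_1 even_mult_iff even_numeral simp_thms)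
   qed
   have "P n - (\<Sum>m<2*k. cos_coeff m * t^m * mo m n) - cos_coeff (2*k) * t^(2*k) * mo (2*k) n =
    (\<Sum>s\<in>S n. p n s*(cos (x s * t) - (\<Sum>m<2*k. cos_coeff m*(x s * t)^m) - cos_coeff (2*k)*(x s * t)^(2*k)))"
    unfolding P_def mo_def sum_distrib_left
    by (subst sum.swap) (simp add: sum_subtractf[symmetric] right_diff_distrib sum_distrib_left power_mult_distrib mult_ac)
   also have "\<bar>...\<bar> <= (\<Sum>s\<in>S n. p n s*(x s * t)^(2 * Suc k))"
   proof (rule order_trans[OF sum_abs sum_mono])
    fix s assume "s \<in> S n"
    then show "\<bar>p n s*(cos (x s * t) - (\<Sum>m<2*k. cos_coeff m*(x s * t)^m) - cos_coeff (2*k)*(x s * t)^(2*k))\<bar> <= p n s*(x s * t)^(2 * Suc k)"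
     unfolding abs_mult using p_nonneg by (simp only: abs_of_nonneg) (intro mult_left_mono cs)
   qed
   also have "... = t^(2 * Suc k) * mo (2 * Suc k) n" by (simp add: mo_def power_mult_distrib sum_distrib_left mult_ac)
   also have "... <= t^(2 * Suc k) * B" using B t by (intro mult_left_mono) auto
   also have "... = t^(2*k)*(t*(t * B))" by simp
   also have "... <= t^(2*k)*(1*(a * e))" using t a e B0 by (intro mult_left_mono[OF mult_mono[OF t(2,3)]]) auto
   finally have *: "\<bar>P n - (\<Sum>m<2*k. cos_coeff m * t^m * mo m n) - cos_coeff (2*k) * t^(2*k) * mo (2*k) n\<bar> <= e*\<bar>cos_coeff (2*k) * t^(2*k)\<bar>"
    using t by (simp add: abs_mult a_def mult_ac)
   define q where "q = cos_coeff (2*k) * t^(2*k)"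
   have q: "q ~= 0" using a t by (auto simp: a_def q_def)
   have "mo (2*k) n - D n = - (P n - (\<Sum>m<2*k. cos_coeff m * t^m * mo m n) - q * mo (2*k) n)/q"
    using q unfolding D_def q_def[symmetric] by (simp add: field_simps)
   then have "\<bar>mo (2*k) n - D n\<bar> = \<bar>P n - (\<Sum>m<2*k. cos_coeff m * t^m * mo m n) - q * mo (2*k) n\<bar>/\<bar>q\<bar>" by (simp only: abs_divide abs_minus_cancel)
   also have "... <= e" using * q by (simp add: q_def[symmetric] pos_divide_le_eq)
   finally show ?thesis .
  qed
  ultimately show "\<exists>D. convergent D \<and> (\<forall>\<^sub>F n in sequentially. \<bar>mo (2*k) n - D n\<bar> <= e)" by auto
 qed
qed

end

section \<open>Row and column limits from smooth statistics\<close>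

lemma convergent_not_both:
 fixes D :: "nat => real"
 assumes "convergent D" "\<exists>\<^sub>F n in sequentially. D n <= p" "\<exists>\<^sub>F n in sequentially. D n >= q"
 shows "q <= p"
proof (rule ccontr)
 assume "\<not> q <= p"
 then have pq: "p < q" by simp
 obtain L where L: "D \<longlonglongrightarrow> L" using assms(1) by (auto simp: convergent_def)
 show False
 proof (cases "p < L")
  case True
  then have "\<forall>\<^sub>F n in sequentially. D n > p" using L order_tendstoD(1) by blast
  then show False using assms(2) by (simp add: frequently_def not_le)
 next
  case False
  then have "\<forall>\<^sub>F n in sequentially. D n < q" using L pq order_tendstoD(2)[of D L] by simp
  then show False using assms(3) by (simp add: frequently_def not_le)
 qed
qed

text \<open>Convergence without knowledge of the limit: an oscillating sequence would be infinitely
  often below and infinitely often above some gap. Only gaps above \<open>l\<close> need to be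
  excluded, and this is where step functions can tell the two behaviours apart.\<close>

lemma convergent_by_gaps:
 fixes Z :: "nat => real"
 assumes low: "\<And>a. a < l ==> \<forall>\<^sub>F n in sequentially. a <= Z n" and up: "\<And>n. Z n <= u"
  and gap: "\<And>a b. l < a ==> a < b ==> \<exists>\<^sub>F n in sequentially. Z n <= a ==> \<exists>\<^sub>F n in sequentially. Z n >= b ==> False"
 shows "convergent Z"
proof -
 define A where "A = {a. \<forall>\<^sub>F n in sequentially. a <= Z n}"
 have ub: "a <= u" if aA: "a \<in> A" for a
 proof -
  obtain n where "a <= Z n" using aA unfolding A_def eventually_sequentially by blast
  then show ?thesis using up[of n] by linarith
 qed
 have ne: "l - 1 \<in> A" using low[of "l - 1"] by (simp add: A_def)
 have bdd: "bdd_above A" using ub by (auto simp: bdd_above_def)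
 define s where "s = Sup A"
 have ls: "l <= s"
 proof (rule dense_le)
  fix a assume "a < l"
  then have "a \<in> A" using low by (simp add: A_def)
  then show "a <= s" unfolding s_def using bdd by (rule cSup_upper)
 qed
 have "Z \<longlonglongrightarrow> s"
 proof (rule order_tendstoI)
  fix a assume "a < s"
  then obtain a' where "a' \<in> A" "a < a'" using ne bdd unfolding s_def using less_cSup_iff[of A a] by auto
  then show "\<forall>\<^sub>F n in sequentially. a < Z n" unfolding A_def by (auto elim: eventually_mono)
 next
  fix b assume b: "s < b"
  define a where "a = (s + b)/2"
  have ab: "s < a" "a < b" using b by (auto simp: a_def)
  have "a \<notin> A" using ab(1) cSup_upper[OF _ bdd, of a] unfolding s_def by auto
  then have "\<exists>\<^sub>F n in sequentially. Z n <= a" unfolding A_def frequently_def using eventually_mono[of "%n. \<not> Z n <= a" sequentially "%n. a <= Z n"] by force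
  then have "\<not> (\<exists>\<^sub>F n in sequentially. Z n >= b)" using gap[of a b] ab ls by auto
  then show "\<forall>\<^sub>F n in sequentially. Z n < b" by (simp add: frequently_def not_le)
 qed
 then show ?thesis by (auto simp: convergent_def)
qed

definition psq :: "real => real" where "psq y = (max 0 y)^2"

lemma psq_second_order: "\<bar>psq (y + h) - psq y - h*(2 * max 0 y)\<bar> <= h^2"
proof -
 have p: "(y + h)^2 = y^2 + 2*h*y + h^2" by (simp add: power2_eq_square algebra_simps)
 consider "y >= 0 \<and> y + h >= 0" | "y < 0 \<and> y + h < 0" | "y >= 0 \<and> y + h < 0" | "y < 0 \<and> y + h >= 0" by linarith
 then show ?thesis
 proof cases
  case 1 then show ?thesis by (simp add: psq_def p)
 next
  case 2 then show ?thesis by (simp add: psq_def)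
 next
  case 3
  have "y*(- 2 * h - y) <= h^2" using zero_le_power2[of "y + h"] unfolding p by (simp add: power2_eq_square algebra_simps)
  moreover have "y*(- 2 * h - y) >= 0" using 3 by (intro mult_nonneg_nonneg) auto
  ultimately show ?thesis using 3 by (simp add: psq_def power2_eq_square algebra_simps)
 next
  case 4
  then have "(y + h)^2 <= h^2" by (intro power_mono) auto
  then show ?thesis using 4 by (simp add: psq_def)
 qed
qed

lemma psq_deriv: "(psq has_real_derivative 2 * max 0 y) (at y)"
 unfolding has_field_derivative_def has_derivative_at
proof (intro conjI)
 show "bounded_linear ((*) (2 * max 0 y))" by (rule bounded_linear_mult_right)
 show "((%h. norm (psq (y + h) - psq y - 2 * max 0 y * h)/norm h) \<longlongrightarrow> 0) (at 0)"
 proof (rule Lim_null_comparison)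
  show "\<forall>\<^sub>F h in at 0. norm (norm (psq (y + h) - psq y - 2 * max 0 y * h)/norm h) <= \<bar>h\<bar>"
  proof (intro always_eventually allI)
   fix h :: real
   show "norm (norm (psq (y + h) - psq y - 2 * max 0 y * h)/norm h) <= \<bar>h\<bar>"
   proof (cases "h = 0")
    case False
    have "\<bar>psq (y + h) - psq y - 2 * max 0 y * h\<bar> <= \<bar>h\<bar>*\<bar>h\<bar>"
     using psq_second_order[of y h] by (simp add: power2_eq_square mult_ac)
    then show ?thesis using False by (simp add: pos_divide_le_eq)
   qed simp
  qed
  show "((%h::real. \<bar>h\<bar>) \<longlongrightarrow> 0) (at 0)" by (intro tendsto_rabs_zero tendsto_ident_at)
 qed
qed

text \<open>A quadratic spline rising from 0 at \<open>a\<close> to 1/2 at \<open>b\<close>. It is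
  continuously differentiable, as polynomial approximation of the derivative requires, and its
  Taylor error of second order is bounded uniformly.\<close>

definition stp :: "real => real => real => real" where
 "stp a b t = (let y = (t - a)/(b - a) in psq y - 2 * psq (y - 1/2) + psq (y - 1))"

definition stp' :: "real => real => real => real" where
 "stp' a b t = (let y = (t - a)/(b - a) in (2 * max 0 y - 4 * max 0 (y - 1/2) + 2 * max 0 (y - 1))*(1/(b - a)))"

lemma stp_deriv: "a < b ==> (stp a b has_real_derivative stp' a b t) (at t)"
proof -
 assume ab: "a < b"
 have "((%y. psq y - 2 * psq (y - 1/2) + psq (y - 1)) has_real_derivative 2 * max 0 y - 4 * max 0 (y - 1/2) + 2 * max 0 (y - 1)) (at y)" for y
  by (auto intro!: derivative_eq_intros DERIV_chain2[OF psq_deriv])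
 moreover have "((%t. (t - a)/(b - a)) has_real_derivative 1/(b - a)) (at t)" using ab by (auto intro!: derivative_eq_intros)
 ultimately show ?thesis unfolding stp_def[abs_def] stp'_def Let_def by (rule DERIV_chain2)
qed

lemma stp'_cont: "a < b ==> continuous_on UNIV (stp' a b)"
 unfolding stp'_def[abs_def] Let_def by (intro continuous_intros) auto

lemma stp_low: "a < b ==> t <= a ==> stp a b t = 0" "a < b ==> t <= a ==> stp' a b t = 0"
proof -
 assume ab: "a < b" "t <= a"
 define y where "y = (t - a)/(b - a)"
 have "y <= 0" unfolding y_def using ab by (simp add: divide_nonpos_pos)
 then show "stp a b t = 0" "stp' a b t = 0" by (auto simp: stp_def stp'_def psq_def y_def[symmetric] Let_def)
qed

lemma stp_high: "a < b ==> t >= b ==> stp a b t = 1/2"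
proof -
 assume ab: "a < b" "t >= b"
 define y where "y = (t - a)/(b - a)"
 have "y >= 1" unfolding y_def using ab by (simp add: le_divide_eq)
 then have m: "max 0 y = y" "max 0 (y - 1/2) = y - 1/2" "max 0 (y - 1) = y - 1" by auto
 show ?thesis unfolding stp_def Let_def y_def[symmetric] psq_def m by (simp add: power2_eq_square algebra_simps)
qed

lemma stp_mono: "a < b ==> t <= t' ==> stp a b t <= stp a b t'"
proof (rule DERIV_nonneg_imp_nondecreasing[of t t'])
 fix x assume "a < b"
 have "0 <= 2 * max 0 y - 4 * max 0 (y - 1/2) + 2 * max 0 (y - 1)" for y :: real by (simp add: max_def)
 then have "stp' a b x >= 0" unfolding stp'_def Let_def using \<open>a < b\<close> by (intro mult_nonneg_nonneg) auto
 then show "\<exists>y. (stp a b has_real_derivative y) (at x) \<and> 0 <= y" using stp_deriv[OF \<open>a < b\<close>] by blast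
qed

lemma stp_range: "a < b ==> 0 <= stp a b t \<and> stp a b t <= 1/2"
 using stp_mono[of a b "min t a" t] stp_low(1)[of a b "min t a"] stp_mono[of a b t "max t b"] stp_high[of a b "max t b"] by simp

lemma stp_second_order: "a < b ==> \<bar>stp a b (t + h) - stp a b t - h * stp' a b t\<bar> <= 4*(h/(b - a))^2"
proof -
 assume ab: "a < b"
 define y where "y = (t - a)/(b - a)"
 define k where "k = h/(b - a)"
 have e: "(t + h - a)/(b - a) = y + k" by (simp add: y_def k_def diff_divide_distrib add_divide_distrib)
 have "h * stp' a b t = k*(2 * max 0 y) - 2*(k*(2 * max 0 (y - 1/2))) + k*(2 * max 0 (y - 1))"
  unfolding stp'_def Let_def y_def[symmetric] k_def by (simp add: algebra_simps add_divide_distrib diff_divide_distrib)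
 then have e: "stp a b (t + h) - stp a b t - h * stp' a b t = (psq (y + k) - psq y - k*(2 * max 0 y))
   - 2*(psq (y - 1/2 + k) - psq (y - 1/2) - k*(2 * max 0 (y - 1/2))) + (psq (y - 1 + k) - psq (y - 1) - k*(2 * max 0 (y - 1)))"
  unfolding stp_def Let_def e y_def[symmetric] by (simp add: algebra_simps)
 have "\<bar>A - 2 * B + D\<bar> <= 4 * q" if "\<bar>A\<bar> <= q" "\<bar>B\<bar> <= q" "\<bar>D\<bar> <= q" for A B D q :: real using that by linarith
 from this[OF psq_second_order psq_second_order psq_second_order] show ?thesis unfolding k_def[symmetric] e .
qed

text \<open>The points \<open>Y n i\<close> are a reference configuration and \<open>X n i\<close>
  the same points moved to the right. The bound on the total displacement controls the differences
  \<open>Lam F n\<close>, although the two sums separately have a growing number of terms.\<close>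

locale diffs =
 fixes X Y :: "nat => nat => real" and T C :: real and m :: "nat => nat"
 assumes Y0: "i < m n ==> 0 <= Y n i" and YX: "i < m n ==> Y n i <= X n i" and XT: "i < m n ==> X n i <= T"
  and mass: "(\<Sum>i<m n. X n i - Y n i) <= C" and T0: "T >= 0"
begin

definition Lam :: "(real => real) => nat => real" where
 "Lam F n = (\<Sum>i<m n. F (X n i) - F (Y n i))"

lemma row_bound:
 assumes "\<And>t. t \<in> {0..T} ==> (F has_real_derivative f t) (at t)" "\<And>t. t \<in> {0..T} ==> \<bar>f t\<bar> <= e" "i < m n"
 shows "\<bar>F (X n i) - F (Y n i)\<bar> <= e*(X n i - Y n i)"
proof -
 have "norm (F (X n i) - F (Y n i)) <= e * norm (X n i - Y n i)"
  by (rule field_differentiable_bound[of "{0..T}" F f])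
   (use assms Y0[OF assms(3)] YX[OF assms(3)] XT[OF assms(3)] in \<open>auto intro: has_field_derivative_at_within\<close>)
 then show ?thesis using YX[OF assms(3)] by simp
qed

lemma Lam_bound:
 assumes "\<And>t. t \<in> {0..T} ==> (F has_real_derivative f t) (at t)" "\<And>t. t \<in> {0..T} ==> \<bar>f t\<bar> <= e"
 shows "\<bar>Lam F n\<bar> <= e * C"
proof -
 have e: "e >= 0" using assms(2)[of 0] T0 abs_ge_zero[of "f 0"] by force
 have "\<bar>Lam F n\<bar> <= (\<Sum>i<m n. e*(X n i - Y n i))" unfolding Lam_def
  by (rule order_trans[OF sum_abs sum_mono]) (use row_bound[OF assms] in auto)
 also have "... <= e * C" unfolding sum_distrib_left[symmetric] using mass e by (intro mult_left_mono)
 finally show ?thesis .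
qed

lemma Lam_diff: "Lam (%t. F t - G t) n = Lam F n - Lam G n"
 by (simp add: Lam_def sum_subtractf)

lemma Lam_scale: "Lam (%t. c * F t) n = c * Lam F n"
 by (simp add: Lam_def sum_distrib_left right_diff_distrib)

lemma Lam_sum: "Lam (%t. \<Sum>k\<in>K. F k t) n = (\<Sum>k\<in>K. Lam (F k) n)"
 unfolding Lam_def sum_subtractf[symmetric] by (rule sum.swap)

lemma C0: "C >= 0"
proof -
 have "0 <= (\<Sum>i<m 0. X 0 i - Y 0 i)" using YX by (intro sum_nonneg) auto
 then show ?thesis using mass[of 0] by linarith
qed

text \<open>For large \<open>V\<close> the kernel is a geometric series in \<open>t^2 / V\<close>.
  After removal of the lower terms, known by induction, \<open>V^(k+1)\<close> times the rest is
  \<open>t^(2*k)\<close> up to a function whose derivative on \<open>[0, T]\<close> is at most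
  \<open>E/V\<close>; the choice of \<open>V\<close> makes the resulting error at most
  \<open>e\<close>.\<close>

lemma even_powers_convergent:
 assumes "\<And>V. V > V0 ==> convergent (Lam (%t. 1/(V - t^2)))"
 shows "convergent (Lam (%t. t^(2*k)))"
proof (induction k rule: less_induct)
 case (less k)
 define E where "E = 8*(real k + 2) * T*(T^2)^k"
 have E0: "E >= 0" using T0 by (simp add: E_def)
 show ?case
 proof (rule convergent_approx)
  fix e :: real assume e: "e > 0"
  define V where "V = max (V0 + 1) (max (2 * T^2 + 1) (E * C/e))"
  have V: "V > V0" "V > 2 * T^2" "E * C/e <= V" by (auto simp: V_def)
  have Vp: "V > 0" using V(2) zero_le_power2[of T] by linarith
  have tb: "t^2 <= T^2" "V/2 <= V - t^2" if "t \<in> {0..T}" for t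
  proof -
   show "t^2 <= T^2" using that by (intro power_mono) auto
   then show "V/2 <= V - t^2" using V(2) by linarith
  qed
  define D where "D n = V^(Suc k)*(Lam (%t. 1/(V - t^2)) n - (\<Sum>j<k. 1/V^Suc j * Lam (%t. t^(2*j)) n))" for n
  have "convergent (%n. \<Sum>j<k. 1/V^Suc j * Lam (%t. t^(2*j)) n)"
   by (intro convergent_sum convergent_mult convergent_const less) auto
  then have "convergent D" unfolding D_def
   by (intro convergent_mult convergent_const convergent_diff assms[OF V(1)])
  moreover have "\<bar>Lam (%t. t^(2*k)) n - D n\<bar> <= e" for n
  proof -
   define G where "G t = t^(2*k) - V^Suc k*(1/(V - t^2) - (\<Sum>j<k. 1/V^Suc j * t^(2*j)))" for t
   have "Lam (%t. t^(2*k)) n - D n = Lam G n"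
    unfolding G_def D_def Lam_diff Lam_scale Lam_sum ..
   moreover have "Lam G n = Lam (%t. - ((t^2)^Suc k/(V - t^2))) n"
   proof -
    have "G t = - ((t^2)^Suc k/(V - t^2))" if t: "t \<in> {0..T}" for t
    proof -
     have p: "V - t^2 > 0" using tb[OF t] Vp by linarith
     define w where "w = (\<Sum>j<k. V^(k - Suc j)*(t^2)^j)"
     have w1: "(V - t^2) * w = V^k - (t^2)^k" unfolding w_def
      using power_diff_sumr2[of "t^2" k V] by (metis minus_diff_eq mult_minus_left)
     have w2: "V^Suc k*(\<Sum>j<k. 1/V^Suc j * t^(2*j)) = V * w"
      unfolding sum_distrib_left w_def
     proof (intro sum.cong refl)
      fix j assume "j \<in> {..<k}"
      then have "V^Suc k = V*(V^(k - Suc j) * V^Suc j)" unfolding power_add[symmetric] by simp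
      then show "V^Suc k*(1/V^Suc j * t^(2*j)) = V*(V^(k - Suc j)*(t^2)^j)" using Vp by (simp add: power_mult)
     qed
     have "G t = (t^2)^k - (V^Suc k/(V - t^2) - V * w)" unfolding G_def right_diff_distrib w2 by (simp add: power_mult)
     then have "(V - t^2) * G t = (V - t^2)*(t^2)^k - ((V - t^2)*(V^Suc k/(V - t^2)) - V*((V - t^2) * w))"
      by (simp only: right_diff_distrib mult.left_commute)
     also have "(V - t^2)*(V^Suc k/(V - t^2)) = V^Suc k" using p by simp
     also have "(V - t^2)*(t^2)^k - (V^Suc k - V*((V - t^2) * w)) = (V - t^2)*(t^2)^k - V^Suc k + V*(V^k - (t^2)^k)"
      unfolding w1 by simp
     also have "... = - ((t^2)^Suc k)" by (simp add: algebra_simps)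
     finally show ?thesis using p by (simp add: field_simps)
    qed
    then show ?thesis unfolding Lam_def using Y0 YX XT by (intro sum.cong refl) (force intro: order_trans)
   qed
   moreover have "\<bar>Lam (%t. - ((t^2)^Suc k/(V - t^2))) n\<bar> <= (E/V) * C"
   proof (rule Lam_bound)
    fix t assume t: "t \<in> {0..T}"
    have p: "V - t^2 > 0" "V/2 <= V - t^2" using tb[OF t] Vp by auto
    show "((%t. - ((t^2)^Suc k/(V - t^2))) has_real_derivative
      - ((real (Suc k)*(t^2)^k*(2 * t))/(V - t^2) + (t^2)^Suc k*(2 * t)/(V - t^2)^2)) (at t)"
    proof -
     have 1: "((%y. y^Suc k) has_real_derivative real (Suc k) * y^k) (at y)" for y :: real using DERIV_pow[of "Suc k" y] by simp
     have 2: "((%y. V - y) has_real_derivative -1) (at y)" for y by (auto intro!: derivative_eq_intros)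
     have 3: "((%t. t^2) has_real_derivative 2 * t) (at t)" by (auto intro!: derivative_eq_intros)
     have "V - t^2 ~= 0" using p by simp
     from DERIV_minus[OF DERIV_chain2[OF DERIV_divide[OF 1 2 this] 3]]
     have "((%t. - ((t^2)^Suc k/(V - t^2))) has_real_derivative
       - ((real (Suc k)*(t^2)^k*(V - t^2) - (t^2)^Suc k*-1)/((V - t^2)*(V - t^2))*(2 * t))) (at t)" .
     moreover have "(A * w - B*-1)/(w * w)*(2 * t) = A*(2 * t)/w + B*(2 * t)/w^2" if "w ~= 0" for A B w :: real
      using that by (simp add: field_simps power2_eq_square)
     ultimately show ?thesis using p by simp
    qed
    have a: "(real (Suc k)*(t^2)^k*(2 * t))/(V - t^2) <= (real (Suc k)*(T^2)^k*(2 * T))/(V/2)"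
     using t p tb[OF t] Vp by (intro frac_le mult_mono power_mono mult_nonneg_nonneg) auto
    have "(V/2)^2 <= (V - t^2)^2" using p Vp by (intro power_mono) auto
    then have "(t^2)^Suc k*(2 * t)/(V - t^2)^2 <= ((T^2)^k*(V/2)*(2 * T))/(V/2)^2"
     unfolding power_Suc2 using t p tb[OF t] Vp V(2) by (intro frac_le mult_mono power_mono mult_nonneg_nonneg) auto
    also have "... = (T^2)^k*(2 * T)/(V/2)" using Vp by (simp add: power2_eq_square)
    finally have b: "(t^2)^Suc k*(2 * t)/(V - t^2)^2 <= (T^2)^k*(2 * T)/(V/2)" .
    have "(real (Suc k)*(T^2)^k*(2 * T))/(V/2) + (T^2)^k*(2 * T)/(V/2) <= E/V"
     using Vp T0 by (simp add: E_def field_simps)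
    moreover have "0 <= (real (Suc k)*(t^2)^k*(2 * t))/(V - t^2)" "0 <= (t^2)^Suc k*(2 * t)/(V - t^2)^2"
     using t p by (auto intro!: divide_nonneg_pos mult_nonneg_nonneg)
    ultimately show "\<bar>- ((real (Suc k)*(t^2)^k*(2 * t))/(V - t^2) + (t^2)^Suc k*(2 * t)/(V - t^2)^2)\<bar> <= E/V"
     using a b by linarith
   qed
   moreover have "(E/V) * C <= e" using V(3) Vp e by (simp add: field_simps)
   ultimately show ?thesis by linarith
  qed
  ultimately show "\<exists>D. convergent D \<and> (\<forall>\<^sub>F n in sequentially. \<bar>Lam (%t. t^(2*k)) n - D n\<bar> <= e)" by auto
 qed
qed

text \<open>As \<open>f\<close> vanishes near 0, the quotient \<open>f t / t\<close> is a continuous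
  function of \<open>t^2\<close> on \<open>[0, T]\<close>, hence uniformly close to a polynomial
  \<open>g (t^2)\<close>. The primitive \<open>Q\<close> of \<open>t * g (t^2)\<close> is an even
  polynomial, and closeness of derivatives passes to \<open>Lam\<close> through
  \<open>Lam_bound\<close>.\<close>

theorem smooth_convergent:
 assumes even: "\<And>k. convergent (Lam (%t. t^(2*k)))"
  and F: "\<And>t. (F has_real_derivative f t) (at t)" and f: "continuous_on UNIV f" and s: "s > 0" "\<And>t. t <= s ==> f t = 0"
 shows "convergent (Lam F)"
proof (rule convergent_approx)
 fix e :: real assume e: "e > 0"
 define e' where "e' = e/(T * C + 1)"
 have TC: "T * C >= 0" using T0 C0 by simp
 have e': "e' > 0" using e TC by (simp add: e'_def)
 \<comment> \<open>The maximum with \<open>s\<close> keeps the denominator positive and does not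
   alter the quotient where \<open>f\<close> is nonzero.\<close>
 define h where "h x = f (sqrt x)/max (sqrt x) s" for x
 have "continuous_on {0..T^2} h" unfolding h_def
  by (intro continuous_intros continuous_on_compose2[OF f]) (use s in auto)
 then obtain g where g: "real_polynomial_function g" "\<And>x. x \<in> {0..T^2} ==> \<bar>h x - g x\<bar> < e'"
  using Stone_Weierstrass_real_polynomial_function[of "{0..T^2}" h e'] e' by auto
 obtain a N where g': "g = (%x. \<Sum>i\<le>N. a i * x^i)" using g(1) unfolding real_polynomial_function_iff_sum by auto
 define Q where "Q t = (\<Sum>i\<le>N. (a i/(2 * real i + 2)) * t^(2 * Suc i))" for t
 have Q': "(Q has_real_derivative t * g (t^2)) (at t)" for t
 proof -
  have "(Q has_real_derivative (\<Sum>i\<le>N. (a i/(2 * real i + 2))*(real (2 * Suc i) * t^(2 * Suc i - 1)))) (at t)"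
   unfolding Q_def One_nat_def by (intro DERIV_sum DERIV_cmult DERIV_pow)
  moreover have "(\<Sum>i\<le>N. (a i/(2 * real i + 2))*(real (2 * Suc i) * t^(2 * Suc i - 1))) = t * g (t^2)"
   unfolding g' sum_distrib_left
  proof (intro sum.cong refl)
   fix i
   have "2 * real i + 2 ~= 0" by linarith
   moreover have "t^(2 * Suc i - 1) = t*(t^2)^i" by (simp add: power_mult)
   moreover have "real (2 * Suc i) = 2 * real i + 2" by simp
   ultimately show "(a i/(2 * real i + 2))*(real (2 * Suc i) * t^(2 * Suc i - 1)) = t*(a i*(t^2)^i)"
    by (simp only: times_divide_eq_left nonzero_mult_div_cancel_left mult.assoc[symmetric] mult.commute[of t] nonzero_eq_divide_eq) simp
  qed
  ultimately show ?thesis by simp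
 qed
 have "Lam Q = (%n. \<Sum>i\<le>N. a i/(2 * real i + 2) * Lam (%t. t^(2 * Suc i)) n)"
  unfolding Q_def[abs_def] fun_eq_iff Lam_sum Lam_scale by simp
 then have "convergent (Lam Q)" by (simp only:) (intro convergent_sum convergent_mult convergent_const even)
 moreover have "\<bar>Lam F n - Lam Q n\<bar> <= e" for n
 proof -
  have "\<bar>Lam (%t. F t - Q t) n\<bar> <= (T * e') * C"
  proof (rule Lam_bound)
   fix t assume t: "t \<in> {0..T}"
   show "((%t. F t - Q t) has_real_derivative f t - t * g (t^2)) (at t)" by (intro DERIV_diff F Q')
   have "f t = t * h (t^2)" using t s by (cases "t <= s") (auto simp: h_def)
   then have "\<bar>f t - t * g (t^2)\<bar> = t*\<bar>h (t^2) - g (t^2)\<bar>" using t by (simp add: abs_mult flip: right_diff_distrib)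
   also have "t^2 \<in> {0..T^2}" using t by (auto intro: power_mono)
   then have "t*\<bar>h (t^2) - g (t^2)\<bar> <= T * e'" using t g(2)[of "t^2"] by (intro mult_mono) auto
   finally show "\<bar>f t - t * g (t^2)\<bar> <= T * e'" .
  qed
  also have "(T * e') * C <= e" using TC e by (simp add: e'_def field_simps)
  finally show ?thesis by (simp add: Lam_diff)
 qed
 ultimately show "\<exists>D. convergent D \<and> (\<forall>\<^sub>F n in sequentially. \<bar>Lam F n - D n\<bar> <= e)" by auto
qed

end

text \<open>\<open>X\<close> and \<open>Y\<close> will be the parameters \<open>ll\<close> of
  \<open>lam n\<close> and of the empty partition, divided by the number \<open>n + 2\<close> of
  variables. \<open>T\<close> bounds the largest point and \<open>C\<close> the number of boxes per
  variable.\<close>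

locale vk =
 fixes theta rhob T C :: real and rho :: "nat => real" and lam :: "nat => nat => nat"
 assumes th: "theta > 0" and rho0: "rho n >= 0" and rho_lim: "(%n. rho n/real (n + 2)) \<longlonglongrightarrow> rhob"
  and part: "is_partition_len (n + 2) (lam n)"
  and first: "(real (lam n 0) + theta * real (n + 1) + rho n)/real (n + 2) <= T"
  and size: "real (part_size (n + 2) (lam n)) <= C * real (n + 2)"
begin

definition Y :: "nat => nat => real" where "Y n i = (theta*(real n + 1 - real i) + rho n)/real (n + 2)"
definition X :: "nat => nat => real" where "X n i = Y n i + real (lam n i)/real (n + 2)"

lemma dec: "i <= j ==> lam n j <= lam n i" and zero: "i >= n + 2 ==> lam n i = 0"
 using part by (auto simp: is_partition_len_def)

lemma Y_step: "Y n i = Y n 0 - theta*(real i/real (n + 2))"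
 by (simp add: Y_def diff_divide_distrib add_divide_distrib algebra_simps)

lemma Y_antimono: "i <= j ==> Y n j <= Y n i"
 unfolding Y_step[of n i] Y_step[of n j] using th by (simp add: mult_left_mono divide_right_mono)

lemma X_antimono: "i <= j ==> X n j <= X n i"
 unfolding X_def using Y_antimono[of i j n] dec[of i j n] by (intro add_mono divide_right_mono) auto

lemma YX_le: "Y n i <= X n i" by (simp add: X_def)

lemma Y_nonneg: "i < n + 2 ==> Y n i >= 0"
 unfolding Y_def using th rho0 by (intro divide_nonneg_nonneg add_nonneg_nonneg mult_nonneg_nonneg) auto

lemma X_le: "X n i <= T"
 using X_antimono[of 0 i n] first[of n] by (simp add: X_def Y_def add_divide_distrib algebra_simps)

lemma mass_eq: "(\<Sum>i<n+2. X n i - Y n i) = real (part_size (n + 2) (lam n))/real (n + 2)"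
 by (simp add: X_def part_size_def sum_divide_distrib[symmetric] del: sum.lessThan_Suc)

sublocale diffs X Y T C "%n. n + 2"
proof
 show "(\<Sum>i<n+2. X n i - Y n i) <= C" for n unfolding mass_eq using size[of n] by (simp add: divide_le_eq)
 show "T >= 0" using order_trans[OF Y_nonneg[of 0 0] order_trans[OF YX_le X_le]] by simp
qed (use Y_nonneg YX_le X_le in auto)

text \<open>The limit of \<open>Y n i\<close> for every fixed \<open>i\<close>: the upper end of the
  reference configuration, whose lower end tends to \<open>rhob\<close>.\<close>

definition tau :: real where "tau = theta + rhob"

lemma rhob: "rhob >= 0"
 by (rule tendsto_lowerbound[OF rho_lim]) (use rho0 in \<open>auto intro!: divide_nonneg_nonneg\<close>)

lemma Y_lim: "(%n. Y n i) \<longlonglongrightarrow> tau"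
proof -
 have "(%n. (real n + 1 - real i)/real (n + 2)) \<longlonglongrightarrow> 1" by real_asymp
 from tendsto_add[OF tendsto_mult_left[OF this, of theta] rho_lim] show ?thesis
  by (simp add: Y_def tau_def add_divide_distrib)
qed

context
 assumes even: "\<And>k. convergent (Lam (%t. t^(2*k)))"
begin

lemma stp_convergent: "0 < a ==> a < b ==> convergent (Lam (stp a b))"
 by (rule smooth_convergent[OF even stp_deriv stp'_cont _ stp_low(2)]) auto

text \<open>A step to the right of \<open>tau\<close> is eventually 0 at all reference points, so
  its statistic counts rows. It is at most \<open>i/2\<close> when \<open>X n i <= a\<close> and at
  least \<open>(i + 1)/2\<close> when \<open>X n i >= b\<close>; a convergent statistic cannot do
  both infinitely often.\<close>

lemma rows: "convergent (%n. real (lam n i)/real (n + 2))"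
proof -
 have "convergent (%n. X n i)"
 proof (rule convergent_by_gaps)
  fix a assume "a < tau"
  then have "\<forall>\<^sub>F n in sequentially. a < Y n i" using Y_lim order_tendstoD(1) by blast
  then show "\<forall>\<^sub>F n in sequentially. a <= X n i" by (rule eventually_mono) (use YX_le[of _ i] in \<open>meson less_imp_le order_trans\<close>)
 next
  show "X n i <= T" for n by (rule X_le)
 next
  fix a b assume ab: "tau < a" "a < b" and f: "\<exists>\<^sub>F n in sequentially. X n i <= a" "\<exists>\<^sub>F n in sequentially. X n i >= b"
  have a0: "a > 0" using ab th rhob by (simp add: tau_def)
  have ev: "\<forall>\<^sub>F n in sequentially. Y n 0 < a" using Y_lim[of 0] ab order_tendstoD(2) by blast
  have ev2: "\<forall>\<^sub>F n in sequentially. i < n + 2" by (intro eventually_sequentiallyI[of i]) auto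
  have L: "Lam (stp a b) n = (\<Sum>k<n+2. stp a b (X n k))" if "Y n 0 < a" for n
  proof -
   have "Y n k <= a" for k using that Y_antimono[of 0 k n] by simp
   then show ?thesis unfolding Lam_def by (simp add: stp_low[OF ab(2)])
  qed
  have "\<exists>\<^sub>F n in sequentially. Lam (stp a b) n <= real i/2"
   using frequently_eventually_conj[OF f(1) eventually_conj[OF ev ev2]]
  proof (rule frequently_mono[rotated], safe)
   fix n assume n: "Y n 0 < a" "i < n + 2" "X n i <= a"
   have "(\<Sum>k<n+2. stp a b (X n k)) <= (\<Sum>k<n+2. if k < i then 1/2 else 0)"
   proof (rule sum_mono)
    fix k
    show "stp a b (X n k) <= (if k < i then 1/2 else 0)"
     using stp_range[OF ab(2)] stp_low(1)[OF ab(2), of "X n k"] X_antimono[of i k n] n(3) by (cases "k < i") auto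
   qed
   also have "... = (\<Sum>k<i. 1/2)" using n(2) by (intro sum.mono_neutral_cong_right) auto
   also have "... = real i/2" by simp
   finally show "Lam (stp a b) n <= real i/2" using L[OF n(1)] by simp
  qed
  moreover have "\<exists>\<^sub>F n in sequentially. Lam (stp a b) n >= real (Suc i)/2"
   using frequently_eventually_conj[OF f(2) eventually_conj[OF ev ev2]]
  proof (rule frequently_mono[rotated], safe)
   fix n assume n: "Y n 0 < a" "i < n + 2" "b <= X n i"
   have "real (Suc i)/2 = (\<Sum>k\<in>{..i}. stp a b (X n k))"
   proof -
    have "stp a b (X n k) = 1/2" if "k <= i" for k using X_antimono[OF that, of n] n(3) by (intro stp_high[OF ab(2)]) linarith
    then have "(\<Sum>k\<in>{..i}. stp a b (X n k)) = (\<Sum>k\<in>{..i}. 1/2)" by (intro sum.cong) auto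
    then show ?thesis by simp
   qed
   also have "... <= (\<Sum>k<n+2. stp a b (X n k))" using n(2) stp_range[OF ab(2)] by (intro sum_mono2) auto
   finally show "Lam (stp a b) n >= real (Suc i)/2" using L[OF n(1)] by simp
  qed
  ultimately show False using convergent_not_both[OF stp_convergent[OF a0 ab(2)]] by fastforce
 qed
 moreover have "convergent (%n. Y n i)" using Y_lim by (auto simp: convergent_def)
 ultimately show ?thesis using convergent_diff[of "%n. X n i" "%n. Y n i"] by (simp add: X_def)
qed

text \<open>The reference points form an arithmetic progression with step
  \<open>theta/(n + 2)\<close>, so for \<open>h = theta\<close> the sum telescopes to the full
  height 1/2. Other shifts are compared at first order, where the sum is proportional to
  \<open>h\<close>; the quadratic errors add up to order \<open>1/n\<close>.\<close>

lemma shift_lim: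
 assumes ab: "rhob < a" "a < b" "b < tau"
 shows "(%n. \<Sum>i<n+2. stp a b (Y n i + h/real (n + 2)) - stp a b (Y n i)) \<longlonglongrightarrow> h/(2 * theta)"
proof -
 define E where "E h n = (\<Sum>i<n+2. stp a b (Y n i + h/real (n + 2)) - stp a b (Y n i))" for h n
 define Q where "Q = 4*(theta * h^2 + \<bar>h\<bar> * theta^2)/(b - a)^2"
 have "\<forall>\<^sub>F n in sequentially. norm (theta * E h n - h/2) <= Q/real (n + 2)"
 proof -
  have "\<forall>\<^sub>F n in sequentially. b < Y n 0" using Y_lim[of 0] ab order_tendstoD(1) by blast
  moreover have "\<forall>\<^sub>F n in sequentially. rho n/real (n + 2) < a" using rho_lim ab order_tendstoD(2) by blast
  ultimately show ?thesis
  proof eventually_elim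
   fix n assume n: "b < Y n 0" "rho n/real (n + 2) < a"
   have "E theta n = 1/2"
   proof -
    define g where "g i = stp a b (Y n 0 + theta/real (n + 2) - theta*(real i/real (n + 2)))" for i
    have "stp a b (Y n i + theta/real (n + 2)) = g i" "stp a b (Y n i) = g (Suc i)" for i
     using Y_step[of n i] unfolding g_def by (auto intro!: arg_cong[where f = "stp a b"] simp: add_divide_distrib distrib_left)
    then have "E theta n = (\<Sum>i<n+2. g i - g (Suc i))" unfolding E_def by simp
    also have "... = g 0 - g (n + 2)" by (rule sum_lessThan_telescope')
    also have "g 0 = 1/2" 
    proof -
     have "b <= Y n 0 + theta/real (n + 2)" using n(1) th by (smt (verit) divide_nonneg_nonneg of_nat_0_le_iff)
     then show ?thesis unfolding g_def by (simp add: stp_high[OF ab(2)])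
    qed
    also have "Y n 0 + theta/real (n + 2) - theta*(real (n + 2)/real (n + 2)) = rho n/real (n + 2)"
    proof -
     have "Y n 0 + theta/real (n + 2) = (theta * real (n + 2) + rho n)/real (n + 2)"
      unfolding Y_def add_divide_distrib[symmetric] by (simp add: algebra_simps)
     then show ?thesis by (simp add: add_divide_distrib)
    qed
    then have "g (n + 2) = 0" unfolding g_def using n by (simp only: stp_low(1)[OF ab(2)] less_imp_le)
    finally show ?thesis by simp
   qed
   then have "theta * E h n - h/2 = theta * E h n - h * E theta n" by simp
   also have "... = (\<Sum>i<n+2. theta*(stp a b (Y n i + h/real (n + 2)) - stp a b (Y n i)) - h*(stp a b (Y n i + theta/real (n + 2)) - stp a b (Y n i)))"
    unfolding E_def sum_distrib_left sum_subtractf[of "%i. theta*(stp a b (Y n i + h/real (n + 2)) - stp a b (Y n i))"] ..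
   finally have eq: "theta * E h n - h/2 = (\<Sum>i<n+2. theta*(stp a b (Y n i + h/real (n + 2)) - stp a b (Y n i)) - h*(stp a b (Y n i + theta/real (n + 2)) - stp a b (Y n i)))" .
   have "norm (theta * E h n - h/2) <= (\<Sum>i<n+2. Q/real (n + 2)^2)"
    unfolding eq
   proof (rule order_trans[OF norm_sum sum_mono])
    fix i
    let ?N = "real (n + 2)"
    define u v where "u = stp a b (Y n i + h/?N) - stp a b (Y n i) - h/?N * stp' a b (Y n i)"
     and "v = stp a b (Y n i + theta/?N) - stp a b (Y n i) - theta/?N * stp' a b (Y n i)"
    have uv: "\<bar>u\<bar> <= 4*(h/?N/(b - a))^2" "\<bar>v\<bar> <= 4*(theta/?N/(b - a))^2" unfolding u_def v_def by (rule stp_second_order[OF ab(2)])+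
    have e: "theta*(stp a b (Y n i + h/?N) - stp a b (Y n i)) - h*(stp a b (Y n i + theta/?N) - stp a b (Y n i)) = theta * u - h * v"
     unfolding u_def v_def by (simp add: algebra_simps)
    have "\<bar>theta * u - h * v\<bar> <= theta*\<bar>u\<bar> + \<bar>h\<bar>*\<bar>v\<bar>"
     using abs_triangle_ineq4[of "theta * u" "h * v"] th by (simp add: abs_mult)
    also have "... <= theta*(4*(h/?N/(b - a))^2) + \<bar>h\<bar>*(4*(theta/?N/(b - a))^2)"
     using uv th by (intro add_mono mult_left_mono) auto
    also have "... = Q/?N^2" unfolding Q_def power_divide by (simp add: add_divide_distrib distrib_left mult_ac)
    finally show "norm (theta*(stp a b (Y n i + h/?N) - stp a b (Y n i)) - h*(stp a b (Y n i + theta/?N) - stp a b (Y n i))) <= Q/?N^2" unfolding e by simp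
   qed
   also have "... = real (n + 2)*(Q/real (n + 2)^2)" by (simp del: sum.lessThan_Suc)
   also have "... = Q/real (n + 2)" unfolding power2_eq_square by simp
   finally show "norm (theta * E h n - h/2) <= Q/real (n + 2)" .
  qed
 qed
 moreover have "(%n. Q/real (n + 2)) \<longlonglongrightarrow> 0" by real_asymp
 ultimately have "(%n. theta * E h n - h/2) \<longlonglongrightarrow> 0" by (rule Lim_null_comparison)
 then have "(%n. theta * E h n) \<longlonglongrightarrow> h/2" by (simp add: LIM_zero_iff)
 from tendsto_divide[OF this tendsto_const[of theta]] show ?thesis using th by (simp add: E_def[abs_def] mult.commute)
qed

text \<open>\<open>E h n\<close> is the statistic of a configuration in which every row has length
  \<open>h\<close>. If the column is short, all rows felt by the step have length at most
  \<open>j\<close>, and the statistic is at most \<open>E j n\<close>; if it is long, they have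
  length at least \<open>j + 1\<close>, and the statistic is at least \<open>E (j + 1) n\<close>. In
  the limit these differ by \<open>1/(2*theta)\<close>, and half of this jump is used for the
  contradiction.\<close>

lemma cols: "convergent (%n. real (conj_part (lam n) j)/real (n + 2))"
proof -
 define c where "c n = conj_part (lam n) j" for n
 have cset: "{k. j < lam n k} = {..<c n}" for n
 proof -
  have fin: "finite {k. j < lam n k}" 
  proof (rule finite_subset[of _ "{..<n+2}"], safe)
   fix k assume "j < lam n k"
   then show "k < n + 2" using zero[of n k] by (cases "n + 2 <= k") auto
  qed
  have "{k. j < lam n k} = {..<card {k. j < lam n k}}"
  proof (cases "{k. j < lam n k} = {}")
   case False
   define M where "M = Max {k. j < lam n k}"
   have M: "M \<in> {k. j < lam n k}" unfolding M_def using fin False by (rule Max_in)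
   have "{k. j < lam n k} = {..M}" using M fin dec[of _ M n] by (auto simp: M_def intro: less_le_trans)
   then show ?thesis by (simp add: lessThan_Suc_atMost)
  qed simp
  then show ?thesis by (simp add: c_def conj_part_def)
 qed
 have mem: "j < lam n k \<longleftrightarrow> k < c n" for n k using eqset_imp_iff[OF cset[of n], of k] by simp
 have lo: "Suc j <= lam n k" if "k < c n" for n k using mem[of n k] that by simp
 have hi: "lam n k <= j" if "\<not> k < c n" for n k using mem[of n k] that by simp
 have cle: "c n <= n + 2" for n using lo[of "n + 2" n] zero[of n "n + 2"] by (cases "c n <= n + 2") auto
 have "convergent (%n. real (c n)/real (n + 2))"
 proof (rule convergent_by_gaps[of 0 _ 1])
  show "real (c n)/real (n + 2) <= 1" for n using cle[of n] by (simp add: divide_le_eq)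
 next
  show "\<forall>\<^sub>F n in sequentially. a <= real (c n)/real (n + 2)" if "a < 0" for a
   using that by (intro always_eventually) (auto intro: order_trans[of _ 0])
 next
  fix a b assume ab: "0 < a" "a < b" and f: "\<exists>\<^sub>F n in sequentially. real (c n)/real (n + 2) <= a" "\<exists>\<^sub>F n in sequentially. b <= real (c n)/real (n + 2)"
  have c1: "real (c n)/real (n + 2) <= 1" for n using cle[of n] by (simp add: divide_le_eq)
  have b1: "b <= 1" using frequently_ex[OF f(2)] c1 by (meson order_trans)
  \<comment> \<open>The thirds place the step strictly between the heights
    \<open>tau - theta * b\<close> and \<open>tau - theta * a\<close>. Rows on the wrong side of the
    column end then lie where the step is constant: saturated above in the first case, 0 in the
    second.\<close>
  define s s' where "s = tau - theta*(a/3 + 2 * b/3)" and "s' = tau - theta*(2 * a/3 + b/3)"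
  have "theta*(a/3 + 2 * b/3) < theta * b" "theta * b <= theta*1" using th ab b1 by (intro mult_strict_left_mono mult_left_mono; simp)+
  then have s1: "tau - theta * b < s" "rhob < s" by (auto simp: s_def tau_def)
  have s2: "s < s'" unfolding s_def s'_def using th ab by (simp add: field_simps)
  have "theta * a < theta*(2 * a/3 + b/3)" "0 < theta * a" using th ab by (auto intro: mult_strict_left_mono)
  then have s3: "s' < tau - theta * a" "s' < tau" by (auto simp: s'_def)
  have s0: "s > 0" using s1 rhob by linarith
  define E where "E h n = (\<Sum>i<n+2. stp s s' (Y n i + h/real (n + 2)) - stp s s' (Y n i))" for h n
  have El: "E h \<longlonglongrightarrow> h/(2 * theta)" for h unfolding E_def[abs_def] by (rule shift_lim[OF s1(2) s2 s3(2)])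
  have XE: "stp s s' (X n i) - stp s s' (Y n i) <= stp s s' (Y n i + q/real (n + 2)) - stp s s' (Y n i)" if "real (lam n i) <= q" for n i q
   unfolding X_def using that by (intro diff_right_mono stp_mono[OF s2]) (simp add: divide_right_mono)
  have XE': "stp s s' (X n i) - stp s s' (Y n i) >= stp s s' (Y n i + q/real (n + 2)) - stp s s' (Y n i)" if "real (lam n i) >= q" for n i q
   unfolding X_def using that by (intro diff_right_mono stp_mono[OF s2]) (simp add: divide_right_mono)
  have "\<exists>\<^sub>F n in sequentially. Lam (stp s s') n - E (real j) n <= 0"
  proof -
   have "\<forall>\<^sub>F n in sequentially. s' < Y n 0 - theta * a"
    by (rule order_tendstoD(1)[OF tendsto_diff[OF Y_lim tendsto_const]]) (use s3 in auto)
   from frequently_eventually_conj[OF f(1) this] show ?thesis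
   proof (rule frequently_mono[rotated], safe)
    fix n assume n: "real (c n)/real (n + 2) <= a" "s' < Y n 0 - theta * a"
    have "Lam (stp s s') n <= E (real j) n" unfolding Lam_def E_def
    proof (rule sum_mono)
     fix i
     show "stp s s' (X n i) - stp s s' (Y n i) <= stp s s' (Y n i + real j/real (n + 2)) - stp s s' (Y n i)"
     proof (cases "i < c n")
      case True
      have "real i/real (n + 2) <= real (c n)/real (n + 2)" using True by (intro divide_right_mono) auto
      then have "theta*(real i/real (n + 2)) <= theta * a" using th n(1) by (intro mult_left_mono) auto
      then have "s' <= Y n i" using n(2) Y_step[of n i] by linarith
      then have "stp s s' (Y n i) = 1/2" "stp s s' (X n i) = 1/2" "stp s s' (Y n i + real j/real (n + 2)) = 1/2"
       using YX_le[of n i] by (intro stp_high[OF s2]; simp add: add_increasing2)+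
      then show ?thesis by simp
     next
      case False
      then show ?thesis using hi[OF False] by (intro XE) auto
     qed
    qed
    then show "Lam (stp s s') n - E (real j) n <= 0" by simp
   qed
  qed
  moreover have "\<exists>\<^sub>F n in sequentially. Lam (stp s s') n - E (real j) n >= 1/(4 * theta)"
  proof -
   have lz: "(%n. (real j + 1)/real (n + 2)) \<longlonglongrightarrow> 0" by real_asymp
   have "(%n. Y n 0 - theta * b + (real j + 1)/real (n + 2)) \<longlonglongrightarrow> tau - theta * b + 0"
    by (intro tendsto_add tendsto_diff Y_lim tendsto_const lz)
   then have e1: "\<forall>\<^sub>F n in sequentially. Y n 0 - theta * b + (real j + 1)/real (n + 2) < s"
    by (rule order_tendstoD(2)) (use s1 in auto)
   have "(%n. E (real j + 1) n - E (real j) n) \<longlonglongrightarrow> (real j + 1)/(2 * theta) - real j/(2 * theta)"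
    by (intro tendsto_diff El)
   then have e2: "\<forall>\<^sub>F n in sequentially. 1/(4 * theta) < E (real j + 1) n - E (real j) n"
    by (rule order_tendstoD(1)) (use th in \<open>simp add: add_divide_distrib frac_less2\<close>)
   from frequently_eventually_conj[OF f(2) eventually_conj[OF e1 e2]] show ?thesis
   proof (rule frequently_mono[rotated], safe)
    fix n assume n: "b <= real (c n)/real (n + 2)" "Y n 0 - theta * b + (real j + 1)/real (n + 2) < s" "1/(4 * theta) < E (real j + 1) n - E (real j) n"
    have "E (real j + 1) n <= Lam (stp s s') n" unfolding Lam_def E_def
    proof (rule sum_mono)
     fix i
     show "stp s s' (Y n i + (real j + 1)/real (n + 2)) - stp s s' (Y n i) <= stp s s' (X n i) - stp s s' (Y n i)"
     proof (cases "i < c n")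
      case True
      then show ?thesis using lo[OF True] by (intro XE') auto
     next
      case False
      have "real (c n)/real (n + 2) <= real i/real (n + 2)" using False by (intro divide_right_mono) auto
      then have "theta * b <= theta*(real i/real (n + 2))" using th n(1) by (intro mult_left_mono) auto
      then have "Y n i + (real j + 1)/real (n + 2) <= s" using n(2) Y_step[of n i] by linarith
      then have "stp s s' (Y n i + (real j + 1)/real (n + 2)) = 0" by (rule stp_low[OF s2])
      then show ?thesis using stp_range[OF s2, of "X n i"] by simp
     qed
    qed
    then show "Lam (stp s s') n - E (real j) n >= 1/(4 * theta)" using n(3) by simp
   qed
  qed
  moreover have "convergent (%n. Lam (stp s s') n - E (real j) n)"
   using El[of "real j"] by (intro convergent_diff stp_convergent[OF s0 s2]) (auto simp: convergent_def)
  ultimately have "1/(4 * theta) <= 0" by (rule convergent_not_both[rotated])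
  then show False using th by simp
 qed
 then show ?thesis by (simp add: c_def)
qed

text \<open>The number of boxes is the statistic of the identity, whose derivative does not vanish
  near 0, so the identity is cut off below \<open>2*s\<close>. Rows that feel the cutoff are among
  the last \<open>2*s*(n + 2)/theta + 1\<close>. Lying in the lower half they have length at most
  \<open>2*C\<close>, since all earlier rows are at least as long and the boxes number at most
  \<open>C*(n + 2)\<close>.\<close>

lemma total: "convergent (%n. real (part_size (n + 2) (lam n))/real (n + 2))"
proof (rule convergent_approx)
 fix e :: real assume e: "e > 0"
 \<comment> \<open>The first term keeps the affected rows in the lower half, the second makes the
   main part \<open>4*C*s/theta\<close> of their contribution at most \<open>e/2\<close>.\<close>
 define s where "s = min (theta/4) (theta * e/(8*(C + 1)))"
 have s: "s > 0" "2 * s/theta <= 1/2" "4 * C * s/theta <= e/2"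
 proof -
  show "s > 0" using th e C0 by (simp add: s_def)
  have "s <= theta/4" unfolding s_def by (rule min.cobounded1)
  then show "2 * s/theta <= 1/2" using th by (simp add: field_simps)
  have "s <= theta * e/(8*(C + 1))" unfolding s_def by (rule min.cobounded2)
  then have "s*(8*(C + 1)) <= theta * e" using C0 by (simp add: pos_le_divide_eq)
  then show "4 * C * s/theta <= e/2" using th \<open>s > 0\<close> by (simp add: field_simps)
 qed
 define F where "F t = (s/2)*(psq ((t - s)/s) - psq ((t - 2 * s)/s))" for t
 define f where "f t = max 0 ((t - s)/s) - max 0 ((t - 2 * s)/s)" for t
 have F': "(F has_real_derivative f t) (at t)" for t
 proof -
  have "((%t. psq ((t - u)/s)) has_real_derivative 2 * max 0 ((t - u)/s)*(1/s)) (at t)" for u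
   by (rule DERIV_chain2[OF psq_deriv]) (use s in \<open>auto intro!: derivative_eq_intros\<close>)
  from DERIV_cmult[OF DERIV_diff[OF this[of s] this[of "2 * s"]], of "s/2"] show ?thesis
   unfolding F_def[abs_def] f_def using s by (simp add: algebra_simps)
 qed
 have cF: "convergent (Lam F)"
 proof (rule smooth_convergent[OF even F' _ s(1)])
  show "continuous_on UNIV f" unfolding f_def by (intro continuous_intros) (use s in auto)
  show "f t = 0" if "t <= s" for t
  proof -
   have "(t - s)/s <= 0" "(t - 2 * s)/s <= 0" using that s by (auto intro!: divide_nonpos_pos)
   then show ?thesis by (simp add: f_def)
  qed
 qed
 have ev: "\<forall>\<^sub>F n in sequentially. 2 * C/real (n + 2) < e/2"
 proof (rule order_tendstoD(2))
  show "(%n. 2 * C/real (n + 2)) \<longlonglongrightarrow> 0" by real_asymp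
 qed (use e in auto)
 have "\<forall>\<^sub>F n in sequentially. \<bar>real (part_size (n + 2) (lam n))/real (n + 2) - Lam F n\<bar> <= e"
  using ev
 proof eventually_elim
  fix n assume n: "2 * C/real (n + 2) < e/2"
  let ?N = "real (n + 2)"
  define G where "G t = t - F t" for t
  have G1: "\<bar>G (X n i) - G (Y n i)\<bar> <= 1*(X n i - Y n i)" if "i < n + 2" for i
  proof (rule row_bound[OF _ _ that])
   show "(G has_real_derivative 1 - f t) (at t)" for t unfolding G_def[abs_def] by (intro DERIV_diff DERIV_ident F')
   fix t
   have "(t - 2 * s)/s = (t - s)/s - 1" using s by (simp add: field_simps)
   then have "0 <= f t" "f t <= 1" unfolding f_def by auto
   then show "\<bar>1 - f t\<bar> <= 1" by simp
  qed
  have G2: "G t = 3 * s/2" if "t >= 2 * s" for t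
  proof -
   have y: "(t - s)/s = (t - 2 * s)/s + 1" using s by (simp add: field_simps)
   have "(t - 2 * s)/s >= 0" using that s by simp
   then have "F t = (s/2)*(2*((t - 2 * s)/s) + 1)" unfolding F_def y psq_def by (simp add: power2_eq_square algebra_simps)
   also have "... = t - 3 * s/2" using s by (simp add: field_simps)
   finally show ?thesis by (simp add: G_def)
  qed
  define z where "z = 2 * s*?N/theta"
  have z0: "z >= 0" using s th by (simp add: z_def)
  define Bs where "Bs = {i. i < n + 2 \<and> Y n i < 2 * s}"
  have Bi: "real n + 1 - real i < z" if "i \<in> Bs" for i
  proof -
   have "theta*(real n + 1 - real i)/?N <= Y n i" unfolding Y_def using rho0[of n] by (intro divide_right_mono) auto
   also have "... < 2 * s" using that by (simp add: Bs_def)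
   finally show ?thesis using th by (simp add: z_def field_simps)
  qed
  have zN: "z <= ?N/2"
  proof -
   have "z = (2 * s/theta)*?N" by (simp add: z_def)
   also have "... <= 1/2*?N" using s by (intro mult_right_mono) auto
   finally show ?thesis by simp
  qed
  have small: "real (lam n i) <= 2 * C" if "i \<in> Bs" for i
  proof -
   have i: "i < n + 2" using that by (simp add: Bs_def)
   have "real (Suc i) * real (lam n i) = (\<Sum>k\<in>{..i}. real (lam n i))" by simp
   also have "... <= (\<Sum>k\<in>{..i}. real (lam n k))" using dec by (intro sum_mono) auto
   also have "... <= (\<Sum>k<n+2. real (lam n k))" using i by (intro sum_mono2) auto
   also have "... <= C*?N" using size[of n] by (simp add: part_size_def del: sum.lessThan_Suc)
   finally have "real (Suc i) * real (lam n i) <= C*?N" .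
   moreover have "?N/2 <= real (Suc i)" using Bi[OF that] zN by simp
   then have "?N/2 * real (lam n i) <= real (Suc i) * real (lam n i)" by (intro mult_right_mono) auto
   ultimately have "?N * real (lam n i) <= ?N*(2 * C)" by (simp add: algebra_simps)
   then show ?thesis by (simp add: mult_le_cancel_left_pos)
  qed
  have "card Bs <= card {n + 1 - nat \<lfloor>z\<rfloor>..n + 1}"
  proof (rule card_mono)
   show "Bs \<subseteq> {n + 1 - nat \<lfloor>z\<rfloor>..n + 1}"
   proof
    fix i assume i: "i \<in> Bs"
    then have "i <= n + 1" by (auto simp: Bs_def)
    moreover have "int n + 1 - int i <= \<lfloor>z\<rfloor>" using Bi[OF i] by (intro le_floor_iff[THEN iffD2]) simp
    ultimately show "i \<in> {n + 1 - nat \<lfloor>z\<rfloor>..n + 1}" by auto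
   qed
  qed simp
  also have "... <= nat \<lfloor>z\<rfloor> + 1" by simp
  finally have cB: "real (card Bs) <= z + 1" using z0 by linarith
  have "real (part_size (n + 2) (lam n))/?N - Lam F n = Lam G n"
   unfolding G_def Lam_diff by (simp only: mass_eq[symmetric] Lam_def)
  also have "\<bar>Lam G n\<bar> <= (\<Sum>i<n+2. \<bar>G (X n i) - G (Y n i)\<bar>)" unfolding Lam_def by (rule sum_abs)
  also have "... = (\<Sum>i\<in>Bs. \<bar>G (X n i) - G (Y n i)\<bar>)"
  proof (rule sum.mono_neutral_right)
   show "\<forall>i\<in>{..<n+2} - Bs. \<bar>G (X n i) - G (Y n i)\<bar> = 0"
   proof
    fix i assume "i \<in> {..<n+2} - Bs"
    then have "2 * s <= Y n i" by (auto simp: Bs_def)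
    then show "\<bar>G (X n i) - G (Y n i)\<bar> = 0" using G2[of "Y n i"] G2[of "X n i"] YX_le[of n i] by simp
   qed
  qed (auto simp: Bs_def)
  also have "... <= (\<Sum>i\<in>Bs. 2 * C/?N)"
  proof (rule sum_mono)
   fix i assume i: "i \<in> Bs"
   have "\<bar>G (X n i) - G (Y n i)\<bar> <= real (lam n i)/?N" using G1[of i] i by (simp add: Bs_def X_def)
   also have "... <= 2 * C/?N" using small[OF i] by (intro divide_right_mono) auto
   finally show "\<bar>G (X n i) - G (Y n i)\<bar> <= 2 * C/?N" .
  qed
  also have "... = real (card Bs)*(2 * C/?N)" by simp
  also have "... <= (z + 1)*(2 * C/?N)" using cB C0 by (intro mult_right_mono) auto
  also have "... = 4 * C * s/theta + 2 * C/?N" using th by (simp add: z_def field_simps)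
  also have "... <= e" using s(3) n by linarith
  finally show "\<bar>real (part_size (n + 2) (lam n))/?N - Lam F n\<bar> <= e" .
 qed
 then show "\<exists>D. convergent D \<and> (\<forall>\<^sub>F n in sequentially. \<bar>real (part_size (n + 2) (lam n))/real (n + 2) - D n\<bar> <= e)" using cF by blast
qed

end

end

section \<open>Logarithm of the product formula\<close>

context bc
begin

lemma Kb_bounds:
 assumes "Kb lam <= K * real n" "n >= 1"
 shows "K >= 0" "rho0/real n <= K/2" "theta/(2 * real n) <= K/4" "\<bar>(rho0 - theta/2)/real n\<bar> <= K"
proof -
 have N: "real n >= 1" using assms(2) by simp
 have k: "2 * rho0 <= K * real n" "2 * theta * real n <= K * real n"
 proof -
  have "2 * theta * real n >= 0" using theta_pos by simp
  then show "2 * rho0 <= K * real n" "2 * theta * real n <= K * real n" using assms(1) rho0_nonneg unfolding Kb_def by linarith+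
 qed
 then show "rho0/real n <= K/2" using N by (simp add: field_simps)
 have "2 * theta <= K" using k(2) N by simp
 then show K0: "K >= 0" using theta_pos by linarith
 have "theta/(2 * real n) <= theta/2" using N theta_pos by (intro frac_le) auto
 then show t: "theta/(2 * real n) <= K/4" using \<open>2 * theta <= K\<close> by linarith
 have e: "(rho0 - theta/2)/real n = rho0/real n - theta/(2 * real n)" by (simp add: diff_divide_distrib)
 have "rho0/real n >= 0" "theta/(2 * real n) >= 0" using rho0_nonneg theta_pos by auto
 moreover have "\<bar>x - y\<bar> <= K" if "0 <= x" "0 <= y" "x <= K/2" "y <= K/4" for x y using that K0 by linarith
 ultimately show "\<bar>(rho0 - theta/2)/real n\<bar> <= K" unfolding e using \<open>rho0/real n <= K/2\<close> t by blast
qed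

text \<open>The product formula at \<open>u = N * U\<close>, with powers of \<open>N\<close> divided
  out. The term \<open>k = 0\<close> of the generating function, where \<open>EE lam 0 = n\<close>,
  becomes \<open>1/W\<close>; all others are collected in \<open>S\<close> and enter one order
  lower, as \<open>S/N\<close>. The condition \<open>U > 2*K\<close> yields convergence and keeps
  every factor of the products positive.\<close>

theorem log_formula:
 fixes K U :: real
 assumes part: "is_partition_len n lam" and n1: "n >= 1" and K: "Kb lam <= K * real n" and U: "U > 2 * K"
 defines "N \<equiv> real n"
 defines "cn \<equiv> (rho0 - theta/2)/N" and "delta \<equiv> theta/(2 * N)"
 defines "W \<equiv> U^2 - cn^2"
 defines "S \<equiv> (\<Sum>k. (EE lam (Suc k)/N^(2 * Suc k))/W^(k + 2))"
 assumes P: "1 + theta*(U - cn)*(1/W + S/N) > 0" and M: "1 - theta*(U + cn)*(1/W + S/N) > 0"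
 shows "(\<Sum>i<n. ln ((U + delta)^2 - (ll lam i/N)^2) - ln ((U - delta)^2 - (ll lam i/N)^2)) =
  ln (1 + theta*(U - cn)*(1/W + S/N)) - ln (1 - theta*(U + cn)*(1/W + S/N))"
proof -
 have N: "N >= 1" using n1 by (simp add: N_def)
 note kb = Kb_bounds[OF K n1, folded N_def, folded cn_def delta_def]
 have "Kb lam > 0" using Kb_ge_1[of lam] by linarith
 then have "K * N > 0" using K by (simp add: N_def)
 then have Kp: "K > 0" using N by (simp add: zero_less_mult_iff)
 have cc: "cn^2 <= K^2" using kb(4) Kp by (simp add: abs_le_square_iff[symmetric])
 have UU: "(2 * K)^2 < U^2" using U Kp by (intro power_strict_mono) auto
 have W: "W > K^2" unfolding W_def using cc UU Kp by (simp add: power_mult_distrib) (smt (verit) zero_less_power)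
 have W0: "W > 0" using W Kp by (smt (verit) zero_less_power)
 have eqw: "(N * U)^2 - (rho0 - theta/2)^2 = N^2 * W"
  using N by (simp add: W_def cn_def power_mult_distrib power_divide right_diff_distrib)
 have big: "(N * U)^2 - (rho0 - theta/2)^2 > (Kb lam)^2"
 proof -
  have "(Kb lam)^2 <= (K * N)^2" using K Kb_ge_1[of lam] by (intro power_mono) (auto simp: N_def)
  also have "... < N^2 * W" using W N by (simp add: power_mult_distrib mult.commute)
  finally show ?thesis unfolding eqw .
 qed
 note pf = product_formula[OF part big, unfolded eqw]
 have R: "RR lam (N^2 * W) = (1/N)*(1/W + S/N)"
 proof -
  have t: "EE lam (Suc k)/(N^2 * W)^(Suc k + 1) = (1/N^2)*((EE lam (Suc k)/N^(2 * Suc k))/W^(k + 2))" for k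
  proof -
   have "(N^2 * W)^(Suc k + 1) = N^2*(N^(2 * Suc k) * W^(k + 2))"
    by (simp only: power_mult_distrib power_mult[symmetric]) (simp add: power_add algebra_simps power2_eq_square)
   then show ?thesis by simp
  qed
  have s: "summable (%k. EE lam (Suc k)/(N^2 * W)^(Suc k + 1))" using pf(2) by (subst summable_Suc_iff)
  then have s2: "summable (%k. (EE lam (Suc k)/N^(2 * Suc k))/W^(k + 2))" unfolding t using N by (subst (asm) summable_cmult_iff) auto
  have "RR lam (N^2 * W) = EE lam 0/(N^2 * W)^(0 + 1) + (\<Sum>k. EE lam (Suc k)/(N^2 * W)^(Suc k + 1))"
   unfolding RR_def using suminf_split_head[OF pf(2)] by simp
  also have "(\<Sum>k. EE lam (Suc k)/(N^2 * W)^(Suc k + 1)) = (1/N^2) * S"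
   unfolding t S_def by (rule suminf_mult[OF s2])
  also have "EE lam 0/(N^2 * W)^(0 + 1) + (1/N^2) * S = (1/N)*(1/W + S/N)"
   using N W0 by (simp add: EE_0 N_def[symmetric] power2_eq_square distrib_left)
  finally show ?thesis .
 qed
 define f where "f s i = (U + s * delta)^2 - (ll lam i/N)^2" for s i
 have fs: "(N * U + s*(theta/2))^2 - (ll lam i)^2 = N^2 * f s i" for s i
 proof -
  have "N * U + s*(theta/2) = N*(U + s * delta)" using N by (simp add: delta_def distrib_left)
  then show ?thesis unfolding f_def using N by (simp add: power_mult_distrib right_diff_distrib power_divide)
 qed
 have fpos: "f s i > 0" if i: "i < n" and s: "s = 1 \<or> s = -1" for i s
 proof -
  have "ll lam i <= K * N" using ll_le_Kb[OF part i] K by (simp add: N_def)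
  then have "ll lam i/N <= K" using N by (simp add: pos_divide_le_eq)
  moreover have "delta >= 0" using theta_pos N by (simp add: delta_def)
  then have "U + s * delta > K" using s kb(3) U Kp by auto
  ultimately have "(ll lam i/N)^2 < (U + s * delta)^2" using ll_nonneg[OF i, of lam] N by (intro power_strict_mono) auto
  then show ?thesis by (simp add: f_def)
 qed
 have e1: "theta*(N * U - (rho0 - theta/2)) * RR lam (N^2 * W) = theta*(U - cn)*(1/W + S/N)"
  "theta*(N * U + (rho0 - theta/2)) * RR lam (N^2 * W) = theta*(U + cn)*(1/W + S/N)"
 proof -
  have "(N * U - (rho0 - theta/2))*(1/N) = U - cn" "(N * U + (rho0 - theta/2))*(1/N) = U + cn"
   using N by (simp_all add: cn_def field_simps)
  then show "theta*(N * U - (rho0 - theta/2)) * RR lam (N^2 * W) = theta*(U - cn)*(1/W + S/N)"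
   "theta*(N * U + (rho0 - theta/2)) * RR lam (N^2 * W) = theta*(U + cn)*(1/W + S/N)"
   unfolding R mult.assoc[symmetric] by (simp_all only: mult.assoc)
 qed
 define p m where "p = 1 + theta*(U - cn)*(1/W + S/N)" and "m = 1 - theta*(U + cn)*(1/W + S/N)"
 have "p*(\<Prod>i<n. N^2 * f (-1) i) = m*(\<Prod>i<n. N^2 * f 1 i)"
  using pf(1) unfolding e1 p_def[symmetric] m_def[symmetric] fs[symmetric] by simp
 then have "p*(\<Prod>i<n. f (-1) i) = m*(\<Prod>i<n. f 1 i)"
  unfolding prod.distrib using N by (simp add: mult.left_commute)
 then have lneq: "ln (p*(\<Prod>i<n. f (-1) i)) = ln (m*(\<Prod>i<n. f 1 i))" by simp
 have "ln p + (\<Sum>i<n. ln (f (-1) i)) = ln m + (\<Sum>i<n. ln (f 1 i))"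
 proof -
  have "ln (q*(\<Prod>i<n. f s i)) = ln q + (\<Sum>i<n. ln (f s i))" if "q > 0" "s = 1 \<or> s = -1" for q s
  proof -
   have "(\<Prod>i<n. f s i) > 0" using fpos that(2) by (intro prod_pos) auto
   then have "ln (q*(\<Prod>i<n. f s i)) = ln q + ln (\<Prod>i<n. f s i)" using that(1) by (intro ln_mult_pos)
   also have "ln (\<Prod>i<n. f s i) = (\<Sum>i<n. ln (f s i))" using fpos[OF _ that(2)] by (intro ln_prod) force+
   finally show ?thesis .
  qed
  from this[of p "-1"] this[of m 1] show ?thesis using P M lneq unfolding p_def[symmetric] m_def[symmetric] by simp
 qed
 then show ?thesis unfolding p_def m_def sum_subtractf f_def by simp
qed

end

text \<open>The derivative of the logarithm along moving base points, by the sandwich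
  \<open>y/(1 + y) <= ln (1 + y) <= y\<close>.\<close>

lemma ln_increment:
 fixes a x N :: "nat => real"
 assumes a: "a \<longlonglongrightarrow> l" "l > 0" and x: "x \<longlonglongrightarrow> z" and N: "filterlim N at_top sequentially"
 shows "(%n. N n*(ln (a n + x n/N n) - ln (a n))) \<longlonglongrightarrow> z/l"
proof -
 define y where "y n = x n/N n/a n" for n
 have "(%n. x n/N n) \<longlonglongrightarrow> 0"
  using tendsto_mult[OF x tendsto_inverse_0_at_top[OF N]] by (simp add: divide_inverse)
 then have y0: "y \<longlonglongrightarrow> 0" unfolding y_def[abs_def] using tendsto_divide[of "%n. x n/N n" 0 _ a l] a by simp
 have q: "(%n. x n/a n) \<longlonglongrightarrow> z/l" using x a by (intro tendsto_divide) auto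
 have q2: "(%n. x n/a n/(1 + y n)) \<longlonglongrightarrow> z/l/(1 + 0)"
  by (rule tendsto_divide[OF q tendsto_add[OF tendsto_const y0]]) simp
 have ev: "\<forall>\<^sub>F n in sequentially. a n > 0 \<and> y n > -1 \<and> N n > 0"
  using order_tendstoD(1)[OF a] order_tendstoD(1)[OF y0, of "-1"] filterlim_at_top_dense[THEN iffD1, OF N, rule_format, of 0]
  by (simp add: eventually_conj)
 have bd: "x n/a n/(1 + y n) <= N n*(ln (a n + x n/N n) - ln (a n)) \<and> N n*(ln (a n + x n/N n) - ln (a n)) <= x n/a n"
  if n: "a n > 0 \<and> y n > -1 \<and> N n > 0" for n
 proof -
  have "a n + x n/N n = a n*(1 + y n)" using n by (simp add: y_def distrib_left)
  then have e: "ln (a n + x n/N n) - ln (a n) = ln (1 + y n)" using n by (simp add: ln_mult)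
  have Ny: "N n * y n = x n/a n" using n by (simp add: y_def)
  have "ln (1 + y n) <= y n" using n by (intro ln_add_one_self_le_self2) auto
  then have "N n * ln (1 + y n) <= N n * y n" using n by (intro mult_left_mono) auto
  moreover have "ln (1/(1 + y n)) <= 1/(1 + y n) - 1" using n by (intro ln_le_minus_one) auto
  then have "ln (1 + y n) >= 1 - 1/(1 + y n)" using n by (simp add: ln_div)
  then have "ln (1 + y n) >= y n/(1 + y n)" using n by (simp add: field_simps)
  then have "N n*(y n/(1 + y n)) <= N n * ln (1 + y n)" using n by (intro mult_left_mono) auto
  ultimately show ?thesis unfolding e Ny[symmetric] by simp
 qed
 show ?thesis
 proof (rule tendsto_sandwich[OF _ _ _ q])
  show "\<forall>\<^sub>F n in sequentially. x n/a n/(1 + y n) <= N n*(ln (a n + x n/N n) - ln (a n))"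
   by (rule eventually_mono[OF ev conjunct1[OF bd]])
  show "\<forall>\<^sub>F n in sequentially. N n*(ln (a n + x n/N n) - ln (a n)) <= x n/a n"
   by (rule eventually_mono[OF ev conjunct2[OF bd]])
  show "(%n. x n/a n/(1 + y n)) \<longlonglongrightarrow> z/l" using q2 by simp
 qed
qed

lemma convergent_imp_Bound: "convergent (f :: nat => real) ==> \<exists>B>0. \<forall>n. \<bar>f n\<bar> <= B"
 using Bseq_def[of f] convergent_imp_Bseq[of f] by auto

section \<open>Sequences of Jacobi polynomials\<close>

text \<open>The index is shifted by 2: the restricted recursion needs a second variable.\<close>

locale fam =
 fixes theta :: real and k1 k2 :: "nat => real" and lam :: "nat => nat => nat"
 assumes th: "theta > 0" and k1n: "k1 n >= 0" and k2n: "k2 n >= 0"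
  and part: "is_partition_len (n + 2) (lam n)"
  and k1c: "convergent (%n. k1 n/real (n + 2))" and k2c: "convergent (%n. k2 n/real (n + 2))"
begin

lemma bcn: "bc theta (k1 n) (k2 n)" using th k1n k2n by unfold_locales

abbreviation "ev n mu k \<equiv> bc.EE (n + 2) theta (k1 n) (k2 n) mu k"
definition eh :: "nat => nat => real" where "eh n k = ev n (lam n) k/real (n + 2)^(2*k)"
definition rho :: "nat => real" where "rho n = k1 n/2 + k2 n"

lemma rho_eq: "bc.rho0 (k1 n) (k2 n) = rho n" by (simp add: bc.rho0_def[OF bcn] rho_def)

lemma rho_nonneg: "rho n >= 0" using k1n[of n] k2n[of n] by (simp add: rho_def)

lemma rho_convergent: "convergent (%n. rho n/real (n + 2))"
 using convergent_add[OF convergent_mult[OF convergent_const[of "1/2"] k1c] k2c] by (simp add: rho_def add_divide_distrib)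

lemma ll_eq: "bc.ll (n + 2) theta (k1 n) (k2 n) mu i = real (mu i) + theta*(real n + 1 - real i) + rho n"
 by (simp add: bc.ll_def[OF bcn] bc.aa_def[OF bcn] rho_eq add_ac)

lemma Kb_eq: "bc.Kb (n + 2) theta (k1 n) (k2 n) mu = real (mu 0) + 2 * theta * real (n + 2) + 2 * rho n + 1"
 by (simp add: bc.Kb_def[OF bcn] rho_eq)

lemma eh_1_ge: "eh n 1 >= (real (lam n 0)/real (n + 2))^2" "eh n 1 >= 0"
 using bc.EE_1_ge_first[OF bcn[of n], of "n + 2" "lam n"] bc.EE_1_nonneg[OF bcn[of n], of "n + 2" "lam n"]
 by (auto simp: eh_def power_divide divide_right_mono simp del: of_nat_add)

lemma part_0: "is_partition_len m (%_. 0)" by (simp add: is_partition_len_def)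

lemma EE_empty: "ev n (%_. 0) (Suc k) = 0"
 using bc.EE_bound[OF bcn[of n] part_0, of "n + 2" k] by (simp add: bc.EE_1[OF bcn, simplified])

lemma eh_le:
 assumes K: "bc.Kb (n + 2) theta (k1 n) (k2 n) (lam n) <= K * real (n + 2)"
 shows "\<bar>eh n (Suc k)\<bar> <= (K^2)^k * eh n 1"
proof -
 have N: "real (n + 2) > 0" by simp
 have b0: "bc.Kb (n + 2) theta (k1 n) (k2 n) (lam n) >= 0" using bc.Kb_ge_1[OF bcn[of n], of "n + 2" "lam n"] by linarith
 have "\<bar>ev n (lam n) (Suc k)\<bar> <= bc.Kb (n + 2) theta (k1 n) (k2 n) (lam n) ^ (2*k) * ev n (lam n) 1"
  by (rule bc.EE_bound[OF bcn part])
 also have "... <= (K * real (n + 2))^(2*k) * ev n (lam n) 1"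
  using K b0 by (intro mult_right_mono power_mono bc.EE_1_nonneg[OF bcn])
 also have "... = (K^2)^k*(eh n 1 * real (n + 2)^(2 * Suc k))"
  using N by (simp add: eh_def power_mult_distrib power_mult power2_eq_square)
 finally have "\<bar>ev n (lam n) (Suc k)\<bar>/real (n + 2)^(2 * Suc k) <= (K^2)^k * eh n 1"
  using N by (subst pos_divide_le_eq) (auto simp: mult_ac)
 then show ?thesis unfolding eh_def[of n "Suc k"] abs_divide by simp
qed

context
 fixes K E1 :: real
 assumes K: "\<And>n. bc.Kb (n + 2) theta (k1 n) (k2 n) (lam n) <= K * real (n + 2)"
  and E1: "\<And>n. eh n 1 <= E1" and ehc: "\<And>k. convergent (%n. eh n (Suc k))"
begin

lemma K_bounds: "K >= 2 * theta" "K > 0" "rho n/real (n + 2) <= K/2" "real (lam n 0)/real (n + 2) + 2 * theta + 2*(rho n/real (n + 2)) <= K"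
proof -
 have "(real (lam n 0) + 2 * theta * real (n + 2) + 2 * rho n)/real (n + 2) <= K" for n
  using K[of n] unfolding Kb_eq by (simp add: pos_divide_le_eq)
 then have a: "real (lam n 0)/real (n + 2) + 2 * theta + 2*(rho n/real (n + 2)) <= K" for n by (simp add: add_divide_distrib)
 moreover have "real (lam n 0)/real (n + 2) >= 0" "rho n/real (n + 2) >= 0" for n using rho_nonneg by simp_all
 ultimately have *: "2 * theta + 2*(rho n/real (n + 2)) <= K" "rho n/real (n + 2) >= 0" for n by (smt (verit))+
 show "K >= 2 * theta" "rho n/real (n + 2) <= K/2" using *(1)[of n] *(2)[of n] th by linarith+
 then show "K > 0" using th by linarith
 show "real (lam n 0)/real (n + 2) + 2 * theta + 2*(rho n/real (n + 2)) <= K" by (rule a)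
qed

lemma eh_bound: "\<bar>eh n (Suc k)\<bar> <= (K^2)^k * E1"
proof -
 have "\<bar>eh n (Suc k)\<bar> <= (K^2)^k * eh n 1" by (rule eh_le[OF K])
 also have "... <= (K^2)^k * E1" using E1 by (intro mult_left_mono) auto
 finally show ?thesis .
qed

lemma size_bound: "real (part_size (n + 2) (lam n)) <= 2 * E1/theta * real (n + 2)"
proof -
 let ?N = "real (n + 2)"
 have "theta*(?N/2) * real (part_size (n + 2) (lam n)) <= theta*(?N - 1) * real (part_size (n + 2) (lam n))"
  using th by (intro mult_right_mono mult_left_mono) auto
 also have "... <= ev n (lam n) 1" by (rule bc.EE_1_ge_size[OF bcn part])
 also have "... = eh n 1*?N^2" by (simp add: eh_def)
 also have "... <= E1*?N^2" using E1 by (intro mult_right_mono) auto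
 finally have "?N*(theta * real (part_size (n + 2) (lam n))) <= ?N*(2 * E1*?N)" by (simp add: power2_eq_square mult_ac)
 then have "theta * real (part_size (n + 2) (lam n)) <= 2 * E1*?N" by simp
 then show ?thesis using th by (simp add: field_simps)
qed

text \<open>For the empty partition \<open>S = 0\<close>, so subtracting its logarithmic formula
  leaves increments of order \<open>1/N\<close>, and \<open>N\<close> times these converges together
  with \<open>S\<close>. On the other side \<open>N n * G n\<close> approaches a multiple of the
  kernel \<open>1/(V - t^2)\<close>, with a derivative error of order \<open>(delta n)^2\<close>.
  This gives convergence of the kernel statistics for all large \<open>V\<close>.\<close>

theorem vershik_limits:
 shows "convergent (%n. real (lam n i)/real (n + 2))" "convergent (%n. real (conj_part (lam n) i)/real (n + 2))"
  "convergent (%n. real (part_size (n + 2) (lam n))/real (n + 2))"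
proof -
 obtain rhob where rb: "(%n. rho n/real (n + 2)) \<longlonglongrightarrow> rhob" using rho_convergent by (auto simp: convergent_def)
 have first: "(real (lam n 0) + theta * real (n + 1) + rho n)/real (n + 2) <= K" for n
 proof -
  have "theta * real (n + 1)/real (n + 2) <= theta" using th by (simp add: pos_divide_le_eq)
  moreover have "rho n/real (n + 2) >= 0" using rho_nonneg by simp
  ultimately show ?thesis using K_bounds(4)[of n] th unfolding add_divide_distrib by linarith
 qed
 interpret v: vk theta rhob K "2 * E1/theta" rho lam
  by unfold_locales (use th rho_nonneg rb part first size_bound in auto)
 have rb2: "0 <= rhob" "rhob <= K/2" using v.rhob tendsto_upperbound[OF rb, of "K/2"] K_bounds(3) by auto
 \<comment> \<open>The lower bound on \<open>V\<close> gives \<open>W n >= 3 * K^2\<close>, hence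
   domination of the series \<open>S\<close> by a geometric series of ratio 1/3, and keeps
   \<open>U - delta n\<close> at distance from \<open>[0, K]\<close>.\<close>
 have "convergent (v.Lam (%t. 1/(V - t^2)))" if V: "V > (2*(K + 1))^2" for V
 proof -
  define U where "U = sqrt V"
  have V0: "V > 0" using V by (smt (verit) zero_le_power2)
  have UV: "U^2 = V" using V0 by (simp add: U_def)
  have U: "U > 2*(K + 1)" unfolding U_def using V K_bounds(2) by (intro real_less_rsqrt)
  define N where "N n = real (n + 2)" for n
  define c where "c n = (rho n - theta/2)/N n" for n
  define delta where "delta n = theta/(2 * N n)" for n
  define W where "W n = U^2 - (c n)^2" for n
  define S where "S n = (\<Sum>k. eh n (Suc k)/W n^(k + 2))" for n
  define a b where "a n = 1 + theta*(U - c n)*(1/W n)" and "b n = 1 - theta*(U + c n)*(1/W n)" for n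
  define x y where "x n = theta*(U - c n) * S n" and "y n = - (theta*(U + c n) * S n)" for n
  have Ninf: "filterlim N at_top sequentially" unfolding N_def by real_asymp
  have d0: "delta \<longlonglongrightarrow> 0" unfolding delta_def[abs_def] N_def by real_asymp
  have N1: "N n >= 2" for n by (simp add: N_def)
  have cl: "c \<longlonglongrightarrow> rhob"
  proof -
   have "(%n. rho n/real (n + 2) - delta n) \<longlonglongrightarrow> rhob - 0" by (intro tendsto_diff rb d0)
   then show ?thesis by (simp add: c_def[abs_def] delta_def N_def diff_divide_distrib)
  qed
  have cK: "\<bar>c n\<bar> <= K" for n
   using bc.Kb_bounds(4)[OF bcn K[of n]] by (simp add: c_def N_def rho_eq)
  have Wl: "W \<longlonglongrightarrow> U^2 - rhob^2" unfolding W_def[abs_def] by (intro tendsto_intros cl)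
  have W3: "W n >= 3 * K^2" "W n >= 1" for n
  proof -
   have "(c n)^2 <= K^2" using cK[of n] K_bounds(2) by (simp add: abs_le_square_iff[symmetric])
   moreover have "(2*(K + 1))^2 = 4 * K^2 + 8 * K + 4" by (simp add: power2_eq_square algebra_simps)
   moreover have "K^2 >= 0" by simp
   ultimately show "W n >= 3 * K^2" "W n >= 1" using V K_bounds(2) unfolding W_def UV by linarith+
  qed
  have Wb: "rhob^2 < U^2" using rb2 U K_bounds(2) by (intro power_strict_mono) auto
  have Sc: "convergent S"
  proof -
   have "\<exists>l. (%n. eh n (Suc k)) \<longlonglongrightarrow> l" for k using ehc[of k] by (auto simp: convergent_def)
   then obtain l where l: "\<And>k. (%n. eh n (Suc k)) \<longlonglongrightarrow> l k" by metis
   have E10: "E1 >= 0" using E1[of 0] eh_1_ge(2)[of 0] by linarith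
   have "\<bar>eh n (Suc k)/W n^(k + 2)\<bar> <= E1*(1/3)^k" for n k
   proof -
    have w: "W n > 0" using W3(2)[of n] by linarith
    have "W n ^ k*1 <= W n ^ k * W n ^ 2" using W3(2)[of n] by (intro mult_left_mono) auto
    then have "W n ^ (k + 2) >= W n ^ k" unfolding power_add by simp
    moreover have "W n ^ k >= (3 * K^2)^k" using W3(1)[of n] by (intro power_mono) auto
    ultimately have "W n ^ (k + 2) >= (3 * K^2)^k" by linarith
    then have "\<bar>eh n (Suc k)/W n^(k + 2)\<bar> <= ((K^2)^k * E1)/(3 * K^2)^k"
     unfolding abs_divide using eh_bound[of n k] w K_bounds(2) E10 by (intro frac_le) auto
    also have "... = E1*(1/3)^k" using K_bounds(2) by (simp add: power_mult_distrib power_divide)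
    finally show ?thesis .
   qed
   moreover have "summable (%k. E1*(1/3::real)^k)" by (intro summable_mult summable_geometric) simp
   moreover have "(%n. eh n (Suc k)/W n^(k + 2)) \<longlonglongrightarrow> l k/(U^2 - rhob^2)^(k + 2)" for k
    using Wb by (intro tendsto_divide l tendsto_power Wl) auto
   ultimately have "S \<longlonglongrightarrow> (\<Sum>k. l k/(U^2 - rhob^2)^(k + 2))"
    using tannerys_theorem[of "%k n. eh n (Suc k)/W n^(k + 2)" "%k. l k/(U^2 - rhob^2)^(k + 2)" sequentially "%k. E1*(1/3)^k"]
    unfolding S_def[abs_def] by (simp add: always_eventually case_prod_beta)
   then show ?thesis by (auto simp: convergent_def)
  qed
  then obtain s where s: "S \<longlonglongrightarrow> s" by (auto simp: convergent_def)
  define al bl where "al = 1 + theta*(U - rhob)*(1/(U^2 - rhob^2))" and "bl = 1 - theta*(U + rhob)*(1/(U^2 - rhob^2))"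
  have al: "a \<longlonglongrightarrow> al" "al > 0" and bl: "b \<longlonglongrightarrow> bl" "bl > 0"
  proof -
   show "a \<longlonglongrightarrow> al" "b \<longlonglongrightarrow> bl" unfolding a_def[abs_def] b_def[abs_def] al_def bl_def
    using Wb by (intro tendsto_intros cl Wl; simp)+
   have "0 <= theta*(U - rhob)*(1/(U^2 - rhob^2))" using th rb2 U K_bounds(2) Wb by (intro mult_nonneg_nonneg) auto
   then show "al > 0" by (simp add: al_def)
   have f: "U^2 - rhob^2 = (U + rhob)*(U - rhob)" by (simp add: power2_eq_square algebra_simps)
   have p: "U + rhob > 0" "U - rhob > theta" using rb2 U K_bounds(1,2) by auto
   have "theta*(U + rhob)*(1/(U^2 - rhob^2)) = theta/(U - rhob)" unfolding f using p by simp
   also have "... < 1" using p th by simp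
   finally show "bl > 0" by (simp add: bl_def)
  qed
  have xl: "x \<longlonglongrightarrow> theta*(U - rhob) * s" and yl: "y \<longlonglongrightarrow> - (theta*(U + rhob) * s)"
   unfolding x_def[abs_def] y_def[abs_def] by (intro tendsto_intros cl s)+
  define G where "G n t = ln ((U + delta n)^2 - t^2) - ln ((U - delta n)^2 - t^2)" for n t
  define D where "D n = N n*(ln (a n + x n/N n) - ln (a n)) - N n*(ln (b n + y n/N n) - ln (b n))" for n
  have "convergent D" unfolding D_def
   using ln_increment[OF al xl Ninf] ln_increment[OF bl yl Ninf] by (intro convergent_diff) (auto simp: convergent_def)
  have lim0: "(%n. x n/N n) \<longlonglongrightarrow> 0" "(%n. y n/N n) \<longlonglongrightarrow> 0"
   using tendsto_mult[OF xl tendsto_inverse_0_at_top[OF Ninf]] tendsto_mult[OF yl tendsto_inverse_0_at_top[OF Ninf]] by (auto simp: divide_inverse)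
  have evD: "\<forall>\<^sub>F n in sequentially. N n * v.Lam (G n) n = D n"
  proof -
   have "\<forall>\<^sub>F n in sequentially. a n > 0 \<and> b n > 0 \<and> a n + x n/N n > 0 \<and> b n + y n/N n > 0"
    using order_tendstoD(1)[OF al] order_tendstoD(1)[OF bl] order_tendstoD(1)[OF tendsto_add[OF al(1) lim0(1)], of 0]
     order_tendstoD(1)[OF tendsto_add[OF bl(1) lim0(2)], of 0] al bl by (simp add: eventually_conj)
   then show ?thesis
   proof eventually_elim
    fix n assume n: "a n > 0 \<and> b n > 0 \<and> a n + x n/N n > 0 \<and> b n + y n/N n > 0"
    have U2: "U > 2 * K" using U by simp
    have exy: "a n + x n/N n = 1 + theta*(U - c n)*(1/W n + S n/N n)" "b n + y n/N n = 1 - theta*(U + c n)*(1/W n + S n/N n)"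
     by (simp_all add: a_def b_def x_def y_def distrib_left)
    have l1: "(\<Sum>i<n+2. G n (v.X n i)) = ln (a n + x n/N n) - ln (b n + y n/N n)"
     using bc.log_formula[OF bcn part _ K U2] n
     unfolding exy G_def rho_eq v.X_def v.Y_def ll_eq N_def[symmetric] c_def[symmetric] delta_def[symmetric] W_def[symmetric]
      eh_def[folded N_def, symmetric] S_def[symmetric] add_divide_distrib[symmetric] by (simp add: add_ac)
    have K0: "bc.Kb (n + 2) theta (k1 n) (k2 n) (%_. 0) <= K * real (n + 2)" using K[of n] unfolding Kb_eq by simp
    have l2: "(\<Sum>i<n+2. G n (v.Y n i)) = ln (a n) - ln (b n)"
     using bc.log_formula[OF bcn part_0 _ K0 U2] n
     unfolding EE_empty G_def rho_eq v.Y_def ll_eq N_def[symmetric] c_def[symmetric] delta_def[symmetric] W_def[symmetric]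
     by (simp add: a_def b_def)
    show "N n * v.Lam (G n) n = D n" unfolding v.Lam_def sum_subtractf l1 l2 D_def by (simp add: algebra_simps)
   qed
  qed
  \<comment> \<open>The limit of \<open>N n * G n t\<close>: the two logarithms differ by the shift
    \<open>2 * delta n\<close> of \<open>U\<close>, where \<open>2 * N n * delta n = theta\<close>,
    and the derivative of \<open>ln (U^2 - t^2)\<close> in \<open>U\<close> is
    \<open>2 * U/(U^2 - t^2)\<close>.\<close>
  define H where "H t = 2 * theta * U*(1/(V - t^2))" for t
  have "(%n. N n * v.Lam (G n) n - v.Lam H n) \<longlonglongrightarrow> 0"
  proof (rule Lim_null_comparison)
   show "\<forall>\<^sub>F n in sequentially. norm (N n * v.Lam (G n) n - v.Lam H n) <= (16 * theta * U^3 * K*(delta n)^2)*(2 * E1/theta)"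
   proof (intro always_eventually allI)
    fix n
    have dd: "0 <= delta n" "delta n <= K/4" using th N1[of n] bc.Kb_bounds(3)[OF bcn K[of n]] by (auto simp: delta_def N_def)
    have "\<bar>v.Lam (%t. N n * G n t - H t) n\<bar> <= (16 * theta * U^3 * K*(delta n)^2)*(2 * E1/theta)"
    proof (rule v.Lam_bound)
     fix t assume t: "t \<in> {0..K}"
     define A B Q where "A = (U - delta n)^2 - t^2" and "B = (U + delta n)^2 - t^2" and "Q = V - t^2"
     have t2: "t^2 <= K^2" using t by (intro power_mono) auto
     have "(K + 1)^2 <= (U - delta n)^2" "(U - delta n)^2 <= (U + delta n)^2" "(K + 1)^2 <= U^2"
      using U dd K_bounds(2) by (intro power_mono; simp)+
     moreover have "(K + 1)^2 >= K^2 + 1" using K_bounds(2) by (simp add: power2_eq_square algebra_simps)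
     ultimately have AB: "A >= 1" "B >= 1" "Q >= 1" using t2 unfolding A_def B_def Q_def UV by linarith+
     show "((%t. N n * G n t - H t) has_real_derivative (N n*(2 * t/A - 2 * t/B) - 2 * theta * U*(2 * t/Q^2))) (at t)"
     proof -
      have dl: "((%t. ln (z - t^2)) has_real_derivative 1/(z - t^2)*(0 - 2 * t)) (at t)" if "z - t^2 >= 1" for z
       by (rule DERIV_chain2[OF DERIV_ln_divide]) (use that in \<open>auto intro!: derivative_eq_intros\<close>)
      have "((%t. V - t^2) has_real_derivative (0 - 2 * t)) (at t)" by (auto intro!: derivative_eq_intros)
      from DERIV_divide[OF DERIV_const this, of 1]
      have dq: "((%t. 1/(V - t^2)) has_real_derivative 2 * t/Q^2) (at t)"
       using AB(3) by (simp add: Q_def power2_eq_square)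
      from DERIV_diff[OF DERIV_cmult[OF DERIV_diff[OF dl dl]] DERIV_cmult[OF dq], of "(U + delta n)^2" "(U - delta n)^2" "N n" "2 * theta * U"]
      show ?thesis using AB unfolding A_def[symmetric] B_def[symmetric] G_def[symmetric] H_def[symmetric] by simp
     qed
     have NU: "N n * delta n = theta/2" using N1[of n] by (simp add: delta_def)
     have BA: "B - A = 4 * U * delta n" by (simp add: A_def B_def power2_eq_square algebra_simps)
     have "2 * t/A - 2 * t/B = 2 * t*((B - A)/(A * B))" using AB by (simp add: field_simps)
     then have "N n*(2 * t/A - 2 * t/B) = 2 * t*(4 * U*(N n * delta n))/(A * B)" unfolding BA by (simp add: mult_ac)
     then have "N n*(2 * t/A - 2 * t/B) - 2 * theta * U*(2 * t/Q^2) = 4 * theta * U * t*(1/(A * B) - 1/Q^2)"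
      unfolding NU by (simp add: algebra_simps)
     also have "1/(A * B) - 1/Q^2 = (Q^2 - A * B)/(A * B * Q^2)" using AB by (simp add: diff_divide_eq_iff field_simps)
     finally have e: "N n*(2 * t/A - 2 * t/B) - 2 * theta * U*(2 * t/Q^2) = 4 * theta * U * t*((Q^2 - A * B)/(A * B * Q^2))" .
     have QAB: "Q^2 - A * B = (delta n)^2*(4 * U^2 - (2 * Q + (delta n)^2))"
      unfolding A_def B_def Q_def UV[symmetric] by (simp add: power2_eq_square algebra_simps)
     have "(delta n)^2 <= U^2" using dd U K_bounds(2) by (intro power_mono) auto
     moreover have "Q <= U^2" by (simp add: Q_def UV)
     moreover have "0 <= (delta n)^2" by simp
     ultimately have "0 <= 4 * U^2 - (2 * Q + (delta n)^2)" "4 * U^2 - (2 * Q + (delta n)^2) <= 4 * U^2" using AB(3) by linarith+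
     then have q: "0 <= Q^2 - A * B" "Q^2 - A * B <= (delta n)^2*(4 * U^2)" unfolding QAB by (intro mult_nonneg_nonneg mult_left_mono; simp)+
     have "1*1 <= A * B" using AB by (intro mult_mono) auto
     moreover have "1 <= Q^2" using AB by simp
     ultimately have "1*1 <= A * B * Q^2" by (intro mult_mono) auto
     then have "(Q^2 - A * B)/(A * B * Q^2) <= (delta n)^2*(4 * U^2)/1" using q by (intro frac_le) auto
     moreover have r0: "0 <= (Q^2 - A * B)/(A * B * Q^2)" using q AB by (intro divide_nonneg_nonneg) auto
     ultimately have "4 * theta * U * t*((Q^2 - A * B)/(A * B * Q^2)) <= 4 * theta * U * K*((delta n)^2*(4 * U^2))"
      using th U K_bounds(2) t by (intro mult_mono mult_nonneg_nonneg) auto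
     also have "... = 16 * theta * U^3 * K*(delta n)^2" by (simp add: power2_eq_square power3_eq_cube)
     finally have up: "4 * theta * U * t*((Q^2 - A * B)/(A * B * Q^2)) <= 16 * theta * U^3 * K*(delta n)^2" .
     have "0 <= 4 * theta * U * t*((Q^2 - A * B)/(A * B * Q^2))" using th U K_bounds(2) t by (intro mult_nonneg_nonneg r0) auto
     then show "\<bar>N n*(2 * t/A - 2 * t/B) - 2 * theta * U*(2 * t/Q^2)\<bar> <= 16 * theta * U^3 * K*(delta n)^2"
      unfolding e using up by (simp only: abs_of_nonneg)
    qed
    then show "norm (N n * v.Lam (G n) n - v.Lam H n) <= (16 * theta * U^3 * K*(delta n)^2)*(2 * E1/theta)"
     unfolding v.Lam_diff v.Lam_scale real_norm_def .
   qed
   have "(%n. (16 * theta * U^3 * K*(delta n)^2)*(2 * E1/theta)) \<longlonglongrightarrow> (16 * theta * U^3 * K*0^2)*(2 * E1/theta)"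
    by (intro tendsto_mult tendsto_const tendsto_power d0)
   then show "(%n. (16 * theta * U^3 * K*(delta n)^2)*(2 * E1/theta)) \<longlonglongrightarrow> 0" by simp
  qed
  moreover obtain d where "D \<longlonglongrightarrow> d" using \<open>convergent D\<close> by (auto simp: convergent_def)
  then have "(%n. N n * v.Lam (G n) n) \<longlonglongrightarrow> d" by (subst tendsto_cong[OF evD])
  ultimately have "(%n. N n * v.Lam (G n) n - (N n * v.Lam (G n) n - v.Lam H n)) \<longlonglongrightarrow> d - 0" by (intro tendsto_diff)
  then have "v.Lam H \<longlonglongrightarrow> d" by simp
  moreover have "v.Lam H = (%n. 2 * theta * U * v.Lam (%t. 1/(V - t^2)) n)" unfolding H_def[abs_def] by (rule ext) (rule v.Lam_scale)
  ultimately have "(%n. (1/(2 * theta * U))*(2 * theta * U * v.Lam (%t. 1/(V - t^2)) n)) \<longlonglongrightarrow> (1/(2 * theta * U)) * d"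
   by (intro tendsto_mult_left) simp
  moreover have "2 * theta * U ~= 0" using th U K_bounds(2) by simp
  ultimately show ?thesis by (auto simp: convergent_def)
 qed
 then have even: "convergent (v.Lam (%t. t^(2*k)))" for k by (rule v.even_powers_convergent)
 show "convergent (%n. real (lam n i)/real (n + 2))" by (rule v.rows[OF even])
 show "convergent (%n. real (conj_part (lam n) i)/real (n + 2))" by (rule v.cols[OF even])
 show "convergent (%n. real (part_size (n + 2) (lam n))/real (n + 2))" by (rule v.total[OF even])
qed

end

end

section \<open>Coefficient weights, their moments and the Taylor coefficients\<close>

lemma higher_deriv_laurent:
 fixes c :: "'a => complex" and j :: "'a => int"
 shows "z ~= 0 ==> (deriv ^^ k) (%z. \<Sum>s\<in>S. c s * z powi j s) z = (\<Sum>s\<in>S. c s*(\<Prod>i<k. of_int (j s) - of_nat i) * z powi (j s - int k))"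
proof (induction k arbitrary: z)
 case (Suc k)
 have "(deriv ^^ Suc k) (%z. \<Sum>s\<in>S. c s * z powi j s) z = deriv (%z. \<Sum>s\<in>S. c s*(\<Prod>i<k. of_int (j s) - of_nat i) * z powi (j s - int k)) z"
  unfolding funpow.simps(2) comp_apply
 proof (rule deriv_cong_ev[OF _ refl])
  have "\<forall>\<^sub>F w in nhds z. w \<in> - {0}" using Suc.prems by (intro eventually_nhds_in_open) auto
  then show "\<forall>\<^sub>F w in nhds z. (deriv ^^ k) (%z. \<Sum>s\<in>S. c s * z powi j s) w = (\<Sum>s\<in>S. c s*(\<Prod>i<k. of_int (j s) - of_nat i) * w powi (j s - int k))"
   by eventually_elim (use Suc.IH in auto)
 qed
 also have "... = (\<Sum>s\<in>S. c s*(\<Prod>i<Suc k. of_int (j s) - of_nat i) * z powi (j s - int (Suc k)))"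
 proof (rule DERIV_imp_deriv)
  have "((%z. \<Sum>s\<in>S. c s*(\<Prod>i<k. of_int (j s) - of_nat i) * z powi (j s - int k)) has_field_derivative
    (\<Sum>s\<in>S. c s*(\<Prod>i<k. of_int (j s) - of_nat i)*(of_int (j s - int k) * z powi (j s - int k - 1)*1))) (at z)"
   by (intro DERIV_sum DERIV_cmult DERIV_power_int DERIV_ident) (use Suc.prems in auto)
  moreover have "j s - int k - 1 = j s - int (Suc k)" for s by simp
  ultimately show "((%z. \<Sum>s\<in>S. c s*(\<Prod>i<k. of_int (j s) - of_nat i) * z powi (j s - int k)) has_field_derivative
    (\<Sum>s\<in>S. c s*(\<Prod>i<Suc k. of_int (j s) - of_nat i) * z powi (j s - int (Suc k)))) (at z)"
   by (simp only: prod.lessThan_Suc of_int_diff of_int_of_nat_eq mult_1_right mult.assoc)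
 qed
 finally show ?case .
qed simp

lemma convergent_complex_of_real: "convergent (%n. complex_of_real (f n)) \<longleftrightarrow> convergent f"
proof
 assume "convergent (%n. complex_of_real (f n))"
 then obtain l where "(%n. complex_of_real (f n)) \<longlonglongrightarrow> l" by (auto simp: convergent_def)
 from tendsto_Re[OF this] show "convergent f" by (auto simp: convergent_def)
qed (rule convergent_of_real)

context fam
begin

lemma vershik_limits_of_eh:
 assumes "\<And>k. convergent (%n. eh n (Suc k))"
 shows "convergent (%n. real (lam n i)/real (n + 2))" "convergent (%n. real (conj_part (lam n) i)/real (n + 2))"
  "convergent (%n. real (part_size (n + 2) (lam n))/real (n + 2))"
proof -
 obtain E1 where E1: "\<And>n. \<bar>eh n 1\<bar> <= E1" using convergent_imp_Bound[OF assms[of 0]] by auto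
 obtain D where D: "\<And>n. \<bar>rho n/real (n + 2)\<bar> <= D" using convergent_imp_Bound[OF rho_convergent] by auto
 have E1': "eh n 1 <= E1" for n using E1[of n] by linarith
 have K: "bc.Kb (n + 2) theta (k1 n) (k2 n) (lam n) <= (E1 + 2 + 2 * theta + 2 * D) * real (n + 2)" for n
 proof -
  let ?N = "real (n + 2)"
  have "x <= 1 + x^2" for x :: real using zero_le_power2[of "x - 1/2"] by (simp add: power2_eq_square algebra_simps)
  from this[of "real (lam n 0)/?N"] have "real (lam n 0)/?N <= 1 + E1" using eh_1_ge(1)[of n] E1'[of n] by linarith
  then have "real (lam n 0) <= (1 + E1)*?N" by (simp add: pos_divide_le_eq)
  moreover have "rho n/?N <= D" using D[of n] by linarith
  then have "rho n <= D*?N" by (simp add: pos_divide_le_eq)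
  moreover have "1 <= ?N" by simp
  moreover have "(E1 + 2 + 2 * theta + 2 * D)*?N = (1 + E1)*?N + 2 * theta*?N + 2*(D*?N) + ?N" by (simp add: algebra_simps)
  ultimately show ?thesis unfolding Kb_eq by linarith
 qed
 note l = vershik_limits[OF K E1' assms]
 show "convergent (%n. real (lam n i)/real (n + 2))" "convergent (%n. real (conj_part (lam n) i)/real (n + 2))"
  "convergent (%n. real (part_size (n + 2) (lam n))/real (n + 2))" by (rule l)+
qed

definition J :: "nat => lpoly" where "J n = jacobi_poly (n + 2) theta (k1 n + k2 n - 1/2) (k2 n - 1/2) (lam n)"
definition S :: "nat => (nat => int) set" where "S n = {mu. J n mu ~= 0}"
definition Z :: "nat => real" where "Z n = (\<Sum>mu\<in>S n. Re (J n mu))"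
text \<open>Since all coefficients are nonnegative, dividing by the value at
  \<open>(1, ..., 1)\<close> makes them a probability distribution on exponents. \<open>Phi1\<close>
  is the generating function of the exponent of the first variable under it.\<close>

definition p :: "nat => (nat => int) => real" where "p n mu = Re (J n mu)/Z n"
definition M :: "nat => nat => real" where "M k n = (\<Sum>mu\<in>S n. p n mu * real_of_int (mu 0)^k)"

lemma J_prop: "bc.jac_prop (n + 2) theta (k1 n) (k2 n) (lam n) (J n)"
 unfolding J_def by (rule bc.jacobi_poly_jac[OF bcn part])

lemma J_props: "lp_ok (n + 2) (J n)" "J n mu \<in> \<real>\<^sub>\<ge>\<^sub>0" "J n (int \<circ> lam n) = 1" "coeff_inv (n + 2) (J n)"
  "bc.Dop (n + 2) theta (k1 n) (k2 n) k (J n) = (%nu. of_real (ev n (lam n) k) * J n nu)"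
 using J_prop[of n] unfolding bc.jac_prop_def[OF bcn] by auto

lemma J_real: "J n mu = of_real (Re (J n mu))" "Re (J n mu) >= 0"
 using J_props(2)[of n mu] by (auto elim!: nonneg_Reals_cases)

lemma fin_S: "finite (S n)" using J_props(1)[of n] by (simp add: lp_ok_def S_def)

lemma Z_pos: "Z n > 0"
proof -
 have "Re (J n (int \<circ> lam n)) <= Z n" unfolding Z_def
  using J_props(3)[of n] by (intro member_le_sum fin_S J_real(2)) (simp add: S_def del: comp_apply)
 then show ?thesis by (simp add: J_props(3))
qed

lemma p_nonneg: "p n mu >= 0" using J_real(2) Z_pos[of n] by (simp add: p_def)

lemma p_sum: "(\<Sum>mu\<in>S n. p n mu) = 1"
 using Z_pos[of n] by (simp add: p_def sum_divide_distrib[symmetric] Z_def)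

lemma J_p: "J n mu/of_real (Z n) = of_real (p n mu)"
 using J_real(1)[of n mu] by (simp add: p_def)

text \<open>Invariance under the flip of the first variable makes the distribution of its exponent
  symmetric.\<close>

lemma M_odd: "odd k ==> M k n = 0"
proof -
 assume k: "odd k"
 have inv: "J n (fl 0 mu) = J n mu" for mu using J_props(4)[of n] by (auto simp: coeff_inv_def fun_eq_iff)
 have ff: "fl 0 (fl 0 mu) = mu" for mu by (auto simp: fl_def)
 have "M k n = (\<Sum>mu\<in>S n. p n (fl 0 mu) * real_of_int (fl 0 mu 0)^k)"
  unfolding M_def by (rule sum.reindex_bij_witness[of _ "fl 0" "fl 0"]) (auto simp: ff S_def inv)
 also have "... = - M k n" 
 proof -
  have "fl 0 mu 0 = - mu 0" for mu by (simp add: fl_def)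
  then show ?thesis using k by (simp add: M_def p_def inv sum_negf)
 qed
 finally show ?thesis by simp
qed

lemma lp_eval_line: "lp_eval (n + 2) (J n) (%i. if i = 0 then z else 1) = (\<Sum>mu\<in>S n. J n mu * z powi mu 0)"
proof -
 have "(\<Prod>i<n+2. (if i = 0 then z else 1) powi mu i) = z powi mu 0" for mu :: "nat => int"
  by (subst prod.remove[of _ 0]) (auto intro!: prod.neutral)
 then show ?thesis by (simp add: lp_eval_def S_def)
qed

lemma Phi1_eq: "Phi1 (n + 2) theta (k1 n + k2 n - 1/2) (k2 n - 1/2) (lam n) z = (\<Sum>mu\<in>S n. of_real (p n mu) * z powi mu 0)"
proof -
 have "lp_eval (n + 2) (J n) (%_. 1) = of_real (Z n)"
  using lp_eval_line[of n 1] J_real(1)[of n] by (simp add: Z_def cong: if_cong)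
 then show ?thesis unfolding Phi1_def jacobi_Phi_def J_def[symmetric] lp_eval_line
  by (simp add: sum_divide_distrib J_p[symmetric])
qed

text \<open>The Taylor coefficients at 1 are factorial moments divided by factorials. With
  \<open>(x)_i\<close> for the falling factorial, \<open>x (x)_i = (x)_(i+1) + i (x)_i\<close>
  converts them into power moments.\<close>

lemma taylor_moment:
 assumes "\<And>k. convergent (%n. taylor_coeff_at1 (Phi1 (n + 2) theta (k1 n + k2 n - 1/2) (k2 n - 1/2) (lam n)) k)"
 shows "convergent (M k)"
proof -
 define F where "F k i n = (\<Sum>mu\<in>S n. p n mu*(real_of_int (mu 0)^k*(\<Prod>l<i. real_of_int (mu 0) - real l)))" for k i n
 have base: "convergent (F 0 i)" for i
 proof -
  have "taylor_coeff_at1 (Phi1 (n + 2) theta (k1 n + k2 n - 1/2) (k2 n - 1/2) (lam n)) i = of_real (F 0 i n)/fact i" for n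
   unfolding taylor_coeff_at1_def Phi1_eq[abs_def] by (subst higher_deriv_laurent) (auto simp: F_def)
  then have "convergent (%n. of_real (F 0 i n)/fact i :: complex)" using assms[of i] by simp
  from convergent_mult[OF this convergent_const[of "fact i"]] show ?thesis
   by (simp add: convergent_complex_of_real)
 qed
 have "convergent (F k i)" for k i
 proof (induction k arbitrary: i)
  case (Suc k)
  have "F (Suc k) i = (%n. F k (Suc i) n + real i * F k i n)"
   by (rule ext) (simp add: F_def sum_distrib_left sum.distrib[symmetric] algebra_simps)
  then show ?case using Suc by (auto intro!: convergent_add convergent_mult convergent_const)
 qed (rule base)
 from this[of k 0] show ?thesis by (simp add: F_def[abs_def] M_def[abs_def])
qed

definition A :: "nat => nat => complex fps" where
 "A n m = fps_const (1/of_real (Z n)) * bc.AA (n + 2) theta (k1 n) (k2 n) (J n) m"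

lemma A_nth: "fps_nth (A n 0) k = of_real (M k n)/fact k"
proof -
 have "fps_nth (A n 0) k = (\<Sum>mu\<in>S n. J n mu/of_real (Z n) * of_int (mu 0)^k)/fact k"
  unfolding A_def bc.AA_def[OF bcn] by (simp add: line_nth S_def sum_divide_distrib mult.commute)
 then show ?thesis by (simp add: J_p M_def)
qed

sublocale r: rec_seq "%n. real (n + 2)" A "%n. ev n (lam n)" theta "%n. k1 n/real (n + 2)" "%n. k2 n/real (n + 2)"
proof
 fix n k
 show "fps_nth (A n 0) 0 = 1" using p_sum[of n] by (simp add: A_nth M_def)
 show "ev n (lam n) 0 = real (n + 2)" by (rule bc.EE_0[OF bcn])
 let ?AA = "bc.AA (n + 2) theta (k1 n) (k2 n) (J n)" and ?z = "fps_const (1/complex_of_real (Z n))"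
 note lr = bc.line_recursion[OF bcn _ J_props(1,4,5), of n k]
 have l1: "fps_X*?AA (Suc (2*k)) = fps_X * fps_deriv (?AA (2*k)) + fps_const (of_real theta) * Hc 1*(fps_const (of_nat (n + 2))*?AA (2*k) - fps_const (of_real (ev n (lam n) k))*?AA 0)"
  and l2: "fps_X*?AA (Suc (Suc (2*k))) = fps_X * fps_deriv (?AA (Suc (2*k))) +
   (fps_const (of_real (theta*(real (n + 2) - 1) + k1 n)) * Hc 1 + fps_const (of_real (2 * k2 n)) * Hc 2)*?AA (Suc (2*k))"
  using lr by simp_all
 have d: "fps_deriv (?z * F) = ?z * fps_deriv F" for F by simp
 have "fps_X * A n (Suc (2*k)) = ?z*(fps_X*?AA (Suc (2*k)))" unfolding A_def by (rule mult.left_commute)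
 then show "fps_X * A n (Suc (2*k)) = fps_X * fps_deriv (A n (2*k)) +
   fps_const (of_real theta) * Hc 1*(fps_const (of_real (real (n + 2))) * A n (2*k) - fps_const (of_real (ev n (lam n) k)) * A n 0)"
  unfolding l1 A_def d of_real_of_nat_eq by (simp only: algebra_simps)
 have "fps_X * A n (Suc (Suc (2*k))) = ?z*(fps_X*?AA (Suc (Suc (2*k))))" unfolding A_def by (rule mult.left_commute)
 moreover have "k1 n/real (n + 2) * real (n + 2) = k1 n" "k2 n/real (n + 2) * real (n + 2) = k2 n" by simp_all
 ultimately show "fps_X * A n (Suc (Suc (2*k))) = fps_X * fps_deriv (A n (Suc (2*k))) +
   (fps_const (of_real (theta*(real (n + 2) - 1) + k1 n/real (n + 2) * real (n + 2))) * Hc 1 + fps_const (of_real (2*(k2 n/real (n + 2) * real (n + 2)))) * Hc 2) * A n (Suc (2*k))"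
  unfolding l2 A_def d by (simp only: algebra_simps)
qed (use th k1n k2n in auto)

lemma r_eh: "r.eh = eh" by (intro ext) (simp only: r.eh_def eh_def)

lemma eh_convergent:
 assumes "\<And>k. convergent (M k)"
 shows "convergent (%n. eh n (Suc k))"
proof -
 have c: "convergent (%n. 1/real (n + 2))"
 proof -
  have "(%n. 1/real (n + 2)) \<longlonglongrightarrow> 0" by real_asymp
  then show ?thesis by (auto simp: convergent_def)
 qed
 have "convergent (%n. fps_nth (A n 0) j)" for j unfolding A_nth divide_inverse
  using assms by (intro convergent_mult convergent_const) (simp add: convergent_complex_of_real)
 from r.convergent_eh[OF this c k1c k2c, of k] show ?thesis unfolding r_eh .
qed

text \<open>Pointwise convergence alone bounds no moment, so the possibly unbounded scale
  \<open>q n\<close> is carried along. Relative to it the eigenvalues have their natural weights,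
  and \<open>bounded_coeffs\<close> makes the moment of order \<open>j\<close> at most a multiple of
  \<open>q n ^ j\<close>. As \<open>(q n)^2\<close> is at most a multiple of
  \<open>1 + M 2 n\<close>, the fourth moment is controlled by the square of the second, and
  tightness then bounds \<open>q\<close>.\<close>

lemma moments_of_pointwise:
 assumes g: "continuous_on (sphere 0 1) g"
  and lim: "\<And>z. z \<in> sphere 0 1 ==> (%n. Phi1 (n + 2) theta (k1 n + k2 n - 1/2) (k2 n - 1/2) (lam n) z) \<longlonglongrightarrow> g z"
 shows "convergent (M k)"
proof -
 interpret w: weights S p "%mu. real_of_int (mu 0)" "%t. Re (g (cis t))"
 proof
  show "(%n. \<Sum>mu\<in>S n. p n mu * cos (real_of_int (mu 0) * t)) \<longlonglongrightarrow> Re (g (cis t))" for t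
  proof -
   have "Re (Phi1 (n + 2) theta (k1 n + k2 n - 1/2) (k2 n - 1/2) (lam n) (cis t)) = (\<Sum>mu\<in>S n. p n mu * cos (real_of_int (mu 0) * t))" for n
    unfolding Phi1_eq Re_sum by (intro sum.cong refl) (simp add: cis_power_int)
   then show ?thesis using tendsto_Re[OF lim[of "cis t"]] by simp
  qed
  show "continuous_on UNIV (%t. Re (g (cis t)))"
   by (intro continuous_on_Re continuous_on_compose2[OF g]) (auto intro!: continuous_intros simp: cis_conv_exp norm_exp_i_times)
 qed (use fin_S p_nonneg p_sum in auto)
 have Mm: "w.mo k = M k" for k by (intro ext) (simp add: w.mo_def M_def)
 obtain D where D: "\<And>n. \<bar>k1 n/real (n + 2)\<bar> <= D" using convergent_imp_Bound[OF k1c] by auto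
 obtain D' where D': "\<And>n. \<bar>k2 n/real (n + 2)\<bar> <= D'" using convergent_imp_Bound[OF k2c] by auto
 define Km where "Km = \<bar>D\<bar> + \<bar>D'\<bar>"
 have kk: "k1 n/real (n + 2) <= Km" "k2 n/real (n + 2) <= Km" for n using D[of n] D'[of n] unfolding Km_def by linarith+
 have Km0: "Km >= 0" by (simp add: Km_def)
 define q where "q n = sqrt (1 + eh n 1)" for n
 have q1: "q n >= 1" for n using eh_1_ge(2)[of n] by (simp add: q_def)
 have q2: "(q n)^2 = 1 + eh n 1" for n using eh_1_ge(2)[of n] by (simp add: q_def)
 \<comment> \<open>Collects the constants in \<open>Kb\<close>: the first row is at most
   \<open>q n * (n + 2)\<close>, the other terms are of order \<open>n + 2\<close>, and
   \<open>q n >= 1\<close> lets them carry the factor \<open>q n\<close> as well.\<close>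
 define L where "L = 2 + 2 * theta + 4 * Km"
 have L0: "L >= 0" using th Km0 by (simp add: L_def)
 have ehb: "\<exists>C. \<forall>n. \<bar>eh n (Suc k)\<bar> <= C * q n ^ (2 * Suc k)" for k
 proof (intro exI allI)
  fix n
  let ?N = "real (n + 2)"
  have K: "bc.Kb (n + 2) theta (k1 n) (k2 n) (lam n) <= (L * q n)*?N"
  proof -
   have "real (lam n 0)/?N <= q n" using eh_1_ge(1)[of n] unfolding q_def by (intro real_le_rsqrt) simp
   then have "real (lam n 0) <= q n*?N" by (simp add: pos_divide_le_eq)
   moreover have "rho n <= 2 * Km*?N" using kk[of n] k1n[of n] Km0 by (simp add: rho_def pos_divide_le_eq)
   ultimately have "real (lam n 0) + 2 * theta*?N + 2 * rho n + 1 <= (q n + (1 + 2 * theta + 4 * Km))*?N" by (simp add: algebra_simps)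
   also have "... <= (q n + (1 + 2 * theta + 4 * Km) * q n)*?N"
   proof -
    have "(1 + 2 * theta + 4 * Km)*1 <= (1 + 2 * theta + 4 * Km) * q n" using q1[of n] th Km0 by (intro mult_left_mono) auto
    then show ?thesis by (intro mult_right_mono) auto
   qed
   finally show ?thesis unfolding Kb_eq by (simp add: L_def algebra_simps)
  qed
  have "eh n 1 <= (q n)^2" unfolding q2 by simp
  have "\<bar>eh n (Suc k)\<bar> <= ((L * q n)^2)^k * eh n 1" by (rule eh_le[OF K])
  also have "... <= ((L * q n)^2)^k*(q n)^2" using q2[of n] by (intro mult_left_mono) auto
  also have "... = (L^2)^k * q n ^ (2 * Suc k)" by (simp add: power_mult_distrib power_mult power2_eq_square)
  finally show "\<bar>eh n (Suc k)\<bar> <= (L^2)^k * q n ^ (2 * Suc k)" .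
 qed
 have odd0: "fps_nth (A n 0) j = 0" if "odd j" for n j using M_odd[OF that] by (simp add: A_nth)
 have bdc: "\<exists>C\<ge>0. \<forall>n. \<bar>M j n\<bar> <= C * q n ^ j" for j
 proof -
  have "r.bd q (%n. fps_nth (A n 0) j) j"
   by (rule r.bounded_coeffs[unfolded r_eh, OF q1 ehb kk odd0])
  then obtain C where C: "C >= 0" "\<And>n. cmod (fps_nth (A n 0) j) <= C * q n ^ j" by (auto simp: r.bd_def)
  have "\<bar>M j n\<bar> <= (C * fact j) * q n ^ j" for n
   using C(2)[of n] by (simp add: A_nth norm_divide pos_divide_le_eq mult_ac)
  then show ?thesis using C(1) by (intro exI[of _ "C * fact j"]) auto
 qed
 have eh1: "eh n 1 <= (1 + 2 * theta + 4 * Km) * M 2 n" for n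
 proof -
  let ?N = "real (n + 2)"
  have M0: "M 2 n >= 0" unfolding M_def using p_nonneg by (intro sum_nonneg) auto
  have "eh n 1 = (1/?N + (2*(theta*(1 - 1/?N) + k1 n/?N) + 2*(k2 n/?N)))*(2 * Re (fps_nth (A n 0) 2))"
   using r.eh_1[of n] odd0[of 1 n] unfolding r_eh by simp
  also have "2 * Re (fps_nth (A n 0) 2) = M 2 n" by (simp add: A_nth)
  also have "(1/?N + (2*(theta*(1 - 1/?N) + k1 n/?N) + 2*(k2 n/?N))) * M 2 n <= (1 + 2 * theta + 4 * Km) * M 2 n"
  proof (rule mult_right_mono[OF _ M0])
   have "1/?N <= 1" by simp
   moreover have "theta*(1 - 1/?N) <= theta" using th by (intro mult_left_le) auto
   ultimately have "1/?N + (2*(theta*(1 - 1/?N) + k1 n/?N) + 2*(k2 n/?N)) <= 1 + (2*(theta + Km) + 2 * Km)"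
    using kk[of n] by (intro add_mono mult_left_mono) auto
   then show "1/?N + (2*(theta*(1 - 1/?N) + k1 n/?N) + 2*(k2 n/?N)) <= 1 + 2 * theta + 4 * Km" by (simp add: algebra_simps)
  qed
  finally show ?thesis .
 qed
 define c1 where "c1 = 1 + 2 * theta + 4 * Km"
 have c1: "c1 >= 1" using th Km0 by (simp add: c1_def)
 obtain C where C: "C >= 0" "\<And>n. \<bar>M 4 n\<bar> <= C * q n ^ 4" using bdc[of 4] by auto
 have "w.mo 4 n <= (C * c1^2)*(1 + w.mo 2 n)^2" for n
 proof -
  have M0: "M 2 n >= 0" unfolding M_def using p_nonneg by (intro sum_nonneg) auto
  have "1 + eh n 1 <= c1*(1 + M 2 n)" using eh1[of n] c1 M0 by (simp add: c1_def[symmetric] distrib_left)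
  then have "(1 + eh n 1)^2 <= (c1*(1 + M 2 n))^2" using eh_1_ge(2)[of n] by (intro power_mono) auto
  moreover have "q n ^ 4 = (1 + eh n 1)^2" unfolding q2[symmetric] by simp
  ultimately have "C * q n ^ 4 <= C*(c1*(1 + M 2 n))^2" using C(1) by (intro mult_left_mono) auto
  then show ?thesis using C(2)[of n] by (simp add: Mm power_mult_distrib mult.assoc)
 qed
 from w.second_moment_bounded[OF this] obtain B where B: "\<And>n. M 2 n <= B" by (auto simp: Mm)
 have qB: "q n <= sqrt (1 + c1 * B)" for n
 proof -
  have "eh n 1 <= c1 * M 2 n" using eh1[of n] by (simp add: c1_def)
  also have "... <= c1 * B" using B c1 by (intro mult_left_mono) auto
  finally show ?thesis by (simp add: q_def)
 qed
 have "\<exists>B. \<forall>n. w.mo (2*k) n <= B" for k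
 proof -
  obtain C where C: "C >= 0" "\<And>n. \<bar>M (2*k) n\<bar> <= C * q n ^ (2*k)" using bdc[of "2*k"] by auto
  have "M (2*k) n <= C * sqrt (1 + c1 * B) ^ (2*k)" for n
  proof -
   have "C * q n ^ (2*k) <= C * sqrt (1 + c1 * B) ^ (2*k)" using C(1) qB q1[of n] by (intro mult_left_mono power_mono) auto
   then show ?thesis using C(2)[of n] by linarith
  qed
  then show ?thesis by (auto simp: Mm)
 qed
 from w.moments_convergent[OF this] have "convergent (M (2*k))" for k by (simp add: Mm)
 moreover have "convergent (M k)" if "odd k" using ext[of "M k" "%_. 0", OF M_odd[OF that]] by (simp add: convergent_const)
 ultimately show ?thesis by (cases "even k") auto
qed

end

theorem theorem4p4:
  fixes \<theta> abar bbar :: real and a b :: "nat \<Rightarrow> real" and lam :: "nat \<Rightarrow> nat \<Rightarrow> nat"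
  assumes "\<theta> > 0"
    and "\<And>n. b n \<ge> -1/2" and "\<And>n. a n \<ge> b n"
    and "(\<lambda>n. a n / real n) \<longlonglongrightarrow> abar" and "(\<lambda>n. b n / real n) \<longlonglongrightarrow> bbar"
    and "\<And>n. is_partition_len n (lam n)"
    and "(\<exists>g. continuous_on (sphere 0 1) g \<and>
            (\<forall>z\<in>sphere 0 1. (\<lambda>n. Phi1 n \<theta> (a n) (b n) (lam n) z) \<longlonglongrightarrow> g z))
         \<or> (\<forall>k. convergent (\<lambda>n. taylor_coeff_at1 (Phi1 n \<theta> (a n) (b n) (lam n)) k))"
  shows "vershik_kerov lam"
proof -
 \<comment> \<open>Inverts \<open>a = k1 + k2 - 1/2\<close> and \<open>b = k2 - 1/2\<close>; the
   inequalities between \<open>a\<close>, \<open>b\<close> and \<open>-1/2\<close> become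
   nonnegativity of \<open>k1\<close> and \<open>k2\<close>.\<close>
 define k1 where "k1 n = a (n + 2) - b (n + 2)" for n
 define k2 where "k2 n = b (n + 2) + 1/2" for n
 have al: "(%n. a (n + 2)/real (n + 2)) \<longlonglongrightarrow> abar" and bl: "(%n. b (n + 2)/real (n + 2)) \<longlonglongrightarrow> bbar"
  using LIMSEQ_ignore_initial_segment[OF assms(4), of 2] LIMSEQ_ignore_initial_segment[OF assms(5), of 2] by simp_all
 have h: "(%n. (1/2)/real (n + 2)) \<longlonglongrightarrow> 0" by real_asymp
 interpret fam \<theta> k1 k2 "%n. lam (n + 2)"
 proof
  show "k1 n >= 0" "k2 n >= 0" for n using assms(2)[of "n + 2"] assms(3)[of "n + 2"] by (auto simp: k1_def k2_def)
  show "convergent (%n. k1 n/real (n + 2))"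
   using tendsto_diff[OF al bl] by (auto simp: convergent_def k1_def diff_divide_distrib)
  show "convergent (%n. k2 n/real (n + 2))"
   using tendsto_add[OF bl h] by (auto simp: convergent_def k2_def add_divide_distrib simp del: of_nat_add)
 qed (use assms(1,6) in auto)
 have ab: "k1 n + k2 n - 1/2 = a (n + 2)" "k2 n - 1/2 = b (n + 2)" for n by (auto simp: k1_def k2_def)
 have "convergent (M k)" for k
  using assms(7)
 proof
  assume "\<exists>g. continuous_on (sphere 0 1) g \<and> (\<forall>z\<in>sphere 0 1. (%n. Phi1 n \<theta> (a n) (b n) (lam n) z) \<longlonglongrightarrow> g z)"
  then obtain g where g: "continuous_on (sphere 0 1) g" "\<And>z. z \<in> sphere 0 1 ==> (%n. Phi1 n \<theta> (a n) (b n) (lam n) z) \<longlonglongrightarrow> g z" by blast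
  show ?thesis
   by (rule moments_of_pointwise[OF g(1)]) (unfold ab, rule LIMSEQ_ignore_initial_segment[OF g(2)])
 next
  assume t: "\<forall>k. convergent (%n. taylor_coeff_at1 (Phi1 n \<theta> (a n) (b n) (lam n)) k)"
  show ?thesis
  proof (rule taylor_moment)
   fix k
   show "convergent (%n. taylor_coeff_at1 (Phi1 (n + 2) \<theta> (k1 n + k2 n - 1/2) (k2 n - 1/2) (lam (n + 2))) k)"
    unfolding ab using convergent_ignore_initial_segment[of "%n. taylor_coeff_at1 (Phi1 n \<theta> (a n) (b n) (lam n)) k" 2] t by simp
  qed
 qed
 then have "\<And>k. convergent (%n. eh n (Suc k))" by (rule eh_convergent)
 note l = vershik_limits_of_eh[OF this]
 show ?thesis unfolding vershik_kerov_def
  using l convergent_ignore_initial_segment[of "%n. real (lam n i)/real n" 2 for i]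
   convergent_ignore_initial_segment[of "%n. real (conj_part (lam n) i)/real n" 2 for i]
   convergent_ignore_initial_segment[of "%n. real (part_size n (lam n))/real n" 2] by blast
qed

end
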